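(* Let $K$ be a field of characteristic zero and $\lambda\in K$. The multigraded operad $\mathcal{PL}_\lambda=\mathcal{F}/(R)$, the quotient of the free multigraded operad $\mathcal{F}$ on one binary product by the ideal $(R)$ generated by the elements $$\big((x_ky_l)z_m\big)-\lambda^m\big(x_k(y_lz_m)\big)-\big((x_kz_m)y_l\big)+\lambda^l\big(x_k(z_my_l)\big),\qquad k,l,m\ge1,$$ is isomorphic to the multigraded operad $\mathcal{O}^\lambda$ of weighted rooted trees.
   Context: $\mathbb{N}^*=\{1,2,\ldots\}$, and $0^0=1$. An operad means a symmetric operad in $K$-vector spaces (spaces $\mathcal{O}_n$, $n\ge1$, right $S_n$-actions, partial compositions $\circ_i$, unit in $\mathcal{O}_1$, usual axioms). An operad $\mathcal{O}$ is multigraded if $\mathcal{O}_n=\prod_{a_1,\ldots,a_n\in\mathbb{N}^*}\mathcal{O}_{n,a_1,\ldots,a_n}$ for every $n\ge1$, where $(\mathcal{O}_{n,a_1,\ldots,a_n}).\sigma=\mathcal{O}_{n,a_{\sigma(1)},\ldots,a_{\sigma(n)}}$ for $\sigma\in S_n$, and $\circ_i$ maps $\mathcal{O}_{n,a_1,\ldots,a_n}\otimes\mathcal{O}_{m,b_1,\ldots,b_m}$ to $\mathcal{O}_{n+m-1,a_1,\ldots,a_{i-1},b_1,\ldots,b_m,a_{i+1},\ldots,a_n}$ with zero image if $\sum_jb_j\ne a_i$. A morphism of multigraded operads is a morphism of operads (linear, equivariant, preserving unit and partial compositions) mapping each component $(n,k_1,\ldots,k_n)$ to the component of the same index. The free multigraded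 operad $\mathcal{F}$: $\mathcal{F}(n)=\prod_{k_1,\ldots,k_n\ge1}\mathcal{F}_{n,k_1,\ldots,k_n}$, where $\mathcal{F}_{n,k_1,\ldots,k_n}$ has as basis the fully parenthesized (non-associative, non-commutative) products of $n$ variables, each occurring exactly once, the $i$-th variable being indexed by the degree $k_i$. For example, a basis of $\mathcal{F}(2)$ in degrees $k,l$ consists of $(x_ky_l)$ and $(y_lx_k)$, and a basis of $\mathcal{F}(3)$ in degrees $k,l,m$ consists of $((x_ky_l)z_m)$, $(x_k(y_lz_m))$ and their permutations. $S_n$ permutes the variables. Partial composition substitutes a monomial for the $i$-th variable when the sum of the degrees of its variables equals the degree of that variable, and is zero otherwise. The unit is the family of the one-variable monomials $x_k$ over all degrees $k\ge1$. The ideal $(R)$ is the multigraded operadic ideal (with $(R)(n)=\prod_{k_1,\ldots,k_n}(R)_{n,k_1,\ldots,k_n}$) generated by the displayed elements, and $\mathcal{PL}_\lambda=\mathcal{F}/(R)$ is formed componentwise. The operad $\mathcal{O}^\lambda$: consider non-planar rooted trees $T$ with vertices labelled bijectively by $\{1,\ldots,n\}$, each vertex $v$ carrying a weight $|v|\in\mathbb{N}^*$, with edges oriented towards the root. Let $v(T)$ be the vertex set, $|T|=\sum_{v\in v(T)}|v|$, $h(v)$ the number of edges between $v$ and the root, $d(T)=\sum_{v\in v(T)}|v|h(v)$, and $E(T,v)$ the set of edges arriving at $v$ from its children. $\mathcal{O}^\lambda_{n,a_1,\ldots,a_n}$ is spanned by such trees whose vertex labelled $i$ has weight $a_i$, and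 $\mathcal{O}^\lambda_n=\prod\mathcal{O}^\lambda_{n,a_1,\ldots,a_n}$. $S_n$ acts by permuting labels (the vertex labelled $i$ in $T$ gets label $\sigma^{-1}(i)$ in $T.\sigma$, keeping its weight). For a vertex $v$ of $S$ and $f:E(S,v)\to v(T)$, $S\circ_v^fT$ is obtained by replacing $v$ by $T$ and connecting each $e\in E(S,v)$ to the vertex $f(e)$ of $T$. The edge leaving $v$, if any, now leaves the root of $T$; if $v$ is the root of $S$, the new root is the root of $T$. Weights are kept. If $v$ has label $i$ and $T$ has $m$ vertices, labels of $S$ less than $i$ are kept, those of $T$ are increased by $i-1$, and those of $S$ greater than $i$ by $m-1$. With $f_0$ the map sending every edge to the root of $T$, $$S\circ_{v,\lambda}T=\sum_{f:E(S,v)\to v(T)}\lambda^{d(S\circ_v^fT)-d(S\circ_v^{f_0}T)}S\circ_v^fT\ \text{ if }|T|=|v|,$$ and $S\circ_{v,\lambda}T=0$ otherwise. The operation $\circ_i$ is $\circ_{v,\lambda}$ for $v$ the vertex of label $i$, extended bilinearly and componentwise to the products. The unit is $\sum_{n\ge1}\bullet_n$, where $\bullet_n$ is the one-vertex tree of weight $n$. *)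

theory Defs
  imports
    "HOL-Library.FuncSet"
    "HOL-Library.Poly_Mapping"
    "HOL-Combinatorics.Permutations"
begin

text \<open>
  Inputs of operations, variables of monomials and vertices of trees are numbered from \<open>0\<close>: an
  operation of arity \<open>n\<close> has the inputs \<open>0, \<dots>, n - 1\<close>, and the symmetric group acts by permutations of
  \<open>{..<n}\<close>.
\<close>

section \<open>Vector spaces on carrier sets\<close>

record ('k, 'v) vspace =
  carr :: "'v set"
  vadd :: "'v \<Rightarrow> 'v \<Rightarrow> 'v"
  vzero :: "'v"
  vsmul :: "'k \<Rightarrow> 'v \<Rightarrow> 'v"

locale is_vspace =
  fixes V :: "('k::field, 'v) vspace"
  assumes add_closed: "\<lbrakk>x \<in> carr V; y \<in> carr V\<rbrakk> \<Longrightarrow> vadd V x y \<in> carr V"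
    and zero_closed: "vzero V \<in> carr V"
    and smul_closed: "x \<in> carr V \<Longrightarrow> vsmul V c x \<in> carr V"
    and add_assoc: "\<lbrakk>x \<in> carr V; y \<in> carr V; z \<in> carr V\<rbrakk>
          \<Longrightarrow> vadd V (vadd V x y) z = vadd V x (vadd V y z)"
    and add_comm: "\<lbrakk>x \<in> carr V; y \<in> carr V\<rbrakk> \<Longrightarrow> vadd V x y = vadd V y x"
    and add_zero: "x \<in> carr V \<Longrightarrow> vadd V x (vzero V) = x"
    and add_inverse: "x \<in> carr V \<Longrightarrow> \<exists>y\<in>carr V. vadd V x y = vzero V"
    and smul_add_right: "\<lbrakk>x \<in> carr V; y \<in> carr V\<rbrakk>
          \<Longrightarrow> vsmul V c (vadd V x y) = vadd V (vsmul V c x) (vsmul V c y)"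
    and smul_add_left: "x \<in> carr V \<Longrightarrow> vsmul V (c + d) x = vadd V (vsmul V c x) (vsmul V d x)"
    and smul_smul: "x \<in> carr V \<Longrightarrow> vsmul V c (vsmul V d x) = vsmul V (c * d) x"
    and smul_one: "x \<in> carr V \<Longrightarrow> vsmul V 1 x = x"

definition linear_map :: "('k, 'v) vspace \<Rightarrow> ('k, 'w) vspace \<Rightarrow> ('v \<Rightarrow> 'w) \<Rightarrow> bool" where
  "linear_map V W f \<longleftrightarrow>
     f \<in> carr V \<rightarrow> carr W \<and>
     (\<forall>x\<in>carr V. \<forall>y\<in>carr V. f (vadd V x y) = vadd W (f x) (f y)) \<and>
     (\<forall>c. \<forall>x\<in>carr V. f (vsmul V c x) = vsmul W c (f x))"

definition lin_subspace :: "('k, 'v) vspace \<Rightarrow> 'v set \<Rightarrow> bool" where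
  "lin_subspace V U \<longleftrightarrow>
     U \<subseteq> carr V \<and> vzero V \<in> U \<and>
     (\<forall>x\<in>U. \<forall>y\<in>U. vadd V x y \<in> U) \<and>
     (\<forall>c. \<forall>x\<in>U. vsmul V c x \<in> U)"

definition prod_vs :: "'i set \<Rightarrow> ('i \<Rightarrow> ('k, 'v) vspace) \<Rightarrow> ('k, 'i \<Rightarrow> 'v) vspace" where
  "prod_vs I V = \<lparr>
     carr = (\<Pi>\<^sub>E i\<in>I. carr (V i)),
     vadd = (\<lambda>x y. \<lambda>i\<in>I. vadd (V i) (x i) (y i)),
     vzero = (\<lambda>i\<in>I. vzero (V i)),
     vsmul = (\<lambda>c x. \<lambda>i\<in>I. vsmul (V i) c (x i))\<rparr>"

definition coset :: "('k, 'v) vspace \<Rightarrow> 'v set \<Rightarrow> 'v \<Rightarrow> 'v set" where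
  "coset V U x = vadd V x ` U"

abbreviation rep :: "'v set \<Rightarrow> 'v" where
  "rep X \<equiv> SOME x. x \<in> X"

definition quot_vs :: "('k, 'v) vspace \<Rightarrow> 'v set \<Rightarrow> ('k, 'v set) vspace" where
  "quot_vs V U = \<lparr>
     carr = coset V U ` carr V,
     vadd = (\<lambda>X Y. coset V U (vadd V (rep X) (rep Y))),
     vzero = coset V U (vzero V),
     vsmul = (\<lambda>c X. coset V U (vsmul V c (rep X)))\<rparr>"

section \<open>Symmetric operads\<close>

text \<open>
  The field \<open>act P n x \<sigma>\<close> is \<open>x.\<sigma>\<close> for \<open>x\<close> of arity \<open>n\<close>, and \<open>pcomp P n m i x y\<close> is \<open>x \<circ>\<^sub>i y\<close> for \<open>x\<close> of
  arity \<open>n\<close> and \<open>y\<close> of arity \<open>m\<close>.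
\<close>

record ('k, 'v) operad_data =
  sp :: "nat \<Rightarrow> ('k, 'v) vspace"
  act :: "nat \<Rightarrow> 'v \<Rightarrow> (nat \<Rightarrow> nat) \<Rightarrow> 'v"
  pcomp :: "nat \<Rightarrow> nat \<Rightarrow> nat \<Rightarrow> 'v \<Rightarrow> 'v \<Rightarrow> 'v"
  ounit :: "'v"

abbreviation ops :: "('k, 'v, 'more) operad_data_scheme \<Rightarrow> nat \<Rightarrow> 'v set" where
  "ops P n \<equiv> carr (sp P n)"

text \<open>
  When an operation of arity \<open>m\<close> is inserted into input \<open>i\<close>, an input \<open>j \<noteq> i\<close> of the outer operation
  becomes input \<open>shift i m j\<close>, and an input \<open>j\<close> of the inner one becomes input \<open>i + j\<close>.
\<close>

definition shift :: "nat \<Rightarrow> nat \<Rightarrow> nat \<Rightarrow> nat" where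
  "shift i m j = (if j < i then j else j + m - 1)"

definition unshift :: "nat \<Rightarrow> nat \<Rightarrow> nat \<Rightarrow> nat" where
  "unshift i m j = (if j < i then j else j + 1 - m)"

text \<open>
  The permutations \<open>\<sigma>'\<close> and \<open>\<tau>'\<close> with \<open>x.\<sigma> \<circ>\<^sub>i y = (x \<circ>\<^bsub>\<sigma>(i)\<^esub> y).\<sigma>'\<close> and \<open>x \<circ>\<^sub>i y.\<tau> = (x \<circ>\<^sub>i y).\<tau>'\<close>, where \<open>y\<close>
  has arity \<open>m\<close>.
\<close>

definition outer_perm :: "(nat \<Rightarrow> nat) \<Rightarrow> nat \<Rightarrow> nat \<Rightarrow> nat \<Rightarrow> nat" where
  "outer_perm \<sigma> i m c =
     (if i \<le> c \<and> c < i + m then \<sigma> i + (c - i) else shift (\<sigma> i) m (\<sigma> (unshift i m c)))"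

definition inner_perm :: "(nat \<Rightarrow> nat) \<Rightarrow> nat \<Rightarrow> nat \<Rightarrow> nat \<Rightarrow> nat" where
  "inner_perm \<tau> i m c = (if i \<le> c \<and> c < i + m then i + \<tau> (c - i) else c)"

locale operad =
  fixes P :: "('k::field, 'v, 'more) operad_data_scheme"
  assumes vspace: "0 < n \<Longrightarrow> is_vspace (sp P n)"
    and act_linear: "\<lbrakk>0 < n; \<sigma> permutes {..<n}\<rbrakk> \<Longrightarrow> linear_map (sp P n) (sp P n) (\<lambda>x. act P n x \<sigma>)"
    and act_id: "\<lbrakk>0 < n; x \<in> ops P n\<rbrakk> \<Longrightarrow> act P n x id = x"
    and act_act: "\<lbrakk>0 < n; x \<in> ops P n; \<sigma> permutes {..<n}; \<tau> permutes {..<n}\<rbrakk>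
          \<Longrightarrow> act P n (act P n x \<sigma>) \<tau> = act P n x (\<sigma> \<circ> \<tau>)"
    and pcomp_linear_left: "\<lbrakk>0 < m; i < n; y \<in> ops P m\<rbrakk>
          \<Longrightarrow> linear_map (sp P n) (sp P (n + m - 1)) (\<lambda>x. pcomp P n m i x y)"
    and pcomp_linear_right: "\<lbrakk>0 < m; i < n; x \<in> ops P n\<rbrakk>
          \<Longrightarrow> linear_map (sp P m) (sp P (n + m - 1)) (\<lambda>y. pcomp P n m i x y)"
    and unit_closed: "ounit P \<in> ops P 1"
    and unit_left: "\<lbrakk>0 < n; x \<in> ops P n\<rbrakk> \<Longrightarrow> pcomp P 1 n 0 (ounit P) x = x"
    and unit_right: "\<lbrakk>i < n; x \<in> ops P n\<rbrakk> \<Longrightarrow> pcomp P n 1 i x (ounit P) = x"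
    and assoc_sequential: "\<lbrakk>0 < l; i < n; j < m; x \<in> ops P n; y \<in> ops P m; z \<in> ops P l\<rbrakk>
          \<Longrightarrow> pcomp P (n + m - 1) l (i + j) (pcomp P n m i x y) z =
              pcomp P n (m + l - 1) i x (pcomp P m l j y z)"
    and assoc_parallel: "\<lbrakk>0 < m; 0 < l; i < j; j < n; x \<in> ops P n; y \<in> ops P m; z \<in> ops P l\<rbrakk>
          \<Longrightarrow> pcomp P (n + m - 1) l (j + m - 1) (pcomp P n m i x y) z =
              pcomp P (n + l - 1) m i (pcomp P n l j x z) y"
    and equivariant_outer: "\<lbrakk>0 < m; i < n; x \<in> ops P n; y \<in> ops P m; \<sigma> permutes {..<n}\<rbrakk>
          \<Longrightarrow> pcomp P n m i (act P n x \<sigma>) y =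
              act P (n + m - 1) (pcomp P n m (\<sigma> i) x y) (outer_perm \<sigma> i m)"
    and equivariant_inner: "\<lbrakk>0 < m; i < n; x \<in> ops P n; y \<in> ops P m; \<tau> permutes {..<m}\<rbrakk>
          \<Longrightarrow> pcomp P n m i x (act P m y \<tau>) =
              act P (n + m - 1) (pcomp P n m i x y) (inner_perm \<tau> i m)"

definition operad_morphism ::
    "('k::field, 'v, 'm) operad_data_scheme \<Rightarrow> ('k, 'w, 'n) operad_data_scheme
       \<Rightarrow> (nat \<Rightarrow> 'v \<Rightarrow> 'w) \<Rightarrow> bool" where
  "operad_morphism P Q \<phi> \<longleftrightarrow>
     (\<forall>n>0. linear_map (sp P n) (sp Q n) (\<phi> n)) \<and>
     (\<forall>n>0. \<forall>x\<in>ops P n. \<forall>\<sigma>. \<sigma> permutes {..<n} \<longrightarrow> \<phi> n (act P n x \<sigma>) = act Q n (\<phi> n x) \<sigma>) \<and>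
     \<phi> 1 (ounit P) = ounit Q \<and>
     (\<forall>n>0. \<forall>m>0. \<forall>i<n. \<forall>x\<in>ops P n. \<forall>y\<in>ops P m.
        \<phi> (n + m - 1) (pcomp P n m i x y) = pcomp Q n m i (\<phi> n x) (\<phi> m y))"

section \<open>Multigraded operads\<close>

definition degrees :: "nat \<Rightarrow> nat list set" where
  "degrees n = {a. length a = n \<and> (\<forall>k\<in>set a. 0 < k)}"

definition subst_degrees :: "nat list \<Rightarrow> nat \<Rightarrow> nat list \<Rightarrow> nat list" where
  "subst_degrees a i b = take i a @ b @ drop (Suc i) a"

text \<open>
  Operations of arity \<open>n\<close> are families indexed by the multidegrees of length \<open>n\<close>; \<open>cmp P a\<close> is the
  component of multidegree \<open>a\<close>.
\<close>

record ('k, 'c) mg_operad_data = "('k, nat list \<Rightarrow> 'c) operad_data" +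
  cmp :: "nat list \<Rightarrow> ('k, 'c) vspace"

text \<open>The component of multidegree \<open>a\<close>, regarded as a subspace of the product.\<close>

definition homogeneous :: "('k, 'c, 'more) mg_operad_data_scheme \<Rightarrow> nat list \<Rightarrow> (nat list \<Rightarrow> 'c) set" where
  "homogeneous P a =
     {x \<in> ops P (length a). \<forall>b\<in>degrees (length a). b \<noteq> a \<longrightarrow> x b = vzero (cmp P b)}"

locale multigraded_operad = operad P
  for P :: "('k::field, 'c, 'more) mg_operad_data_scheme" +
  assumes cmp_vspace: "\<lbrakk>0 < n; a \<in> degrees n\<rbrakk> \<Longrightarrow> is_vspace (cmp P a)"
    and sp_eq_prod: "0 < n \<Longrightarrow> sp P n = prod_vs (degrees n) (cmp P)"
    and act_homogeneous: "\<lbrakk>0 < n; a \<in> degrees n; \<sigma> permutes {..<n}\<rbrakk>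
          \<Longrightarrow> (\<lambda>x. act P n x \<sigma>) ` homogeneous P a = homogeneous P (permute_list \<sigma> a)"
    and pcomp_homogeneous: "\<lbrakk>0 < m; i < n; a \<in> degrees n; b \<in> degrees m;
            x \<in> homogeneous P a; y \<in> homogeneous P b\<rbrakk>
          \<Longrightarrow> pcomp P n m i x y \<in> homogeneous P (subst_degrees a i b)"
    and pcomp_mismatch: "\<lbrakk>0 < m; i < n; a \<in> degrees n; b \<in> degrees m;
            x \<in> homogeneous P a; y \<in> homogeneous P b; sum_list b \<noteq> a ! i\<rbrakk>
          \<Longrightarrow> pcomp P n m i x y = vzero (sp P (n + m - 1))"

definition mg_morphism ::
    "('k::field, 'c, 'm) mg_operad_data_scheme \<Rightarrow> ('k, 'd, 'n) mg_operad_data_scheme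
       \<Rightarrow> (nat \<Rightarrow> (nat list \<Rightarrow> 'c) \<Rightarrow> (nat list \<Rightarrow> 'd)) \<Rightarrow> bool" where
  "mg_morphism P Q \<phi> \<longleftrightarrow>
     operad_morphism P Q \<phi> \<and>
     (\<forall>n>0. \<forall>a\<in>degrees n. \<phi> n ` homogeneous P a \<subseteq> homogeneous Q a)"

definition mg_isomorphic ::
    "('k::field, 'c, 'm) mg_operad_data_scheme \<Rightarrow> ('k, 'd, 'n) mg_operad_data_scheme \<Rightarrow> bool" where
  "mg_isomorphic P Q \<longleftrightarrow>
     (\<exists>\<phi> \<psi>. mg_morphism P Q \<phi> \<and> mg_morphism Q P \<psi> \<and>
        (\<forall>n>0. (\<forall>x\<in>ops P n. \<psi> n (\<phi> n x) = x) \<and> (\<forall>y\<in>ops Q n. \<phi> n (\<psi> n y) = y)))"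

section \<open>Multigraded ideals and quotients\<close>

definition mg_ideal ::
    "('k::field, 'c, 'more) mg_operad_data_scheme \<Rightarrow> (nat list \<Rightarrow> 'c set) \<Rightarrow> bool" where
  "mg_ideal P J \<longleftrightarrow>
     (\<forall>n>0. \<forall>a\<in>degrees n. lin_subspace (cmp P a) (J a)) \<and>
     (\<forall>n>0. \<forall>x \<in> Pi\<^sub>E (degrees n) J. \<forall>\<sigma>. \<sigma> permutes {..<n} \<longrightarrow>
        act P n x \<sigma> \<in> Pi\<^sub>E (degrees n) J) \<and>
     (\<forall>n>0. \<forall>m>0. \<forall>i<n. \<forall>x \<in> Pi\<^sub>E (degrees n) J. \<forall>y \<in> ops P m.
        pcomp P n m i x y \<in> Pi\<^sub>E (degrees (n + m - 1)) J) \<and>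
     (\<forall>n>0. \<forall>m>0. \<forall>i<n. \<forall>x \<in> ops P n. \<forall>y \<in> Pi\<^sub>E (degrees m) J.
        pcomp P n m i x y \<in> Pi\<^sub>E (degrees (n + m - 1)) J)"

definition generated_ideal ::
    "('k::field, 'c, 'more) mg_operad_data_scheme \<Rightarrow> (nat list \<Rightarrow> 'c set) \<Rightarrow> nat list \<Rightarrow> 'c set" where
  "generated_ideal P R a = \<Inter> {J a |J. mg_ideal P J \<and> (\<forall>b. R b \<subseteq> J b)}"

definition mg_quotient ::
    "('k::field, 'c) mg_operad_data \<Rightarrow> (nat list \<Rightarrow> 'c set) \<Rightarrow> ('k, 'c set) mg_operad_data" where
  "mg_quotient P J =
     (let cls = (\<lambda>n x. \<lambda>a\<in>degrees n. coset (cmp P a) (J a) (x a));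
          reps = (\<lambda>n X. \<lambda>a\<in>degrees n. rep (X a))
      in \<lparr>
        sp = (\<lambda>n. prod_vs (degrees n) (\<lambda>a. quot_vs (cmp P a) (J a))),
        act = (\<lambda>n X \<sigma>. cls n (act P n (reps n X) \<sigma>)),
        pcomp = (\<lambda>n m i X Y. cls (n + m - 1) (pcomp P n m i (reps n X) (reps m Y))),
        ounit = cls 1 (ounit P),
        cmp = (\<lambda>a. quot_vs (cmp P a) (J a))\<rparr>)"

section \<open>Multigraded operads given by bases\<close>

definition scale :: "'k::field \<Rightarrow> ('b \<Rightarrow>\<^sub>0 'k) \<Rightarrow> ('b \<Rightarrow>\<^sub>0 'k)" where
  "scale c p = Poly_Mapping.map ((*) c) p"

definition free_vs :: "'b set \<Rightarrow> ('k::field, 'b \<Rightarrow>\<^sub>0 'k) vspace" where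
  "free_vs B = \<lparr>
     carr = {p. Poly_Mapping.keys p \<subseteq> B},
     vadd = (+),
     vzero = 0,
     vsmul = scale\<rparr>"

definition lin_ext :: "('b \<Rightarrow> ('d \<Rightarrow>\<^sub>0 'k::field)) \<Rightarrow> ('b \<Rightarrow>\<^sub>0 'k) \<Rightarrow> ('d \<Rightarrow>\<^sub>0 'k)" where
  "lin_ext f p = (\<Sum>u\<in>Poly_Mapping.keys p. scale (Poly_Mapping.lookup p u) (f u))"

definition bilin_ext ::
    "('b \<Rightarrow> 'c \<Rightarrow> ('d \<Rightarrow>\<^sub>0 'k::field)) \<Rightarrow> ('b \<Rightarrow>\<^sub>0 'k) \<Rightarrow> ('c \<Rightarrow>\<^sub>0 'k) \<Rightarrow> ('d \<Rightarrow>\<^sub>0 'k)" where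
  "bilin_ext f p q = lin_ext (\<lambda>u. lin_ext (f u) q) p"

text \<open>
  The component of multidegree \<open>a\<close> has the basis \<open>B (length a)\<close>. A basis element does not record the
  degrees: they are given by the index \<open>a\<close> of the component. \<open>ba u \<sigma>\<close> is \<open>u.\<sigma>\<close>, \<open>bc a b i u w\<close> is
  \<open>u \<circ>\<^sub>i w\<close> for \<open>u\<close>, \<open>w\<close> in the components \<open>a\<close>, \<open>b\<close>, and \<open>e\<close> is the unit in each degree.

  In \<open>pcomp\<close>, a multidegree \<open>c\<close> determines \<open>b\<close> and all entries of \<open>a\<close> except the \<open>i\<close>-th from
  \<open>c = subst_degrees a i b\<close>; as \<open>bc a b i\<close> vanishes for \<open>a ! i \<noteq> sum_list b\<close>, only one pair \<open>(a, b)\<close>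
  contributes to the component \<open>c\<close>.
\<close>

definition basis_operad ::
    "(nat \<Rightarrow> 'b set) \<Rightarrow> ('b \<Rightarrow> (nat \<Rightarrow> nat) \<Rightarrow> 'b)
      \<Rightarrow> (nat list \<Rightarrow> nat list \<Rightarrow> nat \<Rightarrow> 'b \<Rightarrow> 'b \<Rightarrow> ('b \<Rightarrow>\<^sub>0 'k)) \<Rightarrow> 'b
      \<Rightarrow> ('k::field, 'b \<Rightarrow>\<^sub>0 'k) mg_operad_data" where
  "basis_operad B ba bc e = \<lparr>
     sp = (\<lambda>n. prod_vs (degrees n) (\<lambda>a. free_vs (B (length a)))),
     act = (\<lambda>n x \<sigma>. \<lambda>c\<in>degrees n.
       lin_ext (\<lambda>u. Poly_Mapping.single (ba u \<sigma>) 1) (x (permute_list (inv \<sigma>) c))),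
     pcomp = (\<lambda>n m i x y. \<lambda>c\<in>degrees (n + m - 1).
       let b = take m (drop i c);
           a = take i c @ [sum_list b] @ drop (i + m) c
       in bilin_ext (bc a b i) (x a) (y b)),
     ounit = (\<lambda>c\<in>degrees 1. Poly_Mapping.single e 1),
     cmp = (\<lambda>a. free_vs (B (length a)))\<rparr>"

section \<open>The free multigraded operad on one binary product\<close>

datatype 'a monomial = Var 'a | Mul "'a monomial" "'a monomial"

primrec variables :: "'a monomial \<Rightarrow> 'a list" where
  "variables (Var x) = [x]"
| "variables (Mul u v) = variables u @ variables v"

primrec subst_monomial :: "'a monomial \<Rightarrow> ('a \<Rightarrow> 'b monomial) \<Rightarrow> 'b monomial" where
  "subst_monomial (Var x) s = s x"
| "subst_monomial (Mul u v) s = Mul (subst_monomial u s) (subst_monomial v s)"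

definition monomials :: "nat \<Rightarrow> nat monomial set" where
  "monomials n = {u. distinct (variables u) \<and> set (variables u) = {..<n}}"

definition monomial_comp ::
    "nat list \<Rightarrow> nat list \<Rightarrow> nat \<Rightarrow> nat monomial \<Rightarrow> nat monomial \<Rightarrow> (nat monomial \<Rightarrow>\<^sub>0 'k::field)" where
  "monomial_comp a b i u w =
     (if sum_list b = a ! i
      then Poly_Mapping.single
        (subst_monomial u
           (\<lambda>j. if j = i then map_monomial ((+) i) w else Var (shift i (length b) j))) 1
      else 0)"

definition free_operad :: "('k::field, nat monomial \<Rightarrow>\<^sub>0 'k) mg_operad_data" where
  "free_operad =
     basis_operad monomials (\<lambda>u \<sigma>. map_monomial (inv \<sigma>) u) monomial_comp (Var 0)"

definition PL_element :: "'k::field \<Rightarrow> nat \<Rightarrow> nat \<Rightarrow> nat \<Rightarrow> (nat monomial \<Rightarrow>\<^sub>0 'k)" where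
  "PL_element lam k l m =
     Poly_Mapping.single (Mul (Mul (Var 0) (Var 1)) (Var 2)) 1
     - Poly_Mapping.single (Mul (Var 0) (Mul (Var 1) (Var 2))) (lam ^ m)
     - Poly_Mapping.single (Mul (Mul (Var 0) (Var 2)) (Var 1)) 1
     + Poly_Mapping.single (Mul (Var 0) (Mul (Var 2) (Var 1))) (lam ^ l)"

definition PL_relations :: "'k::field \<Rightarrow> nat list \<Rightarrow> (nat monomial \<Rightarrow>\<^sub>0 'k) set" where
  "PL_relations lam a = {PL_element lam k l m |k l m. 0 < k \<and> 0 < l \<and> 0 < m \<and> a = [k, l, m]}"

definition PL :: "'k::field \<Rightarrow> ('k, (nat monomial \<Rightarrow>\<^sub>0 'k) set) mg_operad_data" where
  "PL lam = mg_quotient free_operad (generated_ideal free_operad (PL_relations lam))"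

section \<open>The operad of weighted rooted trees\<close>

text \<open>
  Vertices are identified with their labels, so the vertex set of a tree with \<open>n\<close> vertices is
  \<open>{..<n}\<close>, and edges are pairs (child, parent). The weight of vertex \<open>v\<close> of a tree in the component
  of multidegree \<open>a\<close> is \<open>a ! v\<close>.
\<close>

datatype rtree = RTree (root: nat) (edges: "(nat \<times> nat) set")

definition rooted_trees :: "nat \<Rightarrow> rtree set" where
  "rooted_trees n =
     {T. root T < n \<and> edges T \<subseteq> {..<n} \<times> {..<n} \<and> single_valued (edges T) \<and>
         root T \<notin> Domain (edges T) \<and> (\<forall>v<n. (v, root T) \<in> (edges T)\<^sup>*)}"

definition height :: "rtree \<Rightarrow> nat \<Rightarrow> nat" where
  "height T v = (LEAST k. (v, root T) \<in> edges T ^^ k)"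

definition weighted_depth :: "nat list \<Rightarrow> rtree \<Rightarrow> nat" where
  "weighted_depth a T = (\<Sum>v<length a. a ! v * height T v)"

definition in_edges :: "rtree \<Rightarrow> nat \<Rightarrow> (nat \<times> nat) set" where
  "in_edges S v = {e \<in> edges S. snd e = v}"

definition relabel_tree :: "(nat \<Rightarrow> nat) \<Rightarrow> rtree \<Rightarrow> rtree" where
  "relabel_tree g T = RTree (g (root T)) (map_prod g g ` edges T)"

text \<open>\<open>graft i m f S T\<close> replaces vertex \<open>i\<close> of \<open>S\<close> by the tree \<open>T\<close> with \<open>m\<close> vertices.\<close>

definition graft :: "nat \<Rightarrow> nat \<Rightarrow> (nat \<times> nat \<Rightarrow> nat) \<Rightarrow> rtree \<Rightarrow> rtree \<Rightarrow> rtree" where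
  "graft i m f S T = RTree
     (if root S = i then i + root T else shift i m (root S))
     ({(shift i m c, shift i m p) |c p. (c, p) \<in> edges S \<and> c \<noteq> i \<and> p \<noteq> i}
      \<union> {(i + c, i + p) |c p. (c, p) \<in> edges T}
      \<union> {(shift i m (fst e), i + f e) |e. e \<in> in_edges S i}
      \<union> {(i + root T, shift i m p) |p. (i, p) \<in> edges S})"

definition tree_comp ::
    "'k::field \<Rightarrow> nat list \<Rightarrow> nat list \<Rightarrow> nat \<Rightarrow> rtree \<Rightarrow> rtree \<Rightarrow> (rtree \<Rightarrow>\<^sub>0 'k)" where
  "tree_comp lam a b i S T =
     (let m = length b;
          c = subst_degrees a i b;
          f0 = (\<lambda>e\<in>in_edges S i. root T)
      in if sum_list b = a ! i
         then \<Sum>f \<in> in_edges S i \<rightarrow>\<^sub>E {..<m}.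
           Poly_Mapping.single (graft i m f S T)
             (lam ^ (weighted_depth c (graft i m f S T) - weighted_depth c (graft i m f0 S T)))
         else 0)"

definition tree_operad :: "'k::field \<Rightarrow> ('k, rtree \<Rightarrow>\<^sub>0 'k) mg_operad_data" where
  "tree_operad lam =
     basis_operad rooted_trees (\<lambda>T \<sigma>. relabel_tree (inv \<sigma>) T) (tree_comp lam) (RTree 0 {})"

end

theory Submission
  imports Complex_Main Defs
begin

text \<open>
  The isomorphism sends the product of two variables to the tree whose root is the first variable and
  whose other vertex is the second. The image of a monomial \<open>u\<close> is then a sum over trees: a product
  stands for attaching the root of a tree of its right factor to any vertex of a tree of its left
  factor, and the trees obtained in this way are the ones \<open>compatible\<close> with \<open>u\<close>. Among them is the
  \<open>shape\<close> of \<open>u\<close>, where every right factor is attached to the root of its left factor. Its weighted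
  depth is the least one, and a compatible tree occurs with the coefficient \<open>lam\<close> to the power of the
  excess of its depth over that of the shape (\<open>expansion\<close>).

  Composition of trees has the same form. A tree \<open>X\<close> occurs in the composition of \<open>S\<close> and \<open>T\<close> at vertex
  \<open>i\<close> if and only if the block of vertices coming from \<open>T\<close> carries the tree \<open>T\<close> and collapsing this
  block to one vertex gives \<open>S\<close>; its coefficient is \<open>lam\<close> to the power of the depth of \<open>X\<close> minus the
  depths of \<open>S\<close> and \<open>T\<close>. In an iterated composition these exponents telescope. So the axioms of an
  operad for trees, and the fact that \<open>expansion\<close> respects composition, reduce to identities between
  sets of trees, in which \<open>lam\<close> does not appear (\<open>twisted_operad\<close>, \<open>graftings\<close>, \<open>compatible_insertion\<close>).

  Since weights are positive, the shape is the only compatible tree of least depth. Every tree is the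
  shape of a monomial, and the depths of the trees with given weights are bounded, so by triangularity
  the morphism is surjective (\<open>Phi_surj_basis\<close>).

  It remains to see that its kernel is the ideal generated by the relations. They hold for trees: the
  part of the image of \<open>(x y) z\<close> with \<open>z\<close> attached to \<open>y\<close> is \<open>lam\<close> to the degree of \<open>z\<close> times the image
  of \<open>x (y z)\<close>, and the other part is symmetric in \<open>y\<close> and \<open>z\<close>. Conversely, modulo deeper monomials the
  relation with \<open>u\<close>, \<open>v\<close>, \<open>w\<close> in place of its variables says that \<open>(u v) w\<close> equals \<open>(u w) v\<close>. Such
  exchanges connect any two monomials of the same shape (\<open>similar_same_shape\<close>). In an element of the
  kernel, the coefficients of the monomials of least depth with a given shape add up to zero,
  because no other monomial that occurs in it produces this shape. So these monomials cancel modulo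
  the relations and modulo deeper ones, and induction on the depth shows that the relations generate
  the kernel (\<open>kernel_null\<close>).

  The axioms of a multigraded operad for the quotient are transported from the operad of trees along
  the induced bijection (\<open>first_isomorphism\<close>).
\<close>

section \<open>Linear extension of maps given on a basis\<close>

abbreviation coef :: "('b \<Rightarrow>\<^sub>0 'k::zero) \<Rightarrow> 'b \<Rightarrow> 'k" where "coef \<equiv> Poly_Mapping.lookup"
abbreviation supp :: "('b \<Rightarrow>\<^sub>0 'k::zero) \<Rightarrow> 'b set" where "supp \<equiv> Poly_Mapping.keys"
abbreviation sgl :: "'b \<Rightarrow> 'k \<Rightarrow> ('b \<Rightarrow>\<^sub>0 'k::zero)" where "sgl \<equiv> Poly_Mapping.single"

lemma coef_scale [simp]: "coef (scale c p) u = c * coef p u"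
  by (simp add: scale_def Poly_Mapping.map.rep_eq when_def)

interpretation scaling: vector_space "scale :: 'k::field \<Rightarrow> ('b \<Rightarrow>\<^sub>0 'k) \<Rightarrow> ('b \<Rightarrow>\<^sub>0 'k)"
  by unfold_locales (auto intro!: poly_mapping_eqI simp: lookup_add algebra_simps)

lemma scale_term [simp]: "scale c (sgl u d) = sgl u (c * d)"
  by (rule poly_mapping_eqI) (simp add: lookup_single when_def)

lemma supp_scale: "supp (scale c p) \<subseteq> supp p"
  by (auto simp: in_keys_iff)

lemma lin_ext_superset:
  assumes "finite A" "supp p \<subseteq> A"
  shows "lin_ext f p = (\<Sum>u\<in>A. scale (coef p u) (f u))"
  unfolding lin_ext_def by (rule sum.mono_neutral_left) (use assms in \<open>auto simp: in_keys_iff\<close>)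

lemma lin_ext_zero [simp]: "lin_ext f 0 = 0"
  by (simp add: lin_ext_def)

lemma lin_ext_term [simp]: "lin_ext f (sgl u c) = scale c (f u)"
  by (subst lin_ext_superset[of "{u}"]) auto

lemma lin_ext_add: "lin_ext f (p + q) = lin_ext f p + lin_ext f q"
  using keys_add[of p q]
  by (simp add: lin_ext_superset[where A = "supp p \<union> supp q"] lookup_add scaling.scale_left_distrib
      sum.distrib)

lemma lin_ext_scale: "lin_ext f (scale c p) = scale c (lin_ext f p)"
  using supp_scale[of c p]
  by (simp add: lin_ext_superset[where A = "supp p"] scaling.scale_sum_right)

lemma lin_ext_diff: "lin_ext f (p - q) = lin_ext f p - lin_ext f q"
proof -
  have "lin_ext f (p - q) + lin_ext f q = lin_ext f p"
    by (simp flip: lin_ext_add)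
  then show ?thesis by (simp add: algebra_simps)
qed

lemma lin_ext_sum: "lin_ext f (sum g A) = (\<Sum>x\<in>A. lin_ext f (g x))"
  by (induction A rule: infinite_finite_induct) (auto simp: lin_ext_add)

lemma lin_ext_cong: "(\<And>u. u \<in> supp p \<Longrightarrow> f u = g u) \<Longrightarrow> lin_ext f p = lin_ext g p"
  by (simp add: lin_ext_def)

lemma lin_ext_const_zero [simp]: "lin_ext (\<lambda>u. 0) p = 0"
  by (simp add: lin_ext_def)

lemma lin_ext_fun_add: "lin_ext (\<lambda>u. f u + g u) p = lin_ext f p + lin_ext g p"
  by (simp add: lin_ext_def scaling.scale_right_distrib sum.distrib)

lemma lin_ext_fun_scale: "lin_ext (\<lambda>u. scale c (f u)) p = scale c (lin_ext f p)"
  by (simp add: lin_ext_def scaling.scale_sum_right mult.commute)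

lemma lin_ext_lin_ext: "lin_ext f (lin_ext g p) = lin_ext (\<lambda>u. lin_ext f (g u)) p"
  by (simp add: lin_ext_def[of g] lin_ext_def[of "\<lambda>u. lin_ext f (g u)"] lin_ext_sum lin_ext_scale)

lemma lin_ext_swap: "lin_ext (\<lambda>u. lin_ext (\<lambda>w. f u w) q) p = lin_ext (\<lambda>w. lin_ext (\<lambda>u. f u w) p) q"
  unfolding lin_ext_def
  by (simp add: scaling.scale_sum_right mult.commute) (rule sum.swap)

lemma sum_terms: "(\<Sum>u\<in>supp p. sgl u (coef p u)) = p"
  by (rule poly_mapping_eqI) (simp add: lookup_sum lookup_single when_def in_keys_iff)

lemma lin_ext_basis: "lin_ext (\<lambda>u. sgl u 1) p = p"
  by (simp add: lin_ext_def sum_terms)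

lemma coef_lin_ext: "coef (lin_ext f p) X = (\<Sum>u\<in>supp p. coef p u * coef (f u) X)"
  by (simp add: lin_ext_def lookup_sum)

lemma supp_lin_ext: "supp (lin_ext f p) \<subseteq> (\<Union>u\<in>supp p. supp (f u))"
  unfolding lin_ext_def using keys_sum supp_scale by fastforce

lemma supp_lin_ext_subset: "(\<And>u. u \<in> supp p \<Longrightarrow> supp (f u) \<subseteq> C) \<Longrightarrow> supp (lin_ext f p) \<subseteq> C"
  using supp_lin_ext[of f p] by blast

lemma supp_sum_terms: "supp (\<Sum>X\<in>A. sgl X (f X)) \<subseteq> A"
  using keys_sum[of "\<lambda>X. sgl X (f X)" A] by (auto split: if_splits)

lemma coef_sum_terms: "finite A \<Longrightarrow> coef (\<Sum>X\<in>A. sgl X (f X)) Y = (if Y \<in> A then f Y else 0)"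
  by (simp add: lookup_sum lookup_single when_def)

lemma supp_bilin_ext:
  "(\<And>u w. u \<in> supp p \<Longrightarrow> w \<in> supp q \<Longrightarrow> supp (f u w) \<subseteq> C) \<Longrightarrow> supp (bilin_ext f p q) \<subseteq> C"
  unfolding bilin_ext_def by (intro supp_lin_ext_subset)

lemma bilin_ext_cong:
  "(\<And>u w. u \<in> supp p \<Longrightarrow> w \<in> supp q \<Longrightarrow> f u w = g u w) \<Longrightarrow> bilin_ext f p q = bilin_ext g p q"
  unfolding bilin_ext_def by (intro lin_ext_cong) auto

lemma bilin_ext_add_left: "bilin_ext f (p + p') q = bilin_ext f p q + bilin_ext f p' q"
  by (simp add: bilin_ext_def lin_ext_add)

lemma bilin_ext_add_right: "bilin_ext f p (q + q') = bilin_ext f p q + bilin_ext f p q'"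
  by (simp add: bilin_ext_def lin_ext_add lin_ext_fun_add)

lemma bilin_ext_scale_left: "bilin_ext f (scale c p) q = scale c (bilin_ext f p q)"
  by (simp add: bilin_ext_def lin_ext_scale)

lemma bilin_ext_scale_right: "bilin_ext f p (scale c q) = scale c (bilin_ext f p q)"
  by (simp add: bilin_ext_def lin_ext_scale lin_ext_fun_scale)

lemma bilin_ext_zero [simp]: "bilin_ext f 0 q = 0" "bilin_ext f p 0 = 0"
  by (simp_all add: bilin_ext_def)

lemma bilin_ext_zero_fun: "(\<And>u w. f u w = 0) \<Longrightarrow> bilin_ext f p q = 0"
  by (simp add: bilin_ext_def lin_ext_def)

lemma lin_ext_bilin_ext:
  "lin_ext h (bilin_ext f p q) = bilin_ext (\<lambda>u w. lin_ext h (f u w)) p q"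
  by (simp add: bilin_ext_def lin_ext_lin_ext)

lemma bilin_ext_lin_ext:
  "bilin_ext f (lin_ext g p) (lin_ext h q) = bilin_ext (\<lambda>u w. bilin_ext f (g u) (h w)) p q"
  by (simp add: bilin_ext_def lin_ext_lin_ext) (intro lin_ext_cong, rule lin_ext_swap)

text \<open>
  Sums of basis elements weighted by powers of \<open>lam\<close> whose exponents telescope compose like the sets
  over which they range. This one computation underlies the associativity of a twisted composition
  and the fact that a twisted map respects it.
\<close>

lemma lin_ext_telescope:
  assumes "finite A" and "\<And>Y. Y \<in> A \<Longrightarrow> finite (H Y)"
    and disj: "\<And>Y Y' X. \<lbrakk>Y \<in> A; Y' \<in> A; X \<in> H Y; X \<in> H Y'\<rbrakk> \<Longrightarrow> Y = Y'"
    and "\<And>Y. Y \<in> A \<Longrightarrow> p \<le> E Y"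
    and "\<And>X Y. Y \<in> A \<Longrightarrow> X \<in> H Y \<Longrightarrow> E Y + q \<le> D X"
  shows "lin_ext (\<lambda>Y. \<Sum>X\<in>H Y. sgl X (lam ^ (D X - (E Y + q)) :: 'k::field))
           (\<Sum>Y\<in>A. sgl Y (lam ^ (E Y - p)))
       = (\<Sum>X\<in>(\<Union>Y\<in>A. H Y). sgl X (lam ^ (D X - (p + q))))"
proof -
  have "lin_ext (\<lambda>Y. \<Sum>X\<in>H Y. sgl X (lam ^ (D X - (E Y + q)) :: 'k::field))
           (\<Sum>Y\<in>A. sgl Y (lam ^ (E Y - p)))
      = (\<Sum>Y\<in>A. \<Sum>X\<in>H Y. sgl X (lam ^ (E Y - p + (D X - (E Y + q)))))"
    by (simp add: lin_ext_sum scaling.scale_sum_right power_add)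
  also have "\<dots> = (\<Sum>Y\<in>A. \<Sum>X\<in>H Y. sgl X (lam ^ (D X - (p + q))))"
  proof (intro sum.cong refl arg_cong[of _ _ "\<lambda>k. sgl _ (lam ^ k)"])
    fix Y X assume "Y \<in> A" "X \<in> H Y"
    then show "E Y - p + (D X - (E Y + q)) = D X - (p + q)"
      using assms(4)[of Y] assms(5)[of Y X] by linarith
  qed
  also have "\<dots> = (\<Sum>X\<in>(\<Union>Y\<in>A. H Y). sgl X (lam ^ (D X - (p + q))))"
    using assms(1,2) disj by (intro sum.UNION_disjoint[symmetric]) blast+
  finally show ?thesis .
qed

section \<open>Free vector spaces and products\<close>

lemma is_vspace_free: "is_vspace (free_vs B :: ('k::field, 'b \<Rightarrow>\<^sub>0 'k) vspace)"
proof
  fix x y :: "'b \<Rightarrow>\<^sub>0 'k" and c :: 'k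
  assume x: "x \<in> carr (free_vs B)"
  { assume "y \<in> carr (free_vs B)"
    then show "vadd (free_vs B) x y \<in> carr (free_vs B)"
      using keys_add[of x y] x by (auto simp: free_vs_def) }
  show "vsmul (free_vs B) c x \<in> carr (free_vs B)"
    using supp_scale[of c x] x by (auto simp: free_vs_def)
  show "\<exists>y\<in>carr (free_vs B). vadd (free_vs B) x y = vzero (free_vs B)"
    using x by (intro bexI[of _ "- x"]) (auto simp: free_vs_def)
qed (auto simp: free_vs_def algebra_simps scaling.scale_left_distrib)

lemma is_vspace_prod:
  assumes "\<And>i. i \<in> I \<Longrightarrow> is_vspace (V i)"
  shows "is_vspace (prod_vs I V)"
proof
  fix x assume x: "x \<in> carr (prod_vs I V)"
  have "\<forall>i\<in>I. \<exists>y\<in>carr (V i). vadd (V i) (x i) y = vzero (V i)"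
    using x assms is_vspace.add_inverse by (fastforce simp: prod_vs_def)
  then obtain y where "\<forall>i\<in>I. y i \<in> carr (V i) \<and> vadd (V i) (x i) (y i) = vzero (V i)"
    by (metis (no_types, lifting))
  then show "\<exists>y\<in>carr (prod_vs I V). vadd (prod_vs I V) x y = vzero (prod_vs I V)"
    by (intro bexI[of _ "restrict y I"]) (auto simp: prod_vs_def intro!: restrict_ext)
qed (use assms in \<open>auto simp: prod_vs_def PiE_iff extensional_def is_vspace.add_closed
      is_vspace.zero_closed is_vspace.smul_closed is_vspace.add_assoc is_vspace.add_zero
      is_vspace.smul_add_right is_vspace.smul_add_left is_vspace.smul_smul is_vspace.smul_one
      intro!: ext is_vspace.add_comm\<close>)

section \<open>Positions and multidegrees under insertion\<close>

abbreviation in_block :: "nat \<Rightarrow> nat \<Rightarrow> nat \<Rightarrow> bool" where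
  "in_block i m c \<equiv> i \<le> c \<and> c < i + m"

text \<open>
  The position in an outer operation from which a position of the composite comes: the \<open>m\<close> positions
  of the operation inserted at \<open>i\<close> all come from \<open>i\<close>, and off this block \<open>collapse\<close> inverts \<open>shift\<close>.
\<close>

definition collapse :: "nat \<Rightarrow> nat \<Rightarrow> nat \<Rightarrow> nat" where
  "collapse i m c = (if in_block i m c then i else unshift i m c)"

lemma shift_outside_block: "\<lbrakk>j \<noteq> i; 0 < m\<rbrakk> \<Longrightarrow> \<not> in_block i m (shift i m j)"
  by (auto simp: shift_def)

lemma unshift_shift [simp]: "\<lbrakk>j \<noteq> i; 0 < m\<rbrakk> \<Longrightarrow> unshift i m (shift i m j) = j"
  by (auto simp: shift_def unshift_def)

lemma shift_unshift: "\<lbrakk>\<not> in_block i m c; 0 < m\<rbrakk> \<Longrightarrow> shift i m (unshift i m c) = c"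
  by (auto simp: shift_def unshift_def)

lemma unshift_ne: "\<lbrakk>\<not> in_block i m c; 0 < m\<rbrakk> \<Longrightarrow> unshift i m c \<noteq> i"
  by (auto simp: unshift_def)

lemma collapse_eq_iff [simp]: "0 < m \<Longrightarrow> collapse i m c = i \<longleftrightarrow> in_block i m c"
  by (auto simp: collapse_def unshift_ne)

lemma collapse_shift [simp]: "\<lbrakk>j \<noteq> i; 0 < m\<rbrakk> \<Longrightarrow> collapse i m (shift i m j) = j"
  by (simp add: collapse_def shift_outside_block)

lemma shift_collapse: "\<lbrakk>\<not> in_block i m c; 0 < m\<rbrakk> \<Longrightarrow> shift i m (collapse i m c) = c"
  by (auto simp: collapse_def shift_unshift)

lemma collapse_add [simp]: "q < m \<Longrightarrow> collapse i m (i + q) = i"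
  by (simp add: collapse_def)

lemma shift_less: "\<lbrakk>j < n; i < n; j \<noteq> i; 0 < m\<rbrakk> \<Longrightarrow> shift i m j < n + m - 1"
  by (auto simp: shift_def)

lemma collapse_less: "\<lbrakk>c < n + m - 1; i < n; 0 < m\<rbrakk> \<Longrightarrow> collapse i m c < n"
  by (auto simp: collapse_def unshift_def)

lemma outer_perm_collapse:
  "outer_perm \<sigma> i m c = (if in_block i m c then \<sigma> i + (c - i) else shift (\<sigma> i) m (\<sigma> (collapse i m c)))"
  by (simp add: outer_perm_def collapse_def)

lemma outer_perm_inverse:
  assumes "\<sigma> permutes S" "0 < m"
  shows "outer_perm (inv \<sigma>) (\<sigma> i) m (outer_perm \<sigma> i m c) = c"
proof -
  have "\<sigma> (unshift i m c) \<noteq> \<sigma> i" if "\<not> in_block i m c"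
    using unshift_ne[OF that assms(2)] permutes_inj[OF assms(1)] by (auto dest: injD)
  then show ?thesis
    using assms(2) permutes_inverses[OF assms(1)]
      shift_outside_block[of "\<sigma> (unshift i m c)" "\<sigma> i" m] shift_unshift[of i c m]
    by (cases "in_block i m c") (auto simp: outer_perm_def)
qed

lemma permutes_less_iff: "\<sigma> permutes {..<n} \<Longrightarrow> \<sigma> x < n \<longleftrightarrow> x < n"
  using permutes_in_image[of \<sigma> "{..<n}" x] by simp

lemma outer_perm_less:
  assumes "\<sigma> permutes {..<n}" "i < n" "0 < m" "c < n + m - 1"
  shows "outer_perm \<sigma> i m c < n + m - 1"
proof (cases "in_block i m c")
  case True
  then have "\<sigma> i < n" using assms permutes_less_iff by blast
  with True show ?thesis by (auto simp: outer_perm_def)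
next
  case False
  then have "\<sigma> (unshift i m c) \<noteq> \<sigma> i"
    using unshift_ne[OF False assms(3)] permutes_inj[OF assms(1)] by (auto dest: injD)
  moreover have "unshift i m c < n" using False assms by (auto simp: unshift_def)
  ultimately show ?thesis
    using False assms shift_less[of "\<sigma> (unshift i m c)" n "\<sigma> i" m]
    by (auto simp: outer_perm_def permutes_less_iff)
qed

lemma outer_perm_permutes:
  assumes "\<sigma> permutes {..<n}" "i < n" "0 < m"
  shows "outer_perm \<sigma> i m permutes {..<n + m - 1}"
proof (rule bij_imp_permutes)
  have inj: "inj (outer_perm \<sigma> i m)"
    using outer_perm_inverse[OF assms(1,3)] by (rule inj_on_inverseI)
  show "bij_betw (outer_perm \<sigma> i m) {..<n + m - 1} {..<n + m - 1}"
    unfolding bij_betw_def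
    using inj outer_perm_less[OF assms] by (intro conjI endo_inj_surj) (auto intro: inj_on_subset)
  fix x assume "x \<notin> {..<n + m - 1}"
  moreover have "\<sigma> (x + 1 - m) = x + 1 - m" if "n \<le> x + 1 - m"
    using that permutes_not_in[OF assms(1)] by auto
  moreover have "\<sigma> i < n" using assms permutes_less_iff by blast
  ultimately show "outer_perm \<sigma> i m x = x"
    using assms by (auto simp: outer_perm_def unshift_def shift_def)
qed

lemma inner_perm_permutes:
  assumes "\<tau> permutes {..<m}" "i < n"
  shows "inner_perm \<tau> i m permutes {..<n + m - 1}"
proof (rule bij_imp_permutes)
  have less: "\<tau> x < m \<longleftrightarrow> x < m" for x using assms permutes_less_iff by blast
  have "inner_perm (inv \<tau>) i m (inner_perm \<tau> i m c) = c" for c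
    using assms less[of "c - i"] by (auto simp: inner_perm_def permutes_inverses)
  then have inj: "inj (inner_perm \<tau> i m)" by (rule inj_on_inverseI)
  have "inner_perm \<tau> i m c < n + m - 1" if "c < n + m - 1" for c
    using less[of "c - i"] assms that by (auto simp: inner_perm_def)
  with inj show "bij_betw (inner_perm \<tau> i m) {..<n + m - 1} {..<n + m - 1}"
    unfolding bij_betw_def by (intro conjI endo_inj_surj) (auto intro: inj_on_subset)
  show "inner_perm \<tau> i m x = x" if "x \<notin> {..<n + m - 1}" for x
    using that assms by (auto simp: inner_perm_def)
qed

text \<open>
  The multidegree \<open>c\<close> of a nonzero composite determines the multidegrees of its factors: the inner one
  is the block of \<open>c\<close>, and in the outer one the block is replaced by its sum. So each component of a
  composite has a single contribution.
\<close>

definition inner_degrees :: "nat \<Rightarrow> nat \<Rightarrow> nat list \<Rightarrow> nat list" where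
  "inner_degrees i m c = take m (drop i c)"

definition outer_degrees :: "nat \<Rightarrow> nat \<Rightarrow> nat list \<Rightarrow> nat list" where
  "outer_degrees i m c = take i c @ [sum_list (take m (drop i c))] @ drop (i + m) c"

lemma length_inner_degrees: "\<lbrakk>length c = n + m - 1; i < n; 0 < m\<rbrakk> \<Longrightarrow> length (inner_degrees i m c) = m"
  by (simp add: inner_degrees_def)

lemma length_outer_degrees: "\<lbrakk>length c = n + m - 1; i < n; 0 < m\<rbrakk> \<Longrightarrow> length (outer_degrees i m c) = n"
  by (simp add: outer_degrees_def)

lemma inner_degrees_in: "\<lbrakk>c \<in> degrees (n + m - 1); i < n; 0 < m\<rbrakk> \<Longrightarrow> inner_degrees i m c \<in> degrees m"
  by (auto simp: degrees_def length_inner_degrees) (auto simp: inner_degrees_def dest!: in_set_takeD in_set_dropD)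

lemma outer_degrees_in:
  assumes "c \<in> degrees (n + m - 1)" "i < n" "0 < m"
  shows "outer_degrees i m c \<in> degrees n"
proof -
  have inner: "inner_degrees i m c \<in> degrees m" by (rule inner_degrees_in) fact+
  then obtain k b where kb: "inner_degrees i m c = k # b"
    using assms(3) by (cases "inner_degrees i m c") (auto simp: degrees_def)
  then have "0 < sum_list (take m (drop i c))"
    using inner by (auto simp: degrees_def inner_degrees_def)
  then show ?thesis using assms
    by (auto simp: degrees_def length_outer_degrees)
      (auto simp: outer_degrees_def dest!: in_set_takeD in_set_dropD)
qed

lemma outer_degrees_nth: "\<lbrakk>length c = n + m - 1; i < n; 0 < m\<rbrakk> \<Longrightarrow> outer_degrees i m c ! i = sum_list (inner_degrees i m c)"
  by (simp add: outer_degrees_def inner_degrees_def nth_append)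

lemma outer_degrees_nth_shift:
  "\<lbrakk>length c = n + m - 1; i < n; 0 < m; j < n; j \<noteq> i\<rbrakk> \<Longrightarrow> outer_degrees i m c ! j = c ! shift i m j"
  by (auto simp: outer_degrees_def nth_append shift_def not_less)
    (metis add.commute)

lemma inner_degrees_nth:
  "\<lbrakk>length c = n + m - 1; i < n; 0 < m; q < m\<rbrakk> \<Longrightarrow> inner_degrees i m c ! q = c ! (i + q)"
  by (simp add: inner_degrees_def)

lemma subst_degrees_outer_inner:
  "\<lbrakk>length c = n + m - 1; i < n; 0 < m\<rbrakk> \<Longrightarrow> subst_degrees (outer_degrees i m c) i (inner_degrees i m c) = c"
  by (simp add: outer_degrees_def inner_degrees_def subst_degrees_def)
    (metis add.commute append_take_drop_id drop_drop)

lemma inner_degrees_subst [simp]: "i < length a \<Longrightarrow> inner_degrees i (length b) (subst_degrees a i b) = b"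
  by (simp add: inner_degrees_def subst_degrees_def)

lemma outer_degrees_subst: "\<lbrakk>i < length a; sum_list b = a ! i\<rbrakk> \<Longrightarrow> outer_degrees i (length b) (subst_degrees a i b) = a"
  by (simp add: outer_degrees_def subst_degrees_def id_take_nth_drop[symmetric])

lemma length_subst_degrees: "i < length a \<Longrightarrow> length (subst_degrees a i b) = length a + length b - 1"
  by (simp add: subst_degrees_def)

lemma subst_degrees_in: "\<lbrakk>a \<in> degrees n; b \<in> degrees m; i < n\<rbrakk> \<Longrightarrow> subst_degrees a i b \<in> degrees (n + m - 1)"
  by (auto simp: degrees_def length_subst_degrees) (auto simp: subst_degrees_def dest!: in_set_takeD in_set_dropD)

lemma outer_degrees_append:
  "\<lbrakk>length A = i; length C = m\<rbrakk> \<Longrightarrow> outer_degrees i m (A @ C @ D) = A @ sum_list C # D"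
  by (simp add: outer_degrees_def)

lemma inner_degrees_append: "\<lbrakk>length A = i; length C = m\<rbrakk> \<Longrightarrow> inner_degrees i m (A @ C @ D) = C"
  by (simp add: inner_degrees_def)

lemma split_list_at: "length c = p + q \<Longrightarrow> \<exists>A B. c = A @ B \<and> length A = p \<and> length B = q"
  by (rule exI[of _ "take p c"], rule exI[of _ "drop p c"]) simp

text \<open>
  The three factors of an iterated composite have the same multidegrees on both sides of the
  associativity laws.
\<close>

lemma degrees_sequential:
  assumes "length c = n + m + l - 2" "i < n" "j < m" "0 < l"
  shows "outer_degrees i m (outer_degrees (i + j) l c) = outer_degrees i (m + l - 1) c"
    and "inner_degrees i m (outer_degrees (i + j) l c) = outer_degrees j l (inner_degrees i (m + l - 1) c)"
    and "inner_degrees (i + j) l c = inner_degrees j l (inner_degrees i (m + l - 1) c)"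
proof -
  have "length c = i + (j + (l + ((m - 1 - j) + (n - 1 - i))))" using assms by simp
  then obtain A B C D E where c: "c = A @ B @ C @ D @ E"
    and len: "length A = i" "length B = j" "length C = l" "length D = m - 1 - j"
    using split_list_at by metis
  have outer: "outer_degrees (i + j) l c = A @ (B @ sum_list C # D) @ E"
    using outer_degrees_append[of "A @ B" "i + j" C l "D @ E"] len by (simp add: c)
  have inner: "inner_degrees i (m + l - 1) c = B @ C @ D"
    using inner_degrees_append[of A i "B @ C @ D" "m + l - 1" E] len assms by (simp add: c)
  show "outer_degrees i m (outer_degrees (i + j) l c) = outer_degrees i (m + l - 1) c"
    using outer_degrees_append[of A i "B @ sum_list C # D" m E] len assms
      outer_degrees_append[of A i "B @ C @ D" "m + l - 1" E] unfolding outer by (simp add: c)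
  show "inner_degrees i m (outer_degrees (i + j) l c) = outer_degrees j l (inner_degrees i (m + l - 1) c)"
    using inner_degrees_append[of A i "B @ sum_list C # D" m E] len assms
      outer_degrees_append[of B j C l D] unfolding outer inner by simp
  show "inner_degrees (i + j) l c = inner_degrees j l (inner_degrees i (m + l - 1) c)"
    using inner_degrees_append[of "A @ B" "i + j" C l "D @ E"] inner_degrees_append[of B j C l D] len
    unfolding inner by (simp add: c)
qed

lemma degrees_parallel:
  assumes "length c = n + m + l - 2" "i < j" "j < n" "0 < m" "0 < l"
  shows "outer_degrees i m (outer_degrees (j + m - 1) l c) = outer_degrees j l (outer_degrees i m c)"
    and "inner_degrees i m (outer_degrees (j + m - 1) l c) = inner_degrees i m c"
    and "inner_degrees (j + m - 1) l c = inner_degrees j l (outer_degrees i m c)"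
proof -
  have "length c = i + (m + ((j - 1 - i) + (l + (n - 1 - j))))" using assms by simp
  then obtain A B C D E where c: "c = A @ B @ C @ D @ E"
    and len: "length A = i" "length B = m" "length C = j - 1 - i" "length D = l"
    using split_list_at by metis
  have outer: "outer_degrees i m c = (A @ sum_list B # C) @ D @ E"
    using outer_degrees_append[of A i B m "C @ D @ E"] len by (simp add: c)
  have outer': "outer_degrees (j + m - 1) l c = A @ B @ C @ sum_list D # E"
    using outer_degrees_append[of "A @ B @ C" "j + m - 1" D l E] len assms by (simp add: c)
  show "outer_degrees i m (outer_degrees (j + m - 1) l c) = outer_degrees j l (outer_degrees i m c)"
    using outer_degrees_append[of A i B m "C @ sum_list D # E"] len assms
      outer_degrees_append[of "A @ sum_list B # C" j D l E] unfolding outer outer' by simp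
  show "inner_degrees i m (outer_degrees (j + m - 1) l c) = inner_degrees i m c"
    using inner_degrees_append[of A i B m "C @ sum_list D # E"] inner_degrees_append[of A i B m "C @ D @ E"]
      len unfolding outer' by (simp add: c)
  show "inner_degrees (j + m - 1) l c = inner_degrees j l (outer_degrees i m c)"
    using inner_degrees_append[of "A @ B @ C" "j + m - 1" D l E]
      inner_degrees_append[of "A @ sum_list B # C" j D l E] len assms unfolding outer by (simp add: c)
qed

lemma degrees_outer_perm:
  assumes "length c = n + m - 1" "i < n" "0 < m" "\<sigma> permutes {..<n}"
  shows "outer_degrees i m (permute_list (outer_perm \<sigma> i m) c) = permute_list \<sigma> (outer_degrees (\<sigma> i) m c)"
    and "inner_degrees i m (permute_list (outer_perm \<sigma> i m) c) = inner_degrees (\<sigma> i) m c"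
proof -
  note perm = outer_perm_permutes[OF assms(4,2,3)]
  have si: "\<sigma> i < n" using assms permutes_less_iff by blast
  show inner: "inner_degrees i m (permute_list (outer_perm \<sigma> i m) c) = inner_degrees (\<sigma> i) m c"
    using assms si perm
    by (intro nth_equalityI)
      (auto simp: length_inner_degrees inner_degrees_nth permute_list_nth outer_perm_def)
  show "outer_degrees i m (permute_list (outer_perm \<sigma> i m) c) = permute_list \<sigma> (outer_degrees (\<sigma> i) m c)"
  proof (rule nth_equalityI)
    show "length (outer_degrees i m (permute_list (outer_perm \<sigma> i m) c)) = length (permute_list \<sigma> (outer_degrees (\<sigma> i) m c))"
      using assms si by (simp add: length_outer_degrees)
    fix j assume "j < length (outer_degrees i m (permute_list (outer_perm \<sigma> i m) c))"
    then have j: "j < n" using assms by (simp add: length_outer_degrees)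
    then have sj: "\<sigma> j < n" using assms permutes_less_iff by blast
    have len: "length (outer_degrees (\<sigma> i) m c) = n" using assms si by (simp add: length_outer_degrees)
    show "outer_degrees i m (permute_list (outer_perm \<sigma> i m) c) ! j = permute_list \<sigma> (outer_degrees (\<sigma> i) m c) ! j"
    proof (cases "j = i")
      case True
      then show ?thesis
        using assms si len inner outer_degrees_nth[of "permute_list (outer_perm \<sigma> i m) c" n m i]
        by (simp add: permute_list_nth outer_degrees_nth)
    next
      case False
      then have "\<sigma> j \<noteq> \<sigma> i" using permutes_inj[OF assms(4)] by (auto dest: injD)
      with False show ?thesis
        using assms si len j sj perm shift_less[OF j assms(2) False assms(3)] shift_outside_block[OF False assms(3)]
        by (auto simp: permute_list_nth outer_degrees_nth_shift outer_perm_def)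
    qed
  qed
qed

lemma degrees_inner_perm:
  assumes "length c = n + m - 1" "i < n" "0 < m" "\<tau> permutes {..<m}"
  shows "outer_degrees i m (permute_list (inner_perm \<tau> i m) c) = outer_degrees i m c"
    and "inner_degrees i m (permute_list (inner_perm \<tau> i m) c) = permute_list \<tau> (inner_degrees i m c)"
proof -
  note perm = inner_perm_permutes[OF assms(4,2)]
  show inner: "inner_degrees i m (permute_list (inner_perm \<tau> i m) c) = permute_list \<tau> (inner_degrees i m c)"
    using assms perm permutes_less_iff[OF assms(4)]
    by (intro nth_equalityI)
      (auto simp: length_inner_degrees inner_degrees_nth permute_list_nth inner_perm_def)
  have "sum_list (permute_list \<tau> (inner_degrees i m c)) = sum_list (inner_degrees i m c)"
    using assms by (metis length_inner_degrees mset_permute_list sum_mset_sum_list)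
  with inner have "outer_degrees i m (permute_list (inner_perm \<tau> i m) c) ! j = outer_degrees i m c ! j"
    if "j < n" for j
    using that assms perm outer_degrees_nth[of "permute_list (inner_perm \<tau> i m) c" n m i]
      shift_less[of j n i m] shift_outside_block[of j i m]
    by (cases "j = i") (auto simp: outer_degrees_nth outer_degrees_nth_shift permute_list_nth inner_perm_def)
  then show "outer_degrees i m (permute_list (inner_perm \<tau> i m) c) = outer_degrees i m c"
    using assms by (intro nth_equalityI) (auto simp: length_outer_degrees)
qed

lemma permute_list_in_degrees: "\<lbrakk>\<sigma> permutes {..<n}; a \<in> degrees n\<rbrakk> \<Longrightarrow> permute_list \<sigma> a \<in> degrees n"
  by (auto simp: degrees_def)

lemma permute_list_inv:
  assumes "\<sigma> permutes {..<n}" "length a = n"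
  shows "permute_list (inv \<sigma>) (permute_list \<sigma> a) = a" "permute_list \<sigma> (permute_list (inv \<sigma>) a) = a"
  using assms permutes_inv[OF assms(1)] permutes_inv_o[OF assms(1)]
  by (metis permute_list_compose permute_list_id)+

declare One_nat_def [simp del]

section \<open>Operads with a basis and a composition twisted by a weight\<close>

text \<open>
  The common form of the free operad and of the operad of trees: \<open>B n\<close> is a basis of every component of
  arity \<open>n\<close>, \<open>ba\<close> is the action of a permutation on it, \<open>bc a b i\<close> is the composition of basis elements
  of multidegrees \<open>a\<close> and \<open>b\<close>, and \<open>e\<close> is the unit in each degree.
\<close>

locale closed_basis =
  fixes B :: "nat \<Rightarrow> 'b set"
    and ba :: "'b \<Rightarrow> (nat \<Rightarrow> nat) \<Rightarrow> 'b"
    and bc :: "nat list \<Rightarrow> nat list \<Rightarrow> nat \<Rightarrow> 'b \<Rightarrow> 'b \<Rightarrow> ('b \<Rightarrow>\<^sub>0 'k::field)"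
    and e :: 'b
  assumes ba_closed: "\<lbrakk>u \<in> B n; \<sigma> permutes {..<n}\<rbrakk> \<Longrightarrow> ba u \<sigma> \<in> B n"
    and e_closed: "e \<in> B 1"
    and supp_bc: "\<lbrakk>0 < m; i < n; a \<in> degrees n; b \<in> degrees m; u \<in> B n; w \<in> B m\<rbrakk> \<Longrightarrow>
        supp (bc a b i u w) \<subseteq> B (n + m - 1)"
begin

abbreviation P :: "('k, 'b \<Rightarrow>\<^sub>0 'k) mg_operad_data" where "P \<equiv> basis_operad B ba bc e"

abbreviation lba :: "(nat \<Rightarrow> nat) \<Rightarrow> ('b \<Rightarrow>\<^sub>0 'k) \<Rightarrow> ('b \<Rightarrow>\<^sub>0 'k)" where
  "lba \<sigma> \<equiv> lin_ext (\<lambda>u. sgl (ba u \<sigma>) 1)"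

lemma sp_P: "sp P n = prod_vs (degrees n) (\<lambda>a. free_vs (B (length a)))"
  by (simp add: basis_operad_def)

lemma ops_P: "x \<in> ops P n \<longleftrightarrow> x \<in> (\<Pi>\<^sub>E a\<in>degrees n. {p. supp p \<subseteq> B n})"
proof -
  have "ops P n = (\<Pi>\<^sub>E a\<in>degrees n. {p. supp p \<subseteq> B (length a)})"
    by (simp add: sp_P prod_vs_def free_vs_def)
  also have "\<dots> = (\<Pi>\<^sub>E a\<in>degrees n. {p. supp p \<subseteq> B n})"
    by (rule PiE_cong) (simp add: degrees_def)
  finally show ?thesis by simp
qed

lemma restrict_in_ops: "(\<And>c. c \<in> degrees n \<Longrightarrow> supp (f c) \<subseteq> B n) \<Longrightarrow> (\<lambda>c\<in>degrees n. f c) \<in> ops P n"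
  unfolding ops_P by auto

lemma supp_ops: "\<lbrakk>x \<in> ops P n; a \<in> degrees n\<rbrakk> \<Longrightarrow> supp (x a) \<subseteq> B n"
  unfolding ops_P by (auto dest: PiE_mem)

lemma ops_eqI: "\<lbrakk>x \<in> ops P n; y \<in> ops P n; \<And>c. c \<in> degrees n \<Longrightarrow> x c = y c\<rbrakk> \<Longrightarrow> x = y"
  unfolding ops_P by (rule PiE_ext)

lemma vadd_P: "vadd (sp P n) x y = (\<lambda>a\<in>degrees n. x a + y a)"
  and vsmul_P: "vsmul (sp P n) c x = (\<lambda>a\<in>degrees n. scale c (x a))"
  and vzero_P: "vzero (sp P n) = (\<lambda>a\<in>degrees n. 0)"
  by (simp_all add: sp_P prod_vs_def free_vs_def)

lemma act_P: "act P n x \<sigma> = (\<lambda>c\<in>degrees n. lba \<sigma> (x (permute_list (inv \<sigma>) c)))"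
  by (simp add: basis_operad_def)

lemma pcomp_P: "pcomp P n m i x y = (\<lambda>c\<in>degrees (n + m - 1).
    bilin_ext (bc (outer_degrees i m c) (inner_degrees i m c) i) (x (outer_degrees i m c)) (y (inner_degrees i m c)))"
  by (simp add: basis_operad_def outer_degrees_def inner_degrees_def Let_def)

lemma ounit_P: "ounit P = (\<lambda>c\<in>degrees 1. sgl e 1)"
  by (simp add: basis_operad_def)

lemma supp_lba: "\<lbrakk>supp p \<subseteq> B n; \<sigma> permutes {..<n}\<rbrakk> \<Longrightarrow> supp (lba \<sigma> p) \<subseteq> B n"
  by (rule supp_lin_ext_subset) (auto simp: ba_closed)

lemma act_closed: "\<lbrakk>0 < n; x \<in> ops P n; \<sigma> permutes {..<n}\<rbrakk> \<Longrightarrow> act P n x \<sigma> \<in> ops P n"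
  unfolding act_P by (intro restrict_in_ops supp_lba supp_ops permute_list_in_degrees permutes_inv)

lemma pcomp_closed:
  assumes "0 < m" "i < n" "x \<in> ops P n" "y \<in> ops P m"
  shows "pcomp P n m i x y \<in> ops P (n + m - 1)"
proof -
  have "supp (bilin_ext (bc (outer_degrees i m c) (inner_degrees i m c) i) (x (outer_degrees i m c))
      (y (inner_degrees i m c))) \<subseteq> B (n + m - 1)" if c: "c \<in> degrees (n + m - 1)" for c
    using supp_ops[OF assms(3) outer_degrees_in[OF c assms(2,1)]]
      supp_ops[OF assms(4) inner_degrees_in[OF c assms(2,1)]]
      outer_degrees_in[OF c assms(2,1)] inner_degrees_in[OF c assms(2,1)] assms
    by (intro supp_bilin_ext supp_bc) auto
  then show ?thesis unfolding pcomp_P by (rule restrict_in_ops)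
qed

lemma act_linear_P: "\<lbrakk>0 < n; \<sigma> permutes {..<n}\<rbrakk> \<Longrightarrow> linear_map (sp P n) (sp P n) (\<lambda>x. act P n x \<sigma>)"
  unfolding linear_map_def
  by (auto simp: act_closed vadd_P vsmul_P)
    (auto simp: act_P permute_list_in_degrees permutes_inv lin_ext_add lin_ext_scale intro!: restrict_ext)

lemma pcomp_linear_left_P:
  "\<lbrakk>0 < m; i < n; y \<in> ops P m\<rbrakk> \<Longrightarrow> linear_map (sp P n) (sp P (n + m - 1)) (\<lambda>x. pcomp P n m i x y)"
  unfolding linear_map_def
  by (auto simp: pcomp_closed vadd_P vsmul_P)
    (auto simp: pcomp_P outer_degrees_in bilin_ext_add_left bilin_ext_scale_left intro!: restrict_ext)

lemma pcomp_linear_right_P: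
  "\<lbrakk>0 < m; i < n; x \<in> ops P n\<rbrakk> \<Longrightarrow> linear_map (sp P m) (sp P (n + m - 1)) (\<lambda>y. pcomp P n m i x y)"
  unfolding linear_map_def
  by (auto simp: pcomp_closed vadd_P vsmul_P)
    (auto simp: pcomp_P inner_degrees_in bilin_ext_add_right bilin_ext_scale_right intro!: restrict_ext)

lemma ounit_closed: "ounit P \<in> ops P 1"
  by (auto simp: ops_P ounit_P e_closed)

lemma homogeneous_P:
  assumes "a \<in> degrees n"
  shows "homogeneous P a = {x \<in> ops P n. \<forall>b\<in>degrees n. b \<noteq> a \<longrightarrow> x b = 0}"
proof -
  have "length a = n" using assms by (simp add: degrees_def)
  then show ?thesis by (simp add: homogeneous_def basis_operad_def free_vs_def)
qed

end

text \<open>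
  The composition of \<open>u\<close> and \<open>w\<close> at \<open>i\<close> is the sum of the elements \<open>X\<close> of a finite set \<open>G n m i u w\<close>, each
  with the coefficient \<open>lam\<close> to the power \<open>d X - d u - d w\<close>. In iterated compositions the exponents
  telescope, and since \<open>X\<close> determines \<open>u\<close> and \<open>w\<close> no basis element is counted twice. So every axiom of an
  operad follows from an identity between sets of basis elements that does not involve \<open>lam\<close>.
\<close>

locale twisted_operad =
  closed_basis B ba bc e
  for B :: "nat \<Rightarrow> 'b set"
    and ba :: "'b \<Rightarrow> (nat \<Rightarrow> nat) \<Rightarrow> 'b"
    and bc :: "nat list \<Rightarrow> nat list \<Rightarrow> nat \<Rightarrow> 'b \<Rightarrow> 'b \<Rightarrow> ('b \<Rightarrow>\<^sub>0 'k::field)"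
    and e :: 'b +
  fixes G :: "nat \<Rightarrow> nat \<Rightarrow> nat \<Rightarrow> 'b \<Rightarrow> 'b \<Rightarrow> 'b set"
    and d :: "nat list \<Rightarrow> 'b \<Rightarrow> nat"
    and lam :: 'k
  assumes ba_id: "u \<in> B n \<Longrightarrow> ba u id = u"
    and ba_ba: "\<lbrakk>u \<in> B n; \<sigma> permutes {..<n}; \<tau> permutes {..<n}\<rbrakk> \<Longrightarrow> ba (ba u \<sigma>) \<tau> = ba u (\<sigma> \<circ> \<tau>)"
    and weight_ba: "\<lbrakk>a \<in> degrees n; u \<in> B n; \<sigma> permutes {..<n}\<rbrakk> \<Longrightarrow> d (permute_list \<sigma> a) (ba u \<sigma>) = d a u"
    and weight_e: "d [k] e = 0"
    and bc_eq: "\<lbrakk>0 < m; i < n; a \<in> degrees n; b \<in> degrees m; u \<in> B n; w \<in> B m\<rbrakk> \<Longrightarrow>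
        bc a b i u w = (if sum_list b = a ! i
          then \<Sum>X\<in>G n m i u w. sgl X (lam ^ (d (subst_degrees a i b) X - (d a u + d b w))) else 0)"
    and G_finite: "\<lbrakk>0 < m; i < n; u \<in> B n; w \<in> B m\<rbrakk> \<Longrightarrow> finite (G n m i u w)"
    and G_closed: "\<lbrakk>0 < m; i < n; u \<in> B n; w \<in> B m\<rbrakk> \<Longrightarrow> G n m i u w \<subseteq> B (n + m - 1)"
    and G_weight: "\<lbrakk>0 < m; i < n; a \<in> degrees n; b \<in> degrees m; u \<in> B n; w \<in> B m; sum_list b = a ! i;
        X \<in> G n m i u w\<rbrakk> \<Longrightarrow> d a u + d b w \<le> d (subst_degrees a i b) X"
    and G_unique: "\<lbrakk>0 < m; i < n; u \<in> B n; w \<in> B m; u' \<in> B n; w' \<in> B m;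
        X \<in> G n m i u w; X \<in> G n m i u' w'\<rbrakk> \<Longrightarrow> u = u' \<and> w = w'"
    and G_unit_left: "\<lbrakk>0 < n; u \<in> B n\<rbrakk> \<Longrightarrow> G 1 n 0 e u = {u}"
    and G_unit_right: "\<lbrakk>i < n; u \<in> B n\<rbrakk> \<Longrightarrow> G n 1 i u e = {u}"
    and G_sequential: "\<lbrakk>0 < l; i < n; j < m; u \<in> B n; w \<in> B m; z \<in> B l\<rbrakk> \<Longrightarrow>
        (\<Union>Y\<in>G n m i u w. G (n + m - 1) l (i + j) Y z) = (\<Union>Z\<in>G m l j w z. G n (m + l - 1) i u Z)"
    and G_parallel: "\<lbrakk>0 < m; 0 < l; i < j; j < n; u \<in> B n; w \<in> B m; z \<in> B l\<rbrakk> \<Longrightarrow>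
        (\<Union>Y\<in>G n m i u w. G (n + m - 1) l (j + m - 1) Y z) = (\<Union>Y\<in>G n l j u z. G (n + l - 1) m i Y w)"
    and G_outer: "\<lbrakk>0 < m; i < n; u \<in> B n; w \<in> B m; \<sigma> permutes {..<n}\<rbrakk> \<Longrightarrow>
        G n m i (ba u \<sigma>) w = (\<lambda>X. ba X (outer_perm \<sigma> i m)) ` G n m (\<sigma> i) u w"
    and G_inner: "\<lbrakk>0 < m; i < n; u \<in> B n; w \<in> B m; \<tau> permutes {..<m}\<rbrakk> \<Longrightarrow>
        G n m i u (ba w \<tau>) = (\<lambda>X. ba X (inner_perm \<tau> i m)) ` G n m i u w"
begin

lemma act_id_P: "\<lbrakk>0 < n; x \<in> ops P n\<rbrakk> \<Longrightarrow> act P n x id = x"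
proof (rule ops_eqI[where n = n])
  fix c assume x: "x \<in> ops P n" and c: "c \<in> degrees n"
  have "lba id (x c) = lin_ext (\<lambda>u. sgl u 1) (x c)"
    using supp_ops[OF x c] ba_id by (intro lin_ext_cong) auto
  then show "act P n x id c = x c" using c by (simp add: act_P lin_ext_basis)
qed (auto simp: act_closed permutes_id)

lemma act_act_P:
  assumes "0 < n" "x \<in> ops P n" "\<sigma> permutes {..<n}" "\<tau> permutes {..<n}"
  shows "act P n (act P n x \<sigma>) \<tau> = act P n x (\<sigma> \<circ> \<tau>)"
proof (rule ops_eqI[where n = n])
  fix c assume c: "c \<in> degrees n"
  have len: "length c = n" using c by (simp add: degrees_def)
  have inv: "inv (\<sigma> \<circ> \<tau>) = inv \<tau> \<circ> inv \<sigma>"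
    using assms(3,4) by (simp add: o_inv_distrib permutes_bij)
  have perm: "permute_list (inv (\<sigma> \<circ> \<tau>)) c = permute_list (inv \<sigma>) (permute_list (inv \<tau>) c)"
    unfolding inv using permute_list_compose[of "inv \<sigma>" c "inv \<tau>"] permutes_inv[OF assms(3)] len by simp
  have "lba \<tau> (lba \<sigma> (x (permute_list (inv \<sigma>) (permute_list (inv \<tau>) c))))
      = lba (\<sigma> \<circ> \<tau>) (x (permute_list (inv \<sigma>) (permute_list (inv \<tau>) c)))"
    using supp_ops[OF assms(2), of "permute_list (inv \<sigma>) (permute_list (inv \<tau>) c)"] c assms
    by (auto simp: lin_ext_lin_ext permute_list_in_degrees permutes_inv ba_ba subset_iff intro!: lin_ext_cong)
  then show "act P n (act P n x \<sigma>) \<tau> c = act P n x (\<sigma> \<circ> \<tau>) c"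
    using c assms by (simp add: act_P perm permute_list_in_degrees permutes_inv)
qed (use assms in \<open>auto simp: act_closed permutes_compose\<close>)

lemma bc_unit_left:
  assumes "0 < n" "c \<in> degrees n" "u \<in> B n"
  shows "bc [sum_list c] c 0 e u = sgl u 1"
proof -
  have "0 < sum_list c"
    using assms by (cases c) (auto simp: degrees_def)
  then have "[sum_list c] \<in> degrees 1" by (simp add: degrees_def)
  then show ?thesis
    using assms bc_eq[of n 0 1 "[sum_list c]" c e u] e_closed G_unit_left
    by (simp add: weight_e subst_degrees_def)
qed

lemma bc_unit_right:
  assumes "i < n" "c \<in> degrees n" "u \<in> B n"
  shows "bc c [c ! i] i u e = sgl u 1"
proof -
  have "i < length c" "[c ! i] \<in> degrees 1" using assms by (auto simp: degrees_def)
  then show ?thesis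
    using assms bc_eq[of 1 i n c "[c ! i]" u e] e_closed G_unit_right
    by (simp add: weight_e subst_degrees_def id_take_nth_drop[symmetric])
qed

lemma unit_left_P: "\<lbrakk>0 < n; x \<in> ops P n\<rbrakk> \<Longrightarrow> pcomp P 1 n 0 (ounit P) x = x"
proof (rule ops_eqI[where n = n])
  fix c assume n: "0 < n" and x: "x \<in> ops P n" and c: "c \<in> degrees n"
  have deg: "outer_degrees 0 n c = [sum_list c]" "inner_degrees 0 n c = c"
    using c by (auto simp: outer_degrees_def inner_degrees_def degrees_def)
  have "[sum_list c] \<in> degrees 1" using outer_degrees_in[of c 1 n 0] n c deg by simp
  moreover have "lin_ext (bc [sum_list c] c 0 e) (x c) = lin_ext (\<lambda>u. sgl u 1) (x c)"
    using supp_ops[OF x c] bc_unit_left[OF n c] by (intro lin_ext_cong) auto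
  ultimately show "pcomp P 1 n 0 (ounit P) x c = x c"
    using c deg by (simp add: pcomp_P ounit_P bilin_ext_def lin_ext_basis)
next
  assume "0 < n" "x \<in> ops P n"
  then show "pcomp P 1 n 0 (ounit P) x \<in> ops P n"
    using pcomp_closed[of n 0 1 "ounit P" x] ounit_closed by simp
qed

lemma unit_right_P: "\<lbrakk>i < n; x \<in> ops P n\<rbrakk> \<Longrightarrow> pcomp P n 1 i x (ounit P) = x"
proof (rule ops_eqI[where n = n])
  fix c assume i: "i < n" and x: "x \<in> ops P n" and c: "c \<in> degrees n"
  have len: "length c = n" using c by (simp add: degrees_def)
  have deg: "inner_degrees i 1 c = [c ! i]" "outer_degrees i 1 c = c"
    using len i by (auto simp: outer_degrees_def inner_degrees_def One_nat_def Cons_nth_drop_Suc[symmetric] id_take_nth_drop[symmetric])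
  have "[c ! i] \<in> degrees 1" using c i by (auto simp: degrees_def)
  moreover have "lin_ext (\<lambda>u. bc c [c ! i] i u e) (x c) = lin_ext (\<lambda>u. sgl u 1) (x c)"
    using supp_ops[OF x c] bc_unit_right[OF i c] by (intro lin_ext_cong) auto
  ultimately show "pcomp P n 1 i x (ounit P) c = x c"
    using c deg by (simp add: pcomp_P ounit_P bilin_ext_def lin_ext_basis)
next
  assume "i < n" "x \<in> ops P n"
  then show "pcomp P n 1 i x (ounit P) \<in> ops P n"
    using pcomp_closed[of 1 i n x "ounit P"] ounit_closed by simp
qed

lemma bc_bc_left:
  assumes "0 < m" "i < n" "0 < l" "j < n + m - 1" "a \<in> degrees n" "b \<in> degrees m" "b' \<in> degrees l"
    and "u \<in> B n" "w \<in> B m" "z \<in> B l"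
  shows "lin_ext (\<lambda>Y. bc (subst_degrees a i b) b' j Y z) (bc a b i u w) =
     (if sum_list b = a ! i \<and> sum_list b' = subst_degrees a i b ! j
      then \<Sum>X\<in>(\<Union>Y\<in>G n m i u w. G (n + m - 1) l j Y z).
        sgl X (lam ^ (d (subst_degrees (subst_degrees a i b) j b') X - (d a u + d b w + d b' z))) else 0)"
proof -
  let ?c = "subst_degrees a i b"
  have c: "?c \<in> degrees (n + m - 1)" using assms by (intro subst_degrees_in)
  have Y: "Y \<in> B (n + m - 1)" if "Y \<in> G n m i u w" for Y
    using G_closed[of m i n u w] that assms by blast
  note eqs = bc_eq[OF assms(1,2,5,6,8,9)]
  show ?thesis
  proof (cases "sum_list b = a ! i")
    case True
    let ?f = "\<lambda>Y. if sum_list b' = ?c ! j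
       then \<Sum>X\<in>G (n + m - 1) l j Y z. sgl X (lam ^ (d (subst_degrees ?c j b') X - (d ?c Y + d b' z))) else 0"
    let ?s = "\<Sum>Y\<in>G n m i u w. sgl Y (lam ^ (d ?c Y - (d a u + d b w)))"
    have "bc ?c b' j Y z = ?f Y" if "Y \<in> supp ?s" for Y
      using bc_eq[of l j "n + m - 1" ?c b' Y z] Y subsetD[OF supp_sum_terms that] assms c by simp
    then have L: "lin_ext (\<lambda>Y. bc ?c b' j Y z) (bc a b i u w) = lin_ext ?f ?s"
      unfolding eqs if_P[OF True] by (rule lin_ext_cong)
    show ?thesis
    proof (cases "sum_list b' = ?c ! j")
      case *: True
      have "lin_ext ?f ?s = (\<Sum>X\<in>(\<Union>Y\<in>G n m i u w. G (n + m - 1) l j Y z).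
        sgl X (lam ^ (d (subst_degrees ?c j b') X - ((d a u + d b w) + d b' z))))"
        unfolding if_P[OF *]
      proof (rule lin_ext_telescope)
        show "Y = Y'" if "Y \<in> G n m i u w" "Y' \<in> G n m i u w" "X \<in> G (n + m - 1) l j Y z"
          "X \<in> G (n + m - 1) l j Y' z" for Y Y' X
          using G_unique[of l j "n + m - 1" Y z Y' z X] that Y assms by blast
      qed (use assms G_finite Y G_weight c True * in auto)
      with L * True show ?thesis by simp
    qed (simp add: L)
  next
    case False
    then show ?thesis by (simp add: eqs)
  qed
qed

lemma bc_bc_right:
  assumes "i < n" "0 < l" "j < m" "a \<in> degrees n" "b \<in> degrees m" "b' \<in> degrees l"
    and "u \<in> B n" "w \<in> B m" "z \<in> B l"
  shows "lin_ext (\<lambda>Z. bc a (subst_degrees b j b') i u Z) (bc b b' j w z) =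
     (if sum_list b' = b ! j \<and> sum_list (subst_degrees b j b') = a ! i
      then \<Sum>X\<in>(\<Union>Z\<in>G m l j w z. G n (m + l - 1) i u Z).
        sgl X (lam ^ (d (subst_degrees a i (subst_degrees b j b')) X - (d a u + d b w + d b' z))) else 0)"
proof -
  let ?c = "subst_degrees b j b'"
  have c: "?c \<in> degrees (m + l - 1)" using assms by (intro subst_degrees_in)
  have Y: "Y \<in> B (m + l - 1)" if "Y \<in> G m l j w z" for Y
    using G_closed[of l j m w z] that assms by blast
  note eqs = bc_eq[OF assms(2,3,5,6,8,9)]
  show ?thesis
  proof (cases "sum_list b' = b ! j")
    case True
    let ?f = "\<lambda>Z. if sum_list ?c = a ! i
       then \<Sum>X\<in>G n (m + l - 1) i u Z. sgl X (lam ^ (d (subst_degrees a i ?c) X - (d ?c Z + d a u))) else 0"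
    let ?s = "\<Sum>Z\<in>G m l j w z. sgl Z (lam ^ (d ?c Z - (d b w + d b' z)))"
    have "bc a ?c i u Z = ?f Z" if "Z \<in> supp ?s" for Z
      using bc_eq[of "m + l - 1" i n a ?c u Z] Y subsetD[OF supp_sum_terms that] assms c
      by (simp add: add.commute)
    then have L: "lin_ext (\<lambda>Z. bc a ?c i u Z) (bc b b' j w z) = lin_ext ?f ?s"
      unfolding eqs if_P[OF True] by (rule lin_ext_cong)
    show ?thesis
    proof (cases "sum_list ?c = a ! i")
      case *: True
      have "lin_ext ?f ?s = (\<Sum>X\<in>(\<Union>Z\<in>G m l j w z. G n (m + l - 1) i u Z).
        sgl X (lam ^ (d (subst_degrees a i ?c) X - ((d b w + d b' z) + d a u))))"
        unfolding if_P[OF *]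
      proof (rule lin_ext_telescope)
        show "Z = Z'" if "Z \<in> G m l j w z" "Z' \<in> G m l j w z" "X \<in> G n (m + l - 1) i u Z"
          "X \<in> G n (m + l - 1) i u Z'" for Z Z' X
          using G_unique[of "m + l - 1" i n u Z u Z' X] that Y assms by simp
        show "d ?c Z + d a u \<le> d (subst_degrees a i ?c) X"
          if "Z \<in> G m l j w z" "X \<in> G n (m + l - 1) i u Z" for Z X
          using G_weight[of "m + l - 1" i n a ?c u Z X] that Y assms c * by simp
      qed (use assms G_finite Y G_weight[OF assms(2,3,5,6,8,9)] c True * in auto)
      with L * True show ?thesis by (simp add: ac_simps)
    qed (simp add: L)
  next
    case False
    then show ?thesis by (simp add: eqs)
  qed
qed

lemma assoc_sequential_P:
  assumes "0 < l" "i < n" "j < m" "x \<in> ops P n" "y \<in> ops P m" "z \<in> ops P l"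
  shows "pcomp P (n + m - 1) l (i + j) (pcomp P n m i x y) z =
    pcomp P n (m + l - 1) i x (pcomp P m l j y z)"
proof (rule ops_eqI[where n = "n + m + l - 2"])
  show "pcomp P (n + m - 1) l (i + j) (pcomp P n m i x y) z \<in> ops P (n + m + l - 2)"
    using pcomp_closed[of l "i + j" "n + m - 1" "pcomp P n m i x y" z] pcomp_closed[of m i n x y] assms
    by (simp add: ac_simps)
  show "pcomp P n (m + l - 1) i x (pcomp P m l j y z) \<in> ops P (n + m + l - 2)"
    using pcomp_closed[of "m + l - 1" i n x "pcomp P m l j y z"] pcomp_closed[of l j m y z] assms
    by (simp add: ac_simps)
  fix c assume c: "c \<in> degrees (n + m + l - 2)"
  have len: "length c = n + m + l - 2" using c by (simp add: degrees_def)
  define a where "a = outer_degrees i (m + l - 1) c"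
  define b where "b = outer_degrees j l (inner_degrees i (m + l - 1) c)"
  define b' where "b' = inner_degrees (i + j) l c"
  have in_c: "c \<in> degrees (n + (m + l - 1) - 1)" "c \<in> degrees (n + m - 1 + l - 1)"
    using c assms by (simp_all add: ac_simps)
  have in_a: "a \<in> degrees n" unfolding a_def using in_c assms by (intro outer_degrees_in) auto
  have in_bb: "inner_degrees i (m + l - 1) c \<in> degrees (m + l - 1)"
    using in_c assms by (intro inner_degrees_in[of _ n]) auto
  have in_b: "b \<in> degrees m" unfolding b_def using in_bb assms by (intro outer_degrees_in) auto
  have in_b': "b' \<in> degrees l" unfolding b'_def using in_c assms by (intro inner_degrees_in[of _ "n + m - 1"]) auto
  have in_ab: "outer_degrees (i + j) l c \<in> degrees (n + m - 1)"
    using in_c assms by (intro outer_degrees_in) auto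
  note seq = degrees_sequential[OF len assms(2,3,1)]
  have ab: "outer_degrees (i + j) l c = subst_degrees a i b"
    using subst_degrees_outer_inner[of "outer_degrees (i + j) l c" n m i] in_ab assms seq
    by (simp add: a_def b_def degrees_def)
  have bb: "inner_degrees i (m + l - 1) c = subst_degrees b j b'"
    using subst_degrees_outer_inner[of "inner_degrees i (m + l - 1) c" m l j] in_bb assms seq
    by (simp add: b_def b'_def degrees_def)
  have aa: "outer_degrees i m (subst_degrees a i b) = a" "inner_degrees i m (subst_degrees a i b) = b"
    using seq unfolding ab[symmetric] by (simp_all add: a_def b_def)
  have bb': "outer_degrees j l (subst_degrees b j b') = b" "inner_degrees j l (subst_degrees b j b') = b'"
    using seq unfolding bb[symmetric] by (simp_all add: b_def b'_def)
  have cc: "subst_degrees (subst_degrees a i b) (i + j) b' = c"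
    "subst_degrees a i (subst_degrees b j b') = c"
    using subst_degrees_outer_inner[of c "n + m - 1" l "i + j"]
      subst_degrees_outer_inner[of c n "m + l - 1" i] in_c assms ab bb
    by (simp_all add: a_def b'_def degrees_def)
  have *: "subst_degrees a i b ! (i + j) = b ! j"
    using in_a in_b assms by (auto simp: degrees_def subst_degrees_def nth_append)
  have **: "sum_list (subst_degrees b j b') = sum_list b" if "sum_list b' = b ! j"
  proof -
    have "j < length b" using in_b assms by (simp add: degrees_def)
    then have "sum_list b = sum_list (take j b @ b ! j # drop (Suc j) b)" by (simp flip: id_take_nth_drop)
    then show ?thesis using that by (simp add: subst_degrees_def)
  qed
  have key: "lin_ext (\<lambda>Y. bc (subst_degrees a i b) b' (i + j) Y w'') (bc a b i u w)
      = lin_ext (\<lambda>Z. bc a (subst_degrees b j b') i u Z) (bc b b' j w w'')"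
    if "u \<in> B n" "w \<in> B m" "w'' \<in> B l" for u w w''
  proof -
    have ij: "i + j < n + m - 1" and m: "0 < m" using assms by simp_all
    show ?thesis
      using bc_bc_left[OF m assms(2,1) ij in_a in_b in_b' that]
        bc_bc_right[OF assms(2,1,3) in_a in_b in_b' that] G_sequential[OF assms(1-3) that]
        * ** by (cases "sum_list b' = b ! j") (simp_all add: cc)
  qed
  have "pcomp P (n + m - 1) l (i + j) (pcomp P n m i x y) z c
      = bilin_ext (bc (subst_degrees a i b) b' (i + j)) (bilin_ext (bc a b i) (x a) (y b)) (z b')"
    using in_c(2) in_ab by (simp add: pcomp_P ab aa flip: b'_def)
  also have "\<dots> = lin_ext (\<lambda>u. lin_ext (\<lambda>w. lin_ext (\<lambda>v.
      lin_ext (\<lambda>Y. bc (subst_degrees a i b) b' (i + j) Y v) (bc a b i u w)) (z b')) (y b)) (x a)"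
    unfolding bilin_ext_def lin_ext_lin_ext by (intro lin_ext_cong, rule lin_ext_swap)
  also have "\<dots> = lin_ext (\<lambda>u. lin_ext (\<lambda>w. lin_ext (\<lambda>v.
      lin_ext (\<lambda>Z. bc a (subst_degrees b j b') i u Z) (bc b b' j w v)) (z b')) (y b)) (x a)"
    using supp_ops[OF assms(4) in_a] supp_ops[OF assms(5) in_b] supp_ops[OF assms(6) in_b']
    by (intro lin_ext_cong key) auto
  also have "\<dots> = bilin_ext (bc a (subst_degrees b j b') i) (x a) (bilin_ext (bc b b' j) (y b) (z b'))"
    unfolding bilin_ext_def lin_ext_lin_ext ..
  also have "\<dots> = pcomp P n (m + l - 1) i x (pcomp P m l j y z) c"
    using in_c(1) in_bb by (simp add: pcomp_P bb bb' flip: a_def)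
  finally show "pcomp P (n + m - 1) l (i + j) (pcomp P n m i x y) z c
    = pcomp P n (m + l - 1) i x (pcomp P m l j y z) c" .
qed

lemma assoc_parallel_P:
  assumes "0 < m" "0 < l" "i < j" "j < n" "x \<in> ops P n" "y \<in> ops P m" "z \<in> ops P l"
  shows "pcomp P (n + m - 1) l (j + m - 1) (pcomp P n m i x y) z =
    pcomp P (n + l - 1) m i (pcomp P n l j x z) y"
proof (rule ops_eqI[where n = "n + m + l - 2"])
  show "pcomp P (n + m - 1) l (j + m - 1) (pcomp P n m i x y) z \<in> ops P (n + m + l - 2)"
    using pcomp_closed[of l "j + m - 1" "n + m - 1" "pcomp P n m i x y" z] pcomp_closed[of m i n x y] assms
    by (simp add: ac_simps)
  show "pcomp P (n + l - 1) m i (pcomp P n l j x z) y \<in> ops P (n + m + l - 2)"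
    using pcomp_closed[of m i "n + l - 1" "pcomp P n l j x z" y] pcomp_closed[of l j n x z] assms
    by (simp add: ac_simps)
  fix c assume c: "c \<in> degrees (n + m + l - 2)"
  have len: "length c = n + m + l - 2" using c by (simp add: degrees_def)
  have in_c: "c \<in> degrees (n + l - 1 + m - 1)" "c \<in> degrees (n + m - 1 + l - 1)"
    using c assms by (simp_all add: ac_simps)
  define al where "al = outer_degrees i m c"
  define am where "am = outer_degrees (j + m - 1) l c"
  define a where "a = outer_degrees i m am"
  define b where "b = inner_degrees i m c"
  define b' where "b' = inner_degrees (j + m - 1) l c"
  have in_al: "al \<in> degrees (n + l - 1)" unfolding al_def using in_c assms by (intro outer_degrees_in) auto
  have in_am: "am \<in> degrees (n + m - 1)" unfolding am_def using in_c assms by (intro outer_degrees_in) auto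
  have in_a: "a \<in> degrees n" unfolding a_def using in_am assms by (intro outer_degrees_in) auto
  have in_b: "b \<in> degrees m" unfolding b_def using in_c assms by (intro inner_degrees_in[of _ "n + l - 1"]) auto
  have in_b': "b' \<in> degrees l" unfolding b'_def using in_c assms by (intro inner_degrees_in[of _ "n + m - 1"]) auto
  note par = degrees_parallel[OF len assms(3,4,1,2)]
  have eqs: "outer_degrees j l al = a" "inner_degrees i m am = b" "inner_degrees j l al = b'"
    using par by (simp_all add: a_def al_def am_def b_def b'_def)
  have am: "am = subst_degrees a i b"
    using subst_degrees_outer_inner[of am n m i] in_am assms eqs by (simp add: a_def degrees_def)
  have al: "al = subst_degrees a j b'"
    using subst_degrees_outer_inner[of al n l j] in_al assms eqs by (simp add: a_def degrees_def)
  have cc: "subst_degrees am (j + m - 1) b' = c" "subst_degrees al i b = c"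
    using subst_degrees_outer_inner[of c "n + m - 1" l "j + m - 1"]
      subst_degrees_outer_inner[of c "n + l - 1" m i] in_c assms
    by (simp_all add: al_def am_def b_def b'_def degrees_def)
  have am_nth: "am ! (j + m - 1) = a ! j"
    using outer_degrees_nth_shift[of am n m i j] in_am assms by (simp add: a_def degrees_def shift_def)
  have al_nth: "al ! i = a ! i"
    using outer_degrees_nth_shift[of al n l j i] in_al assms by (simp add: eqs degrees_def shift_def)
  have key: "lin_ext (\<lambda>Y. bc am b' (j + m - 1) Y w'') (bc a b i u w)
      = lin_ext (\<lambda>Y. bc al b i Y w) (bc a b' j u w'')"
    if "u \<in> B n" "w \<in> B m" "w'' \<in> B l" for u w w''
  proof -
    have less: "j + m - 1 < n + m - 1" "i < n + l - 1" "i < n" using assms by simp_all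
    show ?thesis
      using bc_bc_left[OF assms(1) less(3) assms(2) less(1) in_a in_b in_b' that]
        bc_bc_left[OF assms(2,4,1) less(2) in_a in_b' in_b that(1,3,2)] G_parallel[OF assms(1-4) that]
        am_nth al_nth by (simp add: cc ac_simps flip: am al)
  qed
  have "pcomp P (n + m - 1) l (j + m - 1) (pcomp P n m i x y) z c
      = bilin_ext (bc am b' (j + m - 1)) (bilin_ext (bc a b i) (x a) (y b)) (z b')"
    using in_c in_am assms eqs by (simp add: pcomp_P a_def am_def b_def b'_def)
  also have "\<dots> = lin_ext (\<lambda>u. lin_ext (\<lambda>w. lin_ext (\<lambda>v.
      lin_ext (\<lambda>Y. bc am b' (j + m - 1) Y v) (bc a b i u w)) (z b')) (y b)) (x a)"
    unfolding bilin_ext_def lin_ext_lin_ext by (intro lin_ext_cong, rule lin_ext_swap)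
  also have "\<dots> = lin_ext (\<lambda>u. lin_ext (\<lambda>w. lin_ext (\<lambda>v.
      lin_ext (\<lambda>Y. bc al b i Y w) (bc a b' j u v)) (z b')) (y b)) (x a)"
    using supp_ops[OF assms(5) in_a] supp_ops[OF assms(6) in_b] supp_ops[OF assms(7) in_b']
    by (intro lin_ext_cong key) auto
  also have "\<dots> = bilin_ext (bc al b i) (bilin_ext (bc a b' j) (x a) (z b')) (y b)"
    unfolding bilin_ext_def lin_ext_lin_ext
    by (intro lin_ext_cong, subst lin_ext_swap, intro lin_ext_cong, rule lin_ext_swap)
  also have "\<dots> = pcomp P (n + l - 1) m i (pcomp P n l j x z) y c"
    using in_c in_al assms eqs by (simp add: pcomp_P al_def b_def)
  finally show "pcomp P (n + m - 1) l (j + m - 1) (pcomp P n m i x y) z c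
    = pcomp P (n + l - 1) m i (pcomp P n l j x z) y c" .
qed

lemma lba_sum:
  assumes "A \<subseteq> B n" "\<rho> permutes {..<n}"
  shows "lba \<rho> (\<Sum>X\<in>A. sgl X (f X)) = (\<Sum>X\<in>(\<lambda>X. ba X \<rho>) ` A. sgl X (f (ba X (inv \<rho>))))"
proof -
  have undo: "ba (ba X \<rho>) (inv \<rho>) = X" if "X \<in> A" for X
  proof -
    have "ba (ba X \<rho>) (inv \<rho>) = ba X (\<rho> \<circ> inv \<rho>)"
      using that assms by (intro ba_ba[of _ n] permutes_inv) auto
    then show ?thesis using permutes_inv_o[OF assms(2)] that assms ba_id by auto
  qed
  then have "inj_on (\<lambda>X. ba X \<rho>) A" by (rule inj_on_inverseI)
  then show ?thesis
    by (simp add: lin_ext_sum sum.reindex undo)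
qed

lemma bc_outer:
  assumes "0 < m" "i < n" "a \<in> degrees n" "b \<in> degrees m" "u \<in> B n" "w \<in> B m" "\<sigma> permutes {..<n}"
  shows "bc (permute_list \<sigma> a) b i (ba u \<sigma>) w = lba (outer_perm \<sigma> i m) (bc a b (\<sigma> i) u w)"
proof -
  let ?\<rho> = "outer_perm \<sigma> i m"
  have si: "\<sigma> i < n" using assms permutes_less_iff by blast
  have len: "length a = n" "length b = m" using assms by (auto simp: degrees_def)
  note perm = outer_perm_permutes[OF assms(7,2,1)]
  have nth: "permute_list \<sigma> a ! i = a ! \<sigma> i" using assms len by (simp add: permute_list_nth)
  have deg: "subst_degrees (permute_list \<sigma> a) i b = permute_list ?\<rho> (subst_degrees a (\<sigma> i) b)"
    if "sum_list b = a ! \<sigma> i"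
  proof -
    let ?c = "permute_list ?\<rho> (subst_degrees a (\<sigma> i) b)"
    have lc: "length (subst_degrees a (\<sigma> i) b) = n + m - 1"
      using si len by (simp add: length_subst_degrees)
    have "outer_degrees i m ?c = permute_list \<sigma> a" "inner_degrees i m ?c = b"
      using degrees_outer_perm[OF lc assms(2,1,7)] si len that
        outer_degrees_subst[of "\<sigma> i" a b] inner_degrees_subst[of "\<sigma> i" a b] by simp_all
    then show ?thesis
      using subst_degrees_outer_inner[of ?c n m i] lc assms by simp
  qed
  have w: "d (permute_list ?\<rho> (subst_degrees a (\<sigma> i) b)) X = d (subst_degrees a (\<sigma> i) b) (ba X (inv ?\<rho>))"
    if "X \<in> B (n + m - 1)" for X
  proof -
    have "ba (ba X (inv ?\<rho>)) ?\<rho> = X"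
      using ba_ba[OF that permutes_inv[OF perm] perm] ba_id[OF that] permutes_inv_o[OF perm] by simp
    then show ?thesis
      using weight_ba[of "subst_degrees a (\<sigma> i) b" "n + m - 1" "ba X (inv ?\<rho>)" ?\<rho>] perm
        ba_closed[OF that permutes_inv[OF perm]] subst_degrees_in[OF assms(3,4) si] by simp
  qed
  have sub: "(\<lambda>X. ba X ?\<rho>) ` G n m (\<sigma> i) u w \<subseteq> B (n + m - 1)"
    using G_closed[OF assms(1) si assms(5,6)] ba_closed[OF _ perm] by blast
  show ?thesis
  proof (cases "sum_list b = a ! \<sigma> i")
    case True
    have "bc (permute_list \<sigma> a) b i (ba u \<sigma>) w = (\<Sum>X\<in>(\<lambda>X. ba X ?\<rho>) ` G n m (\<sigma> i) u w.
        sgl X (lam ^ (d (permute_list ?\<rho> (subst_degrees a (\<sigma> i) b)) X - (d a u + d b w))))"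
      using bc_eq[OF assms(1,2) permute_list_in_degrees[OF assms(7,3)] assms(4) ba_closed[OF assms(5,7)] assms(6)]
        True nth deg weight_ba[OF assms(3,5,7)] G_outer[OF assms(1,2,5-7)] by simp
    also have "\<dots> = (\<Sum>X\<in>(\<lambda>X. ba X ?\<rho>) ` G n m (\<sigma> i) u w.
        sgl X (lam ^ (d (subst_degrees a (\<sigma> i) b) (ba X (inv ?\<rho>)) - (d a u + d b w))))"
      using sub w by (intro sum.cong refl) (metis subsetD)
    also have "\<dots> = lba ?\<rho> (bc a b (\<sigma> i) u w)"
      using bc_eq[OF assms(1) si assms(3-6)] True
        lba_sum[OF G_closed[OF assms(1) si assms(5,6)] perm] by simp
    finally show ?thesis .
  next
    case False
    then show ?thesis
      using bc_eq[OF assms(1) si assms(3-6)] nth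
        bc_eq[OF assms(1,2) permute_list_in_degrees[OF assms(7,3)] assms(4) ba_closed[OF assms(5,7)] assms(6)]
      by simp
  qed
qed

lemma bc_inner:
  assumes "0 < m" "i < n" "a \<in> degrees n" "b \<in> degrees m" "u \<in> B n" "w \<in> B m" "\<tau> permutes {..<m}"
  shows "bc a (permute_list \<tau> b) i u (ba w \<tau>) = lba (inner_perm \<tau> i m) (bc a b i u w)"
proof -
  let ?\<rho> = "inner_perm \<tau> i m"
  have len: "length a = n" "length b = m" using assms by (auto simp: degrees_def)
  note perm = inner_perm_permutes[OF assms(7,2)]
  have sum: "sum_list (permute_list \<tau> b) = sum_list b"
    using assms(7) len by (metis mset_permute_list sum_mset_sum_list)
  have deg: "subst_degrees a i (permute_list \<tau> b) = permute_list ?\<rho> (subst_degrees a i b)"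
    if "sum_list b = a ! i"
  proof -
    let ?c = "permute_list ?\<rho> (subst_degrees a i b)"
    have lc: "length (subst_degrees a i b) = n + m - 1"
      using assms(2) len by (simp add: length_subst_degrees)
    have "outer_degrees i m ?c = a" "inner_degrees i m ?c = permute_list \<tau> b"
      using degrees_inner_perm[OF lc assms(2,1,7)] assms(2) len that
        outer_degrees_subst[of i a b] inner_degrees_subst[of i a b] by simp_all
    then show ?thesis
      using subst_degrees_outer_inner[of ?c n m i] lc assms by simp
  qed
  have w: "d (permute_list ?\<rho> (subst_degrees a i b)) X = d (subst_degrees a i b) (ba X (inv ?\<rho>))"
    if "X \<in> B (n + m - 1)" for X
  proof -
    have "ba (ba X (inv ?\<rho>)) ?\<rho> = X"
      using ba_ba[OF that permutes_inv[OF perm] perm] ba_id[OF that] permutes_inv_o[OF perm] by simp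
    then show ?thesis
      using weight_ba[of "subst_degrees a i b" "n + m - 1" "ba X (inv ?\<rho>)" ?\<rho>] perm
        ba_closed[OF that permutes_inv[OF perm]] subst_degrees_in[OF assms(3,4,2)] by simp
  qed
  have sub: "(\<lambda>X. ba X ?\<rho>) ` G n m i u w \<subseteq> B (n + m - 1)"
    using G_closed[OF assms(1,2,5,6)] ba_closed[OF _ perm] by blast
  show ?thesis
  proof (cases "sum_list b = a ! i")
    case True
    have "bc a (permute_list \<tau> b) i u (ba w \<tau>) = (\<Sum>X\<in>(\<lambda>X. ba X ?\<rho>) ` G n m i u w.
        sgl X (lam ^ (d (permute_list ?\<rho> (subst_degrees a i b)) X - (d a u + d b w))))"
      using bc_eq[OF assms(1-3) permute_list_in_degrees[OF assms(7,4)] assms(5) ba_closed[OF assms(6,7)]]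
        True sum deg weight_ba[OF assms(4,6,7)] G_inner[OF assms(1,2,5-7)] by simp
    also have "\<dots> = (\<Sum>X\<in>(\<lambda>X. ba X ?\<rho>) ` G n m i u w.
        sgl X (lam ^ (d (subst_degrees a i b) (ba X (inv ?\<rho>)) - (d a u + d b w))))"
      using sub w by (intro sum.cong refl) (metis subsetD)
    also have "\<dots> = lba ?\<rho> (bc a b i u w)"
      using bc_eq[OF assms(1-6)] True lba_sum[OF G_closed[OF assms(1,2,5,6)] perm] by simp
    finally show ?thesis .
  next
    case False
    then show ?thesis
      using bc_eq[OF assms(1-6)] sum
        bc_eq[OF assms(1-3) permute_list_in_degrees[OF assms(7,4)] assms(5) ba_closed[OF assms(6,7)]]
      by simp
  qed
qed

lemma equivariant_outer_P:
  assumes "0 < m" "i < n" "x \<in> ops P n" "y \<in> ops P m" "\<sigma> permutes {..<n}"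
  shows "pcomp P n m i (act P n x \<sigma>) y = act P (n + m - 1) (pcomp P n m (\<sigma> i) x y) (outer_perm \<sigma> i m)"
proof (rule ops_eqI[where n = "n + m - 1"])
  let ?\<rho> = "outer_perm \<sigma> i m"
  have si: "\<sigma> i < n" using assms permutes_less_iff by blast
  note perm = outer_perm_permutes[OF assms(5,2,1)]
  have n: "0 < n" "0 < n + m - 1" using assms by auto
  show "pcomp P n m i (act P n x \<sigma>) y \<in> ops P (n + m - 1)"
    by (intro pcomp_closed act_closed assms n)
  show "act P (n + m - 1) (pcomp P n m (\<sigma> i) x y) ?\<rho> \<in> ops P (n + m - 1)"
    by (intro pcomp_closed act_closed assms n perm si)
  fix c assume c: "c \<in> degrees (n + m - 1)"
  define c' where "c' = permute_list (inv ?\<rho>) c"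
  have c': "c' \<in> degrees (n + m - 1)" "permute_list ?\<rho> c' = c"
    unfolding c'_def using permute_list_in_degrees[OF permutes_inv[OF perm] c] permute_list_inv[OF perm, of c] c
    by (auto simp: degrees_def)
  define a where "a = outer_degrees (\<sigma> i) m c'"
  define b where "b = inner_degrees (\<sigma> i) m c'"
  have a: "a \<in> degrees n" unfolding a_def by (intro outer_degrees_in c' si assms)
  have b: "b \<in> degrees m" unfolding b_def by (intro inner_degrees_in[of _ n] c' si assms)
  have deg: "outer_degrees i m c = permute_list \<sigma> a" "inner_degrees i m c = b"
    using degrees_outer_perm[of c' n m i \<sigma>] c' assms by (auto simp: a_def b_def degrees_def)
  have "pcomp P n m i (act P n x \<sigma>) y c
      = bilin_ext (\<lambda>u w. bc (permute_list \<sigma> a) b i (ba u \<sigma>) w) (x a) (y b)"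
  proof -
    have "pcomp P n m i (act P n x \<sigma>) y c = bilin_ext (bc (permute_list \<sigma> a) b i) (lba \<sigma> (x a)) (y b)"
      using c a permute_list_inv[OF assms(5), of a] permute_list_in_degrees[OF assms(5) a]
      by (simp add: pcomp_P deg act_P degrees_def)
    then show ?thesis by (simp add: bilin_ext_def lin_ext_lin_ext)
  qed
  also have "\<dots> = bilin_ext (\<lambda>u w. lba ?\<rho> (bc a b (\<sigma> i) u w)) (x a) (y b)"
    using supp_ops[OF assms(3) a] supp_ops[OF assms(4) b] assms a b
    by (intro bilin_ext_cong bc_outer) auto
  also have "\<dots> = act P (n + m - 1) (pcomp P n m (\<sigma> i) x y) ?\<rho> c"
    using c c' by (simp add: act_P pcomp_P lin_ext_bilin_ext a_def b_def c'_def)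
  finally show "pcomp P n m i (act P n x \<sigma>) y c = act P (n + m - 1) (pcomp P n m (\<sigma> i) x y) ?\<rho> c" .
qed

lemma equivariant_inner_P:
  assumes "0 < m" "i < n" "x \<in> ops P n" "y \<in> ops P m" "\<tau> permutes {..<m}"
  shows "pcomp P n m i x (act P m y \<tau>) = act P (n + m - 1) (pcomp P n m i x y) (inner_perm \<tau> i m)"
proof (rule ops_eqI[where n = "n + m - 1"])
  let ?\<rho> = "inner_perm \<tau> i m"
  note perm = inner_perm_permutes[OF assms(5,2)]
  have n: "0 < n + m - 1" using assms by auto
  show "pcomp P n m i x (act P m y \<tau>) \<in> ops P (n + m - 1)"
    by (intro pcomp_closed act_closed assms n)
  show "act P (n + m - 1) (pcomp P n m i x y) ?\<rho> \<in> ops P (n + m - 1)"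
    by (intro pcomp_closed act_closed assms n perm)
  fix c assume c: "c \<in> degrees (n + m - 1)"
  define c' where "c' = permute_list (inv ?\<rho>) c"
  have c': "c' \<in> degrees (n + m - 1)" "permute_list ?\<rho> c' = c"
    unfolding c'_def using permute_list_in_degrees[OF permutes_inv[OF perm] c] permute_list_inv[OF perm, of c] c
    by (auto simp: degrees_def)
  define a where "a = outer_degrees i m c'"
  define b where "b = inner_degrees i m c'"
  have a: "a \<in> degrees n" unfolding a_def by (intro outer_degrees_in c' assms)
  have b: "b \<in> degrees m" unfolding b_def by (intro inner_degrees_in[of _ n] c' assms)
  have deg: "outer_degrees i m c = a" "inner_degrees i m c = permute_list \<tau> b"
    using degrees_inner_perm[of c' n m i \<tau>] c' assms by (auto simp: a_def b_def degrees_def)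
  have "pcomp P n m i x (act P m y \<tau>) c
      = bilin_ext (\<lambda>u w. bc a (permute_list \<tau> b) i u (ba w \<tau>)) (x a) (y b)"
  proof -
    have "pcomp P n m i x (act P m y \<tau>) c = bilin_ext (bc a (permute_list \<tau> b) i) (x a) (lba \<tau> (y b))"
      using c b permute_list_inv[OF assms(5), of b] permute_list_in_degrees[OF assms(5) b]
      by (simp add: pcomp_P deg act_P degrees_def)
    then show ?thesis by (simp add: bilin_ext_def lin_ext_lin_ext)
  qed
  also have "\<dots> = bilin_ext (\<lambda>u w. lba ?\<rho> (bc a b i u w)) (x a) (y b)"
    using supp_ops[OF assms(3) a] supp_ops[OF assms(4) b] assms a b
    by (intro bilin_ext_cong bc_inner) auto
  also have "\<dots> = act P (n + m - 1) (pcomp P n m i x y) ?\<rho> c"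
    using c c' by (simp add: act_P pcomp_P lin_ext_bilin_ext a_def b_def c'_def)
  finally show "pcomp P n m i x (act P m y \<tau>) c = act P (n + m - 1) (pcomp P n m i x y) ?\<rho> c" .
qed

lemma act_into_homogeneous:
  assumes "0 < n" "a \<in> degrees n" "\<sigma> permutes {..<n}" "x \<in> homogeneous P a"
  shows "act P n x \<sigma> \<in> homogeneous P (permute_list \<sigma> a)"
proof -
  have x: "x \<in> ops P n" "\<And>b. b \<in> degrees n \<Longrightarrow> b \<noteq> a \<Longrightarrow> x b = 0"
    using assms by (auto simp: homogeneous_P[OF assms(2)])
  have "act P n x \<sigma> b = 0" if "b \<in> degrees n" "b \<noteq> permute_list \<sigma> a" for b
  proof -
    have "permute_list (inv \<sigma>) b \<noteq> a"
      using permute_list_inv(2)[OF assms(3), of b] that by (auto simp: degrees_def)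
    then have "x (permute_list (inv \<sigma>) b) = 0"
      using x(2) that permute_list_in_degrees[OF permutes_inv[OF assms(3)]] by blast
    then show ?thesis using that by (simp add: act_P)
  qed
  then show ?thesis
    using act_closed[OF assms(1) x(1) assms(3)]
    by (simp add: homogeneous_P[OF permute_list_in_degrees[OF assms(3,2)]])
qed

lemma act_homogeneous_P:
  assumes "0 < n" "a \<in> degrees n" "\<sigma> permutes {..<n}"
  shows "(\<lambda>x. act P n x \<sigma>) ` homogeneous P a = homogeneous P (permute_list \<sigma> a)"
proof (intro equalityI subsetI)
  fix y assume y: "y \<in> homogeneous P (permute_list \<sigma> a)"
  note inv = permutes_inv[OF assms(3)]
  have y_ops: "y \<in> ops P n"
    using y homogeneous_P[OF permute_list_in_degrees[OF assms(3,2)]] by simp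
  have "act P n y (inv \<sigma>) \<in> homogeneous P a"
    using act_into_homogeneous[OF assms(1) permute_list_in_degrees[OF assms(3,2)] inv y]
      permute_list_inv[OF assms(3), of a] assms by (simp add: degrees_def)
  moreover have "act P n (act P n y (inv \<sigma>)) \<sigma> = y"
    using act_act_P[OF assms(1) y_ops inv assms(3)] act_id_P[OF assms(1) y_ops] permutes_inv_o[OF assms(3)]
    by simp
  ultimately show "y \<in> (\<lambda>x. act P n x \<sigma>) ` homogeneous P a" by (metis imageI)
qed (use act_into_homogeneous assms in auto)

lemma pcomp_vanishes:
  assumes "0 < m" "i < n" "a \<in> degrees n" "b \<in> degrees m" "x \<in> homogeneous P a" "y \<in> homogeneous P b"
    and "c \<in> degrees (n + m - 1)" "sum_list b = a ! i \<Longrightarrow> c \<noteq> subst_degrees a i b"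
  shows "pcomp P n m i x y c = 0"
proof -
  have len: "length c = n + m - 1" "length b = m" using assms by (auto simp: degrees_def)
  have ne: "outer_degrees i m c \<noteq> a \<or> inner_degrees i m c \<noteq> b"
    using subst_degrees_outer_inner[OF len(1) assms(2,1)] outer_degrees_nth[OF len(1) assms(2,1)] assms(8)
    by auto
  have "x (outer_degrees i m c) = 0 \<or> y (inner_degrees i m c) = 0"
    using ne assms(5,6) outer_degrees_in[OF assms(7,2,1)] inner_degrees_in[OF assms(7,2,1)]
    by (auto simp: homogeneous_P[OF assms(3)] homogeneous_P[OF assms(4)])
  then show ?thesis using assms(7) by (auto simp: pcomp_P)
qed

theorem multigraded_operad_P: "multigraded_operad P"
proof (rule multigraded_operad.intro)
  show "operad P"
  proof (rule operad.intro)
    show "is_vspace (sp P n)" for n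
      unfolding sp_P by (intro is_vspace_prod is_vspace_free)
  qed (rule act_linear_P act_id_P act_act_P pcomp_linear_left_P pcomp_linear_right_P ounit_closed
      unit_left_P unit_right_P assoc_sequential_P assoc_parallel_P equivariant_outer_P
      equivariant_inner_P; assumption)+
  show "multigraded_operad_axioms P"
  proof (rule multigraded_operad_axioms.intro)
    show "sp P n = prod_vs (degrees n) (cmp P)" for n
      unfolding sp_P by (simp add: basis_operad_def)
    show "is_vspace (cmp P a)" for a
      by (simp add: basis_operad_def is_vspace_free)
  next
    fix n m i a b x y
    assume *: "0 < m" "i < n" "a \<in> degrees n" "b \<in> degrees m" "x \<in> homogeneous P a" "y \<in> homogeneous P b"
    have closed: "pcomp P n m i x y \<in> ops P (n + m - 1)"
      using pcomp_closed[OF *(1,2), of x y] *(5,6)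
      by (simp add: homogeneous_P[OF *(3)] homogeneous_P[OF *(4)])
    then show "pcomp P n m i x y \<in> homogeneous P (subst_degrees a i b)"
      using pcomp_vanishes[OF *] by (auto simp: homogeneous_P[OF subst_degrees_in[OF *(3,4,2)]])
    assume "sum_list b \<noteq> a ! i"
    then have "pcomp P n m i x y c = 0" if "c \<in> degrees (n + m - 1)" for c
      using pcomp_vanishes[OF * that] by blast
    then show "pcomp P n m i x y = vzero (sp P (n + m - 1))"
      unfolding vzero_P by (intro ops_eqI[OF closed restrict_in_ops]) auto
  qed (rule act_homogeneous_P; assumption)
qed

end

section \<open>Rooted trees on finite vertex sets\<close>

text \<open>
  As edges lead from children to parents, single-valuedness says that parents are unique.
\<close>

definition tree_on :: "'a set \<Rightarrow> 'a \<Rightarrow> ('a \<times> 'a) set \<Rightarrow> bool" where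
  "tree_on V r E \<longleftrightarrow> r \<in> V \<and> E \<subseteq> V \<times> V \<and> single_valued E \<and> r \<notin> Domain E \<and> (\<forall>v\<in>V. (v, r) \<in> E\<^sup>*)"

lemma rooted_trees_iff: "T \<in> rooted_trees n \<longleftrightarrow> tree_on {..<n} (root T) (edges T)"
  by (auto simp: rooted_trees_def tree_on_def)

lemma tree_on_unique_root:
  assumes "tree_on V r E" "tree_on V r' E"
  shows "r = r'"
proof -
  have "(r, r') \<in> E\<^sup>*" "r \<notin> Domain E" using assms by (auto simp: tree_on_def)
  then show ?thesis by (auto elim: converse_rtranclE)
qed

lemma rooted_trees_eqI: "\<lbrakk>S \<in> rooted_trees n; T \<in> rooted_trees n; edges S = edges T\<rbrakk> \<Longrightarrow> S = T"
  using tree_on_unique_root by (cases S, cases T) (fastforce simp: rooted_trees_iff)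

lemma finite_rooted_trees: "finite (rooted_trees n)"
proof (rule finite_subset)
  show "rooted_trees n \<subseteq> (\<lambda>(r, E). RTree r E) ` ({..<n} \<times> Pow ({..<n} \<times> {..<n}))"
  proof
    fix T assume "T \<in> rooted_trees n"
    then show "T \<in> (\<lambda>(r, E). RTree r E) ` ({..<n} \<times> Pow ({..<n} \<times> {..<n}))"
      by (cases T) (force simp: rooted_trees_def)
  qed
qed auto

lemma tree_on_parent: "\<lbrakk>tree_on V r E; v \<in> V; v \<noteq> r\<rbrakk> \<Longrightarrow> \<exists>p. (v, p) \<in> E"
  unfolding tree_on_def by (metis converse_rtranclE)

lemma tree_on_single_valued: "\<lbrakk>tree_on V r E; (c, p) \<in> E; (c, q) \<in> E\<rbrakk> \<Longrightarrow> p = q"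
  unfolding tree_on_def by (auto dest: single_valuedD)

lemma tree_on_induct [consumes 2, case_names root edge]:
  assumes "tree_on V r E" "v \<in> V" "P r" "\<And>c p. (c, p) \<in> E \<Longrightarrow> P p \<Longrightarrow> P c"
  shows "P v"
proof -
  have "(v, r) \<in> E\<^sup>*" using assms by (auto simp: tree_on_def)
  then show ?thesis by (induction rule: converse_rtrancl_induct) (use assms in blast)+
qed

lemma tree_on_image:
  assumes "tree_on V r E" "inj_on g V"
  shows "tree_on (g ` V) (g r) (map_prod g g ` E)"
proof -
  have sub: "E \<subseteq> V \<times> V" and r: "r \<in> V" "r \<notin> Domain E" using assms by (auto simp: tree_on_def)
  have "c = c'" if "(c, p) \<in> E" "(c', p') \<in> E" "g c = g c'" for c c' p p'
    using that sub assms(2) by (auto dest: inj_onD)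
  then have "single_valued (map_prod g g ` E)"
    by (auto simp: single_valued_def) (metis tree_on_single_valued[OF assms(1)])
  moreover have "g r \<notin> Domain (map_prod g g ` E)"
    using r sub assms(2) by (fastforce dest: inj_onD)
  moreover have "(g v, g r) \<in> (map_prod g g ` E)\<^sup>*" if "v \<in> V" for v
    using assms(1) that by (induction rule: tree_on_induct) (auto intro: converse_rtrancl_into_rtrancl)
  ultimately show ?thesis using sub r by (auto simp: tree_on_def)
qed

definition level :: "('a \<times> 'a) set \<Rightarrow> 'a \<Rightarrow> 'a \<Rightarrow> nat" where
  "level E r v = (LEAST k. (v, r) \<in> E ^^ k)"

lemma height_eq_level: "height T v = level (edges T) (root T) v"
  by (simp add: height_def level_def)

lemma level_root [simp]: "level E r r = 0"
  unfolding level_def by (rule Least_eq_0) simp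

lemma level_edge:
  assumes "tree_on V r E" "(c, p) \<in> E"
  shows "level E r c = Suc (level E r p)"
proof -
  have "p \<in> V" using assms by (auto simp: tree_on_def)
  then have "\<exists>k. (p, r) \<in> E ^^ k" using assms by (auto simp: tree_on_def rtrancl_power)
  then have k: "(p, r) \<in> E ^^ level E r p" unfolding level_def by (rule LeastI_ex)
  show ?thesis unfolding level_def[of E r c]
  proof (rule Least_equality)
    show "(c, r) \<in> E ^^ Suc (level E r p)" using k assms(2) by (rule relpow_Suc_I2[rotated])
    fix y assume y: "(c, r) \<in> E ^^ y"
    have "c \<noteq> r" using assms by (auto simp: tree_on_def)
    with y obtain y' where y': "y = Suc y'" by (cases y) auto
    then obtain q where "(c, q) \<in> E" "(q, r) \<in> E ^^ y'" using y relpow_Suc_D2 by metis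
    then have "(p, r) \<in> E ^^ y'" using tree_on_single_valued[OF assms(1,2)] by blast
    then show "Suc (level E r p) \<le> y" by (simp add: y' level_def Least_le)
  qed
qed

lemma level_unique:
  assumes "tree_on V r E" "v \<in> V" "g r = 0" "\<And>c p. (c, p) \<in> E \<Longrightarrow> g c = Suc (g p)"
  shows "level E r v = g v"
  using assms(1,2)
  by (induction rule: tree_on_induct) (auto simp: assms(3,4) level_edge[OF assms(1)])

text \<open>
  On the way to the root \<open>g\<close> drops by at most one per edge.
\<close>

lemma level_lower_bound:
  assumes "tree_on V r E" "v \<in> V" "g r = 0" "\<And>c p. (c, p) \<in> E \<Longrightarrow> g c \<le> Suc (g p)"
  shows "g v \<le> level E r v"
  using assms(1,2)
proof (induction rule: tree_on_induct)
  case (edge c p)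
  then show ?case using assms(4)[of c p] level_edge[OF assms(1), of c p] by linarith
qed (simp add: assms(3))

lemma level_eq_0_iff: "\<lbrakk>tree_on V r E; v \<in> V\<rbrakk> \<Longrightarrow> level E r v = 0 \<longleftrightarrow> v = r"
  using tree_on_parent level_edge by fastforce

lemma tree_on_no_loop: "tree_on V r E \<Longrightarrow> (x, x) \<notin> E"
  using level_edge by fastforce

lemma level_image:
  assumes "tree_on V r E" "inj_on g V" "v \<in> V"
  shows "level (map_prod g g ` E) (g r) (g v) = level E r v"
  using assms(1,3)
proof (induction rule: tree_on_induct)
  case (edge c p)
  then have "(g c, g p) \<in> map_prod g g ` E" by force
  then show ?case
    using edge level_edge[OF assms(1)] level_edge[OF tree_on_image[OF assms(1,2)]] by metis
qed simp

section \<open>Collapsing a block of vertices\<close>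

definition within_block :: "nat \<Rightarrow> nat \<Rightarrow> nat \<Rightarrow> nat \<Rightarrow> bool" where
  "within_block i m c p \<longleftrightarrow> in_block i m c \<and> in_block i m p"

text \<open>
  The two halves of a tree \<open>E\<close> with a block of vertices: the tree in which the block has become one
  vertex, and the tree on the block, renumbered from zero.
\<close>

definition collapse_edges :: "nat \<Rightarrow> nat \<Rightarrow> (nat \<times> nat) set \<Rightarrow> (nat \<times> nat) set" where
  "collapse_edges i m E =
     {(collapse i m c, collapse i m p) | c p. (c, p) \<in> E \<and> \<not> within_block i m c p}"

definition block_edges :: "nat \<Rightarrow> nat \<Rightarrow> (nat \<times> nat) set \<Rightarrow> (nat \<times> nat) set" where
  "block_edges i m E = {(c, p). c < m \<and> p < m \<and> (i + c, i + p) \<in> E}"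

lemma collapse_edgesI:
  "\<lbrakk>(c, p) \<in> E; \<not> within_block i m c p\<rbrakk> \<Longrightarrow> (collapse i m c, collapse i m p) \<in> collapse_edges i m E"
  unfolding collapse_edges_def by blast

lemma collapse_edgesE:
  assumes "e \<in> collapse_edges i m E"
  obtains c p where "(c, p) \<in> E" "\<not> within_block i m c p" "e = (collapse i m c, collapse i m p)"
  using assms unfolding collapse_edges_def by blast

lemma in_block_cases:
  assumes "in_block i m c"
  obtains q where "q < m" "c = i + q"
  using assms by (metis le_Suc_ex nat_add_left_cancel_less)

lemma block_edges_add: "\<lbrakk>c < m; p < m\<rbrakk> \<Longrightarrow> (c, p) \<in> block_edges i m E \<longleftrightarrow> (i + c, i + p) \<in> E"
  by (simp add: block_edges_def)

text \<open>
  All vertices of the block except its root have their parent in the block, so an edge leaves the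
  block only from this root.
\<close>

lemma block_exit:
  assumes "single_valued E" "tree_on {..<m} s (block_edges i m E)"
    and "(c, p) \<in> E" "in_block i m c" "\<not> in_block i m p"
  shows "c = i + s"
proof (rule ccontr)
  assume ne: "c \<noteq> i + s"
  obtain q where q: "q < m" "c = i + q" using assms(4) by (rule in_block_cases)
  have "q \<in> {..<m}" "q \<noteq> s" using ne q by simp_all
  then obtain q' where "(q, q') \<in> block_edges i m E"
    using tree_on_parent[OF assms(2)] by metis
  then have "(c, i + q') \<in> E" and q': "q' < m" by (simp_all add: q block_edges_def)
  then have "p = i + q'" using single_valuedD[OF assms(1,3)] by blast
  then show False using q' assms(5) by simp
qed

lemma collapse_eqD:
  assumes eq: "collapse i m c = collapse i m c'" and m: "0 < m"
  shows "c = c' \<or> in_block i m c \<and> in_block i m c'"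
proof (cases "in_block i m c'")
  case True
  then have "collapse i m c = i" using eq collapse_eq_iff[OF m] by simp
  then show ?thesis using True collapse_eq_iff[OF m] by blast
next
  case False
  then have "collapse i m c \<noteq> i" using eq collapse_eq_iff[OF m] by simp
  then have "\<not> in_block i m c" using collapse_eq_iff[OF m] by blast
  then have "c = shift i m (collapse i m c)" using m by (rule shift_collapse[symmetric])
  also have "\<dots> = shift i m (collapse i m c')" by (simp only: eq)
  also have "\<dots> = c'" using False m by (rule shift_collapse)
  finally show ?thesis by blast
qed

text \<open>
  Collapsing keeps parents unique because only the root of the block has a parent outside of it.
\<close>

lemma collapse_edges_tree:
  assumes X: "tree_on {..<n + m - 1} r E" and T: "tree_on {..<m} s (block_edges i m E)" and "i < n"
  shows "tree_on {..<n} (collapse i m r) (collapse_edges i m E)"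
proof -
  have m: "0 < m" using T by (auto simp: tree_on_def)
  have sv: "single_valued E" and sub: "E \<subseteq> {..<n + m - 1} \<times> {..<n + m - 1}" and r: "r < n + m - 1" "r \<notin> Domain E"
    using X by (auto simp: tree_on_def)
  note exit = block_exit[OF sv T]
  have "single_valued (collapse_edges i m E)"
  proof (rule single_valuedI)
    fix x y z assume "(x, y) \<in> collapse_edges i m E" "(x, z) \<in> collapse_edges i m E"
    then obtain c p c' p' where *: "(c, p) \<in> E" "\<not> within_block i m c p" "y = collapse i m p"
      "(c', p') \<in> E" "\<not> within_block i m c' p'" "z = collapse i m p'"
      "collapse i m c = collapse i m c'"
      by (auto simp: collapse_edges_def)
    then have "c = c'" using collapse_eqD[OF *(7) m] exit unfolding within_block_def by metis
    then show "y = z" using * sv by (auto dest: single_valuedD)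
  qed
  moreover have "collapse i m r \<notin> Domain (collapse_edges i m E)"
  proof
    assume "collapse i m r \<in> Domain (collapse_edges i m E)"
    then obtain c p where *: "(c, p) \<in> E" "\<not> within_block i m c p" "collapse i m c = collapse i m r"
      by (auto simp: collapse_edges_def)
    then have ne: "c \<noteq> r" using r by blast
    then have blk: "in_block i m c" "in_block i m r" using collapse_eqD[OF *(3) m] by auto
    then have c: "c = i + s" using exit *(1,2) by (auto simp: within_block_def)
    obtain q where q: "q < m" "r = i + q" using blk(2) by (rule in_block_cases)
    with c ne obtain q' where "(q, q') \<in> block_edges i m E"
      using tree_on_parent[OF T, of q] by auto
    then show False using r q by (auto simp: block_edges_def)
  qed
  moreover have path: "(collapse i m v, collapse i m r) \<in> (collapse_edges i m E)\<^sup>*" if "v \<in> {..<n + m - 1}" for v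
    using X that
  proof (induction rule: tree_on_induct)
    case (edge c p)
    then show ?case
      using collapse_edgesI[OF edge(1), of i m] by (cases "within_block i m c p")
        (auto simp: within_block_def collapse_def intro: converse_rtrancl_into_rtrancl)
  qed simp
  have "(v, collapse i m r) \<in> (collapse_edges i m E)\<^sup>*" if "v < n" for v
    using path[of "shift i m v"] path[of i] that shift_less[OF that assms(3) _ m] m assms(3)
      collapse_eq_iff[OF m, of i i] collapse_shift[OF _ m, of v i]
    by (cases "v = i") (simp_all del: collapse_shift collapse_eq_iff)
  moreover have "collapse_edges i m E \<subseteq> {..<n} \<times> {..<n}"
    using sub collapse_less[OF _ assms(3) m] by (fastforce simp: collapse_edges_def)
  ultimately show ?thesis
    using collapse_less[OF r(1) assms(3) m] by (simp add: tree_on_def)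
qed

text \<open>
  A path to the root in the collapsed tree lifts to \<open>E\<close>: when it passes through the block, it may be
  continued inside the block to the root of the block, where the edge leaving the block starts.
\<close>

lemma expand_tree:
  assumes sub: "E \<subseteq> {..<n + m - 1} \<times> {..<n + m - 1}" and sv: "single_valued E"
    and S: "tree_on {..<n} r' (collapse_edges i m E)" and T: "tree_on {..<m} s (block_edges i m E)"
    and r: "r < n + m - 1" "collapse i m r = r'" "in_block i m r \<Longrightarrow> r = i + s" and i: "i < n"
  shows "tree_on {..<n + m - 1} r E"
proof -
  have m: "0 < m" and s: "s < m" using T by (auto simp: tree_on_def)
  note exit = block_exit[OF sv T]
  have "r \<notin> Domain E"
  proof
    assume "r \<in> Domain E"
    then obtain p where p: "(r, p) \<in> E" by blast
    show False
    proof (cases "within_block i m r p")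
      case True
      then obtain q where "q < m" "p = i + q" unfolding within_block_def using in_block_cases by metis
      then show False using p True r s T by (auto simp: block_edges_def tree_on_def within_block_def)
    next
      case False
      then show False using collapse_edgesI[OF p False] S r by (auto simp: tree_on_def)
    qed
  qed
  moreover have blk: "(i + q, i + s) \<in> E\<^sup>*" if "q \<in> {..<m}" for q
    using T that
    by (induction rule: tree_on_induct) (auto simp: block_edges_def intro: converse_rtrancl_into_rtrancl)
  have "\<forall>v<n + m - 1. collapse i m v = y \<longrightarrow> (v, r) \<in> E\<^sup>*" if "y \<in> {..<n}" for y
    using S that
  proof (induction rule: tree_on_induct)
    case root
    show ?case
    proof (intro allI impI)
      fix v assume "v < n + m - 1" "collapse i m v = r'"
      then have "v = r \<or> in_block i m v \<and> in_block i m r" using collapse_eqD[OF _ m] r by metis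
      then show "(v, r) \<in> E\<^sup>*" 
        using r blk by (metis in_block_cases lessThan_iff rtrancl.rtrancl_refl)
    qed
  next
    case (edge c' p')
    then obtain c p where cp: "(c, p) \<in> E" "\<not> within_block i m c p"
      "c' = collapse i m c" "p' = collapse i m p" by (auto simp: collapse_edges_def)
    have pr: "(p, r) \<in> E\<^sup>*" using edge cp sub by blast
    show ?case
    proof (intro allI impI)
      fix v assume v: "v < n + m - 1" "collapse i m v = c'"
      have "(v, c) \<in> E\<^sup>*"
        using collapse_eqD[of i m v c] v cp m exit[OF cp(1)] blk
        by (metis in_block_cases lessThan_iff rtrancl.rtrancl_refl within_block_def)
      then show "(v, r) \<in> E\<^sup>*" using cp(1) pr by (meson converse_rtrancl_into_rtrancl rtrancl_trans)
    qed
  qed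
  then have "(v, r) \<in> E\<^sup>*" if "v < n + m - 1" for v
    using collapse_less[OF that i m] that by blast
  ultimately show ?thesis using sub sv r by (auto simp: tree_on_def)
qed

lemma tree_restrict_block:
  assumes "single_valued E"
  shows "single_valued (block_edges i m E)"
  by (rule single_valuedI) (auto simp: block_edges_def dest: single_valuedD[OF assms])

lemma block_edges_sub: "block_edges i m E \<subseteq> {..<m} \<times> {..<m}"
  by (auto simp: block_edges_def)

lemma collapse_cases:
  assumes "0 < m"
  obtains (before) "c < i" "collapse i m c = c"
  | (inside) q where "q < m" "c = i + q" "collapse i m c = i"
  | (after) k where "c = i + m + k" "collapse i m c = i + 1 + k"
proof -
  show thesis
  proof (cases "c < i")
    case True
    then show ?thesis by (intro before) (simp_all add: collapse_def unshift_def)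
  next
    case False
    show ?thesis
    proof (cases "c < i + m")
      case True
      with False have "c - i < m" "c = i + (c - i)" by simp_all
      then show ?thesis using inside[of "c - i"] collapse_add[of "c - i" m i] by simp
    next
      case False
      then have "c = i + m + (c - (i + m))" by simp
      moreover from this have "collapse i m c = i + 1 + (c - (i + m))"
        using assms False by (simp add: collapse_def unshift_def)
      ultimately show ?thesis by (rule after)
    qed
  qed
qed

text \<open>
  Collapsing blocks and restricting to blocks commute in the following ways, for a block inside another
  and for disjoint blocks; these are the two associativity laws at the level of vertices and edges.
\<close>

lemma collapse_collapse_nested:
  assumes "j < m" "0 < l"
  shows "collapse i m (collapse (i + j) l c) = collapse i (m + l - 1) c"
    and "within_block (i + j) l c p \<Longrightarrow> within_block i (m + l - 1) c p"
    and "within_block i m (collapse (i + j) l c) (collapse (i + j) l p) \<longleftrightarrow> within_block i (m + l - 1) c p"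
proof -
  have m: "0 < m" "0 < m + l - 1" using assms by auto
  have eq: "collapse i m (collapse (i + j) l c) = collapse i (m + l - 1) c" for c
  proof (cases rule: collapse_cases[OF assms(2), of c "i + j"])
    case 1
    then show ?thesis using assms by (cases "c < i") (auto simp: collapse_def unshift_def)
  next
    case (2 q)
    then show ?thesis using assms by (auto simp: collapse_def)
  next
    case (3 k)
    then show ?thesis using assms
      by (cases "j + 1 + k < m") (auto simp: collapse_def unshift_def)
  qed
  then show "collapse i m (collapse (i + j) l c) = collapse i (m + l - 1) c" .
  have "in_block (i + j) l c \<Longrightarrow> in_block i (m + l - 1) c" for c using assms by auto
  then show "within_block (i + j) l c p \<Longrightarrow> within_block i (m + l - 1) c p"
    by (simp add: within_block_def)
  show "within_block i m (collapse (i + j) l c) (collapse (i + j) l p) \<longleftrightarrow> within_block i (m + l - 1) c p"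
    unfolding within_block_def collapse_eq_iff[OF m(1), symmetric] collapse_eq_iff[OF m(2), symmetric] eq ..
qed

lemma collapse_collapse_disjoint:
  assumes "i < j" "0 < m" "0 < l"
  shows "collapse i m (collapse (j + m - 1) l c) = collapse j l (collapse i m c)"
    and "within_block i m (collapse (j + m - 1) l c) (collapse (j + m - 1) l p) \<longleftrightarrow> within_block i m c p"
    and "within_block j l (collapse i m c) (collapse i m p) \<longleftrightarrow> within_block (j + m - 1) l c p"
proof -
  have *: "collapse i m (collapse (j + m - 1) l c) = collapse j l (collapse i m c) \<and>
      (in_block i m (collapse (j + m - 1) l c) \<longleftrightarrow> in_block i m c) \<and>
      (in_block j l (collapse i m c) \<longleftrightarrow> in_block (j + m - 1) l c)" for c
  proof (cases rule: collapse_cases[OF assms(2), of c i])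
    case 1
    then have "collapse (j + m - 1) l c = c" "collapse j l c = c"
      using assms by (auto simp: collapse_def unshift_def)
    with 1 show ?thesis using assms by simp
  next
    case (2 q)
    then have "collapse (j + m - 1) l c = c" "collapse j l i = i"
      using assms by (auto simp: collapse_def unshift_def)
    with 2 show ?thesis using assms by simp
  next
    case (3 k)
    define d where "d = j - (i + 1)"
    then have d: "j = i + 1 + d" using assms(1) by simp
    show ?thesis
    proof (cases rule: collapse_cases[OF assms(3), of k d])
      case before': 1
      with 3 show ?thesis using assms(2,3) by (simp add: collapse_def unshift_def d)
    next
      case inside': (2 q)
      with 3 show ?thesis using assms(2,3) by (simp add: collapse_def unshift_def d)
    next
      case after': (3 k')
      with 3 show ?thesis using assms(2,3) by (simp add: collapse_def unshift_def d)
    qed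
  qed
  then show "collapse i m (collapse (j + m - 1) l c) = collapse j l (collapse i m c)" by blast
  show "within_block i m (collapse (j + m - 1) l c) (collapse (j + m - 1) l p) \<longleftrightarrow> within_block i m c p"
    "within_block j l (collapse i m c) (collapse i m p) \<longleftrightarrow> within_block (j + m - 1) l c p"
    unfolding within_block_def by (simp_all only: *)
qed

lemma collapse_nested_block:
  "0 < l \<Longrightarrow> collapse (i + j) l (i + c) = i + collapse j l c"
  by (rule collapse_cases[of l c j]) (simp_all add: collapse_def unshift_def)

lemma collapse_edges_nested:
  assumes "j < m" "0 < l"
  shows "collapse_edges i m (collapse_edges (i + j) l E) = collapse_edges i (m + l - 1) E" (is "?L = ?R")
proof
  note c = collapse_collapse_nested[OF assms]
  show "?L \<subseteq> ?R"
    by (auto elim!: collapse_edgesE simp: c intro: collapse_edgesI)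
  show "?R \<subseteq> ?L"
  proof
    fix e assume "e \<in> ?R"
    then obtain x y where xy: "(x, y) \<in> E" "\<not> within_block i (m + l - 1) x y"
      "e = (collapse i (m + l - 1) x, collapse i (m + l - 1) y)" by (rule collapse_edgesE)
    then have "\<not> within_block (i + j) l x y" using c(2) by blast
    then have "(collapse (i + j) l x, collapse (i + j) l y) \<in> collapse_edges (i + j) l E"
      by (rule collapse_edgesI[OF xy(1)])
    then show "e \<in> ?L" using collapse_edgesI[of _ _ _ i m] xy c by metis
  qed
qed

lemma block_collapse_nested:
  assumes "j < m" "0 < l"
  shows "block_edges i m (collapse_edges (i + j) l E) = collapse_edges j l (block_edges i (m + l - 1) E)" (is "?L = ?R")
proof
  note c = collapse_collapse_nested[OF assms]
  show "?L \<subseteq> ?R"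
  proof
    fix e assume "e \<in> ?L"
    then obtain x y c p where e: "e = (x, y)" "x < m" "y < m" "(c, p) \<in> E"
      "\<not> within_block (i + j) l c p"
      "i + x = collapse (i + j) l c" "i + y = collapse (i + j) l p"
      by (auto simp: block_edges_def collapse_edges_def)
    have "within_block i m (collapse (i + j) l c) (collapse (i + j) l p)"
      using e(2,3) unfolding e(6,7)[symmetric] by (simp add: within_block_def)
    then have "in_block i (m + l - 1) c" "in_block i (m + l - 1) p"
      unfolding c by (simp_all add: within_block_def)
    then obtain c' p' where cp: "c = i + c'" "p = i + p'" "c' < m + l - 1" "p' < m + l - 1"
      by (metis in_block_cases)
    have "(c', p') \<in> block_edges i (m + l - 1) E" using cp e by (auto simp: block_edges_def)
    moreover have "\<not> within_block j l c' p'" using e(5) cp by (auto simp: within_block_def)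
    moreover have "x = collapse j l c'" "y = collapse j l p'"
      using e(6,7) by (simp_all add: cp collapse_nested_block assms)
    ultimately show "e \<in> ?R" using collapse_edgesI e(1) by blast
  qed
  show "?R \<subseteq> ?L"
  proof
    fix e assume "e \<in> ?R"
    then obtain c p where cp: "(i + c, i + p) \<in> E" "c < m + l - 1" "p < m + l - 1"
      "\<not> within_block j l c p" "e = (collapse j l c, collapse j l p)"
      by (auto simp: collapse_edges_def block_edges_def)
    have "\<not> within_block (i + j) l (i + c) (i + p)" using cp(4) by (auto simp: within_block_def)
    then have "(i + collapse j l c, i + collapse j l p) \<in> collapse_edges (i + j) l E"
      using collapse_edgesI[OF cp(1), of "i + j" l] by (simp add: collapse_nested_block assms)
    moreover have "collapse j l c < m" "collapse j l p < m"
      using collapse_less[OF _ assms] cp by auto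
    ultimately show "e \<in> ?L" using cp by (simp add: block_edges_def)
  qed
qed

lemma block_block_nested:
  assumes "j < m"
  shows "block_edges (i + j) l E = block_edges j l (block_edges i (m + l - 1) E)"
  using assms by (auto simp: block_edges_def ac_simps)

lemma collapse_edges_disjoint:
  assumes "i < j" "0 < m" "0 < l"
  shows "collapse_edges i m (collapse_edges (j + m - 1) l E) = collapse_edges j l (collapse_edges i m E)" (is "?L = ?R")
proof
  note c = collapse_collapse_disjoint[OF assms]
  show "?L \<subseteq> ?R"
  proof
    fix e assume "e \<in> ?L"
    then obtain x y where xy: "(x, y) \<in> E" "\<not> within_block (j + m - 1) l x y" "\<not> within_block i m x y"
      "e = (collapse j l (collapse i m x), collapse j l (collapse i m y))"
      by (auto elim!: collapse_edgesE simp: c)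
    then show "e \<in> ?R" using collapse_edgesI[OF collapse_edgesI[OF xy(1,3)], of j l] by (simp add: c)
  qed
  show "?R \<subseteq> ?L"
  proof
    fix e assume "e \<in> ?R"
    then obtain x y where xy: "(x, y) \<in> E" "\<not> within_block (j + m - 1) l x y" "\<not> within_block i m x y"
      "e = (collapse j l (collapse i m x), collapse j l (collapse i m y))"
      by (auto elim!: collapse_edgesE simp: c)
    then show "e \<in> ?L"
      using collapse_edgesI[OF collapse_edgesI[OF xy(1,2)], of i m] by (simp add: c)
  qed
qed

lemma block_collapse_before:
  assumes "i < j" "0 < m" "0 < l"
  shows "block_edges i m (collapse_edges (j + m - 1) l E) = block_edges i m E"
proof -
  have undo: "collapse (j + m - 1) l c = i + q \<longleftrightarrow> c = i + q" if "q < m" for c q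
    using assms that by (auto simp: collapse_def unshift_def)
  have "\<not> within_block (j + m - 1) l (i + c) p" if "c < m" for c p
    using assms that by (auto simp: within_block_def)
  then have "(i + c, i + p) \<in> collapse_edges (j + m - 1) l E \<longleftrightarrow> (i + c, i + p) \<in> E" if "c < m" "p < m" for c p
    using that undo by (metis Pair_inject collapse_edgesE collapse_edgesI)
  then show ?thesis by (auto simp: block_edges_def)
qed

lemma block_collapse_after:
  assumes "i < j" "0 < m" "0 < l"
  shows "block_edges j l (collapse_edges i m E) = block_edges (j + m - 1) l E"
proof -
  have undo: "collapse i m c = j + q \<longleftrightarrow> c = j + m - 1 + q" for c q
    using assms by (auto simp: collapse_def unshift_def)
  have "\<not> within_block i m (j + m - 1 + c) p" for c p
    using assms by (auto simp: within_block_def)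
  then have "(j + c, j + p) \<in> collapse_edges i m E \<longleftrightarrow> (j + m - 1 + c, j + m - 1 + p) \<in> E" for c p
    using undo by (metis Pair_inject collapse_edgesE collapse_edgesI)
  then show ?thesis by (auto simp: block_edges_def)
qed

section \<open>Grafting as a relation between trees\<close>

text \<open>
  The trees that replacing vertex \<open>i\<close> of \<open>S\<close> by \<open>T\<close> can produce, described without attaching maps by how
  \<open>S\<close> and \<open>T\<close> are recovered. In this form, iterated composition and relabelling only involve the
  functions \<open>collapse_edges\<close> and \<open>block_edges\<close>.
\<close>

definition graftings :: "nat \<Rightarrow> nat \<Rightarrow> nat \<Rightarrow> rtree \<Rightarrow> rtree \<Rightarrow> rtree set" where
  "graftings n m i S T = {X \<in> rooted_trees (n + m - 1).
     collapse_edges i m (edges X) = edges S \<and> block_edges i m (edges X) = edges T}"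

lemma graftings_unique:
  "\<lbrakk>S \<in> rooted_trees n; T \<in> rooted_trees m; S' \<in> rooted_trees n; T' \<in> rooted_trees m;
    X \<in> graftings n m i S T; X \<in> graftings n m i S' T'\<rbrakk> \<Longrightarrow> S = S' \<and> T = T'"
  by (auto simp: graftings_def intro: rooted_trees_eqI)

lemma rooted_trees_sub: "T \<in> rooted_trees n \<Longrightarrow> edges T \<subseteq> {..<n} \<times> {..<n}"
  by (simp add: rooted_trees_def)

lemma RTree_in_rooted_trees: "RTree r E \<in> rooted_trees n \<longleftrightarrow> tree_on {..<n} r E"
  by (simp add: rooted_trees_iff)

lemma single_vertex_tree: "RTree 0 {} \<in> rooted_trees 1"
  by (simp add: rooted_trees_def)

lemma graftings_unit_left:
  assumes "0 < n" "T \<in> rooted_trees n"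
  shows "graftings 1 n 0 (RTree 0 {}) T = {T}"
proof -
  have "collapse_edges 0 n E = {}" "block_edges 0 n E = E" if "E \<subseteq> {..<n} \<times> {..<n}" for E
    using that by (auto simp: block_edges_def within_block_def elim!: collapse_edgesE)
  then show ?thesis
    using assms rooted_trees_sub by (auto simp: graftings_def intro: rooted_trees_eqI)
qed

lemma graftings_unit_right:
  assumes "i < n" "S \<in> rooted_trees n"
  shows "graftings n 1 i S (RTree 0 {}) = {S}"
proof -
  have "collapse_edges i 1 (edges X) = edges X" "block_edges i 1 (edges X) = {}"
    if "X \<in> rooted_trees n" for X
  proof -
    have no_loop: "(x, x) \<notin> edges X" for x
      using that tree_on_no_loop unfolding rooted_trees_iff by metis
    have c: "collapse i 1 x = x" for x by (rule collapse_cases[of 1 x i]) simp_all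
    have w: "\<not> within_block i 1 x y" if "(x, y) \<in> edges X" for x y
    proof
      assume "within_block i 1 x y"
      then have "x = i" "y = i" by (simp_all add: within_block_def)
      then show False using that no_loop by simp
    qed
    show "collapse_edges i 1 (edges X) = edges X"
      using w by (auto simp: collapse_edges_def c)
    show "block_edges i 1 (edges X) = {}"
      using no_loop by (auto simp: block_edges_def)
  qed
  then have "X \<in> graftings n 1 i S (RTree 0 {}) \<longleftrightarrow> X \<in> rooted_trees n \<and> edges X = edges S" for X
    unfolding graftings_def by auto
  then show ?thesis using assms(2) rooted_trees_eqI by blast
qed

lemma collapsed_tree:
  assumes "X \<in> rooted_trees (n + m - 1)" "tree_on {..<m} s (block_edges i m (edges X))" "i < n"
  shows "RTree (collapse i m (root X)) (collapse_edges i m (edges X)) \<in> rooted_trees n"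
  using collapse_edges_tree[of n m "root X" "edges X" s i] assms
  by (simp add: rooted_trees_iff)

text \<open>
  On either side \<open>X\<close> is characterized by the three trees recovered from it. The intermediate tree is
  forced: on the left it is \<open>X\<close> with the inner block collapsed, on the right the outer block of \<open>X\<close>.
\<close>

lemma graftings_sequential:
  assumes "0 < l" "i < n" "j < m" "S \<in> rooted_trees n" "T \<in> rooted_trees m" "U \<in> rooted_trees l"
  shows "(\<Union>Y\<in>graftings n m i S T. graftings (n + m - 1) l (i + j) Y U) =
    (\<Union>Z\<in>graftings m l j T U. graftings n (m + l - 1) i S Z)" (is "?L = ?R")
proof (intro equalityI subsetI)
  note nested = collapse_edges_nested[OF assms(3,1)] block_collapse_nested[OF assms(3,1)]
    block_block_nested[OF assms(3)]
  have N: "n + m - 1 + l - 1 = n + (m + l - 1) - 1" using assms by simp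
  fix X assume "X \<in> ?L"
  then obtain Y where Y: "Y \<in> graftings n m i S T" "X \<in> graftings (n + m - 1) l (i + j) Y U" by blast
  then have X: "X \<in> rooted_trees (n + (m + l - 1) - 1)"
    and eY: "edges Y = collapse_edges (i + j) l (edges X)" and eU: "edges U = block_edges (i + j) l (edges X)"
    and eS: "edges S = collapse_edges i m (edges Y)" and eT: "edges T = block_edges i m (edges Y)"
    unfolding graftings_def N by auto
  define Z where "Z = block_edges i (m + l - 1) (edges X)"
  have sv: "single_valued Z" unfolding Z_def
    using X by (intro tree_restrict_block) (simp add: rooted_trees_def)
  have "\<exists>r. r < m + l - 1 \<and> collapse j l r = root T \<and> (in_block j l r \<longrightarrow> r = j + root U)"
  proof (cases "root T = j")
    case True
    have "root U < l" using assms by (simp add: rooted_trees_def)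
    then show ?thesis using True assms(3) by (intro exI[of _ "j + root U"]) auto
  next
    case False
    have "root T < m" using assms by (simp add: rooted_trees_def)
    then show ?thesis using shift_less[OF _ assms(3) False assms(1)] shift_outside_block[OF False assms(1)]
        collapse_shift[OF False assms(1)]
      by (intro exI[of _ "shift j l (root T)"]) auto
  qed
  then obtain r where r: "r < m + l - 1" "collapse j l r = root T" "in_block j l r \<Longrightarrow> r = j + root U"
    by blast
  have "tree_on {..<m + l - 1} r Z"
  proof (rule expand_tree[OF _ sv _ _ r assms(3)])
    show "Z \<subseteq> {..<m + l - 1} \<times> {..<m + l - 1}" unfolding Z_def by (rule block_edges_sub)
    show "tree_on {..<m} (root T) (collapse_edges j l Z)"
      using assms(5) eT eY nested by (simp add: rooted_trees_iff Z_def)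
    show "tree_on {..<l} (root U) (block_edges j l Z)"
      using assms(6) eU nested by (simp add: rooted_trees_iff Z_def)
  qed
  then have "RTree r Z \<in> graftings m l j T U" "X \<in> graftings n (m + l - 1) i S (RTree r Z)"
    using X eU eS eT eY by (simp_all add: graftings_def RTree_in_rooted_trees nested Z_def)
  then show "X \<in> ?R" by blast
next
  note nested = collapse_edges_nested[OF assms(3,1)] block_collapse_nested[OF assms(3,1)]
    block_block_nested[OF assms(3)]
  have N: "n + m - 1 + l - 1 = n + (m + l - 1) - 1" using assms by simp
  fix X assume "X \<in> ?R"
  then obtain Z where Z: "Z \<in> graftings m l j T U" "X \<in> graftings n (m + l - 1) i S Z" by blast
  then have X: "X \<in> rooted_trees (n + m - 1 + l - 1)"
    and eZ: "edges Z = block_edges i (m + l - 1) (edges X)" and eS: "edges S = collapse_edges i (m + l - 1) (edges X)"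
    and eT: "edges T = collapse_edges j l (edges Z)" and eU: "edges U = block_edges j l (edges Z)"
    unfolding graftings_def N by auto
  have eU': "edges U = block_edges (i + j) l (edges X)" using eU eZ nested by simp
  have "i + j < n + m - 1" using assms by simp
  moreover have "tree_on {..<l} (root U) (block_edges (i + j) l (edges X))"
    using assms(6) eU' by (simp add: rooted_trees_iff)
  ultimately have "RTree (collapse (i + j) l (root X)) (collapse_edges (i + j) l (edges X)) \<in> rooted_trees (n + m - 1)"
    using collapsed_tree[OF X] by blast
  then have "RTree (collapse (i + j) l (root X)) (collapse_edges (i + j) l (edges X)) \<in> graftings n m i S T"
    "X \<in> graftings (n + m - 1) l (i + j) (RTree (collapse (i + j) l (root X)) (collapse_edges (i + j) l (edges X))) U"
    using X eU' eS eT eZ by (simp_all add: graftings_def nested)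
  then show "X \<in> ?L" by blast
qed

lemma graftings_parallel:
  assumes "0 < m" "0 < l" "i < j" "j < n" "S \<in> rooted_trees n" "T \<in> rooted_trees m" "U \<in> rooted_trees l"
  shows "(\<Union>Y\<in>graftings n m i S T. graftings (n + m - 1) l (j + m - 1) Y U) =
    (\<Union>Y\<in>graftings n l j S U. graftings (n + l - 1) m i Y T)" (is "?L = ?R")
proof (intro equalityI subsetI)
  note disjoint = collapse_edges_disjoint[OF assms(3,1,2)] block_collapse_before[OF assms(3,1,2)]
    block_collapse_after[OF assms(3,1,2)]
  have N: "n + m - 1 + l - 1 = n + l - 1 + m - 1" using assms by simp
  fix X assume "X \<in> ?L"
  then obtain Y where Y: "Y \<in> graftings n m i S T" "X \<in> graftings (n + m - 1) l (j + m - 1) Y U" by blast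
  then have X: "X \<in> rooted_trees (n + l - 1 + m - 1)"
    and eY: "edges Y = collapse_edges (j + m - 1) l (edges X)" and eU: "edges U = block_edges (j + m - 1) l (edges X)"
    and eS: "edges S = collapse_edges i m (edges Y)" and eT: "edges T = block_edges i m (edges Y)"
    unfolding graftings_def N by auto
  have eT': "edges T = block_edges i m (edges X)" using eT eY disjoint by simp
  have "i < n + l - 1" using assms by simp
  moreover have "tree_on {..<m} (root T) (block_edges i m (edges X))"
    using assms(6) eT' by (simp add: rooted_trees_iff)
  ultimately have "RTree (collapse i m (root X)) (collapse_edges i m (edges X)) \<in> rooted_trees (n + l - 1)"
    using collapsed_tree[OF X] by blast
  then have "RTree (collapse i m (root X)) (collapse_edges i m (edges X)) \<in> graftings n l j S U"
    "X \<in> graftings (n + l - 1) m i (RTree (collapse i m (root X)) (collapse_edges i m (edges X))) T"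
    using X eU eS eT' eY by (simp_all add: graftings_def disjoint)
  then show "X \<in> ?R" by blast
next
  note disjoint = collapse_edges_disjoint[OF assms(3,1,2)] block_collapse_before[OF assms(3,1,2)]
    block_collapse_after[OF assms(3,1,2)]
  have N: "n + m - 1 + l - 1 = n + l - 1 + m - 1" using assms by simp
  fix X assume "X \<in> ?R"
  then obtain Y where Y: "Y \<in> graftings n l j S U" "X \<in> graftings (n + l - 1) m i Y T" by blast
  then have X: "X \<in> rooted_trees (n + m - 1 + l - 1)"
    and eY: "edges Y = collapse_edges i m (edges X)" and eT: "edges T = block_edges i m (edges X)"
    and eS: "edges S = collapse_edges j l (edges Y)" and eU: "edges U = block_edges j l (edges Y)"
    unfolding graftings_def N by auto
  let ?Y = "RTree (collapse (j + m - 1) l (root X)) (collapse_edges (j + m - 1) l (edges X))"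
  have eU': "edges U = block_edges (j + m - 1) l (edges X)" using eU eY disjoint by simp
  have "j + m - 1 < n + m - 1" using assms by simp
  moreover have "tree_on {..<l} (root U) (block_edges (j + m - 1) l (edges X))"
    using assms(7) eU' by (simp add: rooted_trees_iff)
  ultimately have "?Y \<in> rooted_trees (n + m - 1)"
    using collapsed_tree[OF X] by blast
  then have "?Y \<in> graftings n m i S T" "X \<in> graftings (n + m - 1) l (j + m - 1) ?Y U"
    using X eU' eS eT eY by (simp_all add: graftings_def disjoint)
  then show "X \<in> ?L" by blast
qed

section \<open>Relabelling trees\<close>

lemma edges_relabel [simp]: "edges (relabel_tree g T) = map_prod g g ` edges T"
  and root_relabel [simp]: "root (relabel_tree g T) = g (root T)"
  by (simp_all add: relabel_tree_def)

lemma relabel_in_rooted_trees: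
  assumes "T \<in> rooted_trees n" "\<sigma> permutes {..<n}"
  shows "relabel_tree \<sigma> T \<in> rooted_trees n"
  using tree_on_image[of "{..<n}" "root T" "edges T" \<sigma>] assms
  by (simp add: rooted_trees_iff permutes_inj_on permutes_image)

lemma relabel_relabel: "relabel_tree g (relabel_tree h T) = relabel_tree (g \<circ> h) T"
  by (simp add: relabel_tree_def image_image map_prod_def split_def)

lemma relabel_id [simp]: "relabel_tree id T = T" "relabel_tree (\<lambda>x. x) T = T"
  by (cases T; simp add: relabel_tree_def map_prod_def split_def)+

lemma relabel_inv:
  assumes "\<sigma> permutes A"
  shows "relabel_tree (inv \<sigma>) (relabel_tree \<sigma> T) = T" "relabel_tree \<sigma> (relabel_tree (inv \<sigma>) T) = T"
  by (simp_all add: relabel_relabel permutes_inv_o[OF assms])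

lemma collapse_edges_relabel:
  assumes "\<And>c. collapse i' m (\<rho> c) = \<sigma> (collapse i m c)" "\<And>c. in_block i' m (\<rho> c) \<longleftrightarrow> in_block i m c"
  shows "collapse_edges i' m (map_prod \<rho> \<rho> ` E) = map_prod \<sigma> \<sigma> ` collapse_edges i m E"
proof -
  have "within_block i' m (\<rho> c) (\<rho> p) \<longleftrightarrow> within_block i m c p" for c p
    by (simp only: within_block_def assms)
  then have w: "within_block i' m (\<rho> c) (\<rho> p) \<longleftrightarrow> within_block i m c p" for c p .
  show ?thesis
  proof (intro equalityI subsetI)
    fix e assume "e \<in> collapse_edges i' m (map_prod \<rho> \<rho> ` E)"
    then obtain c p where cp: "(c, p) \<in> E" "\<not> within_block i' m (\<rho> c) (\<rho> p)"
      "e = (collapse i' m (\<rho> c), collapse i' m (\<rho> p))"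
      by (auto elim!: collapse_edgesE)
    then have "(collapse i m c, collapse i m p) \<in> collapse_edges i m E"
      by (intro collapse_edgesI) (simp_all add: w)
    moreover have "e = map_prod \<sigma> \<sigma> (collapse i m c, collapse i m p)" by (simp add: cp(3) assms(1))
    ultimately show "e \<in> map_prod \<sigma> \<sigma> ` collapse_edges i m E" by (rule rev_image_eqI)
  next
    fix e assume "e \<in> map_prod \<sigma> \<sigma> ` collapse_edges i m E"
    then obtain c p where cp: "(c, p) \<in> E" "\<not> within_block i m c p"
      "e = (\<sigma> (collapse i m c), \<sigma> (collapse i m p))"
      by (auto elim!: collapse_edgesE)
    have "(\<rho> c, \<rho> p) \<in> map_prod \<rho> \<rho> ` E" using cp(1) by (rule rev_image_eqI) simp
    then have "(collapse i' m (\<rho> c), collapse i' m (\<rho> p)) \<in> collapse_edges i' m (map_prod \<rho> \<rho> ` E)"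
      by (rule collapse_edgesI) (simp add: w cp)
    then show "e \<in> collapse_edges i' m (map_prod \<rho> \<rho> ` E)" by (simp add: cp(3) assms(1))
  qed
qed

lemma block_edges_relabel:
  assumes "\<And>c. in_block i' m (\<rho> c) \<longleftrightarrow> in_block i m c" "\<And>q. q < m \<Longrightarrow> \<rho> (i + q) = i' + \<tau> q" "\<tau> permutes {..<m}"
  shows "block_edges i' m (map_prod \<rho> \<rho> ` E) = map_prod \<tau> \<tau> ` block_edges i m E"
proof (intro equalityI subsetI)
  fix e assume "e \<in> map_prod \<tau> \<tau> ` block_edges i m E"
  then obtain c p where cp: "c < m" "p < m" "(i + c, i + p) \<in> E" "e = (\<tau> c, \<tau> p)"
    by (auto simp: block_edges_def)
  have "(\<rho> (i + c), \<rho> (i + p)) \<in> map_prod \<rho> \<rho> ` E" using cp(3) by force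
  then show "e \<in> block_edges i' m (map_prod \<rho> \<rho> ` E)"
    using cp assms(2) permutes_less_iff[OF assms(3)] by (simp add: block_edges_def)
next
  fix e assume "e \<in> block_edges i' m (map_prod \<rho> \<rho> ` E)"
  then obtain c p x y where e: "e = (x, y)" "x < m" "y < m" "(c, p) \<in> E" "i' + x = \<rho> c" "i' + y = \<rho> p"
    by (auto simp: block_edges_def)
  have "in_block i m c" "in_block i m p"
    using e(2,3) assms(1)[of c] assms(1)[of p] unfolding e(5,6)[symmetric] by auto
  then obtain c' p' where cp: "c = i + c'" "p = i + p'" "c' < m" "p' < m" by (metis in_block_cases)
  then have "x = \<tau> c'" "y = \<tau> p'" using e(5,6) assms(2) by simp_all
  moreover have "(c', p') \<in> block_edges i m E" using cp e(4) by (simp add: block_edges_def)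
  ultimately show "e \<in> map_prod \<tau> \<tau> ` block_edges i m E" using e(1) by force
qed

lemma map_prod_image_eq_iff:
  assumes "\<sigma> permutes A"
  shows "map_prod \<sigma> \<sigma> ` E = F \<longleftrightarrow> E = map_prod (inv \<sigma>) (inv \<sigma>) ` F"
proof -
  have "map_prod (inv \<sigma>) (inv \<sigma>) ` (map_prod \<sigma> \<sigma> ` E) = E" "map_prod \<sigma> \<sigma> ` (map_prod (inv \<sigma>) (inv \<sigma>) ` F) = F"
    by (simp_all add: image_image map_prod_def split_def permutes_inverses[OF assms])
  then show ?thesis by auto
qed

text \<open>
  Both equivariance laws are instances: \<open>\<rho>\<close> permutes the vertices of the composite and induces \<open>\<sigma>\<close> on
  the collapsed vertices and \<open>\<tau>\<close> on the vertices of the block.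
\<close>

lemma graftings_relabel:
  assumes \<rho>: "\<rho> permutes {..<n + m - 1}" and \<sigma>: "\<sigma> permutes {..<n}" and \<tau>: "\<tau> permutes {..<m}"
    and "\<And>c. collapse (\<sigma> i) m (\<rho> c) = \<sigma> (collapse i m c)" "\<And>c. in_block (\<sigma> i) m (\<rho> c) \<longleftrightarrow> in_block i m c"
    and "\<And>q. q < m \<Longrightarrow> \<rho> (i + q) = \<sigma> i + \<tau> q"
  shows "graftings n m i (relabel_tree (inv \<sigma>) S) (relabel_tree (inv \<tau>) T) =
    (\<lambda>X. relabel_tree (inv \<rho>) X) ` graftings n m (\<sigma> i) S T"
proof -
  have iff: "relabel_tree \<rho> X \<in> graftings n m (\<sigma> i) S T \<longleftrightarrow>
      X \<in> graftings n m i (relabel_tree (inv \<sigma>) S) (relabel_tree (inv \<tau>) T)" for X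
  proof -
    have "relabel_tree \<rho> X \<in> rooted_trees (n + m - 1) \<longleftrightarrow> X \<in> rooted_trees (n + m - 1)"
      using relabel_in_rooted_trees[OF _ \<rho>] relabel_in_rooted_trees[OF _ permutes_inv[OF \<rho>]] relabel_inv[OF \<rho>]
      by metis
    then show ?thesis
      by (simp add: graftings_def collapse_edges_relabel[OF assms(4,5)] block_edges_relabel[OF assms(5,6) \<tau>]
          map_prod_image_eq_iff[OF \<sigma>] map_prod_image_eq_iff[OF \<tau>])
  qed
  show ?thesis
  proof (intro equalityI subsetI)
    fix X assume "X \<in> graftings n m i (relabel_tree (inv \<sigma>) S) (relabel_tree (inv \<tau>) T)"
    then have "relabel_tree \<rho> X \<in> graftings n m (\<sigma> i) S T" by (simp add: iff)
    moreover have "X = relabel_tree (inv \<rho>) (relabel_tree \<rho> X)" by (simp add: relabel_inv[OF \<rho>])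
    ultimately show "X \<in> (\<lambda>X. relabel_tree (inv \<rho>) X) ` graftings n m (\<sigma> i) S T" by blast
  next
    fix X assume "X \<in> (\<lambda>X. relabel_tree (inv \<rho>) X) ` graftings n m (\<sigma> i) S T"
    then show "X \<in> graftings n m i (relabel_tree (inv \<sigma>) S) (relabel_tree (inv \<tau>) T)"
      using relabel_inv[OF \<rho>] by (auto simp flip: iff)
  qed
qed

lemma collapse_outer_perm:
  assumes "\<sigma> permutes S" "0 < m"
  shows "collapse (\<sigma> i) m (outer_perm \<sigma> i m c) = \<sigma> (collapse i m c)"
    and "in_block (\<sigma> i) m (outer_perm \<sigma> i m c) \<longleftrightarrow> in_block i m c"
proof -
  have "collapse (\<sigma> i) m (outer_perm \<sigma> i m c) = \<sigma> (collapse i m c) \<and>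
    (in_block (\<sigma> i) m (outer_perm \<sigma> i m c) \<longleftrightarrow> in_block i m c)"
  proof (cases "in_block i m c")
    case True
    then obtain q where q: "q < m" "c = i + q" by (rule in_block_cases)
    then have "outer_perm \<sigma> i m c = \<sigma> i + q" by (simp add: outer_perm_def)
    then show ?thesis using q by simp
  next
    case False
    then have "collapse i m c \<noteq> i" using collapse_eq_iff[OF assms(2)] by blast
    then have ne: "\<sigma> (collapse i m c) \<noteq> \<sigma> i" using permutes_inj[OF assms(1)] by (simp add: inj_eq)
    have "outer_perm \<sigma> i m c = shift (\<sigma> i) m (\<sigma> (collapse i m c))"
      unfolding outer_perm_collapse if_not_P[OF False] ..
    then show ?thesis using shift_outside_block[OF ne assms(2)] collapse_shift[OF ne assms(2)] False by metis
  qed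
  then show "collapse (\<sigma> i) m (outer_perm \<sigma> i m c) = \<sigma> (collapse i m c)"
    "in_block (\<sigma> i) m (outer_perm \<sigma> i m c) \<longleftrightarrow> in_block i m c" by blast+
qed

lemma graftings_outer:
  assumes "0 < m" "i < n" "\<sigma> permutes {..<n}"
  shows "graftings n m i (relabel_tree (inv \<sigma>) S) T =
    (\<lambda>X. relabel_tree (inv (outer_perm \<sigma> i m)) X) ` graftings n m (\<sigma> i) S T"
proof -
  have "outer_perm \<sigma> i m (i + q) = \<sigma> i + id q" if "q < m" for q
    using that by (simp add: outer_perm_def)
  then show ?thesis
    using graftings_relabel[OF outer_perm_permutes[OF assms(3,2,1)] assms(3) permutes_id[of "{..<m}"]
        collapse_outer_perm[OF assms(3,1)], where S = S and T = T] by simp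
qed

lemma graftings_inner:
  assumes "0 < m" "i < n" "\<tau> permutes {..<m}"
  shows "graftings n m i S (relabel_tree (inv \<tau>) T) =
    (\<lambda>X. relabel_tree (inv (inner_perm \<tau> i m)) X) ` graftings n m i S T"
proof -
  have less: "\<tau> q < m \<longleftrightarrow> q < m" for q using assms permutes_less_iff by blast
  have block: "in_block i m (inner_perm \<tau> i m c) \<longleftrightarrow> in_block i m c" for c
    using less[of "c - i"] by (auto simp: inner_perm_def)
  have "collapse i m (inner_perm \<tau> i m c) = collapse i m c" for c
  proof (cases "in_block i m c")
    case True
    then show ?thesis using block[of c] by (simp add: collapse_def)
  next
    case False
    then show ?thesis by (auto simp: inner_perm_def)
  qed
  then show ?thesis
    using graftings_relabel[of "inner_perm \<tau> i m" n m id \<tau> i, OF inner_perm_permutes[OF assms(3,2)] permutes_id[of "{..<n}"] assms(3), where S = S and T = T] block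
    by (simp add: inner_perm_def[of \<tau> i m "i + _"])
qed

section \<open>Weighted depth under grafting\<close>

lemma weighted_depth_relabel:
  assumes "length a = n" "T \<in> rooted_trees n" "\<sigma> permutes {..<n}"
  shows "weighted_depth (permute_list \<sigma> a) (relabel_tree (inv \<sigma>) T) = weighted_depth a T"
proof -
  have tree: "tree_on {..<n} (root T) (edges T)" using assms(2) by (simp add: rooted_trees_iff)
  have level: "height (relabel_tree (inv \<sigma>) T) v = height T (\<sigma> v)" if "v < n" for v
    using level_image[OF tree permutes_inj_on[OF permutes_inv[OF assms(3)]], of "\<sigma> v"] that
      permutes_less_iff[OF assms(3)] permutes_inverses[OF assms(3)]
    by (simp add: height_eq_level)
  have "weighted_depth (permute_list \<sigma> a) (relabel_tree (inv \<sigma>) T) = (\<Sum>v<n. a ! \<sigma> v * height T (\<sigma> v))"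
    unfolding weighted_depth_def using assms(1,3) level by (auto simp: permute_list_nth intro!: sum.cong)
  also have "\<dots> = (\<Sum>v<n. a ! v * height T v)"
    using sum.permute[OF assms(3), of "\<lambda>v. a ! v * height T v"] by (simp add: o_def)
  finally show ?thesis by (simp add: weighted_depth_def assms(1))
qed

lemma sum_over_positions:
  assumes "i < n" "0 < m"
  shows "(\<Sum>v<n + m - 1. F v) = (\<Sum>q<m. F (i + q)) + (\<Sum>j\<in>{..<n} - {i}. F (shift i m j))"
proof -
  have "{..<n + m - 1} = (\<lambda>q. i + q) ` {..<m} \<union> shift i m ` ({..<n} - {i})"
  proof (intro equalityI subsetI)
    fix v assume v: "v \<in> {..<n + m - 1}"
    show "v \<in> (\<lambda>q. i + q) ` {..<m} \<union> shift i m ` ({..<n} - {i})"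
    proof (cases "in_block i m v")
      case True
      then obtain q where "q < m" "v = i + q" by (rule in_block_cases)
      then show ?thesis by simp
    next
      case False
      have "v = shift i m (collapse i m v)" using shift_collapse[OF False assms(2)] by (rule sym)
      moreover have "collapse i m v \<in> {..<n} - {i}"
        using v False collapse_less[of v n m i] assms collapse_eq_iff[OF assms(2)] by simp
      ultimately show ?thesis by blast
    qed
  qed (use assms shift_less[of _ n i m] in auto)
  moreover have "(\<lambda>q. i + q) ` {..<m} \<inter> shift i m ` ({..<n} - {i}) = {}"
  proof -
    have "i + q \<noteq> shift i m j" if "q < m" "j \<noteq> i" for q j
      using shift_outside_block[OF that(2) assms(2)] that(1) by (metis le_add1 nat_add_left_cancel_less)
    then show ?thesis by auto
  qed
  moreover have "inj_on (shift i m) ({..<n} - {i})"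
    by (rule inj_on_inverseI[where g = "unshift i m"]) (use assms in auto)
  ultimately show ?thesis
    by (simp add: sum.union_disjoint sum.reindex)
qed

lemma subst_degrees_nth_block:
  "\<lbrakk>i < length a; q < length b\<rbrakk> \<Longrightarrow> subst_degrees a i b ! (i + q) = b ! q"
  by (simp add: subst_degrees_def nth_append)

lemma subst_degrees_nth_shift:
  "\<lbrakk>i < length a; j < length a; j \<noteq> i; 0 < length b\<rbrakk> \<Longrightarrow> subst_degrees a i b ! (shift i (length b) j) = a ! j"
  by (auto simp: subst_degrees_def nth_append shift_def)

text \<open>
  The height of a vertex when all children of \<open>i\<close> are attached to the root of \<open>T\<close>. For any other way of
  attaching them it is a lower bound for the height. Its weighted sum is the sum of the depths of \<open>S\<close> and
  \<open>T\<close>, since the weights of the vertices of \<open>T\<close> add up to the weight of \<open>i\<close>.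
\<close>

definition stacked_level :: "nat \<Rightarrow> nat \<Rightarrow> rtree \<Rightarrow> rtree \<Rightarrow> nat \<Rightarrow> nat" where
  "stacked_level i m S T v =
     height S (collapse i m v) + (if in_block i m v then height T (v - i) else 0)"

lemma sum_stacked_level:
  assumes "length a = n" "length b = m" "i < n" "0 < m" "sum_list b = a ! i"
  shows "(\<Sum>v<n + m - 1. subst_degrees a i b ! v * stacked_level i m S T v) = weighted_depth a S + weighted_depth b T"
proof -
  let ?c = "subst_degrees a i b"
  have "(\<Sum>q<m. ?c ! (i + q) * stacked_level i m S T (i + q)) = (\<Sum>q<m. b ! q * height S i + b ! q * height T q)"
    using assms subst_degrees_nth_block[of i a _ b]
    by (intro sum.cong) (auto simp: stacked_level_def distrib_left)
  also have "\<dots> = a ! i * height S i + weighted_depth b T"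
    using assms by (simp add: sum.distrib weighted_depth_def sum_list_sum_nth atLeast0LessThan flip: sum_distrib_right)
  finally have block: "(\<Sum>q<m. ?c ! (i + q) * stacked_level i m S T (i + q)) = a ! i * height S i + weighted_depth b T" .
  have out: "stacked_level i m S T (shift i m j) = height S j" if "j \<noteq> i" for j
    unfolding stacked_level_def if_not_P[OF shift_outside_block[OF that assms(4)]] using that assms(4) by simp
  have "(\<Sum>j\<in>{..<n} - {i}. ?c ! shift i m j * stacked_level i m S T (shift i m j)) = (\<Sum>j\<in>{..<n} - {i}. a ! j * height S j)"
    using assms subst_degrees_nth_shift[of i a _ b] by (intro sum.cong refl) (simp add: out)
  moreover have "weighted_depth a S = a ! i * height S i + (\<Sum>j\<in>{..<n} - {i}. a ! j * height S j)"
    using assms by (simp add: weighted_depth_def sum.remove[of "{..<n}" i])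
  ultimately show ?thesis by (simp add: sum_over_positions[OF assms(3,4)] block)
qed

text \<open>
  The stacked level fails to drop by exactly one only along an edge that enters the block from outside
  at a vertex different from the root of the block.
\<close>

lemma stacked_level_edge:
  assumes S: "S \<in> rooted_trees n" and T: "T \<in> rooted_trees m" and "X \<in> graftings n m i S T" and "0 < m" "i < n"
    and e: "(c, p) \<in> edges X"
  shows "stacked_level i m S T c \<le> Suc (stacked_level i m S T p)"
    and "in_block i m p \<Longrightarrow> \<not> in_block i m c \<Longrightarrow> p = i + root T \<Longrightarrow>
      stacked_level i m S T c = Suc (stacked_level i m S T p)"
    and "\<not> in_block i m p \<or> in_block i m c \<Longrightarrow> stacked_level i m S T c = Suc (stacked_level i m S T p)"
proof -
  have X: "X \<in> rooted_trees (n + m - 1)" "collapse_edges i m (edges X) = edges S" "block_edges i m (edges X) = edges T"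
    using assms(3) by (auto simp: graftings_def)
  have tS: "tree_on {..<n} (root S) (edges S)" and tT: "tree_on {..<m} (root T) (edges T)"
    using S T by (auto simp: rooted_trees_iff)
  have sv: "single_valued (edges X)" using X(1) by (simp add: rooted_trees_def)
  have outside: "height S (collapse i m c) = Suc (height S (collapse i m p))"
    if "\<not> within_block i m c p"
    using collapse_edgesI[OF e that] level_edge[OF tS] unfolding X(2) height_eq_level by blast
  have inside: "height T (c - i) = Suc (height T (p - i))" "collapse i m c = i" "collapse i m p = i"
    if "within_block i m c p"
  proof -
    obtain c' p' where cp: "c = i + c'" "p = i + p'" "c' < m" "p' < m"
      using \<open>within_block i m c p\<close> in_block_cases unfolding within_block_def by metis
    then have "(c', p') \<in> edges T" using e X(3) block_edges_add by blast
    then show "height T (c - i) = Suc (height T (p - i))"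
      using level_edge[OF tT] cp by (simp add: height_eq_level)
    show "collapse i m c = i" "collapse i m p = i" using cp by simp_all
  qed
  have exit: "height T (c - i) = 0" if "in_block i m c" "\<not> in_block i m p"
    using block_exit[OF sv _ e that] tT X(3) by (simp add: height_eq_level)
  have inb: "stacked_level i m S T v = height S (collapse i m v) + height T (v - i)" if "in_block i m v" for v
    unfolding stacked_level_def if_P[OF that] ..
  have out: "stacked_level i m S T v = height S (collapse i m v)" if "\<not> in_block i m v" for v
    unfolding stacked_level_def if_not_P[OF that] by simp
  show eq: "stacked_level i m S T c = Suc (stacked_level i m S T p)" if *: "\<not> in_block i m p \<or> in_block i m c"
  proof (cases "within_block i m c p")
    case True
    then have "in_block i m c" "in_block i m p" unfolding within_block_def by blast+
    then show ?thesis using inside[OF True] by (simp only: inb)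
  next
    case False
    then have p: "\<not> in_block i m p" using * unfolding within_block_def by blast
    then have "stacked_level i m S T c = height S (collapse i m c)"
      using inb[of c] out[of c] exit by fastforce
    then show ?thesis using outside[OF False] out[OF p] by simp
  qed
  show "stacked_level i m S T c \<le> Suc (stacked_level i m S T p)"
  proof (cases "\<not> in_block i m p \<or> in_block i m c")
    case True
    then show ?thesis using eq by simp
  next
    case False
    then have *: "in_block i m p" "\<not> in_block i m c" by blast+
    then have "\<not> within_block i m c p" unfolding within_block_def by blast
    then show ?thesis using inb[OF *(1)] out[OF *(2)] outside by simp
  qed
  show "stacked_level i m S T c = Suc (stacked_level i m S T p)"
    if *: "in_block i m p" "\<not> in_block i m c" "p = i + root T"
  proof -
    have "\<not> within_block i m c p" using * unfolding within_block_def by blast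
    then show ?thesis using inb[OF *(1)] out[OF *(2)] outside *(3) by (simp add: height_eq_level)
  qed
qed

lemma stacked_level_root:
  assumes "S \<in> rooted_trees n" "T \<in> rooted_trees m" "X \<in> graftings n m i S T" "0 < m" "i < n"
  shows "stacked_level i m S T (root X) = 0"
proof -
  have X: "X \<in> rooted_trees (n + m - 1)" "collapse_edges i m (edges X) = edges S" "block_edges i m (edges X) = edges T"
    using assms(3) by (auto simp: graftings_def)
  have tS: "tree_on {..<n} (root S) (edges S)" and tT: "tree_on {..<m} (root T) (edges T)"
    using assms by (auto simp: rooted_trees_iff)
  have "tree_on {..<n} (collapse i m (root X)) (edges S)"
    using collapse_edges_tree[of n m "root X" "edges X" "root T" i] X tT assms(5) by (simp add: rooted_trees_iff)
  then have "collapse i m (root X) = root S" using tree_on_unique_root[OF _ tS] by blast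
  moreover have "root X - i = root T" if blk: "in_block i m (root X)"
  proof -
    obtain q where q: "q < m" "root X = i + q" using blk by (rule in_block_cases)
    have "(q, p) \<notin> edges T" for p
    proof
      assume "(q, p) \<in> edges T"
      then have "(i + q, i + p) \<in> edges X" using X(3) by (auto simp: block_edges_def)
      then show False using X(1) q(2) by (auto simp: rooted_trees_def)
    qed
    then have "q = root T" using tree_on_parent[OF tT, of q] q(1) by blast
    then show ?thesis using q by simp
  qed
  ultimately show ?thesis by (simp add: stacked_level_def height_eq_level)
qed

lemma weighted_depth_graftings_ge:
  assumes "S \<in> rooted_trees n" "T \<in> rooted_trees m" "X \<in> graftings n m i S T" "0 < m" "i < n"
    and "length a = n" "length b = m" "sum_list b = a ! i"
  shows "weighted_depth a S + weighted_depth b T \<le> weighted_depth (subst_degrees a i b) X"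
proof -
  have X: "tree_on {..<n + m - 1} (root X) (edges X)" using assms(3) by (auto simp: graftings_def rooted_trees_iff)
  have "stacked_level i m S T v \<le> height X v" if "v < n + m - 1" for v
    unfolding height_eq_level
    using that stacked_level_root[OF assms(1-5)] stacked_level_edge(1)[OF assms(1-5)]
    by (intro level_lower_bound[OF X]) auto
  then have "(\<Sum>v<n + m - 1. subst_degrees a i b ! v * stacked_level i m S T v)
      \<le> (\<Sum>v<n + m - 1. subst_degrees a i b ! v * height X v)"
    by (intro sum_mono) simp
  then show ?thesis
    using assms by (simp add: sum_stacked_level weighted_depth_def[of "subst_degrees a i b"] length_subst_degrees)
qed

text \<open>
  The composition of trees compares each depth with that of the graft at the root. By this equation the
  comparison is a difference of weights, as a twisted composition requires.
\<close>

lemma weighted_depth_root_grafting: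
  assumes "S \<in> rooted_trees n" "T \<in> rooted_trees m" "X \<in> graftings n m i S T" "0 < m" "i < n"
    and "length a = n" "length b = m" "sum_list b = a ! i"
    and "\<And>c p. \<lbrakk>(c, p) \<in> edges X; in_block i m p; \<not> in_block i m c\<rbrakk> \<Longrightarrow> p = i + root T"
  shows "weighted_depth (subst_degrees a i b) X = weighted_depth a S + weighted_depth b T"
proof -
  have X: "tree_on {..<n + m - 1} (root X) (edges X)" using assms(3) by (auto simp: graftings_def rooted_trees_iff)
  have "stacked_level i m S T c = Suc (stacked_level i m S T p)" if "(c, p) \<in> edges X" for c p
    using stacked_level_edge(2,3)[OF assms(1-5) that] assms(9)[OF that] by blast
  then have "height X v = stacked_level i m S T v" if "v < n + m - 1" for v
    unfolding height_eq_level
    using that stacked_level_root[OF assms(1-5)] by (intro level_unique[OF X]) auto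
  then show ?thesis
    using assms by (simp add: sum_stacked_level[symmetric] weighted_depth_def[of "subst_degrees a i b"] length_subst_degrees)
qed

section \<open>Graftings enumerated by attaching maps\<close>

lemma mem_edges_graft:
  "e \<in> edges (graft i m f S T) \<longleftrightarrow>
     (\<exists>c p. (c, p) \<in> edges S \<and> c \<noteq> i \<and> p \<noteq> i \<and> e = (shift i m c, shift i m p)) \<or>
     (\<exists>c p. (c, p) \<in> edges T \<and> e = (i + c, i + p)) \<or>
     (\<exists>c. (c, i) \<in> edges S \<and> e = (shift i m c, i + f (c, i))) \<or>
     (\<exists>p. (i, p) \<in> edges S \<and> e = (i + root T, shift i m p))"
  by (auto simp: graft_def in_edges_def)

context
  fixes n m i S T
  assumes S: "S \<in> rooted_trees n" and T: "T \<in> rooted_trees m" and i: "i < n" and m: "0 < m"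
begin

lemma S_loop: "(x, x) \<notin> edges S"
  using S tree_on_no_loop unfolding rooted_trees_iff by metis

lemma graft_edge_cases:
  assumes "f \<in> in_edges S i \<rightarrow>\<^sub>E {..<m}" "(x, y) \<in> edges (graft i m f S T)"
  obtains (outer) c p where "(c, p) \<in> edges S" "c \<noteq> i" "p \<noteq> i" "x = shift i m c" "y = shift i m p"
    "\<not> in_block i m x" "\<not> in_block i m y"
  | (inner) c p where "(c, p) \<in> edges T" "c < m" "p < m" "x = i + c" "y = i + p"
  | (attach) c where "(c, i) \<in> edges S" "c \<noteq> i" "x = shift i m c" "y = i + f (c, i)" "f (c, i) < m"
    "\<not> in_block i m x"
  | (leave) p where "(i, p) \<in> edges S" "p \<noteq> i" "x = i + root T" "y = shift i m p" "\<not> in_block i m y"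
proof -
  have f: "f (c, i) < m" if "(c, i) \<in> edges S" for c
    using PiE_mem[OF assms(1), of "(c, i)"] that by (simp add: in_edges_def)
  show thesis
    using assms(2) unfolding mem_edges_graft
  proof (elim disjE exE conjE)
    fix c p assume "(c, p) \<in> edges S" "c \<noteq> i" "p \<noteq> i" "(x, y) = (shift i m c, shift i m p)"
    then show thesis using shift_outside_block[OF _ m] by (intro outer) auto
  next
    fix c p assume "(c, p) \<in> edges T" "(x, y) = (i + c, i + p)"
    then show thesis using rooted_trees_sub[OF T] by (intro inner) auto
  next
    fix c assume "(c, i) \<in> edges S" "(x, y) = (shift i m c, i + f (c, i))"
    moreover from this have "c \<noteq> i" using S_loop by blast
    ultimately show thesis using shift_outside_block[OF _ m] f by (intro attach) auto
  next
    fix p assume "(i, p) \<in> edges S" "(x, y) = (i + root T, shift i m p)"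
    moreover from this have "p \<noteq> i" using S_loop by blast
    ultimately show thesis using shift_outside_block[OF _ m] by (intro leave) auto
  qed
qed

lemma collapse_edges_graft:
  assumes f: "f \<in> in_edges S i \<rightarrow>\<^sub>E {..<m}"
  shows "collapse_edges i m (edges (graft i m f S T)) = edges S"
proof (intro equalityI subsetI)
  have r: "root T < m" using T by (simp add: rooted_trees_def)
  fix e assume "e \<in> collapse_edges i m (edges (graft i m f S T))"
  then obtain x y where xy: "(x, y) \<in> edges (graft i m f S T)" "\<not> within_block i m x y"
    "e = (collapse i m x, collapse i m y)" by (rule collapse_edgesE)
  show "e \<in> edges S"
    using f xy(1)
  proof (cases rule: graft_edge_cases)
    case (outer c p)
    then show ?thesis using xy(3) m by simp
  next
    case (inner c p)
    then show ?thesis using xy(2) by (simp add: within_block_def)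
  next
    case (attach c)
    then show ?thesis using xy(3) m by simp
  next
    case (leave p)
    then show ?thesis using xy(3) m r by simp
  qed
next
  have r: "root T < m" using T by (simp add: rooted_trees_def)
  fix e assume e: "e \<in> edges S"
  obtain c p where cp: "e = (c, p)" by (cases e)
  have "\<exists>x y. (x, y) \<in> edges (graft i m f S T) \<and> \<not> within_block i m x y \<and> collapse i m x = c \<and> collapse i m y = p"
  proof -
    consider "c \<noteq> i" "p \<noteq> i" | "c \<noteq> i" "p = i" | "c = i" "p \<noteq> i" using e cp S_loop by blast
    then show ?thesis
    proof cases
      case 1
      then have "(shift i m c, shift i m p) \<in> edges (graft i m f S T)"
        using e cp unfolding mem_edges_graft by blast
      then show ?thesis using 1 m shift_outside_block[OF _ m] collapse_shift unfolding within_block_def by metis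
    next
      case 2
      then have "(shift i m c, i + f (c, i)) \<in> edges (graft i m f S T)"
        using e cp unfolding mem_edges_graft by blast
      moreover have "f (c, i) < m" using PiE_mem[OF f, of "(c, i)"] e cp 2 by (simp add: in_edges_def)
      ultimately show ?thesis
        using 2 m shift_outside_block[OF _ m] collapse_shift collapse_add unfolding within_block_def by metis
    next
      case 3
      then have "(i + root T, shift i m p) \<in> edges (graft i m f S T)"
        using e cp unfolding mem_edges_graft by blast
      then show ?thesis
        using 3 m r shift_outside_block[OF _ m] collapse_shift collapse_add unfolding within_block_def by metis
    qed
  qed
  then show "e \<in> collapse_edges i m (edges (graft i m f S T))" using collapse_edgesI cp by metis
qed

lemma block_edges_graft:
  assumes f: "f \<in> in_edges S i \<rightarrow>\<^sub>E {..<m}"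
  shows "block_edges i m (edges (graft i m f S T)) = edges T"
proof (intro equalityI subsetI)
  fix e assume "e \<in> block_edges i m (edges (graft i m f S T))"
  then obtain c p where cp: "e = (c, p)" "c < m" "p < m" "(i + c, i + p) \<in> edges (graft i m f S T)"
    by (auto simp: block_edges_def)
  from f cp(4) show "e \<in> edges T" by (cases rule: graft_edge_cases) (use cp in auto)
next
  fix e assume e: "e \<in> edges T"
  then show "e \<in> block_edges i m (edges (graft i m f S T))"
    using rooted_trees_sub[OF T] by (cases e) (auto simp: block_edges_def mem_edges_graft)
qed

lemma graft_single_valued:
  assumes f: "f \<in> in_edges S i \<rightarrow>\<^sub>E {..<m}"
  shows "single_valued (edges (graft i m f S T))"
proof (rule single_valuedI)
  have svS: "single_valued (edges S)" and svT: "single_valued (edges T)" and r: "root T \<notin> Domain (edges T)" "root T < m"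
    using S T by (auto simp: rooted_trees_def)
  have inj: "c = c'" if "shift i m c = shift i m c'" "c \<noteq> i" "c' \<noteq> i" for c c'
    using that unshift_shift[OF _ m] by metis
  fix x y z assume y: "(x, y) \<in> edges (graft i m f S T)" and z: "(x, z) \<in> edges (graft i m f S T)"
  from f y show "y = z"
  proof (cases rule: graft_edge_cases)
    case (outer c p)
    note 1 = this
    from f z show ?thesis
      by (cases rule: graft_edge_cases) (use 1 inj r in \<open>auto dest: single_valuedD[OF svS]\<close>)
  next
    case (inner c p)
    note 1 = this
    from f z show ?thesis
      by (cases rule: graft_edge_cases) (use 1 r in \<open>auto dest: single_valuedD[OF svT]\<close>)
  next
    case (attach c)
    note 1 = this
    from f z show ?thesis
    proof (cases rule: graft_edge_cases)
      case (outer c' p')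
      then have "(c, p') \<in> edges S" using 1 inj by metis
      then show ?thesis using single_valuedD[OF svS 1(1)] outer by blast
    next
      case (attach c')
      then show ?thesis using 1 inj by metis
    qed (use 1 r in auto)
  next
    case (leave p)
    note 1 = this
    from f z show ?thesis
      by (cases rule: graft_edge_cases) (use 1 r in \<open>auto dest: single_valuedD[OF svS]\<close>)
  qed
qed

lemma graft_in_graftings:
  assumes f: "f \<in> in_edges S i \<rightarrow>\<^sub>E {..<m}"
  shows "graft i m f S T \<in> graftings n m i S T"
proof -
  have r: "root T < m" "root S < n" using S T by (auto simp: rooted_trees_def)
  have sub: "edges (graft i m f S T) \<subseteq> {..<n + m - 1} \<times> {..<n + m - 1}"
  proof
    fix e assume "e \<in> edges (graft i m f S T)"
    moreover obtain x y where xy: "e = (x, y)" by (cases e)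
    ultimately have e: "(x, y) \<in> edges (graft i m f S T)" by simp
    have block: "i + q < n + m - 1" if "q < m" for q using i that by simp
    have less: "c < n" "p < n" if "(c, p) \<in> edges S" for c p using rooted_trees_sub[OF S] that by auto
    from f e have "x < n + m - 1 \<and> y < n + m - 1"
      by (cases rule: graft_edge_cases) (use i m r block less shift_less[OF _ i _ m] in auto)
    then show "e \<in> {..<n + m - 1} \<times> {..<n + m - 1}" by (simp add: xy)
  qed
  have "tree_on {..<n + m - 1} (root (graft i m f S T)) (edges (graft i m f S T))"
  proof (rule expand_tree[OF sub graft_single_valued[OF f], of "root S" i "root T"])
    show "tree_on {..<n} (root S) (collapse_edges i m (edges (graft i m f S T)))"
      using S by (simp add: collapse_edges_graft[OF f] rooted_trees_iff)
    show "tree_on {..<m} (root T) (block_edges i m (edges (graft i m f S T)))"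
      using T by (simp add: block_edges_graft[OF f] rooted_trees_iff)
    show "root (graft i m f S T) < n + m - 1" "collapse i m (root (graft i m f S T)) = root S"
      using r i m shift_less[OF _ i _ m] by (auto simp: graft_def)
    show "root (graft i m f S T) = i + root T" if "in_block i m (root (graft i m f S T))"
    proof (cases "root S = i")
      case False
      then show ?thesis using that shift_outside_block[OF False m] by (simp add: graft_def)
    qed (simp add: graft_def)
  qed (rule i)
  then show ?thesis
    by (simp add: graftings_def collapse_edges_graft[OF f] block_edges_graft[OF f] rooted_trees_iff)
qed

lemma graft_inj: "inj_on (\<lambda>f. graft i m f S T) (in_edges S i \<rightarrow>\<^sub>E {..<m})"
proof (rule inj_onI)
  fix f g assume f: "f \<in> in_edges S i \<rightarrow>\<^sub>E {..<m}" and g: "g \<in> in_edges S i \<rightarrow>\<^sub>E {..<m}"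
    and eq: "graft i m f S T = graft i m g S T"
  show "f = g"
  proof (rule PiE_ext[OF f g])
    fix e assume "e \<in> in_edges S i"
    then obtain c where c: "e = (c, i)" "(c, i) \<in> edges S" by (cases e) (auto simp: in_edges_def)
    then have "(shift i m c, i + f e) \<in> edges (graft i m f S T)" "(shift i m c, i + g e) \<in> edges (graft i m g S T)"
      unfolding mem_edges_graft by blast+
    then show "f e = g e" using graft_single_valued[OF f] eq by (auto dest: single_valuedD)
  qed
qed

text \<open>
  A tree recovers its attaching map. All edges of \<open>X\<close> are edges of the graft along this map, and two
  trees on the same vertices cannot be properly contained in one another.
\<close>

lemma graft_surj:
  assumes X: "X \<in> graftings n m i S T"
  shows "\<exists>f\<in>in_edges S i \<rightarrow>\<^sub>E {..<m}. X = graft i m f S T"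
proof -
  have Xt: "X \<in> rooted_trees (n + m - 1)" and Xc: "collapse_edges i m (edges X) = edges S"
    and Xb: "block_edges i m (edges X) = edges T" using X by (auto simp: graftings_def)
  have sv: "single_valued (edges X)" using Xt by (simp add: rooted_trees_def)
  have tT: "tree_on {..<m} (root T) (block_edges i m (edges X))" using T Xb by (simp add: rooted_trees_iff)
  have "\<exists>q<m. (shift i m c, i + q) \<in> edges X" if c: "(c, i) \<in> edges S" for c
  proof -
    have "c \<noteq> i" using c S_loop by blast
    obtain x y where xy: "(x, y) \<in> edges X" "\<not> within_block i m x y" "c = collapse i m x" "i = collapse i m y"
      using c unfolding Xc[symmetric] by (auto elim: collapse_edgesE)
    have "\<not> in_block i m x" "in_block i m y"
      using xy(3,4) \<open>c \<noteq> i\<close> collapse_eq_iff[OF m] by metis+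
    then have "x = shift i m c" "\<exists>q<m. y = i + q"
      using shift_collapse[OF _ m] xy(3) in_block_cases by metis+
    then show ?thesis using xy(1) by blast
  qed
  then obtain h where h: "\<And>c. (c, i) \<in> edges S \<Longrightarrow> h c < m \<and> (shift i m c, i + h c) \<in> edges X" by metis
  \<comment> \<open>The attaching map is read off from \<open>X\<close>: a child of \<open>i\<close> is attached to its parent in the block.\<close>
  define f where "f = (\<lambda>e\<in>in_edges S i. h (fst e))"
  have f: "f \<in> in_edges S i \<rightarrow>\<^sub>E {..<m}" using h by (auto simp: f_def in_edges_def)
  have fc: "f (c, i) = h c" if "(c, i) \<in> edges S" for c using that by (simp add: f_def in_edges_def)
  have "edges X \<subseteq> edges (graft i m f S T)"
  proof
    fix e assume eX: "e \<in> edges X"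
    obtain x y where e: "e = (x, y)" by (cases e)
    show "e \<in> edges (graft i m f S T)"
    proof (cases "within_block i m x y")
      case True
      then obtain c p where cp: "x = i + c" "y = i + p" "c < m" "p < m"
        using in_block_cases unfolding within_block_def by metis
      then have "(c, p) \<in> edges T" using eX e block_edges_add Xb by blast
      then show ?thesis unfolding mem_edges_graft e cp by blast
    next
      case False
      have cS: "(collapse i m x, collapse i m y) \<in> edges S"
        using collapse_edgesI[OF _ False] eX e Xc by blast
      consider "\<not> in_block i m x" "\<not> in_block i m y" | "\<not> in_block i m x" "in_block i m y"
        | "in_block i m x" "\<not> in_block i m y" using False unfolding within_block_def by blast
      then show ?thesis
      proof cases
        case 1
        then have "x = shift i m (collapse i m x)" "y = shift i m (collapse i m y)"
          "collapse i m x \<noteq> i" "collapse i m y \<noteq> i"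
          using shift_collapse[OF _ m] collapse_eq_iff[OF m] by metis+
        then show ?thesis using cS unfolding mem_edges_graft e by metis
      next
        case 2
        then have x: "x = shift i m (collapse i m x)" and y: "collapse i m y = i"
          using shift_collapse[OF _ m] collapse_eq_iff[OF m] by metis+
        have cS': "(collapse i m x, i) \<in> edges S" using cS y by simp
        then have "(x, i + h (collapse i m x)) \<in> edges X" using h x by metis
        then have "y = i + f (collapse i m x, i)" using single_valuedD[OF sv] eX e fc[OF cS'] by metis
        then show ?thesis using cS' x unfolding mem_edges_graft e by metis
      next
        case 3
        then have y: "y = shift i m (collapse i m y)" and x: "collapse i m x = i"
          using shift_collapse[OF _ m] collapse_eq_iff[OF m] by metis+
        have "x = i + root T" using block_exit[OF sv tT _ 3] eX e by blast
        then show ?thesis using cS x y unfolding mem_edges_graft e by metis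
      qed
    qed
  qed
  moreover have "edges (graft i m f S T) \<subseteq> edges X"
  proof
    fix e assume eG: "e \<in> edges (graft i m f S T)"
    obtain x y where e: "e = (x, y)" by (cases e)
    have "x \<noteq> root (graft i m f S T)" "x < n + m - 1"
      using graft_in_graftings[OF f] eG e by (auto simp: graftings_def rooted_trees_def)
    \<comment> \<open>Two trees on the same vertices, one contained in the other, have the same edges.\<close>
    have "root X = root (graft i m f S T)"
    proof (rule ccontr)
      assume ne: "root X \<noteq> root (graft i m f S T)"
      have "root (graft i m f S T) < n + m - 1" "root (graft i m f S T) \<notin> Domain (edges (graft i m f S T))"
        using graft_in_graftings[OF f] by (auto simp: graftings_def rooted_trees_def)
      then show False
        using tree_on_parent[of "{..<n + m - 1}" "root X" "edges X" "root (graft i m f S T)"] Xt ne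
          \<open>edges X \<subseteq> edges (graft i m f S T)\<close> by (auto simp: rooted_trees_iff)
    qed
    then obtain z where "(x, z) \<in> edges X"
      using tree_on_parent[of "{..<n + m - 1}" "root X" "edges X" x] Xt \<open>x < n + m - 1\<close>
        \<open>x \<noteq> root (graft i m f S T)\<close> by (auto simp: rooted_trees_iff)
    then show "e \<in> edges X"
      using \<open>edges X \<subseteq> edges (graft i m f S T)\<close> single_valuedD[OF graft_single_valued[OF f]] eG e by blast
  qed
  ultimately have "X = graft i m f S T"
    using graft_in_graftings[OF f] Xt by (intro rooted_trees_eqI[of _ "n + m - 1"]) (auto simp: graftings_def)
  then show ?thesis using f by blast
qed

lemma graft_image: "(\<lambda>f. graft i m f S T) ` (in_edges S i \<rightarrow>\<^sub>E {..<m}) = graftings n m i S T"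
  using graft_in_graftings graft_surj by blast

lemma weighted_depth_graft_root:
  assumes "length a = n" "length b = m" "sum_list b = a ! i"
  shows "weighted_depth (subst_degrees a i b) (graft i m (\<lambda>e\<in>in_edges S i. root T) S T)
    = weighted_depth a S + weighted_depth b T"
proof (rule weighted_depth_root_grafting[OF S T _ m i assms])
  have r: "root T < m" using T by (simp add: rooted_trees_def)
  then have f: "(\<lambda>e\<in>in_edges S i. root T) \<in> in_edges S i \<rightarrow>\<^sub>E {..<m}" by simp
  then show "graft i m (\<lambda>e\<in>in_edges S i. root T) S T \<in> graftings n m i S T"
    by (rule graft_in_graftings)
  fix c p assume e: "(c, p) \<in> edges (graft i m (\<lambda>e\<in>in_edges S i. root T) S T)"
    and "in_block i m p" "\<not> in_block i m c"
  with f e show "p = i + root T"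
    by (cases rule: graft_edge_cases) (auto simp: in_edges_def)
qed

end

lemma tree_comp_eq:
  assumes "0 < m" "i < n" "a \<in> degrees n" "b \<in> degrees m" "S \<in> rooted_trees n" "T \<in> rooted_trees m"
  shows "tree_comp lam a b i S T = (if sum_list b = a ! i
    then \<Sum>X\<in>graftings n m i S T. sgl X (lam ^ (weighted_depth (subst_degrees a i b) X
      - (weighted_depth a S + weighted_depth b T))) else 0)"
proof -
  have len: "length a = n" "length b = m" using assms by (auto simp: degrees_def)
  have sums: "(\<Sum>f\<in>in_edges S i \<rightarrow>\<^sub>E {..<m}. F (graft i m f S T)) = (\<Sum>X\<in>graftings n m i S T. F X)"
    for F :: "rtree \<Rightarrow> (rtree \<Rightarrow>\<^sub>0 'a)"
    unfolding graft_image[OF assms(5,6,2,1), symmetric] sum.reindex[OF graft_inj[OF assms(5,6,2,1)]] o_def ..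
  show ?thesis
    using weighted_depth_graft_root[OF assms(5,6,2,1) len]
      sums[of "\<lambda>X. sgl X (lam ^ (weighted_depth (subst_degrees a i b) X - (weighted_depth a S + weighted_depth b T)))"]
    by (simp add: tree_comp_def Let_def len)
qed

theorem tree_operad_twisted:
  "twisted_operad rooted_trees (\<lambda>T \<sigma>. relabel_tree (inv \<sigma>) T) (tree_comp lam) (RTree 0 {})
     graftings weighted_depth lam"
proof
  fix u v :: rtree and n m l i j :: nat and \<sigma> \<tau> :: "nat \<Rightarrow> nat"
  show "relabel_tree (inv \<sigma>) u \<in> rooted_trees n" if "u \<in> rooted_trees n" "\<sigma> permutes {..<n}"
    using relabel_in_rooted_trees[OF that(1) permutes_inv[OF that(2)]] .
  show "relabel_tree (inv id) u = u" by simp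
  show "relabel_tree (inv \<tau>) (relabel_tree (inv \<sigma>) u) = relabel_tree (inv (\<sigma> \<circ> \<tau>)) u"
    if "\<sigma> permutes {..<n}" "\<tau> permutes {..<n}"
    using that by (simp add: relabel_relabel o_inv_distrib permutes_bij)
  show "weighted_depth (permute_list \<sigma> a) (relabel_tree (inv \<sigma>) u) = weighted_depth a u"
    if "a \<in> degrees n" "u \<in> rooted_trees n" "\<sigma> permutes {..<n}" for a
    using weighted_depth_relabel[OF _ that(2,3)] that(1) by (simp add: degrees_def)
  show "weighted_depth [k] (RTree 0 {}) = 0" for k
    by (simp add: weighted_depth_def height_eq_level)
  show "supp (tree_comp lam a b i u v) \<subseteq> rooted_trees (n + m - 1)"
    if "0 < m" "i < n" "a \<in> degrees n" "b \<in> degrees m" "u \<in> rooted_trees n" "v \<in> rooted_trees m" for a b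
    unfolding tree_comp_eq[OF that]
    by (auto simp: graftings_def dest!: subsetD[OF supp_sum_terms])
  show "finite (graftings n m i u v)"
    by (rule finite_subset[OF _ finite_rooted_trees]) (auto simp: graftings_def)
  show "graftings n m i u v \<subseteq> rooted_trees (n + m - 1)" by (auto simp: graftings_def)
  show "weighted_depth a u + weighted_depth b v \<le> weighted_depth (subst_degrees a i b) X"
    if "0 < m" "i < n" "a \<in> degrees n" "b \<in> degrees m" "u \<in> rooted_trees n" "v \<in> rooted_trees m"
      "sum_list b = a ! i" "X \<in> graftings n m i u v" for a b X
    using weighted_depth_graftings_ge[OF that(5,6,8,1,2)] that by (simp add: degrees_def)
qed (rule single_vertex_tree tree_comp_eq graftings_unique graftings_unit_left graftings_unit_right
    graftings_sequential graftings_parallel graftings_outer graftings_inner; assumption)+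

theorem multigraded_tree_operad: "multigraded_operad (tree_operad lam)"
  unfolding tree_operad_def by (rule twisted_operad.multigraded_operad_P[OF tree_operad_twisted])

section \<open>Trees produced by a monomial\<close>

abbreviation vars :: "'a monomial \<Rightarrow> 'a set" where
  "vars u \<equiv> set (variables u)"

text \<open>
  The root of every tree that the monomial produces.
\<close>

primrec leftmost :: "'a monomial \<Rightarrow> 'a" where
  "leftmost (Var x) = x"
| "leftmost (Mul u v) = leftmost u"

text \<open>
  The trees that a monomial produces: for a product, the root of a tree of the right factor is attached
  to some vertex of a tree of the left factor. Only the edges between variables of the monomial matter.
\<close>

primrec compatible :: "'a monomial \<Rightarrow> ('a \<times> 'a) set \<Rightarrow> bool" where
  "compatible (Var x) E \<longleftrightarrow> (x, x) \<notin> E"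
| "compatible (Mul u v) E \<longleftrightarrow> compatible u E \<and> compatible v E \<and>
     (\<forall>c\<in>vars u. \<forall>p\<in>vars v. (c, p) \<notin> E) \<and>
     (\<forall>c\<in>vars v. \<forall>p\<in>vars u. (c, p) \<in> E \<longrightarrow> c = leftmost v) \<and>
     (\<exists>p\<in>vars u. (leftmost v, p) \<in> E)"

text \<open>
  The tree in which every right factor is attached to the root of its left factor.
\<close>

primrec shape :: "'a monomial \<Rightarrow> ('a \<times> 'a) set" where
  "shape (Var x) = {}"
| "shape (Mul u v) = insert (leftmost v, leftmost u) (shape u \<union> shape v)"

definition mweight :: "('a \<Rightarrow> nat) \<Rightarrow> 'a monomial \<Rightarrow> nat" where
  "mweight wt u = sum_list (map wt (variables u))"

text \<open>
  The weighted depth of the shape: a product lowers all vertices of its right factor by one level.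
\<close>

primrec mdepth :: "('a \<Rightarrow> nat) \<Rightarrow> 'a monomial \<Rightarrow> nat" where
  "mdepth wt (Var x) = 0"
| "mdepth wt (Mul u v) = mdepth wt u + mdepth wt v + mweight wt v"

definition tree_depth :: "('a \<Rightarrow> nat) \<Rightarrow> 'a set \<Rightarrow> 'a \<Rightarrow> ('a \<times> 'a) set \<Rightarrow> nat" where
  "tree_depth wt V r E = (\<Sum>v\<in>V. wt v * level E r v)"

lemma weighted_depth_eq: "weighted_depth a X = tree_depth ((!) a) {..<length a} (root X) (edges X)"
  by (simp add: weighted_depth_def tree_depth_def height_eq_level)

lemma mweight_simps [simp]: "mweight wt (Var x) = wt x" "mweight wt (Mul u v) = mweight wt u + mweight wt v"
  by (simp_all add: mweight_def)

lemma mweight_sum: "distinct (variables u) \<Longrightarrow> mweight wt u = (\<Sum>x\<in>vars u. wt x)"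
  by (simp add: mweight_def sum_list_distinct_conv_sum_set)

lemma leftmost_in_vars [simp]: "leftmost u \<in> vars u"
  by (induction u) auto

lemma variables_ne [simp]: "variables u \<noteq> []"
  by (induction u) auto

lemma tree_on_join:
  assumes T1: "tree_on U r E1" and T2: "tree_on V s E2" and disj: "U \<inter> V = {}" and p: "p \<in> U"
  shows "tree_on (U \<union> V) r (insert (s, p) (E1 \<union> E2))" (is "tree_on _ _ ?E")
proof -
  have sub: "E1 \<subseteq> U \<times> U" "E2 \<subseteq> V \<times> V" and rs: "r \<in> U" "s \<in> V" "r \<notin> Domain E1" "s \<notin> Domain E2"
    and sv: "single_valued E1" "single_valued E2"
    using T1 T2 by (auto simp: tree_on_def)
  have "single_valued ?E"
    using sub rs disj p by (auto simp: single_valued_def dest: single_valuedD[OF sv(1)] single_valuedD[OF sv(2)])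
  moreover have "r \<notin> Domain ?E" using sub rs disj by auto
  moreover have U: "(v, r) \<in> ?E\<^sup>*" if "v \<in> U" for v
    using T1 that by (induction rule: tree_on_induct) (auto intro: converse_rtrancl_into_rtrancl)
  moreover have "(v, r) \<in> ?E\<^sup>*" if "v \<in> V" for v
    using T2 that
  proof (induction rule: tree_on_induct)
    case root
    show ?case using U[OF p] by (auto intro: converse_rtrancl_into_rtrancl)
  qed (auto intro: converse_rtrancl_into_rtrancl)
  ultimately show ?thesis using sub rs p by (auto simp: tree_on_def)
qed

lemma level_join:
  assumes T1: "tree_on U r E1" and T2: "tree_on V s E2" and disj: "U \<inter> V = {}" and p: "p \<in> U"
  shows "v \<in> U \<Longrightarrow> level (insert (s, p) (E1 \<union> E2)) r v = level E1 r v"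
    and "v \<in> V \<Longrightarrow> level (insert (s, p) (E1 \<union> E2)) r v = level E2 s v + Suc (level E1 r p)"
proof -
  define g where "g v = (if v \<in> U then level E1 r v else level E2 s v + Suc (level E1 r p))" for v
  have sub: "E1 \<subseteq> U \<times> U" "E2 \<subseteq> V \<times> V" and rs: "r \<in> U" "s \<in> V" using T1 T2 by (auto simp: tree_on_def)
  have V: "v \<notin> U" if "v \<in> V" for v using that disj by auto
  have "level (insert (s, p) (E1 \<union> E2)) r v = g v" if "v \<in> U \<union> V" for v
  proof (rule level_unique[OF tree_on_join[OF assms] that])
    show "g r = 0" using rs by (simp add: g_def)
    fix c q assume "(c, q) \<in> insert (s, p) (E1 \<union> E2)"
    then consider "c = s" "q = p" | "(c, q) \<in> E1" | "(c, q) \<in> E2" by auto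
    then show "g c = Suc (g q)"
    proof cases
      case 1
      then show ?thesis using V rs p by (simp add: g_def)
    next
      case 2
      then show ?thesis using sub level_edge[OF T1] by (auto simp: g_def)
    next
      case 3
      then have "c \<notin> U" "q \<notin> U" using sub V by auto
      then show ?thesis using level_edge[OF T2 3] by (simp add: g_def)
    qed
  qed
  then show "v \<in> U \<Longrightarrow> level (insert (s, p) (E1 \<union> E2)) r v = level E1 r v"
    "v \<in> V \<Longrightarrow> level (insert (s, p) (E1 \<union> E2)) r v = level E2 s v + Suc (level E1 r p)"
    using V by (auto simp: g_def)
qed

lemma tree_depth_join:
  assumes "tree_on U r E1" "tree_on V s E2" "U \<inter> V = {}" "p \<in> U" "finite U" "finite V"
  shows "tree_depth wt (U \<union> V) r (insert (s, p) (E1 \<union> E2)) =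
    tree_depth wt U r E1 + tree_depth wt V s E2 + (\<Sum>v\<in>V. wt v) * Suc (level E1 r p)"
  using assms(3,5,6)
  by (simp add: tree_depth_def sum.union_disjoint level_join[OF assms(1-4)] distrib_left sum.distrib sum_distrib_right)

definition induced :: "'a monomial \<Rightarrow> ('a \<times> 'a) set \<Rightarrow> ('a \<times> 'a) set" where
  "induced u E = E \<inter> vars u \<times> vars u"

lemma compatible_split:
  assumes "single_valued E" "compatible (Mul u v) E"
  obtains p where "p \<in> vars u" "induced (Mul u v) E = insert (leftmost v, p) (induced u E \<union> induced v E)"
proof -
  obtain p where p: "p \<in> vars u" "(leftmost v, p) \<in> E" using assms(2) by auto
  have "induced (Mul u v) E = insert (leftmost v, p) (induced u E \<union> induced v E)"
  proof (intro equalityI subsetI)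
    fix e assume e: "e \<in> induced (Mul u v) E"
    obtain x y where xy: "e = (x, y)" by (cases e)
    have E: "(x, y) \<in> E" and "x \<in> vars u \<union> vars v" "y \<in> vars u \<union> vars v"
      using e xy by (simp_all add: induced_def)
    then consider "x \<in> vars u" "y \<in> vars u" | "x \<in> vars v" "y \<in> vars v" | "x \<in> vars u" "y \<in> vars v"
      | "x \<in> vars v" "y \<in> vars u" by blast
    then show "e \<in> insert (leftmost v, p) (induced u E \<union> induced v E)"
    proof cases
      case 4
      then have "x = leftmost v" using assms(2) E unfolding compatible.simps by blast
      then show ?thesis using single_valuedD[OF assms(1) p(2)] E xy by simp
    qed (use assms(2) E xy in \<open>simp_all add: induced_def\<close>)
  next
    fix e assume "e \<in> insert (leftmost v, p) (induced u E \<union> induced v E)"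
    then show "e \<in> induced (Mul u v) E" using p leftmost_in_vars[of v] unfolding induced_def by auto
  qed
  with p show ?thesis using that by blast
qed

lemma compatible_tree:
  assumes "single_valued E"
  shows "distinct (variables u) \<Longrightarrow> compatible u E \<Longrightarrow> tree_on (vars u) (leftmost u) (induced u E)"
proof (induction u)
  case (Var x)
  then show ?case by (auto simp: tree_on_def induced_def single_valued_def)
next
  case (Mul u v)
  obtain p where p: "p \<in> vars u" "induced (Mul u v) E = insert (leftmost v, p) (induced u E \<union> induced v E)"
    using compatible_split[OF assms Mul.prems(2)] .
  have "tree_on (vars u \<union> vars v) (leftmost u) (insert (leftmost v, p) (induced u E \<union> induced v E))"
    using Mul p by (intro tree_on_join) auto
  then show ?case using p by simp
qed

text \<open>
  The depth of a compatible tree is least when every product attaches the root of its right factor to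
  the root of its left factor, and positive weights make the shape of the monomial the only tree of
  this least depth.
\<close>

lemma compatible_depth:
  assumes "single_valued E"
  shows "distinct (variables u) \<Longrightarrow> compatible u E \<Longrightarrow> mdepth wt u \<le> tree_depth wt (vars u) (leftmost u) (induced u E)"
    and "distinct (variables u) \<Longrightarrow> compatible u E \<Longrightarrow> (\<And>x. x \<in> vars u \<Longrightarrow> 0 < wt x) \<Longrightarrow>
      tree_depth wt (vars u) (leftmost u) (induced u E) = mdepth wt u \<Longrightarrow> induced u E = shape u"
proof -
  have "mdepth wt u \<le> tree_depth wt (vars u) (leftmost u) (induced u E) \<and>
    ((\<forall>x\<in>vars u. 0 < wt x) \<longrightarrow> tree_depth wt (vars u) (leftmost u) (induced u E) = mdepth wt u \<longrightarrow> induced u E = shape u)"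
    if "distinct (variables u)" "compatible u E" for u
    using that
  proof (induction u)
    case (Var x)
    then show ?case by (auto simp: induced_def tree_depth_def)
  next
    case (Mul u v)
    obtain p where p: "p \<in> vars u" "induced (Mul u v) E = insert (leftmost v, p) (induced u E \<union> induced v E)"
      using compatible_split[OF assms Mul.prems(2)] .
    have dist: "distinct (variables u)" "distinct (variables v)" "vars u \<inter> vars v = {}"
      and comp: "compatible u E" "compatible v E" using Mul.prems by auto
    note trees = compatible_tree[OF assms dist(1) comp(1)] compatible_tree[OF assms dist(2) comp(2)]
    have depth: "tree_depth wt (vars (Mul u v)) (leftmost (Mul u v)) (induced (Mul u v) E) =
        tree_depth wt (vars u) (leftmost u) (induced u E) + tree_depth wt (vars v) (leftmost v) (induced v E)
        + mweight wt v * Suc (level (induced u E) (leftmost u) p)"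
      using tree_depth_join[OF trees dist(3) p(1), of wt] p(2) by (simp add: mweight_sum[OF dist(2)])
    note IH = Mul.IH(1)[OF dist(1) comp(1)] Mul.IH(2)[OF dist(2) comp(2)]
    have le: "mweight wt v \<le> mweight wt v * Suc (level (induced u E) (leftmost u) p)" by simp
    have "induced (Mul u v) E = shape (Mul u v)"
      if pos: "\<forall>x\<in>vars (Mul u v). 0 < wt x"
        and eq: "tree_depth wt (vars (Mul u v)) (leftmost (Mul u v)) (induced (Mul u v) E) = mdepth wt (Mul u v)"
    proof -
      have "tree_depth wt (vars u) (leftmost u) (induced u E) = mdepth wt u"
        "tree_depth wt (vars v) (leftmost v) (induced v E) = mdepth wt v"
        "mweight wt v * Suc (level (induced u E) (leftmost u) p) = mweight wt v"
        using eq IH le unfolding depth mdepth.simps by linarith+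
      moreover have "0 < mweight wt v"
      proof -
        have "wt (leftmost v) \<le> mweight wt v"
          unfolding mweight_sum[OF dist(2)] by (rule member_le_sum) auto
        moreover have "0 < wt (leftmost v)" using pos by simp
        ultimately show ?thesis by linarith
      qed
      ultimately show ?thesis
        using IH pos p level_eq_0_iff[OF trees(1) p(1)] by auto
    qed
    then show ?case using IH le unfolding depth by auto
  qed
  then show "distinct (variables u) \<Longrightarrow> compatible u E \<Longrightarrow> mdepth wt u \<le> tree_depth wt (vars u) (leftmost u) (induced u E)"
    "distinct (variables u) \<Longrightarrow> compatible u E \<Longrightarrow> (\<And>x. x \<in> vars u \<Longrightarrow> 0 < wt x) \<Longrightarrow>
      tree_depth wt (vars u) (leftmost u) (induced u E) = mdepth wt u \<Longrightarrow> induced u E = shape u"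
    by blast+
qed

lemma compatible_cong:
  "(\<And>x y. x \<in> vars u \<Longrightarrow> y \<in> vars u \<Longrightarrow> (x, y) \<in> E \<longleftrightarrow> (x, y) \<in> F) \<Longrightarrow> compatible u E \<longleftrightarrow> compatible u F"
proof (induction u)
  case (Mul u v)
  have "compatible u E \<longleftrightarrow> compatible u F" "compatible v E \<longleftrightarrow> compatible v F"
    by (intro Mul.IH Mul.prems; simp)+
  moreover have "(leftmost v, p) \<in> E \<longleftrightarrow> (leftmost v, p) \<in> F" if "p \<in> vars u" for p
    using Mul.prems[of "leftmost v" p] that by simp
  moreover have "(c, p) \<in> E \<longleftrightarrow> (c, p) \<in> F" if "c \<in> vars u \<and> p \<in> vars v \<or> c \<in> vars v \<and> p \<in> vars u" for c p
    using Mul.prems[of c p] that by auto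
  ultimately show ?case by simp
qed simp

lemma shape_sub: "shape u \<subseteq> vars u \<times> vars u"
  by (induction u) auto

lemma compatible_shape: "distinct (variables u) \<Longrightarrow> compatible u (shape u)"
proof (induction u)
  case (Mul u v)
  have disj: "vars u \<inter> vars v = {}" using Mul.prems by auto
  have lm: "leftmost u \<notin> vars v" "leftmost v \<notin> vars u"
    using disj leftmost_in_vars[of u] leftmost_in_vars[of v] by blast+
  have u: "compatible u (shape (Mul u v)) \<longleftrightarrow> compatible u (shape u)"
    using shape_sub[of v] disj lm by (intro compatible_cong) auto
  have v: "compatible v (shape (Mul u v)) \<longleftrightarrow> compatible v (shape v)"
    using shape_sub[of u] disj lm by (intro compatible_cong) auto
  show ?case
    unfolding compatible.simps u v
    using Mul disj shape_sub[of v] shape_sub[of u] leftmost_in_vars[of u] leftmost_in_vars[of v] by auto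
qed simp

lemma shape_tree:
  "distinct (variables u) \<Longrightarrow> tree_on (vars u) (leftmost u) (shape u)"
proof (induction u)
  case (Mul u v)
  then show ?case using tree_on_join[of "vars u" "leftmost u" "shape u" "vars v" "leftmost v" "shape v" "leftmost u"] by simp
qed (simp add: tree_on_def single_valued_def)

lemma tree_depth_shape: "distinct (variables u) \<Longrightarrow> tree_depth wt (vars u) (leftmost u) (shape u) = mdepth wt u"
proof (induction u)
  case (Mul u v)
  then show ?case
    using tree_depth_join[OF shape_tree[of u] shape_tree[of v], of "leftmost u" wt] by (simp add: mweight_sum)
qed (simp add: tree_depth_def)

section \<open>Relabelling and substitution in monomials\<close>

lemma variables_map [simp]: "variables (map_monomial g u) = map g (variables u)"
  by (induction u) auto

lemma leftmost_map [simp]: "leftmost (map_monomial g u) = g (leftmost u)"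
  by (induction u) auto

lemma mdepth_map: "mdepth wt (map_monomial g u) = mdepth (wt \<circ> g) u"
  by (induction u) (auto simp: mweight_def o_def)

lemma mweight_cong: "(\<And>x. x \<in> vars u \<Longrightarrow> wt x = wt' x) \<Longrightarrow> mweight wt u = mweight wt' u"
  unfolding mweight_def by (metis map_cong)

lemma mdepth_cong: "(\<And>x. x \<in> vars u \<Longrightarrow> wt x = wt' x) \<Longrightarrow> mdepth wt u = mdepth wt' u"
  by (induction u) (auto intro: mweight_cong)

lemma compatible_map:
  assumes "inj g"
  shows "compatible (map_monomial g u) (map_prod g g ` E) \<longleftrightarrow> compatible u E"
proof -
  have "(g x, g y) \<in> map_prod g g ` E \<longleftrightarrow> (x, y) \<in> E" for x y
    using injD[OF assms] by auto
  then show ?thesis by (induction u) (auto dest: injD[OF assms])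
qed

lemma vars_subst: "vars (subst_monomial u s) = (\<Union>x\<in>vars u. vars (s x))"
  by (induction u) auto

lemma leftmost_subst: "leftmost (subst_monomial u s) = leftmost (s (leftmost u))"
  by (induction u) auto

definition insertion :: "nat \<Rightarrow> nat \<Rightarrow> nat monomial \<Rightarrow> nat \<Rightarrow> nat monomial" where
  "insertion i m w j = (if j = i then map_monomial ((+) i) w else Var (shift i m j))"

lemma monomialsD:
  "u \<in> monomials n \<Longrightarrow> distinct (variables u)" "u \<in> monomials n \<Longrightarrow> vars u = {..<n}"
  by (simp_all add: monomials_def)

lemma vars_insertion:
  assumes w: "w \<in> monomials m" and m: "0 < m"
  shows "v \<in> vars (subst_monomial u (insertion i m w)) \<longleftrightarrow> collapse i m v \<in> vars u"
proof (cases "in_block i m v")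
  case True
  then obtain q where q: "q < m" "v = i + q" by (rule in_block_cases)
  have "v \<in> vars (insertion i m w x) \<longleftrightarrow> x = i" for x
  proof (cases "x = i")
    case x: True
    have "q \<in> {..<m}" using q by simp
    then have "v \<in> (+) i ` {..<m}" unfolding q(2) by (rule imageI)
    then show ?thesis using x monomialsD(2)[OF w] by (simp add: insertion_def)
  next
    case False
    then have "v \<noteq> shift i m x" using True shift_outside_block[OF False m] by metis
    then show ?thesis using False by (simp add: insertion_def)
  qed
  then show ?thesis using q by (auto simp: vars_subst)
next
  case False
  have "v \<in> vars (insertion i m w x) \<longleftrightarrow> x = collapse i m v" for x
  proof (cases "x = i")
    case True
    have "v \<notin> (+) i ` {..<m}" using False by auto
    moreover have "collapse i m v \<noteq> i" using False collapse_eq_iff[OF m] by blast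
    ultimately show ?thesis using True monomialsD(2)[OF w] by (simp add: insertion_def)
  next
    case ne: False
    have "v = shift i m x \<longleftrightarrow> x = collapse i m v"
      using shift_collapse[OF False m] collapse_shift[OF ne m] by metis
    then show ?thesis using ne by (simp add: insertion_def)
  qed
  then show ?thesis by (auto simp: vars_subst)
qed

lemma leftmost_insertion:
  "leftmost (subst_monomial u (insertion i m w)) =
    (if leftmost u = i then i + leftmost w else shift i m (leftmost u))"
  by (simp add: leftmost_subst insertion_def)

text \<open>
  Compatibility with a substitution is tested on the collapsed tree and on the block: only the edge
  leaving the block needs an argument, and it starts at the root of the block.
\<close>

lemma compatible_insertion:
  assumes w: "w \<in> monomials m" and m: "0 < m" and sv: "single_valued E"
  shows "distinct (variables u) \<Longrightarrow> compatible (subst_monomial u (insertion i m w)) E \<longleftrightarrow>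
    compatible u (collapse_edges i m E) \<and> (i \<in> vars u \<longrightarrow> compatible w (block_edges i m E))"
proof (induction u)
  case (Var x)
  have no_loop: "(i, i) \<notin> collapse_edges i m E"
  proof
    assume "(i, i) \<in> collapse_edges i m E"
    then obtain c p where "\<not> within_block i m c p" "i = collapse i m c" "i = collapse i m p"
      by (auto elim!: collapse_edgesE)
    then show False unfolding within_block_def using collapse_eq_iff[OF m] by metis
  qed
  show ?case
  proof (cases "x = i")
    case True
    have block: "(i + q, i + q') \<in> E \<longleftrightarrow> (i + q, i + q') \<in> map_prod ((+) i) ((+) i) ` block_edges i m E"
      if "q < m" "q' < m" for q q'
    proof -
      have "(i + q, i + q') \<in> E \<longleftrightarrow> (q, q') \<in> block_edges i m E" using that by (simp add: block_edges_def)
      also have "\<dots> \<longleftrightarrow> map_prod ((+) i) ((+) i) (q, q') \<in> map_prod ((+) i) ((+) i) ` block_edges i m E"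
        by (subst inj_image_mem_iff) (auto intro: prod.inj_map)
      finally show ?thesis by simp
    qed
    have "x \<in> vars (map_monomial ((+) i) w) \<Longrightarrow> \<exists>q<m. x = i + q" for x
      using monomialsD(2)[OF w] by auto
    then have "compatible (map_monomial ((+) i) w) E \<longleftrightarrow>
        compatible (map_monomial ((+) i) w) (map_prod ((+) i) ((+) i) ` block_edges i m E)"
      using block by (intro compatible_cong) metis
    also have "\<dots> \<longleftrightarrow> compatible w (block_edges i m E)" by (rule compatible_map) simp
    finally show ?thesis using True no_loop by (simp add: insertion_def)
  next
    case False
    have "(shift i m x, shift i m x) \<in> E \<longleftrightarrow> (x, x) \<in> collapse_edges i m E"
    proof
      assume "(shift i m x, shift i m x) \<in> E"
      moreover have "\<not> within_block i m (shift i m x) (shift i m x)"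
        unfolding within_block_def using shift_outside_block[OF False m] by blast
      ultimately show "(x, x) \<in> collapse_edges i m E"
        using collapse_edgesI[of "shift i m x" "shift i m x" E i m] collapse_shift[OF False m] by simp
    next
      assume "(x, x) \<in> collapse_edges i m E"
      then obtain c p where cp: "(c, p) \<in> E" "x = collapse i m c" "x = collapse i m p"
        by (auto elim!: collapse_edgesE)
      then have "c = shift i m x" "p = shift i m x"
        using shift_collapse[OF _ m] False collapse_eq_iff[OF m] by metis+
      then show "(shift i m x, shift i m x) \<in> E" using cp by simp
    qed
    then show ?thesis using False by (simp add: insertion_def)
  qed
next
  case (Mul u v)
  let ?s = "insertion i m w" and ?C = "collapse_edges i m E"
  define u' where "u' = subst_monomial u ?s"
  define v' where "v' = subst_monomial v ?s"
  have disj: "vars u \<inter> vars v = {}" and dist: "distinct (variables u)" "distinct (variables v)" using Mul.prems by auto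
  have mem: "x \<in> vars u' \<longleftrightarrow> collapse i m x \<in> vars u" "x \<in> vars v' \<longleftrightarrow> collapse i m x \<in> vars v" for x
    unfolding u'_def v'_def by (rule vars_insertion[OF w m])+
  have toC: "(collapse i m c, collapse i m p) \<in> ?C"
    if "(c, p) \<in> E" "c \<in> vars u' \<and> p \<in> vars v' \<or> c \<in> vars v' \<and> p \<in> vars u'" for c p
  proof (rule collapse_edgesI[OF that(1)])
    have "collapse i m c \<noteq> collapse i m p" using that(2) disj by (auto simp: mem)
    then show "\<not> within_block i m c p" unfolding within_block_def collapse_def by auto
  qed
  have A: "(\<forall>c\<in>vars u'. \<forall>p\<in>vars v'. (c, p) \<notin> E) \<longleftrightarrow> (\<forall>c\<in>vars u. \<forall>p\<in>vars v. (c, p) \<notin> ?C)"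
    using toC mem by (fastforce elim!: collapse_edgesE)
  have lm: "collapse i m (leftmost v') = leftmost v"
    using m monomialsD(2)[OF w] leftmost_in_vars[of w] by (auto simp: v'_def leftmost_insertion)
  have B: "(\<forall>c\<in>vars v'. \<forall>p\<in>vars u'. (c, p) \<in> E \<longrightarrow> c = leftmost v') \<longleftrightarrow>
      (\<forall>c\<in>vars v. \<forall>p\<in>vars u. (c, p) \<in> ?C \<longrightarrow> c = leftmost v)"
    if blk: "i \<in> vars v \<Longrightarrow> compatible w (block_edges i m E)"
  proof
    assume "\<forall>c\<in>vars v'. \<forall>p\<in>vars u'. (c, p) \<in> E \<longrightarrow> c = leftmost v'"
    then show "\<forall>c\<in>vars v. \<forall>p\<in>vars u. (c, p) \<in> ?C \<longrightarrow> c = leftmost v"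
      using mem lm by (fastforce elim!: collapse_edgesE)
  next
    assume *: "\<forall>c\<in>vars v. \<forall>p\<in>vars u. (c, p) \<in> ?C \<longrightarrow> c = leftmost v"
    show "\<forall>c\<in>vars v'. \<forall>p\<in>vars u'. (c, p) \<in> E \<longrightarrow> c = leftmost v'"
    proof (intro ballI impI)
      fix c p assume c: "c \<in> vars v'" and p: "p \<in> vars u'" and e: "(c, p) \<in> E"
      have cc: "collapse i m c = leftmost v" using * toC[OF e] c p mem by blast
      show "c = leftmost v'"
      proof (cases "leftmost v = i")
        case True
        have iv: "i \<in> vars v" using True leftmost_in_vars[of v] by simp
        have "tree_on {..<m} (leftmost w) (block_edges i m E)"
          using compatible_tree[OF tree_restrict_block[OF sv] monomialsD(1)[OF w] blk[OF iv]]
            block_edges_sub[of i m E] monomialsD(2)[OF w] by (simp add: induced_def Int_absorb2)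
        moreover have "in_block i m c" using cc True collapse_eq_iff[OF m] by blast
        moreover have "\<not> in_block i m p"
        proof
          assume "in_block i m p"
          then have "collapse i m p = i" using collapse_eq_iff[OF m] by blast
          then show False using p mem iv disj by auto
        qed
        ultimately have "c = i + leftmost w" using block_exit[OF sv _ e] by blast
        then show ?thesis using True by (simp add: v'_def leftmost_insertion)
      next
        case False
        then have "\<not> in_block i m c" using cc collapse_eq_iff[OF m] by metis
        then have "c = shift i m (leftmost v)" using shift_collapse[OF _ m] cc by metis
        then show ?thesis using False by (simp add: v'_def leftmost_insertion)
      qed
    qed
  qed
  have C: "(\<exists>p\<in>vars u'. (leftmost v', p) \<in> E) \<longleftrightarrow> (\<exists>p\<in>vars u. (leftmost v, p) \<in> ?C)"
    if B: "\<forall>c\<in>vars v'. \<forall>p\<in>vars u'. (c, p) \<in> E \<longrightarrow> c = leftmost v'"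
  proof
    assume "\<exists>p\<in>vars u'. (leftmost v', p) \<in> E"
    then obtain p where p: "p \<in> vars u'" "(leftmost v', p) \<in> E" by blast
    then have "(leftmost v, collapse i m p) \<in> ?C" using toC[OF p(2)] lm by auto
    then show "\<exists>p\<in>vars u. (leftmost v, p) \<in> ?C" using p mem by blast
  next
    assume "\<exists>p\<in>vars u. (leftmost v, p) \<in> ?C"
    then obtain c p where cp: "(c, p) \<in> E" "leftmost v = collapse i m c" "collapse i m p \<in> vars u"
      by (auto elim!: collapse_edgesE)
    then have "c \<in> vars v'" "p \<in> vars u'" using mem leftmost_in_vars[of v] by metis+
    then show "\<exists>p\<in>vars u'. (leftmost v', p) \<in> E" using cp(1) B by metis
  qed
  show ?case
    using Mul.IH(1)[OF dist(1)] Mul.IH(2)[OF dist(2)] A B C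
    by (simp flip: u'_def v'_def) blast
qed

section \<open>The morphism from the free operad to the operad of trees\<close>

definition compatible_trees :: "nat \<Rightarrow> nat monomial \<Rightarrow> rtree set" where
  "compatible_trees n u = {X \<in> rooted_trees n. compatible u (edges X)}"

definition shape_rtree :: "nat monomial \<Rightarrow> rtree" where
  "shape_rtree u = RTree (leftmost u) (shape u)"

text \<open>
  The value of a monomial in the operad of trees, when the product of two variables is the tree with
  root the first and child the second.
\<close>

definition expansion :: "'k::field \<Rightarrow> nat list \<Rightarrow> nat monomial \<Rightarrow> (rtree \<Rightarrow>\<^sub>0 'k)" where
  "expansion lam a u = (\<Sum>X\<in>compatible_trees (length a) u. sgl X (lam ^ (weighted_depth a X - mdepth ((!) a) u)))"

lemma finite_compatible_trees [simp]: "finite (compatible_trees n u)"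
  by (rule finite_subset[OF _ finite_rooted_trees]) (auto simp: compatible_trees_def)

lemma compatible_trees_induced:
  assumes "u \<in> monomials n" "X \<in> compatible_trees n u"
  shows "induced u (edges X) = edges X" "root X = leftmost u"
proof -
  have X: "tree_on {..<n} (root X) (edges X)" and c: "compatible u (edges X)"
    using assms(2) by (auto simp: compatible_trees_def rooted_trees_iff)
  then have sv: "single_valued (edges X)" and sub: "edges X \<subseteq> {..<n} \<times> {..<n}" by (auto simp: tree_on_def)
  show eq: "induced u (edges X) = edges X"
    using sub monomialsD(2)[OF assms(1)] by (auto simp: induced_def)
  have "tree_on {..<n} (leftmost u) (edges X)"
    using compatible_tree[OF sv monomialsD(1)[OF assms(1)] c] monomialsD(2)[OF assms(1)] eq by simp
  then show "root X = leftmost u" using tree_on_unique_root[OF X] by blast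
qed

lemma mdepth_le_weighted_depth:
  assumes "u \<in> monomials n" "X \<in> compatible_trees n u" "length a = n"
  shows "mdepth ((!) a) u \<le> weighted_depth a X"
proof -
  have "single_valued (edges X)" "compatible u (edges X)"
    using assms(2) by (auto simp: compatible_trees_def rooted_trees_def)
  then show ?thesis
    using compatible_depth(1)[of "edges X" u "(!) a"] monomialsD[OF assms(1)] compatible_trees_induced[OF assms(1,2)] assms(3)
    by (simp add: weighted_depth_eq)
qed

lemma weighted_depth_eq_mdepth:
  assumes "u \<in> monomials n" "X \<in> compatible_trees n u" "a \<in> degrees n" "weighted_depth a X = mdepth ((!) a) u"
  shows "X = shape_rtree u"
proof -
  have "single_valued (edges X)" "compatible u (edges X)"
    using assms(2) by (auto simp: compatible_trees_def rooted_trees_def)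
  moreover have "0 < a ! x" if "x \<in> vars u" for x
    using that assms(3) monomialsD(2)[OF assms(1)] by (simp add: degrees_def)
  moreover have "length a = n" using assms(3) by (simp add: degrees_def)
  ultimately have "edges X = shape u"
    using compatible_depth(2)[of "edges X" u "(!) a"] monomialsD[OF assms(1)] compatible_trees_induced[OF assms(1,2)] assms(4)
    by (simp add: weighted_depth_eq)
  then show ?thesis using compatible_trees_induced(2)[OF assms(1,2)] by (cases X) (simp add: shape_rtree_def)
qed

lemma shape_rtree_compatible:
  assumes "u \<in> monomials n"
  shows "shape_rtree u \<in> compatible_trees n u" "length a = n \<Longrightarrow> weighted_depth a (shape_rtree u) = mdepth ((!) a) u"
  using shape_tree[of u] compatible_shape[of u] tree_depth_shape[of u "(!) a"] monomialsD[OF assms]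
  by (simp_all add: compatible_trees_def shape_rtree_def rooted_trees_iff weighted_depth_eq)

lemma coef_expansion:
  "coef (expansion lam a u) X = (if X \<in> compatible_trees (length a) u then lam ^ (weighted_depth a X - mdepth ((!) a) u) else 0)"
  unfolding expansion_def by (simp add: coef_sum_terms)

lemma supp_expansion: "supp (expansion lam a u) \<subseteq> compatible_trees (length a) u"
  unfolding expansion_def by (rule supp_sum_terms)

lemma supp_expansion_trees: "length a = n \<Longrightarrow> supp (expansion lam a u) \<subseteq> rooted_trees n"
  using supp_expansion[of lam a u] by (auto simp: compatible_trees_def)

lemma map_in_monomials: "\<lbrakk>u \<in> monomials n; \<sigma> permutes {..<n}\<rbrakk> \<Longrightarrow> map_monomial \<sigma> u \<in> monomials n"
  by (simp add: monomials_def distinct_map permutes_inj_on permutes_image)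

lemma insertion_in_monomials:
  assumes u: "u \<in> monomials n" and w: "w \<in> monomials m" and i: "i < n" and m: "0 < m"
  shows "subst_monomial u (insertion i m w) \<in> monomials (n + m - 1)"
proof -
  have dist: "distinct (variables (subst_monomial v (insertion i m w)))" if "distinct (variables v)" for v
    using that
  proof (induction v)
    case (Var x)
    show ?case using monomialsD(1)[OF w] by (simp add: insertion_def distinct_map)
  next
    case (Mul v1 v2)
    have "vars (subst_monomial v1 (insertion i m w)) \<inter> vars (subst_monomial v2 (insertion i m w)) = {}"
      using Mul.prems vars_insertion[OF w m] by auto
    then show ?case using Mul by simp
  qed
  have "v < n + m - 1 \<longleftrightarrow> collapse i m v < n" for v
  proof
    assume c: "collapse i m v < n"
    show "v < n + m - 1"
    proof (cases "in_block i m v")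
      case True
      then show ?thesis using i by linarith
    next
      case False
      have "collapse i m v \<noteq> i" using False collapse_eq_iff[OF m] by blast
      then show ?thesis using shift_less[OF c i _ m] shift_collapse[OF False m] by simp
    qed
  qed (rule collapse_less[OF _ i m])
  then have "vars (subst_monomial u (insertion i m w)) = {..<n + m - 1}"
    using vars_insertion[OF w m] monomialsD(2)[OF u] by blast
  then show ?thesis using dist[OF monomialsD(1)[OF u]] by (simp add: monomials_def)
qed

lemma monomial_comp_eq:
  "monomial_comp a b i u w =
    (if sum_list b = a ! i then sgl (subst_monomial u (insertion i (length b) w)) 1 else 0)"
  unfolding monomial_comp_def insertion_def ..

text \<open>
  The degrees of the inserted monomial add up to the degree of the variable it replaces, so the weights
  of the factors of the outer monomial do not change.
\<close>

lemma mdepth_insertion: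
  assumes w: "w \<in> monomials m" and "length a = n" "length b = m" "i < n" "0 < m" "sum_list b = a ! i"
  shows "vars u \<subseteq> {..<n} \<Longrightarrow> mweight ((!) (subst_degrees a i b)) (subst_monomial u (insertion i m w)) = mweight ((!) a) u"
    and "vars u \<subseteq> {..<n} \<Longrightarrow> distinct (variables u) \<Longrightarrow>
      mdepth ((!) (subst_degrees a i b)) (subst_monomial u (insertion i m w)) =
      mdepth ((!) a) u + (if i \<in> vars u then mdepth ((!) b) w else 0)"
proof -
  let ?c = "subst_degrees a i b"
  have block: "(!) ?c \<circ> (+) i = (\<lambda>q. ?c ! (i + q))" by auto
  have cq: "?c ! (i + q) = b ! q" if "q \<in> vars w" for q
    using that subst_degrees_nth_block[of i a q b] assms monomialsD(2)[OF w] by simp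
  have "mweight (\<lambda>q. ?c ! (i + q)) w = mweight ((!) b) w" using cq by (rule mweight_cong)
  also have "\<dots> = sum_list b"
    using assms monomialsD[OF w] by (simp add: mweight_sum sum_list_sum_nth atLeast0LessThan)
  finally have ww: "mweight ((!) ?c) (map_monomial ((+) i) w) = a ! i"
    using assms(6) by (simp add: mweight_def o_def)
  have wd: "mdepth ((!) ?c) (map_monomial ((+) i) w) = mdepth ((!) b) w"
    unfolding mdepth_map block using cq by (rule mdepth_cong)
  have outer: "?c ! shift i m j = a ! j" if "j < n" "j \<noteq> i" for j
    using that subst_degrees_nth_shift[of i a j b] assms by simp
  show weight: "vars u \<subseteq> {..<n} \<Longrightarrow> mweight ((!) ?c) (subst_monomial u (insertion i m w)) = mweight ((!) a) u" for u
    by (induction u) (auto simp: insertion_def ww outer)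
  show "vars u \<subseteq> {..<n} \<Longrightarrow> distinct (variables u) \<Longrightarrow>
      mdepth ((!) ?c) (subst_monomial u (insertion i m w)) =
      mdepth ((!) a) u + (if i \<in> vars u then mdepth ((!) b) w else 0)"
  proof (induction u)
    case (Mul u v)
    have "i \<notin> vars u \<or> i \<notin> vars v" using Mul.prems(2) by auto
    then show ?case using Mul weight[of v] by auto
  next
    case (Var x)
    then show ?case using wd by (cases "x = i") (simp_all add: insertion_def)
  qed
qed

lemma compatible_trees_insertion:
  assumes u: "u \<in> monomials n" and w: "w \<in> monomials m" and i: "i < n" and m: "0 < m"
  shows "compatible_trees (n + m - 1) (subst_monomial u (insertion i m w)) =
    (\<Union>S\<in>compatible_trees n u. \<Union>T\<in>compatible_trees m w. graftings n m i S T)"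
proof -
  have iff: "compatible (subst_monomial u (insertion i m w)) (edges X) \<longleftrightarrow>
      compatible u (collapse_edges i m (edges X)) \<and> compatible w (block_edges i m (edges X))"
    if "X \<in> rooted_trees (n + m - 1)" for X
    using compatible_insertion[OF w m _ monomialsD(1)[OF u], of "edges X" i] that i monomialsD(2)[OF u]
    by (simp add: rooted_trees_def)
  show ?thesis
  proof (intro equalityI subsetI)
    fix X assume "X \<in> compatible_trees (n + m - 1) (subst_monomial u (insertion i m w))"
    then have X: "X \<in> rooted_trees (n + m - 1)" and cu: "compatible u (collapse_edges i m (edges X))"
      and cw: "compatible w (block_edges i m (edges X))"
      using iff by (auto simp: compatible_trees_def)
    define T where "T = RTree (leftmost w) (block_edges i m (edges X))"
    define S where "S = RTree (collapse i m (root X)) (collapse_edges i m (edges X))"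
    have sv: "single_valued (block_edges i m (edges X))"
      using X by (intro tree_restrict_block) (simp add: rooted_trees_def)
    have T: "tree_on {..<m} (leftmost w) (block_edges i m (edges X))"
      using compatible_tree[OF sv monomialsD(1)[OF w] cw] monomialsD(2)[OF w] block_edges_sub[of i m "edges X"]
      by (simp add: induced_def Int_absorb2)
    then have "S \<in> rooted_trees n" unfolding S_def by (rule collapsed_tree[OF X _ i])
    then have "S \<in> compatible_trees n u" "T \<in> compatible_trees m w" "X \<in> graftings n m i S T"
      using X T cu cw by (simp_all add: S_def T_def compatible_trees_def graftings_def RTree_in_rooted_trees)
    then show "X \<in> (\<Union>S\<in>compatible_trees n u. \<Union>T\<in>compatible_trees m w. graftings n m i S T)" by blast
  next
    fix X assume "X \<in> (\<Union>S\<in>compatible_trees n u. \<Union>T\<in>compatible_trees m w. graftings n m i S T)"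
    then show "X \<in> compatible_trees (n + m - 1) (subst_monomial u (insertion i m w))"
      using iff by (auto simp: compatible_trees_def graftings_def)
  qed
qed

text \<open>
  Both sides of the equation weigh a tree by the power of \<open>lam\<close> given by its depth minus the depths of
  the monomials, so the equation is the one between the sets of compatible trees.
\<close>

lemma expansion_comp:
  assumes n: "0 < n" and m: "0 < m" and i: "i < n" and a: "a \<in> degrees n" and b: "b \<in> degrees m"
    and u: "u \<in> monomials n" and w: "w \<in> monomials m"
  shows "lin_ext (expansion lam (subst_degrees a i b)) (monomial_comp a b i u w) =
    bilin_ext (tree_comp lam a b i) (expansion lam a u) (expansion lam b w)"
proof (cases "sum_list b = a ! i")
  case False
  have "tree_comp lam a b i S T = 0" for S T using False by (simp add: tree_comp_def Let_def)
  then have "bilin_ext (tree_comp lam a b i) (expansion lam a u) (expansion lam b w) = 0"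
    by (rule bilin_ext_zero_fun)
  then show ?thesis using False by (simp add: monomial_comp_eq)
next
  case True
  let ?c = "subst_degrees a i b"
  have len: "length a = n" "length b = m" "length ?c = n + m - 1"
    using a b i by (auto simp: degrees_def length_subst_degrees)
  have ctS: "S \<in> rooted_trees n" if "S \<in> compatible_trees n u" for S using that by (simp add: compatible_trees_def)
  have ctT: "T \<in> rooted_trees m" if "T \<in> compatible_trees m w" for T using that by (simp add: compatible_trees_def)
  have fin: "finite (graftings n m i S T)" for S T
    by (rule finite_subset[OF _ finite_rooted_trees]) (auto simp: graftings_def)
  have inner: "lin_ext (tree_comp lam a b i S) (expansion lam b w) =
      (\<Sum>X\<in>(\<Union>T\<in>compatible_trees m w. graftings n m i S T).
        sgl X (lam ^ (weighted_depth ?c X - (weighted_depth a S + mdepth ((!) b) w))))"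
    if S: "S \<in> compatible_trees n u" for S
  proof -
    have "lin_ext (tree_comp lam a b i S) (expansion lam b w) =
        lin_ext (\<lambda>T. \<Sum>X\<in>graftings n m i S T. sgl X (lam ^ (weighted_depth ?c X - (weighted_depth b T + weighted_depth a S))))
          (\<Sum>T\<in>compatible_trees m w. sgl T (lam ^ (weighted_depth b T - mdepth ((!) b) w)))"
      unfolding expansion_def len
      using True tree_comp_eq[OF m i a b ctS[OF S] ctT]
      by (intro lin_ext_cong) (auto simp: add.commute dest!: subsetD[OF supp_sum_terms])
    also have "\<dots> = (\<Sum>X\<in>(\<Union>T\<in>compatible_trees m w. graftings n m i S T).
        sgl X (lam ^ (weighted_depth ?c X - (mdepth ((!) b) w + weighted_depth a S))))"
    proof (rule lin_ext_telescope)
      show "T = T'" if "T \<in> compatible_trees m w" "T' \<in> compatible_trees m w"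
        "X \<in> graftings n m i S T" "X \<in> graftings n m i S T'" for T T' X
        using graftings_unique[OF ctS[OF S] ctT[OF that(1)] ctS[OF S] ctT[OF that(2)] that(3,4)] by blast
      show "mdepth ((!) b) w \<le> weighted_depth b T" if "T \<in> compatible_trees m w" for T
        using mdepth_le_weighted_depth[OF w that len(2)] .
      show "weighted_depth b T + weighted_depth a S \<le> weighted_depth ?c X"
        if "T \<in> compatible_trees m w" "X \<in> graftings n m i S T" for T X
        using weighted_depth_graftings_ge[OF ctS[OF S] ctT[OF that(1)] that(2) m i len(1,2) True] by simp
    qed (simp_all add: fin)
    finally show ?thesis by (simp add: add.commute)
  qed
  have "bilin_ext (tree_comp lam a b i) (expansion lam a u) (expansion lam b w) =
      lin_ext (\<lambda>S. \<Sum>X\<in>(\<Union>T\<in>compatible_trees m w. graftings n m i S T).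
          sgl X (lam ^ (weighted_depth ?c X - (weighted_depth a S + mdepth ((!) b) w))))
        (\<Sum>S\<in>compatible_trees n u. sgl S (lam ^ (weighted_depth a S - mdepth ((!) a) u)))"
    unfolding bilin_ext_def expansion_def[of lam a u] len
    using inner by (intro lin_ext_cong) (auto dest!: subsetD[OF supp_sum_terms])
  also have "\<dots> = (\<Sum>X\<in>(\<Union>S\<in>compatible_trees n u. \<Union>T\<in>compatible_trees m w. graftings n m i S T).
        sgl X (lam ^ (weighted_depth ?c X - (mdepth ((!) a) u + mdepth ((!) b) w))))"
  proof (rule lin_ext_telescope)
    show "S = S'" if S: "S \<in> compatible_trees n u" "S' \<in> compatible_trees n u"
      and X: "X \<in> (\<Union>T\<in>compatible_trees m w. graftings n m i S T)" "X \<in> (\<Union>T\<in>compatible_trees m w. graftings n m i S' T)" for S S' X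
    proof -
      obtain T T' where T: "T \<in> compatible_trees m w" "T' \<in> compatible_trees m w"
        "X \<in> graftings n m i S T" "X \<in> graftings n m i S' T'" using X by blast
      then show ?thesis using graftings_unique[OF ctS[OF S(1)] ctT[OF T(1)] ctS[OF S(2)] ctT[OF T(2)]] by blast
    qed
    show "mdepth ((!) a) u \<le> weighted_depth a S" if "S \<in> compatible_trees n u" for S
      using mdepth_le_weighted_depth[OF u that len(1)] .
    show "weighted_depth a S + mdepth ((!) b) w \<le> weighted_depth ?c X"
      if S: "S \<in> compatible_trees n u" and X: "X \<in> (\<Union>T\<in>compatible_trees m w. graftings n m i S T)" for S X
    proof -
      obtain T where T: "T \<in> compatible_trees m w" "X \<in> graftings n m i S T" using X by blast
      show ?thesis
        using weighted_depth_graftings_ge[OF ctS[OF S] ctT[OF T(1)] T(2) m i len(1,2) True]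
          mdepth_le_weighted_depth[OF w T(1) len(2)] by linarith
    qed
  qed (simp_all add: fin)
  also have "\<dots> = expansion lam ?c (subst_monomial u (insertion i m w))"
    using mdepth_insertion(2)[OF w len(1,2) i m True, of u] monomialsD[OF u] i
    by (simp add: expansion_def len compatible_trees_insertion[OF u w i m])
  also have "\<dots> = lin_ext (expansion lam ?c) (monomial_comp a b i u w)"
    using True by (simp add: monomial_comp_eq len)
  finally show ?thesis by simp
qed

lemma expansion_act:
  assumes a: "a \<in> degrees n" and u: "u \<in> monomials n" and \<sigma>: "\<sigma> permutes {..<n}"
  shows "lin_ext (\<lambda>X. sgl (relabel_tree (inv \<sigma>) X) 1) (expansion lam a u) =
    expansion lam (permute_list \<sigma> a) (map_monomial (inv \<sigma>) u)"
proof -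
  have len: "length a = n" using a by (simp add: degrees_def)
  note inv = permutes_inv[OF \<sigma>]
  have ct: "compatible_trees n (map_monomial (inv \<sigma>) u) = relabel_tree (inv \<sigma>) ` compatible_trees n u"
  proof (intro equalityI subsetI)
    fix X assume X: "X \<in> compatible_trees n (map_monomial (inv \<sigma>) u)"
    have "compatible (map_monomial (inv \<sigma>) u) (map_prod (inv \<sigma>) (inv \<sigma>) ` edges (relabel_tree \<sigma> X))"
      using X relabel_inv(1)[OF \<sigma>, of X] unfolding edges_relabel[symmetric] by (simp add: compatible_trees_def)
    then have "compatible u (edges (relabel_tree \<sigma> X))"
      using compatible_map[OF permutes_inj[OF inv]] by blast
    then have "relabel_tree \<sigma> X \<in> compatible_trees n u"
      using X relabel_in_rooted_trees[OF _ \<sigma>] by (simp add: compatible_trees_def)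
    then show "X \<in> relabel_tree (inv \<sigma>) ` compatible_trees n u"
      using relabel_inv(1)[OF \<sigma>, of X] by (metis imageI)
  next
    fix X assume "X \<in> relabel_tree (inv \<sigma>) ` compatible_trees n u"
    then show "X \<in> compatible_trees n (map_monomial (inv \<sigma>) u)"
      using relabel_in_rooted_trees[OF _ inv] compatible_map[OF permutes_inj[OF inv]]
      by (auto simp: compatible_trees_def)
  qed
  have inj: "inj_on (relabel_tree (inv \<sigma>)) A" for A
    by (rule inj_on_inverseI[where g = "relabel_tree \<sigma>"]) (simp add: relabel_inv[OF \<sigma>])
  have "mdepth ((!) (permute_list \<sigma> a)) (map_monomial (inv \<sigma>) u) = mdepth ((!) a) u"
    unfolding mdepth_map
  proof (rule mdepth_cong)
    fix x assume "x \<in> vars u"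
    then have "inv \<sigma> x < n" using monomialsD(2)[OF u] permutes_less_iff[OF inv] by simp
    then show "((!) (permute_list \<sigma> a) \<circ> inv \<sigma>) x = a ! x"
      using \<sigma> len by (simp add: permute_list_nth permutes_inverses)
  qed
  moreover have "weighted_depth (permute_list \<sigma> a) (relabel_tree (inv \<sigma>) X) = weighted_depth a X"
    if "X \<in> compatible_trees n u" for X
    using weighted_depth_relabel[OF len _ \<sigma>] that by (simp add: compatible_trees_def)
  ultimately show ?thesis
    by (simp add: expansion_def len ct sum.reindex[OF inj] lin_ext_sum)
qed

lemma expansion_Var: "expansion lam [k] (Var 0) = sgl (RTree 0 {}) 1"
proof -
  have one: "X = RTree 0 {}" if "X \<in> rooted_trees 1" for X
    using that by (cases X) (auto simp: rooted_trees_def One_nat_def)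
  have "compatible_trees 1 (Var 0) = {RTree 0 {}}"
  proof (intro equalityI subsetI)
    fix X assume "X \<in> compatible_trees 1 (Var 0)"
    then show "X \<in> {RTree 0 {}}" using one[of X] by (simp add: compatible_trees_def)
  next
    fix X assume "X \<in> {RTree 0 {}}"
    then show "X \<in> compatible_trees 1 (Var 0)" using single_vertex_tree by (simp add: compatible_trees_def)
  qed
  then show ?thesis by (simp add: expansion_def weighted_depth_def height_eq_level One_nat_def)
qed

lemma free_closed_basis: "closed_basis monomials (\<lambda>u \<sigma>. map_monomial (inv \<sigma>) u) monomial_comp (Var 0)"
proof
  show "map_monomial (inv \<sigma>) u \<in> monomials n" if "u \<in> monomials n" "\<sigma> permutes {..<n}" for u n and \<sigma> :: "nat \<Rightarrow> nat"
    using map_in_monomials[OF that(1) permutes_inv[OF that(2)]] .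
  show "Var 0 \<in> monomials 1" by (auto simp: monomials_def)
  show "supp (monomial_comp a b i u w) \<subseteq> monomials (n + m - 1)"
    if "0 < m" "i < n" "a \<in> degrees n" "b \<in> degrees m" "u \<in> monomials n" "w \<in> monomials m" for m i n a b u w
    using insertion_in_monomials[OF that(5,6,2,1)] that(4) by (simp add: monomial_comp_eq degrees_def)
qed

interpretation free: closed_basis monomials "\<lambda>u \<sigma>. map_monomial (inv \<sigma>) u" monomial_comp "Var 0"
  rewrites "basis_operad monomials (\<lambda>u \<sigma>. map_monomial (inv \<sigma>) u) monomial_comp (Var 0) = free_operad"
  using free_closed_basis by (simp_all add: free_operad_def)

interpretation trees: twisted_operad rooted_trees "\<lambda>T \<sigma>. relabel_tree (inv \<sigma>) T" "tree_comp lam" "RTree 0 {}"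
    graftings weighted_depth lam
  rewrites "basis_operad rooted_trees (\<lambda>T \<sigma>. relabel_tree (inv \<sigma>) T) (tree_comp lam) (RTree 0 {}) = tree_operad lam"
  for lam
  using tree_operad_twisted by (simp_all add: tree_operad_def)

text \<open>
  The elements of arity \<open>n\<close> are families indexed by multidegrees, on which maps act componentwise.
\<close>

definition family_map :: "(nat list \<Rightarrow> 'v \<Rightarrow> 'w) \<Rightarrow> nat \<Rightarrow> (nat list \<Rightarrow> 'v) \<Rightarrow> (nat list \<Rightarrow> 'w)" where
  "family_map f n x = (\<lambda>a\<in>degrees n. f a (x a))"

abbreviation Phi :: "'k::field \<Rightarrow> nat list \<Rightarrow> (nat monomial \<Rightarrow>\<^sub>0 'k) \<Rightarrow> (rtree \<Rightarrow>\<^sub>0 'k)" where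
  "Phi lam a \<equiv> lin_ext (expansion lam a)"

lemma supp_Phi: "length a = n \<Longrightarrow> supp (Phi lam a p) \<subseteq> rooted_trees n"
  by (intro supp_lin_ext_subset supp_expansion_trees)

lemma family_Phi_act:
  assumes "0 < n" "x \<in> ops free_operad n" "\<sigma> permutes {..<n}"
  shows "family_map (Phi lam) n (act free_operad n x \<sigma>) = act (tree_operad lam) n (family_map (Phi lam) n x) \<sigma>"
  unfolding family_map_def trees.act_P
proof (rule restrict_ext)
  fix c assume c: "c \<in> degrees n"
  define a where "a = permute_list (inv \<sigma>) c"
  have a: "a \<in> degrees n" unfolding a_def by (rule permute_list_in_degrees[OF permutes_inv[OF assms(3)] c])
  have ca: "permute_list \<sigma> a = c" using c permute_list_inv[OF assms(3), of c] by (simp add: a_def degrees_def)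
  have "Phi lam c (act free_operad n x \<sigma> c) = lin_ext (\<lambda>u. expansion lam c (map_monomial (inv \<sigma>) u)) (x a)"
    using c by (simp add: free.act_P lin_ext_lin_ext a_def)
  also have "\<dots> = lin_ext (\<lambda>u. lin_ext (\<lambda>X. sgl (relabel_tree (inv \<sigma>) X) 1) (expansion lam a u)) (x a)"
    using subsetD[OF free.supp_ops[OF assms(2) a]] expansion_act[OF a _ assms(3), of _ lam] ca
    by (intro lin_ext_cong) simp
  finally show "Phi lam c (act free_operad n x \<sigma> c) =
      lin_ext (\<lambda>X. sgl (relabel_tree (inv \<sigma>) X) 1) ((\<lambda>a\<in>degrees n. Phi lam a (x a)) (permute_list (inv \<sigma>) c))"
    using a by (simp add: lin_ext_lin_ext flip: a_def)
qed

lemma family_Phi_pcomp: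
  assumes "0 < n" "0 < m" "i < n" "x \<in> ops free_operad n" "y \<in> ops free_operad m"
  shows "family_map (Phi lam) (n + m - 1) (pcomp free_operad n m i x y) =
    pcomp (tree_operad lam) n m i (family_map (Phi lam) n x) (family_map (Phi lam) m y)"
  unfolding family_map_def trees.pcomp_P
proof (rule restrict_ext)
  fix c assume c: "c \<in> degrees (n + m - 1)"
  define a where "a = outer_degrees i m c"
  define b where "b = inner_degrees i m c"
  have a: "a \<in> degrees n" unfolding a_def by (intro outer_degrees_in c assms)
  have b: "b \<in> degrees m" unfolding b_def by (intro inner_degrees_in[of _ n] c assms)
  have cab: "subst_degrees a i b = c"
    using subst_degrees_outer_inner[of c n m i] c assms by (simp add: a_def b_def degrees_def)
  have "Phi lam c (pcomp free_operad n m i x y c) =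
      bilin_ext (\<lambda>u w. Phi lam c (monomial_comp a b i u w)) (x a) (y b)"
    using c by (simp add: free.pcomp_P lin_ext_bilin_ext a_def b_def)
  also have "\<dots> = bilin_ext (\<lambda>u w. bilin_ext (tree_comp lam a b i) (expansion lam a u) (expansion lam b w)) (x a) (y b)"
    using subsetD[OF free.supp_ops[OF assms(4) a]] subsetD[OF free.supp_ops[OF assms(5) b]]
      expansion_comp[OF assms(1,2,3) a b, of _ _ lam]
    by (intro bilin_ext_cong) (simp add: cab)
  also have "\<dots> = bilin_ext (tree_comp lam a b i) (Phi lam a (x a)) (Phi lam b (y b))"
    by (rule bilin_ext_lin_ext[symmetric])
  finally show "Phi lam c (pcomp free_operad n m i x y c) =
      bilin_ext (tree_comp lam (outer_degrees i m c) (inner_degrees i m c) i)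
        ((\<lambda>a\<in>degrees n. Phi lam a (x a)) (outer_degrees i m c)) ((\<lambda>a\<in>degrees m. Phi lam a (y a)) (inner_degrees i m c))"
    using a b by (simp flip: a_def b_def)
qed

lemma family_Phi_unit: "family_map (Phi lam) 1 (ounit free_operad) = ounit (tree_operad lam)"
  unfolding family_map_def trees.ounit_P free.ounit_P
proof (rule restrict_ext)
  fix c assume c: "c \<in> degrees 1"
  then obtain k where "c = [k]" by (cases c) (auto simp: degrees_def One_nat_def)
  then show "Phi lam c ((\<lambda>c\<in>degrees 1. sgl (Var 0) 1) c) = sgl (RTree 0 {}) 1"
    using c by (simp add: expansion_Var)
qed

section \<open>Transport of multigraded operads along bijections\<close>

lemma vspace_cancel_left:
  assumes "is_vspace V" "x \<in> carr V" "y \<in> carr V" "z \<in> carr V" "vadd V x y = vadd V x z"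
  shows "y = z"
proof -
  interpret is_vspace V by fact
  obtain w where w: "w \<in> carr V" "vadd V x w = vzero V" using add_inverse[OF assms(2)] by blast
  have "vadd V w (vadd V x u) = u" if "u \<in> carr V" for u
  proof -
    have "vadd V w (vadd V x u) = vadd V (vadd V w x) u" using w(1) assms(2) that by (rule add_assoc[symmetric])
    also have "\<dots> = vadd V u (vzero V)"
      using add_comm[OF w(1) assms(2)] add_comm[OF zero_closed that] w(2) by simp
    finally show ?thesis using add_zero[OF that] by simp
  qed
  then show ?thesis using assms(3-5) by metis
qed

lemma linear_map_closed: "\<lbrakk>linear_map V W f; x \<in> carr V\<rbrakk> \<Longrightarrow> f x \<in> carr W"
  and linear_map_add: "\<lbrakk>linear_map V W f; x \<in> carr V; y \<in> carr V\<rbrakk> \<Longrightarrow> f (vadd V x y) = vadd W (f x) (f y)"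
  and linear_map_smul: "\<lbrakk>linear_map V W f; x \<in> carr V\<rbrakk> \<Longrightarrow> f (vsmul V c x) = vsmul W c (f x)"
  by (auto simp: linear_map_def)

lemma linear_map_zero:
  assumes V: "is_vspace V" and W: "is_vspace W" and f: "linear_map V W f"
  shows "f (vzero V) = vzero W"
proof -
  note z = is_vspace.zero_closed[OF V]
  have fz: "f (vzero V) \<in> carr W" using linear_map_closed[OF f z] .
  have "vadd W (f (vzero V)) (f (vzero V)) = f (vzero V)"
    using linear_map_add[OF f z z] is_vspace.add_zero[OF V z] by simp
  also have "\<dots> = vadd W (f (vzero V)) (vzero W)" using is_vspace.add_zero[OF W fz] by simp
  finally show ?thesis using vspace_cancel_left[OF W fz fz is_vspace.zero_closed[OF W]] by blast
qed

lemma is_vspace_transport: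
  assumes W: "is_vspace W" and inj: "inj_on g (carr V)" and img: "g ` carr V = carr W"
    and zero: "vzero V \<in> carr V" "g (vzero V) = vzero W"
    and add: "\<And>x y. \<lbrakk>x \<in> carr V; y \<in> carr V\<rbrakk> \<Longrightarrow> vadd V x y \<in> carr V \<and> g (vadd V x y) = vadd W (g x) (g y)"
    and smul: "\<And>c x. x \<in> carr V \<Longrightarrow> vsmul V c x \<in> carr V \<and> g (vsmul V c x) = vsmul W c (g x)"
  shows "is_vspace V"
proof
  interpret W: is_vspace W by (rule W)
  note gI = inj_onD[OF inj]
  have gc: "g x \<in> carr W" if "x \<in> carr V" for x using that img by blast
  fix x y z c d assume x: "x \<in> carr V"
  show "vsmul V c x \<in> carr V" using smul x by blast
  show "vadd V x (vzero V) = x" by (rule gI) (use x zero add W.add_zero gc in auto)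
  show "\<exists>y\<in>carr V. vadd V x y = vzero V"
  proof -
    obtain w where w: "w \<in> carr W" "vadd W (g x) w = vzero W" using W.add_inverse[OF gc[OF x]] by blast
    have "w \<in> g ` carr V" using w(1) img by simp
    then obtain y where y: "y \<in> carr V" "vadd W (g x) (g y) = vzero W" using w(2) by blast
    have "vadd V x y = vzero V" by (rule gI) (use x y zero add in auto)
    then show ?thesis using y by blast
  qed
  show "vsmul V (c + d) x = vadd V (vsmul V c x) (vsmul V d x)"
    by (rule gI) (use x smul add W.smul_add_left gc in auto)
  show "vsmul V c (vsmul V d x) = vsmul V (c * d) x"
    by (rule gI) (use x smul W.smul_smul gc in auto)
  show "vsmul V 1 x = x" by (rule gI) (use x smul W.smul_one gc in auto)
  assume y: "y \<in> carr V"
  show "vadd V x y \<in> carr V" using add x y by blast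
  show "vadd V x y = vadd V y x" by (rule gI) (use x y add W.add_comm gc in auto)
  show "vsmul V c (vadd V x y) = vadd V (vsmul V c x) (vsmul V c y)"
    by (rule gI) (use x y add smul W.smul_add_right gc in auto)
  assume z: "z \<in> carr V"
  show "vadd V (vadd V x y) z = vadd V x (vadd V y z)"
    by (rule gI) (use x y z add W.add_assoc gc in auto)
qed (rule zero(1))

text \<open>
  Linear bijections \<open>g\<close> of the components of \<open>M\<close> onto those of a multigraded operad \<open>Q\<close>, compatible with
  the operations. An axiom for \<open>M\<close> is an equation that becomes an axiom of \<open>Q\<close> when \<open>g\<close> is applied, and \<open>g\<close>
  is injective.
\<close>

locale mg_transport = Q: multigraded_operad Q
  for Q :: "('k::field, 'd) mg_operad_data" +
  fixes M :: "('k, 'c) mg_operad_data" and g :: "nat list \<Rightarrow> 'c \<Rightarrow> 'd"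
  assumes sp_M: "0 < n \<Longrightarrow> sp M n = prod_vs (degrees n) (cmp M)"
    and cmp_M: "\<lbrakk>0 < n; a \<in> degrees n\<rbrakk> \<Longrightarrow> is_vspace (cmp M a)"
    and g_linear: "\<lbrakk>0 < n; a \<in> degrees n\<rbrakk> \<Longrightarrow> linear_map (cmp M a) (cmp Q a) (g a)"
    and g_inj: "\<lbrakk>0 < n; a \<in> degrees n\<rbrakk> \<Longrightarrow> inj_on (g a) (carr (cmp M a))"
    and g_image: "\<lbrakk>0 < n; a \<in> degrees n\<rbrakk> \<Longrightarrow> g a ` carr (cmp M a) = carr (cmp Q a)"
    and act_M: "\<lbrakk>0 < n; x \<in> ops M n; \<sigma> permutes {..<n}\<rbrakk> \<Longrightarrow> act M n x \<sigma> \<in> ops M n"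
    and pcomp_M: "\<lbrakk>0 < n; 0 < m; i < n; x \<in> ops M n; y \<in> ops M m\<rbrakk> \<Longrightarrow> pcomp M n m i x y \<in> ops M (n + m - 1)"
    and unit_M: "ounit M \<in> ops M 1"
    and g_act: "\<lbrakk>0 < n; x \<in> ops M n; \<sigma> permutes {..<n}\<rbrakk> \<Longrightarrow>
        family_map g n (act M n x \<sigma>) = act Q n (family_map g n x) \<sigma>"
    and g_pcomp: "\<lbrakk>0 < n; 0 < m; i < n; x \<in> ops M n; y \<in> ops M m\<rbrakk> \<Longrightarrow>
        family_map g (n + m - 1) (pcomp M n m i x y) = pcomp Q n m i (family_map g n x) (family_map g m y)"
    and g_unit: "family_map g 1 (ounit M) = ounit Q"
begin

abbreviation \<theta> where "\<theta> \<equiv> family_map g"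

lemma ops_M: "0 < n \<Longrightarrow> ops M n = (\<Pi>\<^sub>E a\<in>degrees n. carr (cmp M a))"
  and ops_Q: "0 < n \<Longrightarrow> ops Q n = (\<Pi>\<^sub>E a\<in>degrees n. carr (cmp Q a))"
  by (simp_all add: sp_M Q.sp_eq_prod prod_vs_def)

lemma vspace_M: "0 < n \<Longrightarrow> is_vspace (sp M n)"
  unfolding sp_M by (intro is_vspace_prod cmp_M)

lemma theta_linear: "0 < n \<Longrightarrow> linear_map (sp M n) (sp Q n) (\<theta> n)"
proof -
  assume n: "0 < n"
  have cl: "x a \<in> carr (cmp M a)" if "x \<in> ops M n" "a \<in> degrees n" for x a
    using that n ops_M by auto
  show ?thesis
    unfolding linear_map_def
  proof (intro conjI ballI allI)
    show "\<theta> n \<in> ops M n \<rightarrow> ops Q n"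
      using cl linear_map_closed[OF g_linear[OF n]] by (auto simp: family_map_def ops_Q[OF n])
    fix x assume x: "x \<in> ops M n"
    { fix y assume y: "y \<in> ops M n"
      show "\<theta> n (vadd (sp M n) x y) = vadd (sp Q n) (\<theta> n x) (\<theta> n y)"
        using cl[OF x] cl[OF y] linear_map_add[OF g_linear[OF n]]
        by (auto simp: family_map_def sp_M[OF n] Q.sp_eq_prod[OF n] prod_vs_def intro!: restrict_ext) }
    fix c show "\<theta> n (vsmul (sp M n) c x) = vsmul (sp Q n) c (\<theta> n x)"
      using cl[OF x] linear_map_smul[OF g_linear[OF n]]
      by (auto simp: family_map_def sp_M[OF n] Q.sp_eq_prod[OF n] prod_vs_def intro!: restrict_ext)
  qed
qed

lemma theta_inj:
  assumes n: "0 < n" and x: "x \<in> ops M n" and y: "y \<in> ops M n" and eq: "\<theta> n x = \<theta> n y"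
  shows "x = y"
proof -
  have xy: "x \<in> (\<Pi>\<^sub>E a\<in>degrees n. carr (cmp M a))" "y \<in> (\<Pi>\<^sub>E a\<in>degrees n. carr (cmp M a))"
    using x y ops_M[OF n] by auto
  show ?thesis
  proof (rule PiE_ext[OF xy])
    fix a assume a: "a \<in> degrees n"
    have "g a (x a) = g a (y a)" using fun_cong[OF eq, of a] a by (simp add: family_map_def)
    then show "x a = y a" using inj_onD[OF g_inj[OF n a]] PiE_mem[OF xy(1) a] PiE_mem[OF xy(2) a] by blast
  qed
qed

lemma theta_surj:
  assumes n: "0 < n" and y: "y \<in> ops Q n"
  shows "\<exists>x\<in>ops M n. \<theta> n x = y"
proof -
  have yE: "y \<in> (\<Pi>\<^sub>E a\<in>degrees n. carr (cmp Q a))" using y ops_Q[OF n] by simp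
  have "\<forall>a\<in>degrees n. \<exists>x\<in>carr (cmp M a). g a x = y a"
    using PiE_mem[OF yE] g_image[OF n] by (metis imageE)
  then obtain x where x: "\<forall>a\<in>degrees n. x a \<in> carr (cmp M a) \<and> g a (x a) = y a" by metis
  have "\<theta> n (restrict x (degrees n)) = y"
    using x yE by (auto simp: family_map_def PiE_iff extensional_def)
  moreover have "restrict x (degrees n) \<in> ops M n" using x by (simp add: ops_M[OF n])
  ultimately show ?thesis by blast
qed

lemma theta_closed: "\<lbrakk>0 < n; x \<in> ops M n\<rbrakk> \<Longrightarrow> \<theta> n x \<in> ops Q n"
  by (rule linear_map_closed[OF theta_linear])

lemma linear_map_into_M:
  assumes n: "0 < n" "0 < n'" and closed: "\<And>x. x \<in> ops M n \<Longrightarrow> h x \<in> ops M n'"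
    and comm: "\<And>x. x \<in> ops M n \<Longrightarrow> \<theta> n' (h x) = k (\<theta> n x)" and k: "linear_map (sp Q n) (sp Q n') k"
  shows "linear_map (sp M n) (sp M n') h"
  unfolding linear_map_def
proof (intro conjI ballI allI)
  show "h \<in> ops M n \<rightarrow> ops M n'" using closed by blast
  note V = vspace_M[OF n(1)] and W = vspace_M[OF n(2)]
  fix x assume x: "x \<in> ops M n"
  { fix y assume y: "y \<in> ops M n"
    show "h (vadd (sp M n) x y) = vadd (sp M n') (h x) (h y)"
    proof (rule theta_inj[OF n(2)])
      show "\<theta> n' (h (vadd (sp M n) x y)) = \<theta> n' (vadd (sp M n') (h x) (h y))"
        using x y closed is_vspace.add_closed[OF V] linear_map_add[OF theta_linear] linear_map_add[OF k] theta_closed n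
        by (simp add: comm)
    qed (use x y closed is_vspace.add_closed[OF V] is_vspace.add_closed[OF W] in auto) }
  fix c show "h (vsmul (sp M n) c x) = vsmul (sp M n') c (h x)"
  proof (rule theta_inj[OF n(2)])
    show "\<theta> n' (h (vsmul (sp M n) c x)) = \<theta> n' (vsmul (sp M n') c (h x))"
      using x closed is_vspace.smul_closed[OF V] linear_map_smul[OF theta_linear] linear_map_smul[OF k] theta_closed n
      by (simp add: comm)
  qed (use x closed is_vspace.smul_closed[OF V] is_vspace.smul_closed[OF W] in auto)
qed

lemma operad_M: "operad M"
proof (rule operad.intro)
  note closed = theta_closed act_M pcomp_M unit_M
  note comm = g_act g_pcomp g_unit
  fix n :: nat and \<sigma> :: "nat \<Rightarrow> nat"
  show "is_vspace (sp M n)" if "0 < n" by (rule vspace_M[OF that])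
  show "linear_map (sp M n) (sp M n) (\<lambda>x. act M n x \<sigma>)" if "0 < n" "\<sigma> permutes {..<n}"
    by (rule linear_map_into_M[where k = "\<lambda>x. act Q n x \<sigma>"])
      (use that act_M g_act Q.act_linear in simp_all)
  show "act M n x id = x" if n: "0 < n" and x: "x \<in> ops M n" for x
    by (rule theta_inj[OF n]) (use n x closed comm Q.act_id permutes_id[of "{..<n}"] in simp_all)
  show "act M n (act M n x \<sigma>) \<tau> = act M n x (\<sigma> \<circ> \<tau>)"
    if "0 < n" "x \<in> ops M n" "\<sigma> permutes {..<n}" "\<tau> permutes {..<n}" for x \<tau>
    by (rule theta_inj[OF that(1)])
      (use that closed comm Q.act_act permutes_compose[OF that(4,3)] in simp_all)
  show "ounit M \<in> ops M 1" by (rule unit_M)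
  show "pcomp M 1 n 0 (ounit M) x = x" if n: "0 < n" and x: "x \<in> ops M n" for x
    by (rule theta_inj[OF n])
      (use n x unit_M pcomp_M[of 1 n 0 "ounit M" x] g_pcomp[of 1 n 0 "ounit M" x] g_unit Q.unit_left theta_closed in simp_all)
  fix m i :: nat
  show "linear_map (sp M n) (sp M (n + m - 1)) (\<lambda>x. pcomp M n m i x y)"
    if "0 < m" "i < n" "y \<in> ops M m" for y
    by (rule linear_map_into_M[where k = "\<lambda>x. pcomp Q n m i x (\<theta> m y)"])
      (use that pcomp_M g_pcomp Q.pcomp_linear_left theta_closed in simp_all)
  show "linear_map (sp M m) (sp M (n + m - 1)) (\<lambda>y. pcomp M n m i x y)"
    if "0 < m" "i < n" "x \<in> ops M n" for x
    by (rule linear_map_into_M[where k = "\<lambda>y. pcomp Q n m i (\<theta> n x) y"])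
      (use that pcomp_M g_pcomp Q.pcomp_linear_right theta_closed in simp_all)
  show "pcomp M n 1 i x (ounit M) = x" if i: "i < n" and x: "x \<in> ops M n" for x
  proof -
    have n: "0 < n" using i by simp
    show ?thesis
      by (rule theta_inj[OF n])
        (use n i x unit_M pcomp_M[of n 1 i x "ounit M"] g_pcomp[of n 1 i x "ounit M"] g_unit Q.unit_right theta_closed in simp_all)
  qed
  show "pcomp M n m i (act M n x \<sigma>) y = act M (n + m - 1) (pcomp M n m (\<sigma> i) x y) (outer_perm \<sigma> i m)"
    if *: "0 < m" "i < n" "x \<in> ops M n" "y \<in> ops M m" "\<sigma> permutes {..<n}" for x y
  proof -
    have n: "0 < n" "0 < n + m - 1" "\<sigma> i < n" using * permutes_less_iff[OF *(5)] by auto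
    note perm = outer_perm_permutes[OF *(5,2,1)]
    show ?thesis
      by (rule theta_inj[OF n(2)])
        (use n * perm act_M pcomp_M g_act g_pcomp theta_closed Q.equivariant_outer in simp_all)
  qed
  show "pcomp M n m i x (act M m y \<tau>) = act M (n + m - 1) (pcomp M n m i x y) (inner_perm \<tau> i m)"
    if *: "0 < m" "i < n" "x \<in> ops M n" "y \<in> ops M m" "\<tau> permutes {..<m}" for x y \<tau>
  proof -
    have n: "0 < n" "0 < n + m - 1" using * by auto
    note perm = inner_perm_permutes[OF *(5,2)]
    show ?thesis
      by (rule theta_inj[OF n(2)])
        (use n * perm act_M pcomp_M g_act g_pcomp theta_closed Q.equivariant_inner in simp_all)
  qed
  fix l j :: nat
  show "pcomp M (n + m - 1) l (i + j) (pcomp M n m i x y) z = pcomp M n (m + l - 1) i x (pcomp M m l j y z)"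
    if *: "0 < l" "i < n" "j < m" "x \<in> ops M n" "y \<in> ops M m" "z \<in> ops M l" for x y z
  proof -
    have n: "0 < n" "0 < m" "0 < n + m - 1" "0 < m + l - 1" "i + j < n + m - 1" using * by auto
    have N: "n + m - 1 + l - 1 = n + (m + l - 1) - 1" using * by simp
    have c1: "pcomp M n m i x y \<in> ops M (n + m - 1)" "pcomp M m l j y z \<in> ops M (m + l - 1)"
      using pcomp_M[OF n(1,2) *(2,4,5)] pcomp_M[OF n(2) *(1,3,5,6)] .
    show ?thesis
    proof (rule theta_inj[of "n + m - 1 + l - 1"])
      show "0 < n + m - 1 + l - 1" using n * by simp
      show "pcomp M (n + m - 1) l (i + j) (pcomp M n m i x y) z \<in> ops M (n + m - 1 + l - 1)"
        by (rule pcomp_M[OF n(3) *(1) n(5) c1(1) *(6)])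
      show "pcomp M n (m + l - 1) i x (pcomp M m l j y z) \<in> ops M (n + m - 1 + l - 1)"
        unfolding N by (rule pcomp_M[OF n(1,4) *(2,4) c1(2)])
      have "\<theta> (n + m - 1 + l - 1) (pcomp M (n + m - 1) l (i + j) (pcomp M n m i x y) z)
          = pcomp Q (n + m - 1) l (i + j) (pcomp Q n m i (\<theta> n x) (\<theta> m y)) (\<theta> l z)"
        using g_pcomp[OF n(3) *(1) n(5) c1(1) *(6)] g_pcomp[OF n(1,2) *(2,4,5)] by simp
      also have "\<dots> = pcomp Q n (m + l - 1) i (\<theta> n x) (pcomp Q m l j (\<theta> m y) (\<theta> l z))"
        by (rule Q.assoc_sequential[OF *(1-3)]) (use * n theta_closed in auto)
      also have "\<dots> = \<theta> (n + m - 1 + l - 1) (pcomp M n (m + l - 1) i x (pcomp M m l j y z))"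
        unfolding N using g_pcomp[OF n(1,4) *(2,4) c1(2)] g_pcomp[OF n(2) *(1,3,5,6)] by simp
      finally show "\<theta> (n + m - 1 + l - 1) (pcomp M (n + m - 1) l (i + j) (pcomp M n m i x y) z)
          = \<theta> (n + m - 1 + l - 1) (pcomp M n (m + l - 1) i x (pcomp M m l j y z))" .
    qed
  qed
  show "pcomp M (n + m - 1) l (j + m - 1) (pcomp M n m i x y) z = pcomp M (n + l - 1) m i (pcomp M n l j x z) y"
    if *: "0 < m" "0 < l" "i < j" "j < n" "x \<in> ops M n" "y \<in> ops M m" "z \<in> ops M l" for x y z
  proof -
    have n: "0 < n" "i < n" "0 < n + m - 1" "0 < n + l - 1" "j + m - 1 < n + m - 1" "i < n + l - 1" using * by auto
    have N: "n + m - 1 + l - 1 = n + l - 1 + m - 1" using * by simp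
    have c1: "pcomp M n m i x y \<in> ops M (n + m - 1)" "pcomp M n l j x z \<in> ops M (n + l - 1)"
      using pcomp_M[OF n(1) *(1) n(2) *(5,6)] pcomp_M[OF n(1) *(2,4,5,7)] .
    show ?thesis
    proof (rule theta_inj[of "n + m - 1 + l - 1"])
      show "0 < n + m - 1 + l - 1" using n * by simp
      show "pcomp M (n + m - 1) l (j + m - 1) (pcomp M n m i x y) z \<in> ops M (n + m - 1 + l - 1)"
        by (rule pcomp_M[OF n(3) *(2) n(5) c1(1) *(7)])
      show "pcomp M (n + l - 1) m i (pcomp M n l j x z) y \<in> ops M (n + m - 1 + l - 1)"
        unfolding N by (rule pcomp_M[OF n(4) *(1) n(6) c1(2) *(6)])
      have "\<theta> (n + m - 1 + l - 1) (pcomp M (n + m - 1) l (j + m - 1) (pcomp M n m i x y) z)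
          = pcomp Q (n + m - 1) l (j + m - 1) (pcomp Q n m i (\<theta> n x) (\<theta> m y)) (\<theta> l z)"
        using g_pcomp[OF n(3) *(2) n(5) c1(1) *(7)] g_pcomp[OF n(1) *(1) n(2) *(5,6)] by simp
      also have "\<dots> = pcomp Q (n + l - 1) m i (pcomp Q n l j (\<theta> n x) (\<theta> l z)) (\<theta> m y)"
        by (rule Q.assoc_parallel[OF *(1-4)]) (use * n theta_closed in auto)
      also have "\<dots> = \<theta> (n + m - 1 + l - 1) (pcomp M (n + l - 1) m i (pcomp M n l j x z) y)"
        unfolding N using g_pcomp[OF n(4) *(1) n(6) c1(2) *(6)] g_pcomp[OF n(1) *(2,4,5,7)] by simp
      finally show "\<theta> (n + m - 1 + l - 1) (pcomp M (n + m - 1) l (j + m - 1) (pcomp M n m i x y) z)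
          = \<theta> (n + m - 1 + l - 1) (pcomp M (n + l - 1) m i (pcomp M n l j x z) y)" .
    qed
  qed
qed

lemma homogeneous_iff:
  assumes n: "0 < n" and a: "a \<in> degrees n" and x: "x \<in> ops M n"
  shows "x \<in> homogeneous M a \<longleftrightarrow> \<theta> n x \<in> homogeneous Q a"
proof -
  have len: "length a = n" using a by (simp add: degrees_def)
  have "x b = vzero (cmp M b) \<longleftrightarrow> \<theta> n x b = vzero (cmp Q b)" if b: "b \<in> degrees n" for b
  proof -
    have xb: "x b \<in> carr (cmp M b)" using x b ops_M[OF n] by auto
    have gz: "g b (vzero (cmp M b)) = vzero (cmp Q b)"
      by (rule linear_map_zero[OF cmp_M[OF n b] Q.cmp_vspace[OF n b] g_linear[OF n b]])
    have "x b = vzero (cmp M b) \<longleftrightarrow> g b (x b) = vzero (cmp Q b)"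
      using gz inj_onD[OF g_inj[OF n b] _ xb is_vspace.zero_closed[OF cmp_M[OF n b]]] by auto
    then show ?thesis using b by (simp add: family_map_def)
  qed
  then show ?thesis using x theta_closed[OF n x] by (simp add: homogeneous_def len)
qed

lemma homogeneous_ops: "a \<in> degrees n \<Longrightarrow> x \<in> homogeneous R a \<Longrightarrow> x \<in> ops R n"
  by (simp add: homogeneous_def degrees_def)

theorem multigraded_M: "multigraded_operad M"
proof (rule multigraded_operad.intro[OF operad_M], rule multigraded_operad_axioms.intro)
  show "is_vspace (cmp M a)" if "0 < n" "a \<in> degrees n" for n a by (rule cmp_M[OF that])
  show "sp M n = prod_vs (degrees n) (cmp M)" if "0 < n" for n by (rule sp_M[OF that])
next
  fix n :: nat and a and \<sigma> :: "nat \<Rightarrow> nat"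
  assume *: "0 < n" "a \<in> degrees n" "\<sigma> permutes {..<n}"
  note a' = permute_list_in_degrees[OF *(3,2)]
  have iff: "x \<in> homogeneous M a \<longleftrightarrow> \<theta> n x \<in> homogeneous Q a"
    "act M n x \<sigma> \<in> homogeneous M (permute_list \<sigma> a) \<longleftrightarrow> act Q n (\<theta> n x) \<sigma> \<in> homogeneous Q (permute_list \<sigma> a)"
    if "x \<in> ops M n" for x
    using homogeneous_iff[OF *(1,2) that] homogeneous_iff[OF *(1) a' act_M[OF *(1) that *(3)]] g_act[OF *(1) that *(3)]
    by simp_all
  note Qh = Q.act_homogeneous[OF *]
  show "(\<lambda>x. act M n x \<sigma>) ` homogeneous M a = homogeneous M (permute_list \<sigma> a)"
  proof (intro equalityI subsetI)
    fix y assume "y \<in> (\<lambda>x. act M n x \<sigma>) ` homogeneous M a"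
    then obtain x where x: "x \<in> homogeneous M a" "y = act M n x \<sigma>" by blast
    have xo: "x \<in> ops M n" using homogeneous_ops[OF *(2) x(1)] .
    have "act Q n (\<theta> n x) \<sigma> \<in> homogeneous Q (permute_list \<sigma> a)"
      unfolding Qh[symmetric] using iff(1)[OF xo] x(1) by simp
    then show "y \<in> homogeneous M (permute_list \<sigma> a)" using iff(2)[OF xo] x(2) by simp
  next
    fix y assume y: "y \<in> homogeneous M (permute_list \<sigma> a)"
    have yo: "y \<in> ops M n" using homogeneous_ops[OF a' y] .
    have "\<theta> n y \<in> homogeneous Q (permute_list \<sigma> a)" using homogeneous_iff[OF *(1) a' yo] y by simp
    then obtain z where z: "z \<in> homogeneous Q a" "\<theta> n y = act Q n z \<sigma>" unfolding Qh[symmetric] by blast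
    obtain x where x: "x \<in> ops M n" "\<theta> n x = z" using theta_surj[OF *(1) homogeneous_ops[OF *(2) z(1)]] by blast
    have "y = act M n x \<sigma>"
      using theta_inj[OF *(1) yo act_M[OF *(1) x(1) *(3)]] g_act[OF *(1) x(1) *(3)] z x by simp
    moreover have "x \<in> homogeneous M a" using iff(1)[OF x(1)] x z by simp
    ultimately show "y \<in> (\<lambda>x. act M n x \<sigma>) ` homogeneous M a" by blast
  qed
next
  fix n m i :: nat and a b x y
  assume *: "0 < m" "i < n" "a \<in> degrees n" "b \<in> degrees m" "x \<in> homogeneous M a" "y \<in> homogeneous M b"
  have n: "0 < n" "0 < n + m - 1" using * by auto
  have xo: "x \<in> ops M n" and yo: "y \<in> ops M m" using homogeneous_ops * by blast+
  have x: "\<theta> n x \<in> homogeneous Q a" and y: "\<theta> m y \<in> homogeneous Q b"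
    using homogeneous_iff[OF n(1) *(3) xo] homogeneous_iff[OF *(1,4) yo] *(5,6) by simp_all
  note c = pcomp_M[OF n(1) *(1,2) xo yo] and e = g_pcomp[OF n(1) *(1,2) xo yo]
  show "pcomp M n m i x y \<in> homogeneous M (subst_degrees a i b)"
    using homogeneous_iff[OF n(2) subst_degrees_in[OF *(3,4,2)] c] e Q.pcomp_homogeneous[OF *(1-4) x y] by simp
  assume s: "sum_list b \<noteq> a ! i"
  show "pcomp M n m i x y = vzero (sp M (n + m - 1))"
  proof (rule theta_inj[OF n(2) c is_vspace.zero_closed[OF vspace_M[OF n(2)]]])
    show "\<theta> (n + m - 1) (pcomp M n m i x y) = \<theta> (n + m - 1) (vzero (sp M (n + m - 1)))"
      using e Q.pcomp_mismatch[OF *(1-4) x y s]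
        linear_map_zero[OF vspace_M[OF n(2)] Q.vspace[OF n(2)] theta_linear[OF n(2)]] by simp
  qed
qed

theorem isomorphic_M: "mg_isomorphic M Q"
proof -
  define \<psi> where "\<psi> n y = (SOME x. x \<in> ops M n \<and> \<theta> n x = y)" for n y
  have \<psi>: "\<psi> n y \<in> ops M n" "\<theta> n (\<psi> n y) = y" if "0 < n" "y \<in> ops Q n" for n y
    using someI_ex[of "\<lambda>x. x \<in> ops M n \<and> \<theta> n x = y"] theta_surj[OF that] unfolding \<psi>_def by auto
  have \<psi>_eq: "\<psi> n y = x" if "0 < n" "x \<in> ops M n" "\<theta> n x = y" for n x y
    using theta_inj[OF that(1) \<psi>(1)[OF that(1)] that(2)] \<psi>(2)[OF that(1)] theta_closed[OF that(1,2)] that(3) by metis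
  have "operad_morphism M Q \<theta>"
    unfolding operad_morphism_def using theta_linear g_act g_pcomp g_unit by blast
  moreover have "\<theta> n ` homogeneous M a \<subseteq> homogeneous Q a" if "0 < n" "a \<in> degrees n" for n a
    using homogeneous_iff[OF that] homogeneous_ops[OF that(2)] by blast
  ultimately have "mg_morphism M Q \<theta>" by (simp add: mg_morphism_def)
  moreover have "mg_morphism Q M \<psi>"
    unfolding mg_morphism_def operad_morphism_def
  proof (intro conjI allI impI ballI)
    fix n :: nat assume n: "0 < n"
    note V = vspace_M[OF n]
    show "linear_map (sp Q n) (sp M n) (\<psi> n)"
      unfolding linear_map_def
    proof (intro conjI ballI allI)
      show "\<psi> n \<in> ops Q n \<rightarrow> ops M n" using \<psi>(1)[OF n] by blast
      fix x assume x: "x \<in> ops Q n"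
      show "\<psi> n (vadd (sp Q n) x y) = vadd (sp M n) (\<psi> n x) (\<psi> n y)" if y: "y \<in> ops Q n" for y
        by (rule \<psi>_eq[OF n]) (use x y \<psi>[OF n] is_vspace.add_closed[OF V] linear_map_add[OF theta_linear[OF n]] in simp_all)
      show "\<psi> n (vsmul (sp Q n) c x) = vsmul (sp M n) c (\<psi> n x)" for c
        by (rule \<psi>_eq[OF n]) (use x \<psi>[OF n] is_vspace.smul_closed[OF V] linear_map_smul[OF theta_linear[OF n]] in simp_all)
    qed
    fix x assume x: "x \<in> ops Q n"
    show "\<psi> n (act Q n x \<sigma>) = act M n (\<psi> n x) \<sigma>" if "\<sigma> permutes {..<n}" for \<sigma>
      by (rule \<psi>_eq[OF n]) (use n x that \<psi>[OF n] act_M g_act in simp_all)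
    fix m i :: nat and y assume m: "0 < m" and i: "i < n" and y: "y \<in> ops Q m"
    have "0 < n + m - 1" using n m by simp
    then show "\<psi> (n + m - 1) (pcomp Q n m i x y) = pcomp M n m i (\<psi> n x) (\<psi> m y)"
      by (rule \<psi>_eq) (use n m i x y \<psi>(1)[OF n x] \<psi>(1)[OF m y] \<psi>(2)[OF n x] \<psi>(2)[OF m y] pcomp_M g_pcomp in simp_all)
  next
    show "\<psi> 1 (ounit Q) = ounit M" by (rule \<psi>_eq) (simp_all add: unit_M g_unit)
  next
    fix n a assume *: "0 < n" "a \<in> degrees n"
    show "\<psi> n ` homogeneous Q a \<subseteq> homogeneous M a"
      using homogeneous_iff[OF *] homogeneous_ops[OF *(2)] \<psi>[OF *(1)] by fastforce
  qed
  moreover have "(\<forall>x\<in>ops M n. \<psi> n (\<theta> n x) = x) \<and> (\<forall>y\<in>ops Q n. \<theta> n (\<psi> n y) = y)" if "0 < n" for n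
    using \<psi>_eq[OF that] \<psi>(2)[OF that] by blast
  ultimately show ?thesis unfolding mg_isomorphic_def by blast
qed

end

section \<open>The first isomorphism theorem\<close>

text \<open>
  Operations on cosets are computed on representatives. Since \<open>f\<close> is constant on each coset of its
  kernel \<open>U\<close>, the value of \<open>f\<close> at the representative identifies the quotient with \<open>W\<close>.
\<close>

locale vspace_surjection =
  fixes V :: "('k::field, 'v) vspace" and W :: "('k, 'w) vspace" and f U
  assumes V: "is_vspace V" and W: "is_vspace W" and f: "linear_map V W f"
    and f_image: "f ` carr V = carr W"
    and U: "U = {x \<in> carr V. f x = vzero W}"
begin

lemma f_closed: "x \<in> carr V \<Longrightarrow> f x \<in> carr W"
  using linear_map_closed[OF f] .

lemma f_coset: "\<lbrakk>x \<in> carr V; y \<in> coset V U x\<rbrakk> \<Longrightarrow> y \<in> carr V \<and> f y = f x"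
  using linear_map_add[OF f] is_vspace.add_closed[OF V] is_vspace.add_zero[OF W] f_closed
  by (auto simp: coset_def U)

lemma self_in_coset: "x \<in> carr V \<Longrightarrow> x \<in> coset V U x"
  using is_vspace.zero_closed[OF V] linear_map_zero[OF V W f] is_vspace.add_zero[OF V]
  unfolding coset_def U by (metis (mono_tags, lifting) imageI mem_Collect_eq)

lemma rep_coset: "x \<in> carr V \<Longrightarrow> rep (coset V U x) \<in> carr V \<and> f (rep (coset V U x)) = f x"
  by (rule f_coset[OF _ someI[of "\<lambda>y. y \<in> coset V U x", OF self_in_coset]])

lemma coset_mem:
  assumes x: "x \<in> carr V" and y: "y \<in> carr V" and eq: "f x = f y"
  shows "y \<in> coset V U x"
proof -
  interpret V: is_vspace V by (rule V)
  obtain z where z: "z \<in> carr V" "vadd V x z = vzero V" using V.add_inverse[OF x] by blast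
  have d: "vadd V z y \<in> carr V" by (rule V.add_closed[OF z(1) y])
  have "vadd V x (vadd V z y) = vadd V y (vzero V)"
    using V.add_assoc[OF x z(1) y] V.add_comm[OF V.zero_closed y] z(2) by simp
  then have yd: "y = vadd V x (vadd V z y)" using V.add_zero[OF y] by simp
  have "vadd W (f x) (f (vadd V z y)) = vadd W (f x) (vzero W)"
    using linear_map_add[OF f x d] yd eq is_vspace.add_zero[OF W f_closed[OF x]] by simp
  then have "f (vadd V z y) = vzero W"
    by (rule vspace_cancel_left[OF W f_closed[OF x] f_closed[OF d] is_vspace.zero_closed[OF W]])
  then show ?thesis using yd d unfolding coset_def U by blast
qed

lemma coset_eqI:
  assumes "x \<in> carr V" "y \<in> carr V" "f x = f y"
  shows "coset V U x = coset V U y"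
  using coset_mem f_coset assms by (intro equalityI subsetI) metis+

lemma coset_carr: "x \<in> carr V \<Longrightarrow> coset V U x \<in> carr (quot_vs V U)"
  by (simp add: quot_vs_def)

lemma carr_quot:
  assumes "X \<in> carr (quot_vs V U)"
  shows "rep X \<in> carr V \<and> X = coset V U (rep X)"
proof -
  obtain x where x: "x \<in> carr V" "X = coset V U x" using assms by (auto simp: quot_vs_def)
  have r: "rep X \<in> carr V" "f (rep X) = f x" using rep_coset[OF x(1)] by (simp_all only: x(2))
  have "coset V U x = coset V U (rep X)" by (rule coset_eqI[OF x(1) r(1) r(2)[symmetric]])
  then show ?thesis using r(1) x(2) by simp
qed

lemma quot_map_linear: "linear_map (quot_vs V U) W (\<lambda>X. f (rep X))"
  unfolding linear_map_def
proof (intro conjI ballI allI)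
  fix X assume X: "X \<in> carr (quot_vs V U)"
  show "f (rep (vadd (quot_vs V U) X Y)) = vadd W (f (rep X)) (f (rep Y))" if Y: "Y \<in> carr (quot_vs V U)" for Y
    using rep_coset[OF is_vspace.add_closed[OF V]] carr_quot[OF X] carr_quot[OF Y] linear_map_add[OF f]
    by (simp add: quot_vs_def)
  show "f (rep (vsmul (quot_vs V U) c X)) = vsmul W c (f (rep X))" for c
    using rep_coset[OF is_vspace.smul_closed[OF V]] carr_quot[OF X] linear_map_smul[OF f]
    by (simp add: quot_vs_def)
qed (use carr_quot f_closed in blast)

lemma quot_map_inj: "inj_on (\<lambda>X. f (rep X)) (carr (quot_vs V U))"
  by (rule inj_onI) (metis carr_quot coset_eqI)

lemma quot_map_image: "(\<lambda>X. f (rep X)) ` carr (quot_vs V U) = carr W"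
proof (intro equalityI subsetI)
  fix y assume "y \<in> carr W"
  then obtain x where x: "x \<in> carr V" "f x = y" unfolding f_image[symmetric] by blast
  then show "y \<in> (\<lambda>X. f (rep X)) ` carr (quot_vs V U)"
    by (intro rev_image_eqI[OF coset_carr[OF x(1)]]) (simp add: rep_coset)
next
  fix y assume "y \<in> (\<lambda>X. f (rep X)) ` carr (quot_vs V U)"
  then obtain X where "X \<in> carr (quot_vs V U)" "y = f (rep X)" by blast
  then show "y \<in> carr W" using carr_quot[of X] f_closed[of "rep X"] by simp
qed

lemma quot_vspace: "is_vspace (quot_vs V U)"
proof (rule is_vspace_transport[OF W quot_map_inj quot_map_image])
  note z = is_vspace.zero_closed[OF V]
  show "vzero (quot_vs V U) \<in> carr (quot_vs V U)" using z by (simp add: quot_vs_def)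
  show "f (rep (vzero (quot_vs V U))) = vzero W"
    using rep_coset[OF z] linear_map_zero[OF V W f] by (simp add: quot_vs_def)
  show "vadd (quot_vs V U) X Y \<in> carr (quot_vs V U) \<and>
      f (rep (vadd (quot_vs V U) X Y)) = vadd W (f (rep X)) (f (rep Y))"
    if "X \<in> carr (quot_vs V U)" "Y \<in> carr (quot_vs V U)" for X Y
    using linear_map_add[OF quot_map_linear that] is_vspace.add_closed[OF V] carr_quot[OF that(1)] carr_quot[OF that(2)]
    by (simp add: quot_vs_def)
  show "vsmul (quot_vs V U) c X \<in> carr (quot_vs V U) \<and> f (rep (vsmul (quot_vs V U) c X)) = vsmul W c (f (rep X))"
    if "X \<in> carr (quot_vs V U)" for c X
    using linear_map_smul[OF quot_map_linear that] is_vspace.smul_closed[OF V] carr_quot[OF that]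
    by (simp add: quot_vs_def)
qed

end

text \<open>
  Linear surjections of the components of \<open>P\<close> onto those of a multigraded operad \<open>Q\<close>, compatible with the
  operations. The axioms come from \<open>Q\<close> and pass to the quotient of \<open>P\<close> by the kernel.
\<close>

locale mg_surjection = Q: multigraded_operad Q
  for Q :: "('k::field, 'd) mg_operad_data" +
  fixes P :: "('k, 'c) mg_operad_data" and f :: "nat list \<Rightarrow> 'c \<Rightarrow> 'd"
  assumes sp_P: "0 < n \<Longrightarrow> sp P n = prod_vs (degrees n) (cmp P)"
    and cmp_P: "\<lbrakk>0 < n; a \<in> degrees n\<rbrakk> \<Longrightarrow> is_vspace (cmp P a)"
    and f_linear: "\<lbrakk>0 < n; a \<in> degrees n\<rbrakk> \<Longrightarrow> linear_map (cmp P a) (cmp Q a) (f a)"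
    and f_image: "\<lbrakk>0 < n; a \<in> degrees n\<rbrakk> \<Longrightarrow> f a ` carr (cmp P a) = carr (cmp Q a)"
    and act_P: "\<lbrakk>0 < n; x \<in> ops P n; \<sigma> permutes {..<n}\<rbrakk> \<Longrightarrow> act P n x \<sigma> \<in> ops P n"
    and pcomp_P: "\<lbrakk>0 < n; 0 < m; i < n; x \<in> ops P n; y \<in> ops P m\<rbrakk> \<Longrightarrow> pcomp P n m i x y \<in> ops P (n + m - 1)"
    and unit_P: "ounit P \<in> ops P 1"
    and f_act: "\<lbrakk>0 < n; x \<in> ops P n; \<sigma> permutes {..<n}\<rbrakk> \<Longrightarrow>
        family_map f n (act P n x \<sigma>) = act Q n (family_map f n x) \<sigma>"
    and f_pcomp: "\<lbrakk>0 < n; 0 < m; i < n; x \<in> ops P n; y \<in> ops P m\<rbrakk> \<Longrightarrow>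
        family_map f (n + m - 1) (pcomp P n m i x y) = pcomp Q n m i (family_map f n x) (family_map f m y)"
    and f_unit: "family_map f 1 (ounit P) = ounit Q"
begin

definition kernel :: "nat list \<Rightarrow> 'c set" where
  "kernel a = {x \<in> carr (cmp P a). f a x = vzero (cmp Q a)}"

lemma ops_P: "0 < n \<Longrightarrow> ops P n = (\<Pi>\<^sub>E a\<in>degrees n. carr (cmp P a))"
  and ops_Q: "0 < n \<Longrightarrow> ops Q n = (\<Pi>\<^sub>E a\<in>degrees n. carr (cmp Q a))"
  by (simp_all add: sp_P Q.sp_eq_prod prod_vs_def)

lemma family_closed: "\<lbrakk>0 < n; x \<in> ops P n\<rbrakk> \<Longrightarrow> family_map f n x \<in> ops Q n"
  using linear_map_closed[OF f_linear] by (auto simp: ops_P ops_Q family_map_def)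

lemma kernel_iff:
  assumes n: "0 < n" and x: "x \<in> ops P n"
  shows "x \<in> Pi\<^sub>E (degrees n) kernel \<longleftrightarrow> family_map f n x = vzero (sp Q n)"
proof -
  have xE: "x \<in> (\<Pi>\<^sub>E a\<in>degrees n. carr (cmp P a))" using x ops_P[OF n] by simp
  have "family_map f n x = vzero (sp Q n) \<longleftrightarrow> (\<forall>a\<in>degrees n. f a (x a) = vzero (cmp Q a))"
    unfolding family_map_def Q.sp_eq_prod[OF n] prod_vs_def by (auto simp: fun_eq_iff restrict_def)
  then show ?thesis using xE by (auto simp: kernel_def PiE_iff)
qed

lemma kernel_ops: "0 < n \<Longrightarrow> x \<in> Pi\<^sub>E (degrees n) kernel \<Longrightarrow> x \<in> ops P n"
  by (auto simp: ops_P kernel_def PiE_iff)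

lemma kernel_ideal: "mg_ideal P kernel"
  unfolding mg_ideal_def
proof (intro conjI allI impI ballI)
  fix n a assume n: "0 < n" and a: "a \<in> degrees n"
  interpret V: is_vspace "cmp P a" by (rule cmp_P[OF n a])
  interpret W: is_vspace "cmp Q a" by (rule Q.cmp_vspace[OF n a])
  note l = f_linear[OF n a]
  have smul_zero: "vsmul (cmp Q a) c (vzero (cmp Q a)) = vzero (cmp Q a)" for c
    using linear_map_zero[of "cmp Q a" "cmp Q a" "vsmul (cmp Q a) c"] Q.cmp_vspace[OF n a]
    by (simp add: linear_map_def W.smul_closed W.smul_add_right W.smul_smul mult.commute)
  show "lin_subspace (cmp P a) (kernel a)"
    unfolding lin_subspace_def kernel_def
    using linear_map_zero[OF cmp_P[OF n a] Q.cmp_vspace[OF n a] l] linear_map_add[OF l] linear_map_smul[OF l]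
      V.zero_closed V.add_closed V.smul_closed W.add_zero[OF W.zero_closed] smul_zero by auto
next
  fix n x \<sigma> assume n: "0 < n" and x: "x \<in> Pi\<^sub>E (degrees n) kernel" and \<sigma>: "\<sigma> permutes {..<n}"
  note xo = kernel_ops[OF n x]
  have "family_map f n (act P n x \<sigma>) = vzero (sp Q n)"
    using f_act[OF n xo \<sigma>] kernel_iff[OF n xo] x
      linear_map_zero[OF Q.vspace[OF n] Q.vspace[OF n] Q.act_linear[OF n \<sigma>]] by simp
  then show "act P n x \<sigma> \<in> Pi\<^sub>E (degrees n) kernel" using kernel_iff[OF n act_P[OF n xo \<sigma>]] by simp
next
  fix n m i x y assume n: "0 < n" and m: "0 < m" and i: "i < n" and x: "x \<in> Pi\<^sub>E (degrees n) kernel" and y: "y \<in> ops P m"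
  note xo = kernel_ops[OF n x]
  have N: "0 < n + m - 1" using n m by simp
  have "family_map f (n + m - 1) (pcomp P n m i x y) = vzero (sp Q (n + m - 1))"
    using f_pcomp[OF n m i xo y] kernel_iff[OF n xo] x
      linear_map_zero[OF Q.vspace[OF n] Q.vspace[OF N] Q.pcomp_linear_left[OF m i family_closed[OF m y]]] by simp
  then show "pcomp P n m i x y \<in> Pi\<^sub>E (degrees (n + m - 1)) kernel"
    using kernel_iff[OF N pcomp_P[OF n m i xo y]] by simp
next
  fix n m i x y assume n: "0 < n" and m: "0 < m" and i: "i < n" and x: "x \<in> ops P n" and y: "y \<in> Pi\<^sub>E (degrees m) kernel"
  note yo = kernel_ops[OF m y]
  have N: "0 < n + m - 1" using n m by simp
  have "family_map f (n + m - 1) (pcomp P n m i x y) = vzero (sp Q (n + m - 1))"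
    using f_pcomp[OF n m i x yo] kernel_iff[OF m yo] y
      linear_map_zero[OF Q.vspace[OF m] Q.vspace[OF N] Q.pcomp_linear_right[OF m i family_closed[OF n x]]] by simp
  then show "pcomp P n m i x y \<in> Pi\<^sub>E (degrees (n + m - 1)) kernel"
    using kernel_iff[OF N pcomp_P[OF n m i x yo]] by simp
qed

lemma quotient_transport:
  assumes J: "\<And>n a. \<lbrakk>0 < n; a \<in> degrees n\<rbrakk> \<Longrightarrow> J a = kernel a"
  shows "mg_transport Q (mg_quotient P J) (\<lambda>a X. f a (rep X))"
proof -
  let ?M = "mg_quotient P J"
  have S: "vspace_surjection (cmp P a) (cmp Q a) (f a) (J a)" if "0 < n" "a \<in> degrees n" for n a
    using cmp_P[OF that] Q.cmp_vspace[OF that] f_linear[OF that] f_image[OF that] J[OF that]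
    by (intro vspace_surjection.intro) (simp_all add: kernel_def)
  define cls where "cls n x = (\<lambda>a\<in>degrees n. coset (cmp P a) (J a) (x a))" for n x
  define reps where "reps n X = (\<lambda>a\<in>degrees n. rep (X a :: 'c set))" for n X
  have cmp: "cmp ?M a = quot_vs (cmp P a) (J a)" for a by (simp add: mg_quotient_def Let_def)
  have sp: "sp ?M n = prod_vs (degrees n) (cmp ?M)" for n by (simp add: mg_quotient_def Let_def)
  have ops: "ops ?M n = (\<Pi>\<^sub>E a\<in>degrees n. carr (quot_vs (cmp P a) (J a)))" for n
    by (simp add: sp cmp prod_vs_def)
  have act: "act ?M n X \<sigma> = cls n (act P n (reps n X) \<sigma>)" for n X \<sigma>
    by (simp add: mg_quotient_def Let_def cls_def reps_def)
  have pcomp: "pcomp ?M n m i X Y = cls (n + m - 1) (pcomp P n m i (reps n X) (reps m Y))" for n m i X Y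
    by (simp add: mg_quotient_def Let_def cls_def reps_def)
  have unit: "ounit ?M = cls 1 (ounit P)" by (simp add: mg_quotient_def Let_def cls_def)
  have cls: "cls n x \<in> ops ?M n" "family_map (\<lambda>a X. f a (rep X)) n (cls n x) = family_map f n x"
    if n: "0 < n" and x: "x \<in> ops P n" for n x
  proof -
    have xa: "x a \<in> carr (cmp P a)" if "a \<in> degrees n" for a using x that ops_P[OF n] by auto
    show "cls n x \<in> ops ?M n"
      using vspace_surjection.coset_carr[OF S[OF n]] xa by (simp add: cls_def ops)
    show "family_map (\<lambda>a X. f a (rep X)) n (cls n x) = family_map f n x"
      using vspace_surjection.rep_coset[OF S[OF n]] xa
      by (auto simp: family_map_def cls_def intro!: restrict_ext)
  qed
  have reps: "reps n X \<in> ops P n" "family_map f n (reps n X) = family_map (\<lambda>a X. f a (rep X)) n X"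
    if n: "0 < n" and X: "X \<in> ops ?M n" for n X
  proof -
    have Xa: "X a \<in> carr (quot_vs (cmp P a) (J a))" if "a \<in> degrees n" for a using X that ops by auto
    show "reps n X \<in> ops P n"
      using vspace_surjection.carr_quot[OF S[OF n]] Xa by (simp add: reps_def ops_P[OF n])
    show "family_map f n (reps n X) = family_map (\<lambda>a X. f a (rep X)) n X"
      by (auto simp: family_map_def reps_def intro!: restrict_ext)
  qed
  show ?thesis
  proof (rule mg_transport.intro[OF Q.multigraded_operad_axioms], rule mg_transport_axioms.intro)
    show "sp ?M n = prod_vs (degrees n) (cmp ?M)" for n by (rule sp)
    show "is_vspace (cmp ?M a)" if "0 < n" "a \<in> degrees n" for n a
      unfolding cmp by (rule vspace_surjection.quot_vspace[OF S[OF that]])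
    show "linear_map (cmp ?M a) (cmp Q a) (\<lambda>X. f a (rep X))" if "0 < n" "a \<in> degrees n" for n a
      unfolding cmp by (rule vspace_surjection.quot_map_linear[OF S[OF that]])
    show "inj_on (\<lambda>X. f a (rep X)) (carr (cmp ?M a))" if "0 < n" "a \<in> degrees n" for n a
      unfolding cmp by (rule vspace_surjection.quot_map_inj[OF S[OF that]])
    show "(\<lambda>X. f a (rep X)) ` carr (cmp ?M a) = carr (cmp Q a)" if "0 < n" "a \<in> degrees n" for n a
      unfolding cmp by (rule vspace_surjection.quot_map_image[OF S[OF that]])
    show "act ?M n X \<sigma> \<in> ops ?M n"
      "family_map (\<lambda>a X. f a (rep X)) n (act ?M n X \<sigma>) = act Q n (family_map (\<lambda>a X. f a (rep X)) n X) \<sigma>"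
      if "0 < n" "X \<in> ops ?M n" "\<sigma> permutes {..<n}" for n X \<sigma>
      using cls[OF that(1) act_P[OF that(1) reps(1)[OF that(1,2)] that(3)]] f_act[OF that(1) reps(1)[OF that(1,2)] that(3)]
        reps(2)[OF that(1,2)] by (simp_all add: act)
    show "pcomp ?M n m i X Y \<in> ops ?M (n + m - 1)"
      "family_map (\<lambda>a X. f a (rep X)) (n + m - 1) (pcomp ?M n m i X Y) =
        pcomp Q n m i (family_map (\<lambda>a X. f a (rep X)) n X) (family_map (\<lambda>a X. f a (rep X)) m Y)"
      if *: "0 < n" "0 < m" "i < n" "X \<in> ops ?M n" "Y \<in> ops ?M m" for n m i X Y
    proof -
      have N: "0 < n + m - 1" using * by simp
      note r = reps[OF *(1,4)] reps[OF *(2,5)]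
      show "pcomp ?M n m i X Y \<in> ops ?M (n + m - 1)"
        "family_map (\<lambda>a X. f a (rep X)) (n + m - 1) (pcomp ?M n m i X Y) =
          pcomp Q n m i (family_map (\<lambda>a X. f a (rep X)) n X) (family_map (\<lambda>a X. f a (rep X)) m Y)"
        using cls[OF N pcomp_P[OF *(1-3) r(1,3)]] f_pcomp[OF *(1-3) r(1,3)] r(2,4) by (simp_all add: pcomp)
    qed
    show "ounit ?M \<in> ops ?M 1" "family_map (\<lambda>a X. f a (rep X)) 1 (ounit ?M) = ounit Q"
      using cls[OF _ unit_P] f_unit by (simp_all add: unit)
  qed
qed

text \<open>
  The induced map on cosets is a bijection compatible with the operations, along which the structure
  of \<open>Q\<close> is transported.
\<close>

theorem first_isomorphism:
  assumes "\<And>n a. \<lbrakk>0 < n; a \<in> degrees n\<rbrakk> \<Longrightarrow> J a = kernel a"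
  shows "multigraded_operad (mg_quotient P J)" "mg_isomorphic (mg_quotient P J) Q"
proof -
  have T: "mg_transport Q (mg_quotient P J) (\<lambda>a X. f a (rep X))" by (rule quotient_transport) (rule assms)
  show "multigraded_operad (mg_quotient P J)" by (rule mg_transport.multigraded_M[OF T])
  show "mg_isomorphic (mg_quotient P J) Q" by (rule mg_transport.isomorphic_M[OF T])
qed

end

section \<open>Reduction of monomials modulo the relations\<close>

definition monomials_on :: "nat set \<Rightarrow> nat monomial set" where
  "monomials_on V = {u. distinct (variables u) \<and> vars u = V}"

definition mul_left :: "'a monomial \<Rightarrow> ('a monomial \<Rightarrow>\<^sub>0 'k::field) \<Rightarrow> ('a monomial \<Rightarrow>\<^sub>0 'k)" where
  "mul_left u = lin_ext (\<lambda>v. sgl (Mul u v) 1)"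

definition mul_right :: "('a monomial \<Rightarrow>\<^sub>0 'k::field) \<Rightarrow> 'a monomial \<Rightarrow> ('a monomial \<Rightarrow>\<^sub>0 'k)" where
  "mul_right p v = lin_ext (\<lambda>u. sgl (Mul u v) 1) p"

text \<open>
  The defining relation with monomials in place of its three variables.
\<close>

definition relator :: "'k::field \<Rightarrow> (nat \<Rightarrow> nat) \<Rightarrow> nat monomial \<Rightarrow> nat monomial \<Rightarrow> nat monomial \<Rightarrow> (nat monomial \<Rightarrow>\<^sub>0 'k)" where
  "relator lam wt u v w =
     sgl (Mul (Mul u v) w) 1 - sgl (Mul u (Mul v w)) (lam ^ mweight wt w)
     - sgl (Mul (Mul u w) v) 1 + sgl (Mul u (Mul w v)) (lam ^ mweight wt v)"

text \<open>
  The linear combinations that the relations force to vanish, generated from substituted relations by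
  linear combinations and products. The set of variables need not be an initial segment of
  the numbers, so that the factors of a monomial are covered as well.
\<close>

inductive null :: "'k::field \<Rightarrow> (nat \<Rightarrow> nat) \<Rightarrow> nat set \<Rightarrow> (nat monomial \<Rightarrow>\<^sub>0 'k) \<Rightarrow> bool" for lam wt where
  relator: "\<lbrakk>u \<in> monomials_on U; v \<in> monomials_on V; w \<in> monomials_on W; U \<inter> V = {}; U \<inter> W = {}; V \<inter> W = {}\<rbrakk>
    \<Longrightarrow> null lam wt (U \<union> V \<union> W) (relator lam wt u v w)"
| zero: "null lam wt V 0"
| add: "\<lbrakk>null lam wt V p; null lam wt V q\<rbrakk> \<Longrightarrow> null lam wt V (p + q)"
| scale: "null lam wt V p \<Longrightarrow> null lam wt V (scale c p)"
| left: "\<lbrakk>u \<in> monomials_on U; null lam wt V p; U \<inter> V = {}\<rbrakk> \<Longrightarrow> null lam wt (U \<union> V) (mul_left u p)"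
| right: "\<lbrakk>null lam wt U p; v \<in> monomials_on V; U \<inter> V = {}\<rbrakk> \<Longrightarrow> null lam wt (U \<union> V) (mul_right p v)"

lemma monomials_eq: "monomials n = monomials_on {..<n}"
  by (simp add: monomials_def monomials_on_def)

lemma Mul_in_monomials_on [intro]:
  "\<lbrakk>u \<in> monomials_on U; v \<in> monomials_on V; U \<inter> V = {}\<rbrakk> \<Longrightarrow> Mul u v \<in> monomials_on (U \<union> V)"
  by (simp add: monomials_on_def)

lemma Mul_monomials_onE:
  assumes "Mul u v \<in> monomials_on V"
  shows "u \<in> monomials_on (vars u)" "v \<in> monomials_on (vars v)" "vars u \<inter> vars v = {}" "V = vars u \<union> vars v"
  using assms by (auto simp: monomials_on_def)

lemma mweight_on: "u \<in> monomials_on V \<Longrightarrow> mweight wt u = (\<Sum>x\<in>V. wt x)"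
  by (auto simp: monomials_on_def mweight_sum)

lemma scale_minus_one: "scale (- 1) p = - (p :: 'b \<Rightarrow>\<^sub>0 'k::field)"
  by (rule poly_mapping_eqI) simp

lemma null_minus: "null lam wt V p \<Longrightarrow> null lam wt V (- p)"
  using null.scale[of lam wt V p "- 1"] by (simp add: scale_minus_one)

locale reduction =
  fixes lam :: "'k::field" and wt :: "nat \<Rightarrow> nat"
  assumes wt_pos: "0 < wt x"
begin

definition deeper :: "nat set \<Rightarrow> nat \<Rightarrow> nat monomial set" where
  "deeper V d = {u \<in> monomials_on V. d \<le> mdepth wt u}"

text \<open>Vanishing modulo the relations and modulo the monomials of depth at least \<open>d\<close>.\<close>

definition negligible :: "nat set \<Rightarrow> nat \<Rightarrow> (nat monomial \<Rightarrow>\<^sub>0 'k) \<Rightarrow> bool" where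
  "negligible V d p \<longleftrightarrow> (\<exists>q. null lam wt V q \<and> supp (p - q) \<subseteq> deeper V d)"

lemma negligible_null: "null lam wt V p \<Longrightarrow> negligible V d p"
  unfolding negligible_def by (intro exI[of _ p]) simp

lemma negligible_deeper: "supp p \<subseteq> deeper V d \<Longrightarrow> negligible V d p"
  unfolding negligible_def by (intro exI[of _ 0]) (simp add: null.zero)

lemma negligible_add:
  assumes "negligible V d p" "negligible V d p'"
  shows "negligible V d (p + p')"
proof -
  obtain q q' where *: "null lam wt V q" "supp (p - q) \<subseteq> deeper V d" "null lam wt V q'" "supp (p' - q') \<subseteq> deeper V d"
    using assms by (auto simp: negligible_def)
  have "(p + p') - (q + q') = (p - q) + (p' - q')" by simp
  then have "supp ((p + p') - (q + q')) \<subseteq> deeper V d"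
    using keys_add[of "p - q" "p' - q'"] *(2,4) by (simp only:) blast
  then show ?thesis unfolding negligible_def using null.add[OF *(1,3)] by blast
qed

lemma negligible_minus: "negligible V d p \<Longrightarrow> negligible V d (- p)"
proof -
  assume "negligible V d p"
  then obtain q where *: "null lam wt V q" "supp (p - q) \<subseteq> deeper V d" by (auto simp: negligible_def)
  have "- p - - q = - (p - q)" by simp
  then have "supp (- p - - q) \<subseteq> deeper V d" using *(2) by (simp only: keys_minus)
  then show ?thesis unfolding negligible_def using null_minus[OF *(1)] by blast
qed

lemma negligible_scale: "negligible V d p \<Longrightarrow> negligible V d (scale c p)"
proof -
  assume "negligible V d p"
  then obtain q where *: "null lam wt V q" "supp (p - q) \<subseteq> deeper V d" by (auto simp: negligible_def)
  have "scale c p - scale c q = scale c (p - q)" by (simp add: scaling.scale_right_diff_distrib)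
  then have "supp (scale c p - scale c q) \<subseteq> deeper V d" by (simp only: order_trans[OF supp_scale *(2)])
  then show ?thesis unfolding negligible_def using null.scale[OF *(1)] by blast
qed

lemma negligible_sum: "(\<And>x. x \<in> A \<Longrightarrow> negligible V d (f x)) \<Longrightarrow> negligible V d (sum f A)"
  by (induction A rule: infinite_finite_induct) (auto intro: negligible_add negligible_null null.zero)

lemma mul_left_diff: "mul_left u (p - q) = mul_left u p - mul_left u q"
  by (simp add: mul_left_def lin_ext_diff)

lemma mul_right_diff: "mul_right (p - q) v = mul_right p v - mul_right q v"
  by (simp add: mul_right_def lin_ext_diff)

lemma negligible_left:
  assumes u: "u \<in> monomials_on U" and p: "negligible V d p" and disj: "U \<inter> V = {}"
  shows "negligible (U \<union> V) (mdepth wt u + d + (\<Sum>x\<in>V. wt x)) (mul_left u p)"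
proof -
  obtain q where q: "null lam wt V q" "supp (p - q) \<subseteq> deeper V d" using p by (auto simp: negligible_def)
  have "supp (sgl (Mul u v) (1 :: 'k)) \<subseteq> deeper (U \<union> V) (mdepth wt u + d + (\<Sum>x\<in>V. wt x))" if "v \<in> supp (p - q)" for v
    using subsetD[OF q(2) that] u disj by (auto simp: deeper_def mweight_on)
  then have "supp (mul_left u (p - q)) \<subseteq> deeper (U \<union> V) (mdepth wt u + d + (\<Sum>x\<in>V. wt x))"
    unfolding mul_left_def by (rule supp_lin_ext_subset)
  then show ?thesis
    using null.left[OF u q(1) disj] unfolding negligible_def mul_left_diff by blast
qed

lemma negligible_right:
  assumes p: "negligible U d p" and v: "v \<in> monomials_on V" and disj: "U \<inter> V = {}"
  shows "negligible (U \<union> V) (d + mdepth wt v + (\<Sum>x\<in>V. wt x)) (mul_right p v)"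
proof -
  obtain q where q: "null lam wt U q" "supp (p - q) \<subseteq> deeper U d" using p by (auto simp: negligible_def)
  have "supp (sgl (Mul u v) (1 :: 'k)) \<subseteq> deeper (U \<union> V) (d + mdepth wt v + (\<Sum>x\<in>V. wt x))" if "u \<in> supp (p - q)" for u
    using subsetD[OF q(2) that] v disj by (auto simp: deeper_def mweight_on)
  then have "supp (mul_right (p - q) v) \<subseteq> deeper (U \<union> V) (d + mdepth wt v + (\<Sum>x\<in>V. wt x))"
    unfolding mul_right_def by (rule supp_lin_ext_subset)
  then show ?thesis
    using null.right[OF q(1) v disj] unfolding negligible_def mul_right_diff by blast
qed

text \<open>
  Equality of leading terms modulo the relations, where terms are ordered by depth.
\<close>

definition similar :: "nat set \<Rightarrow> nat monomial \<Rightarrow> nat monomial \<Rightarrow> bool" where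
  "similar V u u' \<longleftrightarrow> u \<in> monomials_on V \<and> u' \<in> monomials_on V \<and> mdepth wt u = mdepth wt u' \<and>
     negligible V (Suc (mdepth wt u)) (sgl u 1 - sgl u' 1)"

lemma similar_negligible: "similar V u u' \<Longrightarrow> negligible V (Suc (mdepth wt u)) (sgl u 1 - sgl u' 1)"
  unfolding similar_def by blast

lemma similar_refl: "u \<in> monomials_on V \<Longrightarrow> similar V u u"
  by (simp add: similar_def negligible_null null.zero)

lemma similar_sym:
  assumes "similar V u u'"
  shows "similar V u' u"
proof -
  have "negligible V (Suc (mdepth wt u')) (sgl u 1 - sgl u' 1)" using assms unfolding similar_def by metis
  then have "negligible V (Suc (mdepth wt u')) (sgl u' 1 - sgl u 1)" using negligible_minus by fastforce
  then show ?thesis using assms by (simp add: similar_def)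
qed

lemma similar_trans:
  assumes "similar V u u'" "similar V u' u''"
  shows "similar V u u''"
proof -
  have "negligible V (Suc (mdepth wt u)) (sgl u' 1 - sgl u'' 1)" using assms unfolding similar_def by metis
  then have "negligible V (Suc (mdepth wt u)) ((sgl u 1 - sgl u' 1) + (sgl u' 1 - sgl u'' 1))"
    by (rule negligible_add[OF similar_negligible[OF assms(1)]])
  then show ?thesis using assms by (simp add: similar_def)
qed

text \<open>
  A product is replaced factor by factor; the error made in one factor is deeper, and it remains deeper
  in the product.
\<close>

lemma similar_Mul:
  assumes u: "similar U u u'" and v: "similar V v v'" and disj: "U \<inter> V = {}"
  shows "similar (U \<union> V) (Mul u v) (Mul u' v')"
proof -
  have on: "u \<in> monomials_on U" "u' \<in> monomials_on U" "v \<in> monomials_on V" "v' \<in> monomials_on V"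
    and d: "mdepth wt u = mdepth wt u'" "mdepth wt v = mdepth wt v'" using u v by (auto simp: similar_def)
  have "mul_right (sgl u 1 - sgl u' 1) v + mul_left u' (sgl v 1 - sgl v' 1) = sgl (Mul u v) 1 - sgl (Mul u' v') (1 :: 'k)"
    by (simp add: mul_right_def mul_left_def lin_ext_diff)
  moreover have "negligible (U \<union> V) (Suc (mdepth wt (Mul u v))) (mul_right (sgl u 1 - sgl u' 1) v)"
    using negligible_right[OF similar_negligible[OF u] on(3) disj] by (simp add: mweight_on[OF on(3)])
  moreover have "negligible (U \<union> V) (Suc (mdepth wt (Mul u v))) (mul_left u' (sgl v 1 - sgl v' 1))"
    using negligible_left[OF on(2) similar_negligible[OF v] disj] by (simp add: mweight_on[OF on(3)] d(1))
  ultimately have "negligible (U \<union> V) (Suc (mdepth wt (Mul u v))) (sgl (Mul u v) 1 - sgl (Mul u' v') 1)"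
    using negligible_add by metis
  then show ?thesis
    using on disj d by (auto simp: similar_def mweight_on)
qed

lemma mweight_pos: "0 < mweight wt u"
  by (induction u) (auto simp: wt_pos)

text \<open>
  In the relation for \<open>u\<close>, \<open>v\<close>, \<open>w\<close> the terms \<open>u (v w)\<close> and \<open>u (w v)\<close> are deeper than the other two, because
  weights are positive.
\<close>

lemma similar_swap:
  assumes u: "u \<in> monomials_on U" and v: "v \<in> monomials_on V" and w: "w \<in> monomials_on W"
    and disj: "U \<inter> V = {}" "U \<inter> W = {}" "V \<inter> W = {}"
  shows "similar (U \<union> V \<union> W) (Mul (Mul u v) w) (Mul (Mul u w) v)"
proof -
  let ?X = "U \<union> V \<union> W" and ?d = "Suc (mdepth wt (Mul (Mul u v) w))"
  have on: "Mul (Mul u v) w \<in> monomials_on ?X" "Mul (Mul u w) v \<in> monomials_on ?X"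
    "Mul u (Mul v w) \<in> monomials_on ?X" "Mul u (Mul w v) \<in> monomials_on ?X"
    using u v w disj by (auto simp: monomials_on_def)
  have deep: "negligible ?X ?d (sgl (Mul u (Mul v w)) c)" "negligible ?X ?d (sgl (Mul u (Mul w v)) c)" for c
    using on(3,4) mweight_pos[of v] mweight_pos[of w] by (auto intro!: negligible_deeper simp: deeper_def split: if_splits)
  have "negligible ?X ?d (relator lam wt u v w + (sgl (Mul u (Mul v w)) (lam ^ mweight wt w)
      + - sgl (Mul u (Mul w v)) (lam ^ mweight wt v)))"
    by (intro negligible_add negligible_minus deep negligible_null null.relator u v w disj)
  then have "negligible ?X ?d (sgl (Mul (Mul u v) w) 1 - sgl (Mul (Mul u w) v) 1)"
    by (simp add: relator_def algebra_simps)
  then show ?thesis using on by (simp add: similar_def)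
qed

text \<open>
  The child \<open>y\<close> of the root is the leftmost variable of a right factor of one of
  the products that start with the leftmost variable; swaps bring this factor to the outermost place.
\<close>

lemma similar_pull:
  "\<lbrakk>u \<in> monomials_on V; (y, leftmost u) \<in> shape u\<rbrakk> \<Longrightarrow>
    \<exists>v w. leftmost w = y \<and> leftmost v = leftmost u \<and> similar V u (Mul v w) \<and> shape (Mul v w) = shape u"
proof (induction u arbitrary: V)
  case (Mul a b)
  note E = Mul_monomials_onE[OF Mul.prems(1)]
  show ?case
  proof (cases "y = leftmost b")
    case True
    then show ?thesis using similar_refl[OF Mul.prems(1)] by (intro exI[of _ a] exI[of _ b]) simp
  next
    case False
    have "leftmost a \<notin> vars b" using E(3) leftmost_in_vars[of a] by blast
    then have "(y, leftmost a) \<in> shape a" using Mul.prems(2) False shape_sub[of b] by auto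
    then obtain v w where vw: "leftmost w = y" "leftmost v = leftmost a" "similar (vars a) a (Mul v w)"
      "shape (Mul v w) = shape a" using Mul.IH(1)[OF E(1)] by blast
    have on: "Mul v w \<in> monomials_on (vars a)" using vw(3) by (simp add: similar_def)
    note F = Mul_monomials_onE[OF on]
    have "similar V (Mul a b) (Mul (Mul v w) b)"
      using similar_Mul[OF vw(3) similar_refl[OF E(2)] E(3)] E(4) by simp
    moreover have "similar V (Mul (Mul v w) b) (Mul (Mul v b) w)"
      using similar_swap[OF F(1,2) E(2)] F(3,4) E(3,4) by auto
    ultimately have "similar V (Mul a b) (Mul (Mul v b) w)" by (rule similar_trans)
    moreover have "shape (Mul (Mul v b) w) = shape (Mul a b)" using vw(2,4) by auto
    ultimately show ?thesis using vw(1,2) by (intro exI[of _ "Mul v b"] exI[of _ w]) simp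
  qed
qed simp

text \<open>
  The variables of the right factor are the descendants of its leftmost variable in the shape. Hence
  the shape and the leftmost variable of the right factor determine the shapes of both factors.
\<close>

lemma shape_right_factor:
  assumes "Mul a b \<in> monomials_on V"
  shows "vars b = {z. (z, leftmost b) \<in> (shape (Mul a b))\<^sup>*}"
    and "shape b = shape (Mul a b) \<inter> vars b \<times> vars b" "shape a = shape (Mul a b) \<inter> vars a \<times> vars a"
proof -
  note E = Mul_monomials_onE[OF assms]
  have la: "leftmost a \<notin> vars b" "leftmost b \<notin> vars a"
    using E(3) leftmost_in_vars[of a] leftmost_in_vars[of b] by blast+
  note sub = shape_sub[of a] shape_sub[of b]
  show "shape b = shape (Mul a b) \<inter> vars b \<times> vars b" "shape a = shape (Mul a b) \<inter> vars a \<times> vars a"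
    using la sub E(3) by auto
  show "vars b = {z. (z, leftmost b) \<in> (shape (Mul a b))\<^sup>*}"
  proof (intro equalityI subsetI)
    fix z assume "z \<in> vars b"
    moreover have "tree_on (vars b) (leftmost b) (shape b)"
      using E(2) by (intro shape_tree) (simp add: monomials_on_def)
    ultimately have "(z, leftmost b) \<in> (shape b)\<^sup>*" by (simp add: tree_on_def)
    moreover have "shape b \<subseteq> shape (Mul a b)" by auto
    ultimately show "z \<in> {z. (z, leftmost b) \<in> (shape (Mul a b))\<^sup>*}" using rtrancl_mono by blast
  next
    fix z assume "z \<in> {z. (z, leftmost b) \<in> (shape (Mul a b))\<^sup>*}"
    then have "(z, leftmost b) \<in> (shape (Mul a b))\<^sup>*" by simp
    then show "z \<in> vars b"
    proof (induction rule: converse_rtrancl_induct)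
      case (step y z)
      then show ?case using la sub E(3) by auto
    qed simp
  qed
qed

lemma leftmost_determined:
  assumes "u \<in> monomials_on V" "u' \<in> monomials_on V" "shape u = shape u'"
  shows "leftmost u = leftmost u'"
  using shape_tree[of u] shape_tree[of u'] assms tree_on_unique_root[of V "leftmost u" "shape u" "leftmost u'"]
  by (simp add: monomials_on_def)

text \<open>
  Monomials of the same shape differ by permutations of the factors of their products, which the
  relations perform up to deeper monomials.
\<close>

lemma similar_same_shape:
  "\<lbrakk>u \<in> monomials_on V; u' \<in> monomials_on V; shape u = shape u'\<rbrakk> \<Longrightarrow> similar V u u'"
proof (induction u arbitrary: V u')
  case (Var x)
  have "u' = Var x"
  proof (cases u')
    case (Mul a b)
    have "leftmost a \<in> {x}" "leftmost b \<in> {x}" "vars a \<inter> vars b = {}"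
      using Var(1,2) Mul leftmost_in_vars[of a] leftmost_in_vars[of b] by (auto simp: monomials_on_def)
    then show ?thesis using leftmost_in_vars[of a] leftmost_in_vars[of b] by auto
  qed (use Var in \<open>auto simp: monomials_on_def\<close>)
  then show ?case using Var similar_refl by blast
next
  case (Mul a b)
  have "(leftmost b, leftmost u') \<in> shape u'"
    using leftmost_determined[OF Mul.prems] Mul.prems(3) by auto
  then obtain v w where vw: "leftmost w = leftmost b" "similar V u' (Mul v w)" "shape (Mul v w) = shape u'"
    using similar_pull[OF Mul.prems(2)] by blast
  have on: "Mul v w \<in> monomials_on V" using vw(2) by (simp add: similar_def)
  note E = Mul_monomials_onE[OF Mul.prems(1)] and F = Mul_monomials_onE[OF on]
  have sh: "shape (Mul v w) = shape (Mul a b)" using vw(3) Mul.prems(3) by (simp only:)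
  have wb: "vars w = vars b"
    using shape_right_factor(1)[OF on] shape_right_factor(1)[OF Mul.prems(1)] by (simp only: sh vw(1))
  then have va: "vars v = vars a" using E(3,4) F(3,4) by blast
  have "shape w = shape b" "shape v = shape a"
    using shape_right_factor(2,3)[OF on] shape_right_factor(2,3)[OF Mul.prems(1)] by (simp_all only: sh wb va)
  then have "similar (vars a) a v" "similar (vars b) b w"
    using Mul.IH(1)[OF E(1), of v] Mul.IH(2)[OF E(2), of w] F(1,2) va wb by simp_all
  then have "similar V (Mul a b) (Mul v w)" using similar_Mul[OF _ _ E(3)] E(4) by simp
  then show ?case using similar_sym[OF vw(2)] similar_trans by blast
qed

end

section \<open>Every tree is the shape of a monomial\<close>

lemma tree_on_descendants:
  assumes T: "tree_on V r E" and c: "(c, r) \<in> E"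
  defines "D \<equiv> {v \<in> V. (v, c) \<in> E\<^sup>*}"
  shows "tree_on D c (E \<inter> D \<times> D)" "tree_on (V - D) r (E \<inter> (V - D) \<times> (V - D))"
    "E = insert (c, r) ((E \<inter> (V - D) \<times> (V - D)) \<union> (E \<inter> D \<times> D))"
proof -
  have sub: "E \<subseteq> V \<times> V" and sv: "single_valued E" and r: "r \<in> V" "r \<notin> Domain E" using T by (auto simp: tree_on_def)
  have cV: "c \<in> V" using c sub by blast
  have rD: "r \<notin> D"
  proof
    assume "r \<in> D"
    then have "(r, c) \<in> E\<^sup>*" by (simp add: D_def)
    then have "r = c" using r(2) by (auto elim: converse_rtranclE)
    then show False using c r(2) by blast
  qed
  have down: "x \<in> D" if "(x, y) \<in> E" "y \<in> D" for x y
    using that sub by (auto simp: D_def intro: converse_rtrancl_into_rtrancl)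
  have up: "y \<in> D" if e: "(x, y) \<in> E" and x: "x \<in> D" "x \<noteq> c" for x y
  proof -
    have "(x, c) \<in> E\<^sup>*" using x by (simp add: D_def)
    then obtain z where "(x, z) \<in> E" "(z, c) \<in> E\<^sup>*" using x(2) by (auto elim: converse_rtranclE)
    then show ?thesis using single_valuedD[OF sv e] e sub by (auto simp: D_def)
  qed
  have cD: "c \<in> D" using cV by (simp add: D_def)
  show "E = insert (c, r) ((E \<inter> (V - D) \<times> (V - D)) \<union> (E \<inter> D \<times> D))"
  proof (intro equalityI subsetI)
    fix e assume e: "e \<in> E"
    obtain x y where xy: "e = (x, y)" by (cases e)
    have V: "x \<in> V" "y \<in> V" using e xy sub by auto
    consider "x = c" | "x \<in> D" "x \<noteq> c" | "x \<notin> D" by blast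
    then show "e \<in> insert (c, r) ((E \<inter> (V - D) \<times> (V - D)) \<union> (E \<inter> D \<times> D))"
    proof cases
      case 1
      then show ?thesis using single_valuedD[OF sv c] e xy by simp
    next
      case 2
      then show ?thesis using up e xy by blast
    next
      case 3
      then show ?thesis using down e xy V by blast
    qed
  qed (use c in auto)
  have sv': "single_valued (E \<inter> A)" for A by (rule single_valued_subset[OF _ sv]) blast
  have "c \<notin> Domain (E \<inter> D \<times> D)"
  proof
    assume "c \<in> Domain (E \<inter> D \<times> D)"
    then obtain y where "(c, y) \<in> E" "y \<in> D" by blast
    then show False using single_valuedD[OF sv c] rD by blast
  qed
  moreover have "(v, c) \<in> (E \<inter> D \<times> D)\<^sup>*" if "v \<in> D" for v
  proof -
    have "(v, c) \<in> E\<^sup>*" using that by (simp add: D_def)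
    then show ?thesis
    proof (induction rule: converse_rtrancl_induct)
      case (step y z)
      then have "z \<in> D" using sub by (auto simp: D_def)
      then have "(y, z) \<in> E \<inter> D \<times> D" using down step(1) by blast
      then show ?case using step(3) by (rule converse_rtrancl_into_rtrancl)
    qed simp
  qed
  ultimately show "tree_on D c (E \<inter> D \<times> D)" using cD sv' by (simp add: tree_on_def)
  have "v \<notin> D \<longrightarrow> (v, r) \<in> (E \<inter> (V - D) \<times> (V - D))\<^sup>*" if "v \<in> V" for v
    using T that
  proof (induction rule: tree_on_induct)
    case (edge x y)
    show ?case
    proof
      assume x: "x \<notin> D"
      then have "y \<notin> D" using down edge(1) by blast
      then have "(x, y) \<in> E \<inter> (V - D) \<times> (V - D)" using x edge(1) sub by blast
      then show "(x, r) \<in> (E \<inter> (V - D) \<times> (V - D))\<^sup>*"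
        using edge(2) \<open>y \<notin> D\<close> by (blast intro: converse_rtrancl_into_rtrancl)
    qed
  qed simp
  then show "tree_on (V - D) r (E \<inter> (V - D) \<times> (V - D))" using r rD sv' by (auto simp: tree_on_def)
qed

text \<open>
  The subtree below a child of the root is the shape of a right factor, and the rest of the tree that
  of a left factor.
\<close>

lemma shape_surj:
  "\<lbrakk>finite V; tree_on V r E\<rbrakk> \<Longrightarrow> \<exists>u\<in>monomials_on V. leftmost u = r \<and> shape u = E"
proof (induction "card V" arbitrary: V r E rule: less_induct)
  case less
  note T = less.prems(2)
  show ?case
  proof (cases "V = {r}")
    case True
    then have "E = {}" using T by (auto simp: tree_on_def)
    then show ?thesis using True by (intro bexI[of _ "Var r"]) (auto simp: monomials_on_def)
  next
    case False
    have r: "r \<in> V" using T by (simp add: tree_on_def)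
    then obtain v where v: "v \<in> V" "v \<noteq> r" using False by blast
    have "(v, r) \<in> E\<^sup>*" using T v by (simp add: tree_on_def)
    then obtain c where c: "(c, r) \<in> E" using v(2) by (auto elim: rtranclE)
    define D where "D = {v \<in> V. (v, c) \<in> E\<^sup>*}"
    note split = tree_on_descendants[OF T c, folded D_def]
    have D: "D \<subseteq> V" "c \<in> D" "r \<notin> D"
      using split(1,2) by (auto simp: tree_on_def D_def)
    have "card D < card V" "card (V - D) < card V"
      using D r less.prems(1) by (auto intro!: psubset_card_mono)
    then obtain a b where a: "a \<in> monomials_on (V - D)" "leftmost a = r" "shape a = E \<inter> (V - D) \<times> (V - D)"
      and b: "b \<in> monomials_on D" "leftmost b = c" "shape b = E \<inter> D \<times> D"
      using less.hyps[OF _ _ split(1)] less.hyps[OF _ _ split(2)] less.prems(1) D(1) finite_subset by blast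
    have "Mul a b \<in> monomials_on ((V - D) \<union> D)" using a(1) b(1) by (rule Mul_in_monomials_on) blast
    moreover have "(V - D) \<union> D = V" using D(1) by blast
    moreover have "shape (Mul a b) = E" using split(3) a b by simp
    ultimately show ?thesis using a(2) by (intro bexI[of _ "Mul a b"]) simp_all
  qed
qed

section \<open>Operadic ideals containing the relations\<close>

lemma subst_map_monomial:
  "(\<And>x. x \<in> vars w \<Longrightarrow> g x \<noteq> i) \<Longrightarrow>
    subst_monomial (map_monomial g w) (insertion i m z) = map_monomial (shift i m \<circ> g) w"
  by (induction w) (auto simp: insertion_def)

lemma map_monomial_cong: "(\<And>x. x \<in> vars u \<Longrightarrow> f x = g x) \<Longrightarrow> map_monomial f u = map_monomial g u"
  by (induction u) auto

lemma map_monomial_map: "map_monomial f (map_monomial g u) = map_monomial (f \<circ> g) u"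
  by (induction u) auto

lemma map_monomial_id [simp]: "map_monomial id u = u" "map_monomial (\<lambda>x. x) u = u"
  by (induction u) auto

lemma map_monomial_add_zero [simp]: "map_monomial ((+) (0 :: nat)) u = u"
  by (induction u) auto

text \<open>
  A numbering \<open>h\<close> of the variables in \<open>V\<close> by an initial segment, together with the multidegree that gives
  each of them its weight. It turns a linear combination of monomials on \<open>V\<close> into one in a component of
  the free operad.
\<close>

definition labelling :: "(nat \<Rightarrow> nat) \<Rightarrow> nat set \<Rightarrow> nat \<Rightarrow> (nat \<Rightarrow> nat) \<Rightarrow> nat list \<Rightarrow> bool" where
  "labelling wt V n h a \<longleftrightarrow> 0 < n \<and> bij_betw h V {..<n} \<and> a \<in> degrees n \<and> (\<forall>v\<in>V. a ! h v = wt v)"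

lemma labelling_monomial:
  assumes "labelling wt V n h a" "u \<in> monomials_on V"
  shows "map_monomial h u \<in> monomials n"
  using assms by (auto simp: labelling_def monomials_on_def monomials_def distinct_map bij_betw_def)

lemma labelling_weight:
  assumes L: "labelling wt V n h a" and u: "u \<in> monomials_on V"
  shows "sum_list a = mweight wt u"
proof -
  have "sum_list a = (\<Sum>j<n. a ! j)" using L by (simp add: labelling_def degrees_def sum_list_sum_nth atLeast0LessThan)
  also have "\<dots> = (\<Sum>v\<in>V. a ! h v)"
    using L sum.reindex_bij_betw[of h V "{..<n}" "\<lambda>j. a ! j"] by (simp add: labelling_def)
  also have "\<dots> = (\<Sum>v\<in>V. wt v)" using L by (simp add: labelling_def)
  finally show ?thesis by (simp add: mweight_on[OF u])
qed

lemma labelling_exists: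
  assumes "finite V" "V \<noteq> {}" "\<And>v. 0 < wt v"
  shows "\<exists>n h a. labelling wt V n h a"
proof -
  obtain h where h: "bij_betw h V {0..<card V}" using ex_bij_betw_finite_nat[OF assms(1)] by blast
  define a where "a = map (\<lambda>j. wt (inv_into V h j)) [0..<card V]"
  have "a ! h v = wt v" if "v \<in> V" for v
  proof -
    have "h v < card V" using h that by (auto simp: bij_betw_def)
    moreover have "inv_into V h (h v) = v" using h that by (simp add: bij_betw_def)
    ultimately show ?thesis by (simp add: a_def)
  qed
  moreover have "a \<in> degrees (card V)" using assms(3) by (auto simp: a_def degrees_def)
  moreover have "0 < card V" using assms by (simp add: card_gt_0_iff)
  ultimately have "labelling wt V (card V) h a" using h by (simp add: labelling_def atLeast0LessThan)
  then show ?thesis by blast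
qed

lemma labelling_join:
  assumes L1: "labelling wt V1 n1 h1 a1" and L2: "labelling wt V2 n2 h2 a2" and disj: "V1 \<inter> V2 = {}"
  shows "labelling wt (V1 \<union> V2) (n1 + n2) (\<lambda>v. if v \<in> V1 then h1 v else n1 + h2 v) (a1 @ a2)"
proof -
  let ?h = "\<lambda>v. if v \<in> V1 then h1 v else n1 + h2 v"
  have b1: "bij_betw h1 V1 {..<n1}" and b2: "bij_betw h2 V2 {..<n2}" using L1 L2 by (auto simp: labelling_def)
  have notin: "v \<notin> V1" if "v \<in> V2" for v using disj that by blast
  have c1: "bij_betw ?h V1 {..<n1}" using b1 by (rule bij_betw_cong[THEN iffD1, rotated]) simp
  have "bij_betw ((+) n1) {..<n2} {n1..<n1 + n2}"
    by (rule bij_betwI[where g = "\<lambda>x. x - n1"]) auto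
  from bij_betw_trans[OF b2 this] have "bij_betw (\<lambda>v. n1 + h2 v) V2 {n1..<n1 + n2}"
    unfolding o_def .
  then have c2: "bij_betw ?h V2 {n1..<n1 + n2}"
    by (rule bij_betw_cong[THEN iffD1, rotated]) (simp add: notin)
  have "bij_betw ?h (V1 \<union> V2) ({..<n1} \<union> {n1..<n1 + n2})"
    by (rule bij_betw_combine[OF c1 c2]) auto
  moreover have "{..<n1} \<union> {n1..<n1 + n2} = {..<n1 + n2}" by auto
  moreover have "(a1 @ a2) ! ?h v = wt v" if "v \<in> V1 \<union> V2" for v
  proof (cases "v \<in> V1")
    case True
    then have "h1 v < n1" using b1 by (auto simp: bij_betw_def)
    then show ?thesis using True L1 by (simp add: labelling_def degrees_def nth_append)
  next
    case False
    then show ?thesis using that L1 L2 by (simp add: labelling_def degrees_def nth_append)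
  qed
  moreover have "a1 @ a2 \<in> degrees (n1 + n2)" using L1 L2 by (auto simp: labelling_def degrees_def)
  ultimately show ?thesis using L1 by (simp add: labelling_def)
qed

definition relabel :: "('a \<Rightarrow> 'b) \<Rightarrow> ('a monomial \<Rightarrow>\<^sub>0 'k::field) \<Rightarrow> ('b monomial \<Rightarrow>\<^sub>0 'k)" where
  "relabel h = lin_ext (\<lambda>u. sgl (map_monomial h u) 1)"

lemma cmp_free: "cmp free_operad a = free_vs (monomials (length a))"
  by (simp add: free_operad_def basis_operad_def)

lemma cmp_tree: "cmp (tree_operad lam) a = free_vs (rooted_trees (length a))"
  by (simp add: tree_operad_def basis_operad_def)

locale PL_ideal =
  fixes lam :: "'k::field" and J :: "nat list \<Rightarrow> (nat monomial \<Rightarrow>\<^sub>0 'k) set"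
  assumes ideal: "mg_ideal free_operad J" and relations: "PL_relations lam b \<subseteq> J b"
begin

lemma subspace:
  assumes "0 < n" "a \<in> degrees n"
  shows "p \<in> J a \<Longrightarrow> supp p \<subseteq> monomials n" "0 \<in> J a" "\<lbrakk>p \<in> J a; q \<in> J a\<rbrakk> \<Longrightarrow> p + q \<in> J a"
    "p \<in> J a \<Longrightarrow> scale c p \<in> J a"
proof -
  have "lin_subspace (cmp free_operad a) (J a)" using ideal assms by (simp add: mg_ideal_def)
  moreover have "length a = n" using assms by (simp add: degrees_def)
  ultimately show "p \<in> J a \<Longrightarrow> supp p \<subseteq> monomials n" "0 \<in> J a" "\<lbrakk>p \<in> J a; q \<in> J a\<rbrakk> \<Longrightarrow> p + q \<in> J a"
    "p \<in> J a \<Longrightarrow> scale c p \<in> J a"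
    by (auto simp: lin_subspace_def cmp_free free_vs_def)
qed

definition component :: "nat \<Rightarrow> nat list \<Rightarrow> (nat monomial \<Rightarrow>\<^sub>0 'k) \<Rightarrow> nat list \<Rightarrow> (nat monomial \<Rightarrow>\<^sub>0 'k)" where
  "component n a p = (\<lambda>c\<in>degrees n. if c = a then p else 0)"

lemma component_ideal: "\<lbrakk>0 < n; p \<in> J a\<rbrakk> \<Longrightarrow> component n a p \<in> Pi\<^sub>E (degrees n) J"
  by (auto simp: component_def subspace(2))

lemma component_ops: "supp p \<subseteq> monomials n \<Longrightarrow> component n a p \<in> ops free_operad n"
  unfolding component_def by (rule free.restrict_in_ops) auto

lemma pcomp_component:
  assumes "0 < m" "i < n" "a \<in> degrees n" "b \<in> degrees m" "sum_list b = a ! i"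
  shows "pcomp free_operad n m i (component n a p) (component m b q) (subst_degrees a i b) =
    bilin_ext (monomial_comp a b i) p q"
proof -
  have len: "length a = n" "length b = m" using assms by (auto simp: degrees_def)
  have "outer_degrees i m (subst_degrees a i b) = a" "inner_degrees i m (subst_degrees a i b) = b"
    using outer_degrees_subst[of i a b] inner_degrees_subst[of i a b] assms len by simp_all
  then show ?thesis
    using subst_degrees_in[OF assms(3,4,2)] assms(3,4) by (simp add: free.pcomp_P component_def)
qed

lemma comp_left:
  assumes *: "0 < m" "i < n" "a \<in> degrees n" "b \<in> degrees m" "sum_list b = a ! i" and w: "w \<in> monomials m" and p: "p \<in> J a"
  shows "lin_ext (\<lambda>u. sgl (subst_monomial u (insertion i m w)) 1) p \<in> J (subst_degrees a i b)"
proof -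
  have n: "0 < n" using * by simp
  have "component m b (sgl w 1) \<in> ops free_operad m" using w by (intro component_ops) simp
  then have "pcomp free_operad n m i (component n a p) (component m b (sgl w 1)) \<in> Pi\<^sub>E (degrees (n + m - 1)) J"
    using ideal n *(1,2) component_ideal[OF n p] by (simp add: mg_ideal_def)
  then have "bilin_ext (monomial_comp a b i) p (sgl w 1) \<in> J (subst_degrees a i b)"
    unfolding pcomp_component[OF *, symmetric] by (rule PiE_mem[OF _ subst_degrees_in[OF *(3,4,2)]])
  moreover have "length b = m" using * by (simp add: degrees_def)
  ultimately show ?thesis using *(5) by (simp add: bilin_ext_def monomial_comp_eq)
qed

lemma comp_right:
  assumes *: "0 < m" "i < n" "a \<in> degrees n" "b \<in> degrees m" "sum_list b = a ! i" and u: "u \<in> monomials n" and p: "p \<in> J b"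
  shows "lin_ext (\<lambda>w. sgl (subst_monomial u (insertion i m w)) 1) p \<in> J (subst_degrees a i b)"
proof -
  have n: "0 < n" using * by simp
  have "component n a (sgl u 1) \<in> ops free_operad n" using u by (intro component_ops) simp
  then have "pcomp free_operad n m i (component n a (sgl u 1)) (component m b p) \<in> Pi\<^sub>E (degrees (n + m - 1)) J"
    using ideal n *(1,2) component_ideal[OF *(1) p] by (simp add: mg_ideal_def)
  then have "bilin_ext (monomial_comp a b i) (sgl u 1) p \<in> J (subst_degrees a i b)"
    unfolding pcomp_component[OF *, symmetric] by (rule PiE_mem[OF _ subst_degrees_in[OF *(3,4,2)]])
  moreover have "monomial_comp a b i u = (\<lambda>w. sgl (subst_monomial u (insertion i m w)) (1 :: 'k))"
    using *(4,5) by (intro ext) (simp add: monomial_comp_eq degrees_def)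
  ultimately show ?thesis by (simp add: bilin_ext_def)
qed

lemma act_ideal:
  assumes n: "0 < n" and a: "a \<in> degrees n" and \<sigma>: "\<sigma> permutes {..<n}" and p: "p \<in> J a"
  shows "relabel (inv \<sigma>) p \<in> J (permute_list \<sigma> a)"
proof -
  note a' = permute_list_in_degrees[OF \<sigma> a]
  have "act free_operad n (component n a p) \<sigma> \<in> Pi\<^sub>E (degrees n) J"
    using ideal n \<sigma> component_ideal[OF n p] by (simp add: mg_ideal_def)
  then have "act free_operad n (component n a p) \<sigma> (permute_list \<sigma> a) \<in> J (permute_list \<sigma> a)"
    by (rule PiE_mem[OF _ a'])
  moreover have "permute_list (inv \<sigma>) (permute_list \<sigma> a) = a"
    using permute_list_inv(1)[OF \<sigma>, of a] a by (simp add: degrees_def)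
  ultimately show ?thesis using a a' by (simp add: free.act_P component_def relabel_def)
qed

text \<open>Membership in the ideal does not depend on how the variables are numbered, by equivariance.\<close>

lemma relabel_in_ideal:
  assumes L: "labelling wt V n h a" and L': "labelling wt V n' h' a'" and p: "supp p \<subseteq> monomials_on V"
    and mem: "relabel h' p \<in> J a'"
  shows "relabel h p \<in> J a"
proof -
  have b: "bij_betw h V {..<n}" and b': "bij_betw h' V {..<n'}" using L L' by (auto simp: labelling_def)
  have nn: "n' = n" using bij_betw_same_card[OF b] bij_betw_same_card[OF b'] by simp
  define \<sigma> where "\<sigma> x = (if x < n then h' (inv_into V h x) else x)" for x
  have \<sigma>h: "\<sigma> (h v) = h' v" if "v \<in> V" for v
    using that b by (auto simp: \<sigma>_def bij_betw_def)
  have "bij_betw (h' \<circ> inv_into V h) {..<n} {..<n}"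
    using bij_betw_trans[OF bij_betw_inv_into[OF b] b'] nn by simp
  then have "bij_betw \<sigma> {..<n} {..<n}"
    by (rule bij_betw_cong[THEN iffD1, rotated]) (simp add: \<sigma>_def)
  then have \<sigma>: "\<sigma> permutes {..<n}" by (rule bij_imp_permutes) (simp add: \<sigma>_def)
  have "permute_list \<sigma> a' = a"
  proof (rule nth_equalityI)
    show "length (permute_list \<sigma> a') = length a" using L L' nn by (simp add: labelling_def degrees_def)
    fix j assume "j < length (permute_list \<sigma> a')"
    then have j: "j < n" "length a' = n" using L' nn by (simp_all add: labelling_def degrees_def)
    then obtain v where v: "v \<in> V" "j = h v" using b by (metis bij_betw_iff_bijections lessThan_iff)
    then show "permute_list \<sigma> a' ! j = a ! j"
      using L L' j \<sigma> \<sigma>h[OF v(1)] by (simp add: permute_list_nth labelling_def)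
  qed
  moreover have "relabel (inv \<sigma>) (relabel h' p) = relabel h p"
  proof -
    have "inv \<sigma> (h' v) = h v" if "v \<in> V" for v
      using \<sigma>h[OF that] permutes_inverses(2)[OF \<sigma>] by metis
    then have "map_monomial (inv \<sigma>) (map_monomial h' u) = map_monomial h u" if "u \<in> supp p" for u
      unfolding map_monomial_map using subsetD[OF p that] by (intro map_monomial_cong) (simp add: monomials_on_def)
    then show ?thesis by (simp add: relabel_def lin_ext_lin_ext cong: lin_ext_cong)
  qed
  moreover have "0 < n'" "a' \<in> degrees n'" using L' by (auto simp: labelling_def)
  ultimately show ?thesis using act_ideal[OF _ _ _ mem, of n' \<sigma>] \<sigma> nn by simp
qed

lemma comp_sgl:
  assumes "0 < m" "i < n" "a \<in> degrees n" "b \<in> degrees m" "sum_list b = a ! i" "w \<in> monomials m"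
    and mem: "sgl u1 c1 - sgl u2 c2 - sgl u3 c3 + sgl u4 c4 \<in> J a"
  shows "sgl (subst_monomial u1 (insertion i m w)) c1 - sgl (subst_monomial u2 (insertion i m w)) c2
    - sgl (subst_monomial u3 (insertion i m w)) c3 + sgl (subst_monomial u4 (insertion i m w)) c4 \<in> J (subst_degrees a i b)"
  using comp_left[OF assms] by (simp add: lin_ext_add lin_ext_diff)

text \<open>
  The monomials are inserted into the defining relation at the inputs \<open>2\<close>, \<open>1\<close> and \<open>0\<close>, in this order, so
  that the inputs still to be filled keep their numbers.
\<close>

lemma relator_in_ideal:
  assumes u: "u \<in> monomials_on U" and v: "v \<in> monomials_on V" and w: "w \<in> monomials_on W"
    and disj: "U \<inter> V = {}" "U \<inter> W = {}" "V \<inter> W = {}"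
    and L: "labelling wt U n1 h1 a1" "labelling wt V n2 h2 a2" "labelling wt W n3 h3 a3"
  shows "\<exists>n h a. labelling wt (U \<union> V \<union> W) n h a \<and> relabel h (relator lam wt u v w) \<in> J a"
proof -
  define h where "h x = (if x \<in> U \<union> V then if x \<in> U then h1 x else n1 + h2 x else n1 + n2 + h3 x)" for x
  have Lh: "labelling wt (U \<union> V \<union> W) (n1 + n2 + n3) h ((a1 @ a2) @ a3)"
    unfolding h_def using labelling_join[OF labelling_join[OF L(1,2) disj(1)] L(3)] disj by auto
  have n: "0 < n1" "0 < n2" "0 < n3" and a: "a1 \<in> degrees n1" "a2 \<in> degrees n2" "a3 \<in> degrees n3"
    using L by (auto simp: labelling_def)
  have len: "length a1 = n1" "length a2 = n2" "length a3 = n3" using a by (auto simp: degrees_def)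
  define u' v' w' where "u' = map_monomial h1 u" and "v' = map_monomial h2 v" and "w' = map_monomial h3 w"
  have mon: "u' \<in> monomials n1" "v' \<in> monomials n2" "w' \<in> monomials n3"
    unfolding u'_def v'_def w'_def using labelling_monomial L u v w by blast+
  define k l m where "k = sum_list a1" and "l = sum_list a2" and "m = sum_list a3"
  have wts: "l = mweight wt v" "m = mweight wt w"
    unfolding l_def m_def using labelling_weight L v w by blast+
  have pos: "0 < sum_list c" if "0 < q" "c \<in> degrees q" for c q
    using that by (cases c) (auto simp: degrees_def)
  have klm: "0 < k" "0 < l" "0 < m" unfolding k_def l_def m_def using pos n a by blast+
  have "PL_element lam k l m \<in> J [k, l, m]"
    using relations[of "[k, l, m]"] klm by (auto simp: PL_relations_def)
  then have 0: "sgl (Mul (Mul (Var 0) (Var 1)) (Var 2)) 1 - sgl (Mul (Var 0) (Mul (Var 1) (Var 2))) (lam ^ m)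
     - sgl (Mul (Mul (Var 0) (Var 2)) (Var 1)) 1 + sgl (Mul (Var 0) (Mul (Var 2) (Var 1))) (lam ^ l) \<in> J [k, l, m]"
    by (simp add: PL_element_def)
  have shift_eq: "shift 2 n3 0 = 0" "shift 2 n3 1 = 1" "shift 1 n2 0 = 0"
    "shift 1 n2 \<circ> (+) 2 = (+) (1 + n2)" "shift 0 n1 \<circ> (+) 1 = (+) n1" "shift 0 n1 \<circ> (+) (1 + n2) = (+) (n1 + n2)"
    using n by (auto simp: shift_def fun_eq_iff)
  have s3: "subst_monomial (Var 0) (insertion 2 n3 w') = Var 0" "subst_monomial (Var 1) (insertion 2 n3 w') = Var 1"
    "subst_monomial (Var 2) (insertion 2 n3 w') = map_monomial ((+) 2) w'"
    by (simp_all add: insertion_def shift_eq)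
  have c3: "2 < (3 :: nat)" "[k, l, m] \<in> degrees 3" "sum_list a3 = [k, l, m] ! 2"
    using klm by (simp_all add: degrees_def m_def)
  have "sgl (Mul (Mul (Var 0) (Var 1)) (map_monomial ((+) 2) w')) 1
     - sgl (Mul (Var 0) (Mul (Var 1) (map_monomial ((+) 2) w'))) (lam ^ m)
     - sgl (Mul (Mul (Var 0) (map_monomial ((+) 2) w')) (Var 1)) 1
     + sgl (Mul (Var 0) (Mul (map_monomial ((+) 2) w') (Var 1))) (lam ^ l) \<in> J (subst_degrees [k, l, m] 2 a3)"
    by (rule comp_sgl[OF n(3) c3(1,2) a(3) c3(3) mon(3) 0, unfolded subst_monomial.simps(2) s3])
  moreover have "subst_degrees [k, l, m] 2 a3 = [k, l] @ a3" by (simp add: subst_degrees_def)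
  ultimately have 1: "sgl (Mul (Mul (Var 0) (Var 1)) (map_monomial ((+) 2) w')) 1
     - sgl (Mul (Var 0) (Mul (Var 1) (map_monomial ((+) 2) w'))) (lam ^ m)
     - sgl (Mul (Mul (Var 0) (map_monomial ((+) 2) w')) (Var 1)) 1
     + sgl (Mul (Var 0) (Mul (map_monomial ((+) 2) w') (Var 1))) (lam ^ l) \<in> J ([k, l] @ a3)" by (simp only:)
  have s2: "subst_monomial (Var 0) (insertion 1 n2 v') = Var 0"
    "subst_monomial (Var 1) (insertion 1 n2 v') = map_monomial ((+) 1) v'"
    "subst_monomial (map_monomial ((+) 2) w') (insertion 1 n2 v') = map_monomial ((+) (1 + n2)) w'"
  proof -
    show "subst_monomial (Var 0) (insertion 1 n2 v') = Var 0"
      "subst_monomial (Var 1) (insertion 1 n2 v') = map_monomial ((+) 1) v'"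
      by (simp_all add: insertion_def shift_eq)
    show "subst_monomial (map_monomial ((+) 2) w') (insertion 1 n2 v') = map_monomial ((+) (1 + n2)) w'"
      by (subst subst_map_monomial) (arith, simp only: shift_eq)
  qed
  have d1: "[k, l] @ a3 \<in> degrees (2 + n3)" using klm a(3) by (auto simp: degrees_def)
  have c2: "1 < 2 + n3" "sum_list a2 = ([k, l] @ a3) ! 1" by (simp_all add: l_def)
  have "sgl (Mul (Mul (Var 0) (map_monomial ((+) 1) v')) (map_monomial ((+) (1 + n2)) w')) 1
     - sgl (Mul (Var 0) (Mul (map_monomial ((+) 1) v') (map_monomial ((+) (1 + n2)) w'))) (lam ^ m)
     - sgl (Mul (Mul (Var 0) (map_monomial ((+) (1 + n2)) w')) (map_monomial ((+) 1) v')) 1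
     + sgl (Mul (Var 0) (Mul (map_monomial ((+) (1 + n2)) w') (map_monomial ((+) 1) v'))) (lam ^ l)
     \<in> J (subst_degrees ([k, l] @ a3) 1 a2)"
    by (rule comp_sgl[OF n(2) c2(1) d1 a(2) c2(2) mon(2) 1, unfolded subst_monomial.simps(2) s2])
  moreover have "subst_degrees ([k, l] @ a3) 1 a2 = [k] @ a2 @ a3" by (simp add: subst_degrees_def One_nat_def)
  ultimately have 2: "sgl (Mul (Mul (Var 0) (map_monomial ((+) 1) v')) (map_monomial ((+) (1 + n2)) w')) 1
     - sgl (Mul (Var 0) (Mul (map_monomial ((+) 1) v') (map_monomial ((+) (1 + n2)) w'))) (lam ^ m)
     - sgl (Mul (Mul (Var 0) (map_monomial ((+) (1 + n2)) w')) (map_monomial ((+) 1) v')) 1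
     + sgl (Mul (Var 0) (Mul (map_monomial ((+) (1 + n2)) w') (map_monomial ((+) 1) v'))) (lam ^ l)
     \<in> J ([k] @ a2 @ a3)" by (simp only:)
  have s1: "subst_monomial (Var 0) (insertion 0 n1 u') = u'"
    "subst_monomial (map_monomial ((+) 1) v') (insertion 0 n1 u') = map_monomial ((+) n1) v'"
    "subst_monomial (map_monomial ((+) (1 + n2)) w') (insertion 0 n1 u') = map_monomial ((+) (n1 + n2)) w'"
  proof -
    show "subst_monomial (Var 0) (insertion 0 n1 u') = u'" by (simp add: insertion_def)
    show "subst_monomial (map_monomial ((+) 1) v') (insertion 0 n1 u') = map_monomial ((+) n1) v'"
      by (subst subst_map_monomial) (arith, simp only: shift_eq)
    show "subst_monomial (map_monomial ((+) (1 + n2)) w') (insertion 0 n1 u') = map_monomial ((+) (n1 + n2)) w'"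
      by (subst subst_map_monomial) (arith, simp only: shift_eq)
  qed
  have d2: "[k] @ a2 @ a3 \<in> degrees (1 + n2 + n3)" using klm a by (auto simp: degrees_def)
  have c1: "0 < 1 + n2 + n3" "sum_list a1 = ([k] @ a2 @ a3) ! 0" by (simp_all add: k_def)
  have "sgl (Mul (Mul u' (map_monomial ((+) n1) v')) (map_monomial ((+) (n1 + n2)) w')) 1
     - sgl (Mul u' (Mul (map_monomial ((+) n1) v') (map_monomial ((+) (n1 + n2)) w'))) (lam ^ m)
     - sgl (Mul (Mul u' (map_monomial ((+) (n1 + n2)) w')) (map_monomial ((+) n1) v')) 1
     + sgl (Mul u' (Mul (map_monomial ((+) (n1 + n2)) w') (map_monomial ((+) n1) v'))) (lam ^ l)
     \<in> J (subst_degrees ([k] @ a2 @ a3) 0 a1)"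
    by (rule comp_sgl[OF n(1) c1(1) d2 a(1) c1(2) mon(1) 2, unfolded subst_monomial.simps(2) s1])
  moreover have "subst_degrees ([k] @ a2 @ a3) 0 a1 = (a1 @ a2) @ a3" by (simp add: subst_degrees_def)
  moreover have "map_monomial h u = u'" "map_monomial h v = map_monomial ((+) n1) v'"
    "map_monomial h w = map_monomial ((+) (n1 + n2)) w'"
    unfolding u'_def v'_def w'_def map_monomial_map
    using u v w disj by (auto intro!: map_monomial_cong simp: h_def monomials_on_def)
  ultimately have "relabel h (relator lam wt u v w) \<in> J ((a1 @ a2) @ a3)"
    by (simp add: relabel_def relator_def lin_ext_add lin_ext_diff wts)
  with Lh show ?thesis by blast
qed

lemma monomials_on_finite: "u \<in> monomials_on V \<Longrightarrow> finite V \<and> V \<noteq> {}"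
  by (auto simp: monomials_on_def)

lemma labelling_exists_on:
  assumes "u \<in> monomials_on V" "\<And>v. 0 < wt v"
  obtains n h a where "labelling wt V n h a"
proof -
  have "finite V" "V \<noteq> {}" using monomials_on_finite[OF assms(1)] by auto
  then have "\<exists>n h a. labelling wt V n h a" using assms(2) by (rule labelling_exists)
  then show thesis by (elim exE) (rule that)
qed

text \<open>
  Multiplication by a monomial is insertion into the product of this monomial with one variable.
\<close>

lemma null_in_ideal:
  assumes wt: "\<And>x. 0 < wt x"
  shows "null lam wt V p \<Longrightarrow> supp p \<subseteq> monomials_on V \<and> (\<forall>n h a. labelling wt V n h a \<longrightarrow> relabel h p \<in> J a)"
proof (induction rule: null.induct)
  case (relator u U v V w W)
  have on: "Mul (Mul u v) w \<in> monomials_on (U \<union> V \<union> W)" "Mul u (Mul v w) \<in> monomials_on (U \<union> V \<union> W)"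
    "Mul (Mul u w) v \<in> monomials_on (U \<union> V \<union> W)" "Mul u (Mul w v) \<in> monomials_on (U \<union> V \<union> W)"
    using relator by (auto simp: monomials_on_def)
  have sub: "supp (p - q) \<subseteq> A" "supp (p + q) \<subseteq> A" if "supp p \<subseteq> A" "supp q \<subseteq> A" for p q :: "nat monomial \<Rightarrow>\<^sub>0 'k" and A
    using that keys_add[of p q] keys_diff[of p q] by blast+
  have supp: "supp (relator lam wt u v w) \<subseteq> monomials_on (U \<union> V \<union> W)"
    unfolding relator_def using on by (intro sub) simp_all
  obtain n1 h1 a1 where L1: "labelling wt U n1 h1 a1" using labelling_exists_on[OF relator(1) wt] .
  obtain n2 h2 a2 where L2: "labelling wt V n2 h2 a2" using labelling_exists_on[OF relator(2) wt] .
  obtain n3 h3 a3 where L3: "labelling wt W n3 h3 a3" using labelling_exists_on[OF relator(3) wt] .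
  obtain n h a where L: "labelling wt (U \<union> V \<union> W) n h a" "relabel h (relator lam wt u v w) \<in> J a"
    using relator_in_ideal[OF relator L1 L2 L3] by (elim exE conjE)
  show ?case
  proof (intro conjI supp allI impI)
    fix n' h' a' assume "labelling wt (U \<union> V \<union> W) n' h' a'"
    then show "relabel h' (relator lam wt u v w) \<in> J a'" by (rule relabel_in_ideal[OF _ L(1) supp L(2)])
  qed
next
  case (zero V)
  then show ?case using subspace(2) by (auto simp: relabel_def labelling_def)
next
  case (add V p q)
  then show ?case using keys_add[of p q] subspace(3) by (auto simp: relabel_def labelling_def lin_ext_add)
next
  case (scale V p c)
  then show ?case using supp_scale[of c p] subspace(4) by (auto simp: relabel_def labelling_def lin_ext_scale)
next
  case (left u U V p)
  note p_on = conjunct1[OF left.IH] and p_J = conjunct2[OF left.IH, rule_format]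
  have supp: "supp (mul_left u p) \<subseteq> monomials_on (U \<union> V)"
    unfolding mul_left_def using left by (intro supp_lin_ext_subset) auto
  show ?case
  proof (cases "p = 0")
    case True
    then show ?thesis using subspace(2) by (auto simp: relabel_def mul_left_def labelling_def)
  next
    case False
    then have "supp p \<noteq> {}" by simp
    then obtain v0 where "v0 \<in> supp p" by blast
    then have v0: "v0 \<in> monomials_on V" by (rule subsetD[OF p_on])
    obtain n1 h1 a1 where L1: "labelling wt U n1 h1 a1" using labelling_exists_on[OF left.hyps(1) wt] .
    obtain n2 h2 a2 where L2: "labelling wt V n2 h2 a2" using labelling_exists_on[OF v0 wt] .
    note L = L1 L2
    have n: "0 < n1" "0 < n2" and a: "a1 \<in> degrees n1" "a2 \<in> degrees n2" using L by (auto simp: labelling_def)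
    define h where "h x = (if x \<in> U then h1 x else n1 + h2 x)" for x
    have Lh: "labelling wt (U \<union> V) (n1 + n2) h (a1 @ a2)" unfolding h_def by (rule labelling_join[OF L left.hyps(3)])
    define u' where "u' = map_monomial h1 u"
    have u': "u' \<in> monomials n1" unfolding u'_def by (rule labelling_monomial[OF L(1) left.hyps(1)])
    have outer: "Mul u' (Var n1) \<in> monomials (n1 + 1)"
    proof -
      have "insert n1 {..<n1} = {..<n1 + 1}" by auto
      then show ?thesis using monomialsD[OF u'] by (simp add: monomials_def)
    qed
    have "0 < sum_list a2" using n a by (cases a2) (auto simp: degrees_def)
    then have d: "a1 @ [sum_list a2] \<in> degrees (n1 + 1)" using a by (auto simp: degrees_def)
    have len: "length a1 = n1" using a by (simp add: degrees_def)
    have sub: "subst_monomial (Mul u' (Var n1)) (insertion n1 n2 x) = Mul u' (map_monomial ((+) n1) x)" for x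
    proof -
      have "subst_monomial (map_monomial id u') (insertion n1 n2 x) = map_monomial (shift n1 n2 \<circ> id) u'"
        using monomialsD(2)[OF u'] by (intro subst_map_monomial) auto
      also have "\<dots> = map_monomial id u'"
        using monomialsD(2)[OF u'] by (intro map_monomial_cong) (auto simp: shift_def)
      finally show ?thesis by (simp add: insertion_def)
    qed
    have less: "n1 < n1 + 1" by simp
    have nth: "sum_list a2 = (a1 @ [sum_list a2]) ! n1" using nth_append_length[of a1 "sum_list a2" "[]"] unfolding len by simp
    have "relabel h2 p \<in> J a2" by (rule p_J[OF L2])
    then have "lin_ext (\<lambda>x. sgl (Mul u' (map_monomial ((+) n1) x)) 1) (relabel h2 p) \<in> J (subst_degrees (a1 @ [sum_list a2]) n1 a2)"
      by (rule comp_right[OF n(2) less d a(2) nth outer, unfolded sub])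
    moreover have "subst_degrees (a1 @ [sum_list a2]) n1 a2 = a1 @ a2" using len by (simp add: subst_degrees_def)
    moreover have "lin_ext (\<lambda>x. sgl (Mul u' (map_monomial ((+) n1) x)) 1) (relabel h2 p) = relabel h (mul_left u p)"
    proof -
      have "map_monomial h u = u'"
        unfolding u'_def using left.hyps(1) by (intro map_monomial_cong) (simp add: h_def monomials_on_def)
      moreover have "map_monomial h x = map_monomial ((+) n1) (map_monomial h2 x)" if "x \<in> supp p" for x
        unfolding map_monomial_map using subsetD[OF p_on that] left.hyps(3)
        by (intro map_monomial_cong) (auto simp: h_def monomials_on_def)
      ultimately show ?thesis unfolding relabel_def mul_left_def lin_ext_lin_ext by (simp cong: lin_ext_cong)
    qed
    ultimately have mem: "relabel h (mul_left u p) \<in> J (a1 @ a2)" by (simp only:)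
    show ?thesis
    proof (intro conjI supp allI impI)
      fix n' h' a' assume "labelling wt (U \<union> V) n' h' a'"
      then show "relabel h' (mul_left u p) \<in> J a'" by (rule relabel_in_ideal[OF _ Lh supp mem])
    qed
  qed
next
  case (right U p v V)
  note p_on = conjunct1[OF right.IH] and p_J = conjunct2[OF right.IH, rule_format]
  have supp: "supp (mul_right p v) \<subseteq> monomials_on (U \<union> V)"
    unfolding mul_right_def using right by (intro supp_lin_ext_subset) auto
  show ?case
  proof (cases "p = 0")
    case True
    then show ?thesis using subspace(2) by (auto simp: relabel_def mul_right_def labelling_def)
  next
    case False
    then have "supp p \<noteq> {}" by simp
    then obtain u0 where "u0 \<in> supp p" by blast
    then have u0: "u0 \<in> monomials_on U" by (rule subsetD[OF p_on])
    obtain n1 h1 a1 where L1: "labelling wt U n1 h1 a1" using labelling_exists_on[OF u0 wt] .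
    obtain n2 h2 a2 where L2: "labelling wt V n2 h2 a2" using labelling_exists_on[OF right.hyps(2) wt] .
    note L = L1 L2
    have n: "0 < n1" "0 < n2" and a: "a1 \<in> degrees n1" "a2 \<in> degrees n2" using L by (auto simp: labelling_def)
    define h where "h x = (if x \<in> U then h1 x else n1 + h2 x)" for x
    have Lh: "labelling wt (U \<union> V) (n1 + n2) h (a1 @ a2)" unfolding h_def by (rule labelling_join[OF L right.hyps(3)])
    define v' where "v' = map_monomial h2 v"
    have v': "v' \<in> monomials n2" unfolding v'_def by (rule labelling_monomial[OF L(2) right.hyps(2)])
    have outer: "Mul (Var 0) (map_monomial ((+) 1) v') \<in> monomials (1 + n2)"
    proof -
      have "insert 0 ((+) 1 ` {..<n2}) = {..<1 + n2}"
        by (simp add: One_nat_def lessThan_Suc_eq_insert_0)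
      then show ?thesis using monomialsD[OF v'] by (simp add: monomials_def distinct_map image_iff)
    qed
    have "0 < sum_list a1" using n a by (cases a1) (auto simp: degrees_def)
    then have d: "sum_list a1 # a2 \<in> degrees (1 + n2)" using a by (auto simp: degrees_def)
    have sub: "subst_monomial (Mul (Var 0) (map_monomial ((+) 1) v')) (insertion 0 n1 x) = Mul x (map_monomial ((+) n1) v')" for x
    proof -
      have "subst_monomial (map_monomial ((+) 1) v') (insertion 0 n1 x) = map_monomial (shift 0 n1 \<circ> (+) 1) v'"
        by (rule subst_map_monomial) simp
      also have "shift 0 n1 \<circ> (+) 1 = (+) n1" using n by (auto simp: shift_def fun_eq_iff)
      finally show ?thesis by (simp add: insertion_def[of _ _ _ 0])
    qed
    have less: "0 < 1 + n2" and nth: "sum_list a1 = (sum_list a1 # a2) ! 0" by simp_all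
    have "relabel h1 p \<in> J a1" by (rule p_J[OF L1])
    then have "lin_ext (\<lambda>x. sgl (Mul x (map_monomial ((+) n1) v')) 1) (relabel h1 p) \<in> J (subst_degrees (sum_list a1 # a2) 0 a1)"
      by (rule comp_right[OF n(1) less d a(1) nth outer, unfolded sub])
    moreover have "subst_degrees (sum_list a1 # a2) 0 a1 = a1 @ a2" by (simp add: subst_degrees_def)
    moreover have "lin_ext (\<lambda>x. sgl (Mul x (map_monomial ((+) n1) v')) 1) (relabel h1 p) = relabel h (mul_right p v)"
    proof -
      have "map_monomial h v = map_monomial ((+) n1) v'"
        unfolding v'_def map_monomial_map using right.hyps(2,3)
        by (intro map_monomial_cong) (auto simp: h_def monomials_on_def)
      moreover have "map_monomial h x = map_monomial h1 x" if "x \<in> supp p" for x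
        using subsetD[OF p_on that] by (intro map_monomial_cong) (auto simp: h_def monomials_on_def)
      ultimately show ?thesis unfolding relabel_def mul_right_def lin_ext_lin_ext by (simp cong: lin_ext_cong)
    qed
    ultimately have mem: "relabel h (mul_right p v) \<in> J (a1 @ a2)" by (simp only:)
    show ?thesis
    proof (intro conjI supp allI impI)
      fix n' h' a' assume "labelling wt (U \<union> V) n' h' a'"
      then show "relabel h' (mul_right p v) \<in> J a'" by (rule relabel_in_ideal[OF _ Lh supp mem])
    qed
  qed
qed

lemma null_in_component:
  assumes n: "0 < n" and a: "a \<in> degrees n" and p: "null lam (\<lambda>x. if x < n then a ! x else 1) {..<n} p"
  shows "p \<in> J a"
proof -
  let ?wt = "\<lambda>x. if x < n then a ! x else 1"
  have "0 < ?wt x" for x using a by (simp add: degrees_def)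
  moreover have "labelling ?wt {..<n} n id a" using n a by (simp add: labelling_def)
  ultimately have "relabel id p \<in> J a" using null_in_ideal[OF _ p] by blast
  then show ?thesis by (simp add: relabel_def lin_ext_basis)
qed

end

section \<open>The relations hold for trees\<close>

lemma induced_Var: "(x, x) \<notin> E \<Longrightarrow> induced (Var x) E = {}"
  by (auto simp: induced_def)

lemma ternary_compatible:
  assumes X: "X \<in> compatible_trees 3 u" and u: "u \<in> monomials 3"
  shows "u = Mul (Mul (Var r) (Var x)) (Var y) \<Longrightarrow> X = RTree r {(x, r), (y, r)} \<or> X = RTree r {(x, r), (y, x)}"
    and "u = Mul (Var r) (Mul (Var x) (Var y)) \<Longrightarrow> X = RTree r {(x, r), (y, x)}"
proof -
  have sv: "single_valued (edges X)" and c: "compatible u (edges X)"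
    using X by (auto simp: compatible_trees_def rooted_trees_def)
  note ind = compatible_trees_induced[OF u X]
  show "X = RTree r {(x, r), (y, r)} \<or> X = RTree r {(x, r), (y, x)}" if eq: "u = Mul (Mul (Var r) (Var x)) (Var y)"
  proof -
    have c': "compatible (Mul (Var r) (Var x)) (edges X)" "compatible (Var r) (edges X)"
      "compatible (Var x) (edges X)" "compatible (Var y) (edges X)" using c eq by simp_all
    obtain p where p: "p \<in> vars (Mul (Var r) (Var x))"
      "induced u (edges X) = insert (leftmost (Var y), p) (induced (Mul (Var r) (Var x)) (edges X) \<union> induced (Var y) (edges X))"
      using compatible_split[OF sv c[unfolded eq]] unfolding eq .
    obtain q where q: "q \<in> vars (Var r)"
      "induced (Mul (Var r) (Var x)) (edges X) = insert (leftmost (Var x), q) (induced (Var r) (edges X) \<union> induced (Var x) (edges X))"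
      using compatible_split[OF sv c'(1)] .
    have "edges X = {(y, p), (x, r)}"
      using p(2) q ind(1) c'(2-4) by (simp add: induced_Var)
    moreover have "p = r \<or> p = x" using p(1) by simp
    moreover have "root X = r" using ind(2) eq by simp
    ultimately show ?thesis by (cases X) auto
  qed
  show "X = RTree r {(x, r), (y, x)}" if eq: "u = Mul (Var r) (Mul (Var x) (Var y))"
  proof -
    have c': "compatible (Mul (Var x) (Var y)) (edges X)" "compatible (Var r) (edges X)"
      "compatible (Var x) (edges X)" "compatible (Var y) (edges X)" using c eq by simp_all
    obtain p where p: "p \<in> vars (Var r)"
      "induced u (edges X) = insert (leftmost (Mul (Var x) (Var y)), p) (induced (Var r) (edges X) \<union> induced (Mul (Var x) (Var y)) (edges X))"
      using compatible_split[OF sv c[unfolded eq]] unfolding eq .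
    obtain q where q: "q \<in> vars (Var x)"
      "induced (Mul (Var x) (Var y)) (edges X) = insert (leftmost (Var y), q) (induced (Var x) (edges X) \<union> induced (Var y) (edges X))"
      using compatible_split[OF sv c'(1)] .
    have "edges X = {(x, r), (y, x)}"
      using p q ind(1) c'(2-4) by (simp add: induced_Var)
    moreover have "root X = r" using ind(2) eq by simp
    ultimately show ?thesis by (cases X) simp
  qed
qed

text \<open>
  In a tree of \<open>(r x) y\<close> the vertex \<open>y\<close> is attached to \<open>r\<close> or to \<open>x\<close>; in a tree of \<open>r (x y)\<close> it is attached
  to \<open>x\<close>, and \<open>x\<close> to \<open>r\<close>.
\<close>

lemma ternary_expansions:
  assumes a: "length a = 3" and u: "Mul (Mul (Var r) (Var x)) (Var y) \<in> monomials 3"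
  shows "expansion lam a (Mul (Mul (Var r) (Var x)) (Var y)) =
      sgl (RTree r {(x, r), (y, r)}) 1 + sgl (RTree r {(x, r), (y, x)}) (lam ^ (a ! y))"
    and "expansion lam a (Mul (Var r) (Mul (Var x) (Var y))) = sgl (RTree r {(x, r), (y, x)}) 1"
proof -
  let ?u = "Mul (Mul (Var r) (Var x)) (Var y)" and ?v = "Mul (Var r) (Mul (Var x) (Var y))"
  let ?S = "RTree r {(x, r), (y, r)}" and ?T = "RTree r {(x, r), (y, x)}"
  have v: "?v \<in> monomials 3" using u by (auto simp: monomials_def)
  have ne: "r \<noteq> x" "r \<noteq> y" "x \<noteq> y" using u by (auto simp: monomials_def)
  have S: "?S = shape_rtree ?u" and T: "?T = shape_rtree ?v" by (auto simp: shape_rtree_def)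
  note Su = shape_rtree_compatible[OF u, folded S] and Tv = shape_rtree_compatible[OF v, folded T]
  have Tu: "?T \<in> compatible_trees 3 ?u" using Tv(1) ne by (simp add: compatible_trees_def)
  have "compatible_trees 3 ?u = {?S, ?T}"
  proof (intro equalityI subsetI)
    fix X assume "X \<in> compatible_trees 3 ?u"
    from ternary_compatible(1)[OF this u refl] show "X \<in> {?S, ?T}" by blast
  next
    fix X assume "X \<in> {?S, ?T}"
    then show "X \<in> compatible_trees 3 ?u" using Su(1) Tu by blast
  qed
  moreover have "?S \<noteq> ?T"
  proof
    assume "?S = ?T"
    then have "{(x, r), (y, r)} = {(x, r), (y, x)}" by simp
    then have "(y, r) \<in> {(x, r), (y, x)}" by (metis insertCI)
    then show False using ne by simp
  qed
  ultimately show "expansion lam a ?u = sgl ?S 1 + sgl ?T (lam ^ (a ! y))"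
    using Su(2)[OF a] Tv(2)[OF a] by (simp add: expansion_def a)
  have "compatible_trees 3 ?v = {?T}"
  proof (intro equalityI subsetI)
    fix X assume "X \<in> compatible_trees 3 ?v"
    from ternary_compatible(2)[OF this v refl] show "X \<in> {?T}" by blast
  next
    fix X assume "X \<in> {?T}"
    then show "X \<in> compatible_trees 3 ?v" using Tv(1) by blast
  qed
  then show "expansion lam a ?v = sgl ?T 1"
    using Tv(2)[OF a] by (simp add: expansion_def a)
qed

lemma ternary_monomials: "Mul (Mul (Var 0) (Var 1)) (Var 2) \<in> monomials 3" "Mul (Mul (Var 0) (Var 2)) (Var 1) \<in> monomials 3"
  "Mul (Var 0) (Mul (Var 1) (Var 2)) \<in> monomials 3" "Mul (Var 0) (Mul (Var 2) (Var 1)) \<in> monomials 3"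
  by (auto simp: monomials_def)

text \<open>
  Subtracting the multiple of \<open>x (y z)\<close> from \<open>(x y) z\<close> leaves the tree with two edges at the root, which
  is symmetric in \<open>y\<close> and \<open>z\<close>.
\<close>

lemma Phi_PL_element: "Phi lam [k, l, m] (PL_element lam k l m) = 0"
proof -
  have nth: "[k, l, m] ! 1 = l" "[k, l, m] ! 2 = m" by (simp_all add: One_nat_def)
  have len: "length [k, l, m] = 3" by simp
  have comm: "RTree 0 {(1, 0), (2, 0)} = RTree 0 {(2, 0), (1, 0)}" by (simp add: insert_commute)
  show ?thesis
    unfolding PL_element_def lin_ext_add lin_ext_diff lin_ext_term
      ternary_expansions[OF len ternary_monomials(1)] ternary_expansions[OF len ternary_monomials(2)] nth comm
    by (simp add: scaling.scale_right_distrib)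
qed

lemma supp_PL_element: "supp (PL_element lam k l m) \<subseteq> monomials 3"
proof -
  have sub: "supp (p - q) \<subseteq> A" "supp (p + q) \<subseteq> A" if "supp p \<subseteq> A" "supp q \<subseteq> A" for p q :: "nat monomial \<Rightarrow>\<^sub>0 'a" and A
    using that keys_add[of p q] keys_diff[of p q] by blast+
  show ?thesis unfolding PL_element_def using ternary_monomials by (intro sub) simp_all
qed

section \<open>Surjectivity and the kernel\<close>

definition depth_bound :: "nat list \<Rightarrow> nat" where
  "depth_bound a = Max (weighted_depth a ` rooted_trees (length a))"

lemma weighted_depth_le_bound: "X \<in> rooted_trees (length a) \<Longrightarrow> weighted_depth a X \<le> depth_bound a"
  unfolding depth_bound_def by (rule Max_ge) (simp_all add: finite_rooted_trees)

lemma supp_sum_scale: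
  assumes "\<And>x. x \<in> A \<Longrightarrow> supp (f x) \<subseteq> C"
  shows "supp (\<Sum>x\<in>A. scale (c x) (f x)) \<subseteq> C"
  using keys_sum[of "\<lambda>x. scale (c x) (f x)" A] supp_scale assms by fastforce

lemma shape_rtree_surj:
  assumes "X \<in> rooted_trees n"
  shows "\<exists>u\<in>monomials n. shape_rtree u = X"
proof -
  have "tree_on {..<n} (root X) (edges X)" using assms by (simp add: rooted_trees_iff)
  then obtain u where "u \<in> monomials_on {..<n}" "leftmost u = root X" "shape u = edges X"
    using shape_surj by blast
  then show ?thesis by (intro bexI[of _ u]) (simp_all add: shape_rtree_def monomials_eq)
qed

text \<open>
  A monomial of shape \<open>X\<close> expands into \<open>X\<close> and trees that are deeper than \<open>X\<close>, which are values of the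
  morphism by induction, as depths are bounded.
\<close>

lemma Phi_surj_basis:
  fixes lam :: "'k::field"
  assumes a: "a \<in> degrees n"
  shows "X \<in> rooted_trees n \<Longrightarrow> \<exists>p. supp p \<subseteq> monomials n \<and> Phi lam a p = sgl X 1"
proof (induction "depth_bound a - weighted_depth a X" arbitrary: X rule: less_induct)
  case less
  have len: "length a = n" using a by (simp add: degrees_def)
  obtain u where u: "u \<in> monomials n" "shape_rtree u = X" using shape_rtree_surj[OF less.prems] by blast
  have X: "X \<in> compatible_trees n u" and dX: "weighted_depth a X = mdepth ((!) a) u"
    using shape_rtree_compatible[OF u(1)] len unfolding u(2) by blast+
  let ?C = "compatible_trees n u - {X}"
  have "\<exists>p. supp p \<subseteq> monomials n \<and> Phi lam a p = sgl Y 1" if Y: "Y \<in> ?C" for Y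
  proof (rule less.hyps)
    show Yt: "Y \<in> rooted_trees n" using Y by (simp add: compatible_trees_def)
    have "mdepth ((!) a) u \<le> weighted_depth a Y" using mdepth_le_weighted_depth[OF u(1) _ len] Y by blast
    moreover have "weighted_depth a Y \<noteq> mdepth ((!) a) u"
      using weighted_depth_eq_mdepth[OF u(1) _ a] Y u(2) by blast
    moreover have "weighted_depth a Y \<le> depth_bound a" using weighted_depth_le_bound[of Y a] Yt len by simp
    ultimately show "depth_bound a - weighted_depth a Y < depth_bound a - weighted_depth a X" using dX by linarith
  qed
  then obtain q where q: "\<And>Y. Y \<in> ?C \<Longrightarrow> supp (q Y) \<subseteq> monomials n \<and> Phi lam a (q Y) = sgl Y 1" by metis
  define c :: "rtree \<Rightarrow> 'k" where "c Y = lam ^ (weighted_depth a Y - mdepth ((!) a) u)" for Y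
  define p where "p = sgl u 1 - (\<Sum>Y\<in>?C. scale (c Y) (q Y))"
  have "supp (\<Sum>Y\<in>?C. scale (c Y) (q Y)) \<subseteq> monomials n" using q by (intro supp_sum_scale) blast
  then have "supp p \<subseteq> monomials n"
    unfolding p_def using keys_diff[of "sgl u 1" "\<Sum>Y\<in>?C. scale (c Y) (q Y)"] u(1) by auto
  moreover have "Phi lam a p = sgl X 1"
  proof -
    have "Phi lam a (\<Sum>Y\<in>?C. scale (c Y) (q Y)) = (\<Sum>Y\<in>?C. sgl Y (c Y))"
      unfolding lin_ext_sum lin_ext_scale using q by (intro sum.cong) simp_all
    moreover have "expansion lam a u = sgl X (c X) + (\<Sum>Y\<in>?C. sgl Y (c Y))"
      unfolding expansion_def len c_def using X by (intro sum.remove) simp_all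
    ultimately show ?thesis by (simp add: p_def lin_ext_diff c_def dX)
  qed
  ultimately show ?case by blast
qed

lemma Phi_image:
  assumes a: "a \<in> degrees n"
  shows "Phi lam a ` {p. supp p \<subseteq> monomials n} = {p. supp p \<subseteq> rooted_trees n}"
proof (intro equalityI subsetI)
  fix y assume "y \<in> Phi lam a ` {p. supp p \<subseteq> monomials n}"
  then show "y \<in> {p. supp p \<subseteq> rooted_trees n}" using supp_Phi[of a n lam] a by (auto simp: degrees_def)
next
  fix y :: "rtree \<Rightarrow>\<^sub>0 'a" assume "y \<in> {p. supp p \<subseteq> rooted_trees n}"
  then have "\<exists>p. supp p \<subseteq> monomials n \<and> Phi lam a p = sgl X 1" if "X \<in> supp y" for X
    using Phi_surj_basis[OF a, of X lam] that by blast
  then obtain q where q: "\<And>X. X \<in> supp y \<Longrightarrow> supp (q X) \<subseteq> monomials n \<and> Phi lam a (q X) = sgl X 1" by metis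
  have "Phi lam a (\<Sum>X\<in>supp y. scale (coef y X) (q X)) = (\<Sum>X\<in>supp y. sgl X (coef y X))"
    unfolding lin_ext_sum lin_ext_scale using q by (intro sum.cong) simp_all
  moreover have "supp (\<Sum>X\<in>supp y. scale (coef y X) (q X)) \<subseteq> monomials n" using q by (intro supp_sum_scale) blast
  ultimately show "y \<in> Phi lam a ` {p. supp p \<subseteq> monomials n}" unfolding sum_terms by (intro image_eqI) simp_all
qed

lemma Phi_surjection: "mg_surjection (tree_operad lam) free_operad (Phi lam)"
proof (rule mg_surjection.intro[OF multigraded_tree_operad], rule mg_surjection_axioms.intro)
  show "sp free_operad n = prod_vs (degrees n) (cmp free_operad)" for n
    by (simp add: free_operad_def basis_operad_def)
  show "is_vspace (cmp free_operad a)" for a unfolding cmp_free by (rule is_vspace_free)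
  show "linear_map (cmp free_operad a) (cmp (tree_operad lam) a) (Phi lam a)" for a
    unfolding cmp_free cmp_tree linear_map_def using supp_Phi[of a "length a" lam]
    by (auto simp: free_vs_def lin_ext_add lin_ext_scale)
  show "Phi lam a ` carr (cmp free_operad a) = carr (cmp (tree_operad lam) a)" if "a \<in> degrees n" for n a
    using Phi_image[OF that, of lam] that by (simp add: cmp_free cmp_tree free_vs_def degrees_def)
qed (rule free.act_closed free.pcomp_closed free.ounit_closed family_Phi_act family_Phi_pcomp family_Phi_unit; assumption)+

interpretation Phi: mg_surjection "tree_operad lam" free_operad "Phi lam" for lam
  by (rule Phi_surjection)

lemma kernel_Phi: "Phi.kernel lam a = {p. supp p \<subseteq> monomials (length a) \<and> Phi lam a p = 0}"
  by (simp add: Phi.kernel_def cmp_free cmp_tree free_vs_def)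

lemma kernel_PL_ideal: "PL_ideal lam (Phi.kernel lam)"
proof
  show "mg_ideal free_operad (Phi.kernel lam)" by (rule Phi.kernel_ideal)
  show "PL_relations lam b \<subseteq> Phi.kernel lam b" for b
  proof
    fix p assume "p \<in> PL_relations lam b"
    then obtain k l m where "p = PL_element lam k l m" "b = [k, l, m]" by (auto simp: PL_relations_def)
    then show "p \<in> Phi.kernel lam b"
      using Phi_PL_element[of lam k l m] supp_PL_element[of lam k l m] by (simp add: kernel_Phi numeral_3_eq_3)
  qed
qed

context reduction
begin

definition normal_form :: "nat set \<Rightarrow> (nat \<times> nat) set \<Rightarrow> nat monomial" where
  "normal_form V E = (SOME u. u \<in> monomials_on V \<and> shape u = E)"

lemma similar_normal_form:
  assumes "u \<in> monomials_on V"
  shows "similar V u (normal_form V (shape u))"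
proof -
  have "normal_form V (shape u) \<in> monomials_on V \<and> shape (normal_form V (shape u)) = shape u"
    unfolding normal_form_def by (rule someI[of "\<lambda>v. v \<in> monomials_on V \<and> shape v = shape u" u]) (use assms in simp)
  then show ?thesis using similar_same_shape[OF assms] by metis
qed

text \<open>
  The monomials of least depth in \<open>p\<close> may be replaced by normal forms, and a tree whose shape is such
  a normal form receives no contribution from deeper monomials. So the coefficients of each normal
  form add up to zero, and \<open>p\<close> is negligible in the next depth.
\<close>

lemma kernel_negligible:
  assumes a: "a \<in> degrees n" and wt: "\<And>x. x < n \<Longrightarrow> wt x = a ! x"
    and p: "supp p \<subseteq> deeper {..<n} d" and zero: "Phi lam a p = 0"
  shows "negligible {..<n} (Suc d) p"
proof -
  have len: "length a = n" using a by (simp add: degrees_def)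
  have mon: "u \<in> monomials n" "u \<in> monomials_on {..<n}" "d \<le> mdepth wt u" if "u \<in> supp p" for u
    using subsetD[OF p that] by (simp_all add: deeper_def monomials_eq)
  have depth: "mdepth wt u = mdepth ((!) a) u" if "u \<in> monomials n" for u
    using monomialsD(2)[OF that] wt by (intro mdepth_cong) simp
  define A where "A = {u \<in> supp p. mdepth wt u = d}"
  have finA: "finite A" by (simp add: A_def)
  have coeffs: "(\<Sum>u\<in>{u \<in> A. shape u = E}. coef p u) = 0" if "E \<in> shape ` A" for E
  proof -
    obtain u0 where u0: "u0 \<in> A" "shape u0 = E" using \<open>E \<in> shape ` A\<close> by blast
    have u0m: "u0 \<in> monomials n" and d0: "mdepth ((!) a) u0 = d" using u0(1) mon depth by (auto simp: A_def)
    let ?X = "shape_rtree u0"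
    have dX: "weighted_depth a ?X = d" using shape_rtree_compatible(2)[OF u0m len] d0 by simp
    \<comment> \<open>Deeper monomials do not produce \<open>?X\<close>, and those of depth \<open>d\<close> only if it is their shape.\<close>
    have c: "coef (expansion lam a u) ?X = (if u \<in> {u \<in> A. shape u = E} then 1 else 0)" if u: "u \<in> supp p" for u
    proof (cases "u \<in> {u \<in> A. shape u = E}")
      case True
      have "leftmost u = leftmost u0"
        using True u0 leftmost_determined[of u "{..<n}" u0] mon by (auto simp: A_def)
      then have "?X = shape_rtree u" using True u0(2) by (simp add: shape_rtree_def)
      moreover have "mdepth ((!) a) u = d" using True mon depth by (auto simp: A_def)
      ultimately show ?thesis
        using True shape_rtree_compatible(1)[OF mon(1)[OF u]] dX by (simp add: coef_expansion len)
    next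
      case False
      have "?X \<notin> compatible_trees n u"
      proof
        assume X: "?X \<in> compatible_trees n u"
        have "mdepth ((!) a) u \<le> d" using mdepth_le_weighted_depth[OF mon(1)[OF u] X len] dX by simp
        then have du: "mdepth ((!) a) u = d" using mon(3)[OF u] depth[OF mon(1)[OF u]] by simp
        then have "?X = shape_rtree u" using weighted_depth_eq_mdepth[OF mon(1)[OF u] X a] dX by simp
        then have "shape u = E" using u0(2) by (simp add: shape_rtree_def)
        then show False using False u du depth[OF mon(1)[OF u]] by (simp add: A_def)
      qed
      then show ?thesis unfolding if_not_P[OF False] by (simp add: coef_expansion len)
    qed
    have "0 = coef (Phi lam a p) ?X" by (simp add: zero)
    also have "\<dots> = (\<Sum>u\<in>supp p. if u \<in> {u \<in> A. shape u = E} then coef p u else 0)"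
      unfolding coef_lin_ext by (intro sum.cong refl) (simp add: c)
    also have "\<dots> = (\<Sum>u\<in>{u \<in> A. shape u = E}. coef p u)"
      by (subst sum.inter_filter[symmetric]) (auto simp: A_def intro!: sum.cong)
    finally show ?thesis by simp
  qed
  let ?N = "\<lambda>u. normal_form {..<n} (shape u)"
  have "(\<Sum>u\<in>A. sgl (?N u) (coef p u)) = (\<Sum>E\<in>shape ` A. \<Sum>u\<in>{u \<in> A. shape u = E}. sgl (?N u) (coef p u))"
    by (rule sum.image_gen[OF finA])
  also have "\<dots> = (\<Sum>E\<in>shape ` A. sgl (normal_form {..<n} E) (\<Sum>u\<in>{u \<in> A. shape u = E}. coef p u))"
  proof (rule sum.cong[OF refl])
    fix E
    have single_sum: "sgl w (sum f B) = (\<Sum>u\<in>B. sgl w (f u))" for w :: "nat monomial" and f :: "nat monomial \<Rightarrow> 'k" and B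
      by (induction B rule: infinite_finite_induct) (simp_all add: single_add)
    show "(\<Sum>u\<in>{u \<in> A. shape u = E}. sgl (?N u) (coef p u)) = sgl (normal_form {..<n} E) (\<Sum>u\<in>{u \<in> A. shape u = E}. coef p u)"
      unfolding single_sum by (intro sum.cong) auto
  qed
  also have "\<dots> = 0" by (simp add: coeffs)
  finally have nf: "(\<Sum>u\<in>A. sgl (?N u) (coef p u)) = 0" .
  have "negligible {..<n} (Suc d) (\<Sum>u\<in>A. scale (coef p u) (sgl u 1 - sgl (?N u) 1))"
  proof (intro negligible_sum negligible_scale)
    fix u assume u: "u \<in> A"
    then have "similar {..<n} u (?N u)" using mon by (intro similar_normal_form) (simp add: A_def)
    then show "negligible {..<n} (Suc d) (sgl u 1 - sgl (?N u) 1)"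
      using similar_negligible u by (fastforce simp: A_def)
  qed
  then have low: "negligible {..<n} (Suc d) (\<Sum>u\<in>A. sgl u (coef p u))"
    using nf by (simp add: scaling.scale_right_diff_distrib sum_subtractf)
  have "negligible {..<n} (Suc d) (\<Sum>u\<in>supp p - A. sgl u (coef p u))"
  proof (intro negligible_deeper subsetI)
    fix u assume "u \<in> supp (\<Sum>u\<in>supp p - A. sgl u (coef p u))"
    then have "u \<in> supp p - A" using supp_sum_terms by fast
    then show "u \<in> deeper {..<n} (Suc d)" using mon[of u] by (auto simp: A_def deeper_def)
  qed
  then have "negligible {..<n} (Suc d) ((\<Sum>u\<in>supp p - A. sgl u (coef p u)) + (\<Sum>u\<in>A. sgl u (coef p u)))"
    using low by (rule negligible_add)
  moreover have "(\<Sum>u\<in>supp p - A. sgl u (coef p u)) + (\<Sum>u\<in>A. sgl u (coef p u)) = p"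
    using sum.subset_diff[of A "supp p" "\<lambda>u. sgl u (coef p u)"] by (simp add: A_def sum_terms)
  ultimately show ?thesis by simp
qed

end

text \<open>
  Each step removes a null element, which lies in the kernel, and raises the least depth of the rest.
  The rest therefore stays in the kernel, and it is zero once this depth exceeds that of every monomial.
\<close>

lemma kernel_null:
  fixes lam :: "'k::field"
  assumes n: "0 < n" and a: "a \<in> degrees n" and p: "supp p \<subseteq> monomials n" and zero: "Phi lam a p = 0"
  shows "null lam (\<lambda>x. if x < n then a ! x else 1) {..<n} p"
proof -
  let ?wt = "\<lambda>x. if x < n then a ! x else 1"
  \<comment> \<open>The value \<open>1\<close> keeps all weights positive; the variables of \<open>p\<close> are the numbers below \<open>n\<close>.\<close>
  interpret reduction lam ?wt by standard (use a in \<open>simp add: degrees_def\<close>)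
  have len: "length a = n" using a by (simp add: degrees_def)
  have bound: "mdepth ?wt u \<le> depth_bound a" if "u \<in> monomials n" for u
  proof -
    have "mdepth ?wt u = mdepth ((!) a) u" using monomialsD(2)[OF that] by (intro mdepth_cong) simp
    also have "\<dots> = weighted_depth a (shape_rtree u)" using shape_rtree_compatible(2)[OF that len] by simp
    also have "\<dots> \<le> depth_bound a"
      using weighted_depth_le_bound[of "shape_rtree u" a] shape_rtree_compatible(1)[OF that] len
      by (simp add: compatible_trees_def)
    finally show ?thesis .
  qed
  have "null lam ?wt {..<n} p" if "supp p \<subseteq> deeper {..<n} d" "Phi lam a p = 0" for d p
    using that
  proof (induction "Suc (depth_bound a) - d" arbitrary: d p rule: less_induct)
    case less
    show ?case
    proof (cases "d \<le> depth_bound a")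
      case False
      have "supp p = {}"
      proof (rule ccontr)
        assume "supp p \<noteq> {}"
        then obtain u where "u \<in> supp p" by blast
        then have "u \<in> monomials n" "d \<le> mdepth ?wt u"
          using less.prems(1) by (auto simp: deeper_def monomials_eq)
        then show False using bound False by fastforce
      qed
      then show ?thesis by (simp add: null.zero)
    next
      case True
      have "negligible {..<n} (Suc d) p" using kernel_negligible[OF a _ less.prems] by simp
      then obtain q where q: "null lam ?wt {..<n} q" "supp (p - q) \<subseteq> deeper {..<n} (Suc d)"
        by (auto simp: negligible_def)
      have "q \<in> Phi.kernel lam a" by (rule PL_ideal.null_in_component[OF kernel_PL_ideal n a q(1)])
      then have "Phi lam a (p - q) = 0" using less.prems(2) by (simp add: kernel_Phi lin_ext_diff)
      then have "null lam ?wt {..<n} (p - q)" using less.hyps[OF _ q(2)] True by simp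
      then have "null lam ?wt {..<n} ((p - q) + q)" using q(1) by (rule null.add)
      then show ?thesis by simp
    qed
  qed
  moreover have "supp p \<subseteq> deeper {..<n} 0" using p by (simp add: deeper_def monomials_eq)
  ultimately show ?thesis using zero by blast
qed

text \<open>
  The kernel is an ideal that contains the relations, and null elements belong to every such ideal.
\<close>

lemma generated_ideal_eq_kernel:
  assumes n: "0 < n" and a: "a \<in> degrees n"
  shows "generated_ideal free_operad (PL_relations lam) a = Phi.kernel lam a"
proof (intro equalityI subsetI)
  fix p assume "p \<in> generated_ideal free_operad (PL_relations lam) a"
  moreover have "mg_ideal free_operad (Phi.kernel lam)" "\<forall>b. PL_relations lam b \<subseteq> Phi.kernel lam b"
    using kernel_PL_ideal[of lam] by (simp_all add: PL_ideal_def)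
  ultimately show "p \<in> Phi.kernel lam a" unfolding generated_ideal_def by blast
next
  fix p assume p: "p \<in> Phi.kernel lam a"
  have "length a = n" using a by (simp add: degrees_def)
  then have "null lam (\<lambda>x. if x < n then a ! x else 1) {..<n} p"
    using p by (intro kernel_null[OF n a]) (simp_all add: kernel_Phi)
  then have "p \<in> J a" if "mg_ideal free_operad J" "\<forall>b. PL_relations lam b \<subseteq> J b" for J
    using PL_ideal.null_in_component[OF _ n a, of lam J p] that by (simp add: PL_ideal_def)
  then show "p \<in> generated_ideal free_operad (PL_relations lam) a" unfolding generated_ideal_def by blast
qed

theorem theorem18:
  fixes lam :: "'k::field_char_0"
  shows "multigraded_operad (PL lam) \<and> multigraded_operad (tree_operad lam) \<and>
         mg_isomorphic (PL lam) (tree_operad lam)"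
  unfolding PL_def
proof (intro conjI multigraded_tree_operad)
  have kernel: "generated_ideal free_operad (PL_relations lam) a = Phi.kernel lam a" if "0 < n" "a \<in> degrees n" for n a
    using that by (rule generated_ideal_eq_kernel)
  show "multigraded_operad (mg_quotient free_operad (generated_ideal free_operad (PL_relations lam)))"
    by (rule Phi.first_isomorphism(1)[OF kernel])
  show "mg_isomorphic (mg_quotient free_operad (generated_ideal free_operad (PL_relations lam))) (tree_operad lam)"
    by (rule Phi.first_isomorphism(2)[OF kernel])
qed

end
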